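(* Let $\mathcal T$ be a quasi-uniform triangulation of $\Omega$. Let the data satisfy $u^0\in D(A^2)$, $v^0\in D(A^{3/2})$, $f(0)\in D(A)$, $f_t(0)\in D(A^{1/2})$, $f_{tt}(0)\in L^2(\Omega)$, $f,f_t,f_{tt},f_{ttt}\in L^2(0,T;L^2(\Omega))$, and let $u$ be the weak solution of the biharmonic wave problem. Let $U^0,\dots,U^N\in V_h$ be given by the explicit scheme $U^0=\mathcal R_hu^0$, $$2k^{-1}(\bar\partial_tU^{1/2},v_h)+a_h(U^{1/2},v_h)=(f^{1/2}+2k^{-1}v^0,v_h)\quad\text{for all }v_h\in V_h,$$ $$(\bar\partial_t^2U^n,v_h)+a_h(U^n,v_h)=(f^n,v_h)\quad\text{for all }v_h\in V_h,\ n=1,\dots,N-1 .$$ If the CFL condition $k\le\beta^{-1/2}C_{\rm inv}^{-1}h^2$ holds, then there is a constant $C>0$, depending on $\alpha,\beta,T,C_1,C_2$ but independent of $h$ and $k$, such that for $1\le m\le N-1$ $$\|\bar\partial_tu^{m+1/2}-\bar\partial_tU^{m+1/2}\|+\|u^{m+1/2}-U^{m+1/2}\|_h\le C\big(h^{\gamma_0}L_{(f,u)}+k^2M_{(u)}\big),$$ where $$L_{(f,u)}=\|f\|_{L^\infty(L^2)}+\|f_t\|_{L^2(L^2)}+\|u\|_{L^\infty(H^{2+\gamma_0})}+\|u_t\|_{L^\infty(H^{2+\gamma_0})}+\|u_{tt}\|_{L^\infty(L^2)}+\|u_{tt}\|_{L^2(H^{2+\gamma_0})}+\|u_{ttt}\|_{L^2(L^2)},$$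 $$M_{(u)}=\|u_{ttt}\|_{L^\infty(L^2)}+\|u_{tttt}\|_{L^2(L^2)} .$$
   Context: Time grid: $N$ is a positive integer, $k=T/N$, $t_n=nk$. For a function of time $\phi$ (or a sequence $\phi^n$): $\phi^n=\phi(t_n)$, $\phi^{n+1/2}=\frac12(\phi^{n+1}+\phi^n)$, $\bar\partial_t\phi^{n+1/2}=(\phi^{n+1}-\phi^n)/k$, $\bar\partial_t^2\phi^n=(\phi^{n+1}-2\phi^n+\phi^{n-1})/k^2$. $\Omega\subset\mathbb R^2$ is a bounded polygonal Lipschitz domain, $T>0$; $(\cdot,\cdot)$ and $\|\cdot\|$ are the $L^2(\Omega)$ inner product and norm; $a(w,v)=\int_\Omega D^2w:D^2v\,dx$; $L^p(X)$ abbreviates $L^p(0,T;X)$ with $X=L^2(\Omega)$ or $H^{2+\gamma_0}(\Omega)$. The weak solution $u\in C^0([0,T];H^2_0(\Omega))\cap C^1([0,T];L^2(\Omega))$ satisfies $(u_{tt},v)+a(u,v)=(f,v)$ for all $v\in H^2_0(\Omega)$, $u(0)=u^0$, $u_t(0)=v^0$. Under the stated data assumptions, $u,u_t,u_{tt}\in L^\infty(0,T;H^{2+\gamma_0}(\Omega))$ and $u_{tt},u_{ttt},u_{tttt}\in L^\infty(0,T;L^2(\Omega))$. $A\psi=\Delta^2\psi$ with $D(A)=\{\psi\in H^2_0(\Omega):\Delta^2\psi\in L^2(\Omega)\}$, and $D(A^r)=\{w\in L^2(\Omega):\sum_n\lambda_n^{2r}|(w,\psi_n)|^2<\infty\}$,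 where $(\lambda_n,\psi_n)$ are the eigenpairs of $A$, with $\{\psi_n\}$ an orthonormal basis of $L^2(\Omega)$. $\gamma_0\in(1/2,1]$ is the elliptic regularity index of the clamped biharmonic operator; $D(A)\subset H^{2+\gamma_0}(\Omega)$ continuously. Mesh: $\mathcal T$ is a shape-regular triangulation of $\overline\Omega$ with mesh-size $h=\max_{K\in\mathcal T}\mathrm{diam}(K)$, edges $\mathcal E$, vertices $\mathcal V$; $\mathcal V(e)$ is the set of endpoints of edge $e$ and $h_e$ its length; $[\![\cdot]\!]$ is the jump across an interior edge and the trace on a boundary edge; $\{\!\{\cdot\}\!\}$ is the average across an interior edge; $H^m(\mathcal T)$ is the space of piecewise $H^m$ functions; $P_r(\mathcal T)$ is the space of piecewise polynomials of degree at most $r$. Discrete space and form: $\mathrm M(\mathcal T)\subset P_2(\mathcal T)$ is the Morley space: piecewise quadratics continuous at interior vertices, with normal derivatives continuous at midpoints of interior edges, vanishing at boundary vertices and with normal derivatives vanishing at midpoints of boundary edges. $V_h\subset H^2(\mathcal T)$ is a finite-dimensional subspace; on $H^2_0(\Omega)+V_h$ one uses $$\|v\|_h^2=\sum_{K\in\mathcal T}|v|_{H^2(K)}^2+\sum_{e\in\mathcal E}\sum_{z\in\mathcal V(e)}h_e^{-2}\big|[\![v]\!](z)\big|^2+\sum_{e\in\mathcal E}\Big|\frac1{h_e}\int_e\Big[\!\Big[\frac{\partial v}{\partial n}\Big]\!\Big]ds\Big|^2 ,$$ and $a_h$ is a symmetric bilinear form on $V_h+\mathrm M(\mathcal T)$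 such that, for all $w_h,v_h\in V_h$, $\alpha\|w_h\|_h^2\le a_h(w_h,w_h)$ and $a_h(w_h,v_h)\le\beta\|w_h\|_h\|v_h\|_h$ with constants $\alpha,\beta>0$ independent of $h$. (The Morley, quadratic discontinuous Galerkin and quadratic $C^0$ interior penalty methods are instances.) $C_{\rm inv}>0$ is the constant of the discrete inverse inequality on quasi-uniform meshes: $\|v_h\|_h\le C_{\rm inv}h^{-2}\|v_h\|$ for all $v_h\in V_h$. Smoother: $I_{\mathrm M}:H^2(\mathcal T)\to\mathrm M(\mathcal T)$ is the extended Morley interpolation: at each interior vertex $z$, $(I_{\mathrm M}v)(z)$ is the average of the values $(v|_K)(z)$ over the triangles $K$ containing $z$, and on each interior edge $\int_e\partial_n(I_{\mathrm M}v)\,ds=\int_e\{\!\{\partial_nv\}\!\}\,ds$ (boundary degrees of freedom vanish). $J:\mathrm M(\mathcal T)\to H^2_0(\Omega)$ is a fixed linear companion operator, with values in the sum of the Hsieh–Clough–Tocher space and $P_8(\mathcal T)$, such that for $w\in\mathrm M(\mathcal T)$: $Jw=w$ at all vertices, $\nabla(Jw)(z)$ is the average of $(\nabla w|_K)(z)$ over the triangles $K$ containing $z$ at every interior vertex $z$, and $\int_e\partial_n(Jw)\,ds=\int_e\partial_nw\,ds$ for every edge $e$. $Q:=J I_{\mathrm M}:V_h\to H^2_0(\Omega)$ satisfies, with $C_1>0$ independent of $h$, $$\|v_h-Qv_h\|_{H^s(\mathcal T)}\le C_1h^{2-s}\min_{v\in H^2_0(\Omega)}\|v-v_h\|_h,\qquad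 v_h\in V_h,\ 0\le s\le2 .$$ Modified Ritz projection $\mathcal R_h:H^2_0(\Omega)\to V_h$: $a_h(\mathcal R_hw,v_h)=a(w,Qv_h)$ for all $v_h\in V_h$. It satisfies, with $C_2>0$ independent of $h$, $\|v-\mathcal R_hv\|+h^{\gamma_0}\|v-\mathcal R_hv\|_h\le C_2h^{2\gamma_0}\|v\|_{H^{2+\gamma_0}(\Omega)}$ for all $v\in H^2_0(\Omega)\cap H^{2+\gamma_0}(\Omega)$. *)

theory Defs
  imports "HOL-Analysis.Analysis" "HOL-Probability.Essential_Supremum"
begin

section \<open>Function spaces on planar sets\<close>

text \<open>
  Functions on a planar set are total functions on the plane of which only the values on the
  set, up to null sets, matter.
\<close>

type_synonym sfun = "real^2 \<Rightarrow> real"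

definition L2 :: "'a measure \<Rightarrow> ('a \<Rightarrow> real) set" where
  "L2 M = {v \<in> borel_measurable M. integrable M (\<lambda>x. (v x)^2)}"

definition ip :: "'a measure \<Rightarrow> ('a \<Rightarrow> real) \<Rightarrow> ('a \<Rightarrow> real) \<Rightarrow> real" where
  "ip M v w = (LINT x|M. v x * w x)"

definition L2norm :: "'a measure \<Rightarrow> ('a \<Rightarrow> real) \<Rightarrow> real" where
  "L2norm M v = sqrt (ip M v v)"

abbreviation L2d :: "(real^2) set \<Rightarrow> sfun set" where "L2d G \<equiv> L2 (lebesgue_on G)"
abbreviation ipd :: "(real^2) set \<Rightarrow> sfun \<Rightarrow> sfun \<Rightarrow> real" where "ipd G \<equiv> ip (lebesgue_on G)"
abbreviation L2normd :: "(real^2) set \<Rightarrow> sfun \<Rightarrow> real" where "L2normd G \<equiv> L2norm (lebesgue_on G)"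

text \<open>Iterated partial derivatives are indexed by the list of differentiation directions.\<close>

fun pd :: "2 list \<Rightarrow> sfun \<Rightarrow> sfun" where
  "pd [] \<phi> = \<phi>"
| "pd (i # \<alpha>) \<phi> = (\<lambda>x. deriv (\<lambda>t. pd \<alpha> \<phi> (x + t *\<^sub>R axis i 1)) 0)"

definition smooth :: "sfun \<Rightarrow> bool" where
  "smooth \<phi> \<longleftrightarrow> (\<forall>\<alpha> x. pd \<alpha> \<phi> differentiable (at x))"

definition test_functions :: "(real^2) set \<Rightarrow> sfun set" where
  "test_functions G = {\<phi>. smooth \<phi> \<and> compact (closure {x. \<phi> x \<noteq> 0}) \<and> closure {x. \<phi> x \<noteq> 0} \<subseteq> G}"

definition is_weak_pd :: "(real^2) set \<Rightarrow> 2 list \<Rightarrow> sfun \<Rightarrow> sfun \<Rightarrow> bool" where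
  "is_weak_pd G \<alpha> v g \<longleftrightarrow> g \<in> L2d G \<and>
     (\<forall>\<phi>\<in>test_functions G. ipd G v (pd \<alpha> \<phi>) = (- 1) ^ length \<alpha> * ipd G g \<phi>)"

definition weak_pd :: "(real^2) set \<Rightarrow> 2 list \<Rightarrow> sfun \<Rightarrow> sfun" where
  "weak_pd G \<alpha> v = (SOME g. is_weak_pd G \<alpha> v g)"

text \<open>
  The Sobolev spaces \<open>H\<^sup>s(G)\<close>, for real \<open>s = m + \<sigma> \<ge> 0\<close> with \<open>m\<close> a natural number and
  \<open>0 \<le> \<sigma> < 1\<close>, carry the Sobolev-Slobodeckij norm.  The factor \<open>1 - \<sigma>\<close> in front of the Gagliardo
  seminorm does not change the space; without it the norms blow up as \<open>\<sigma>\<close> tends to 1, so that no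
  estimate could be uniform in \<open>s\<close>.
\<close>

definition gagliardo_sq :: "real \<Rightarrow> (real^2) set \<Rightarrow> sfun \<Rightarrow> ennreal" where
  "gagliardo_sq \<sigma> G v =
     (\<integral>\<^sup>+x. \<integral>\<^sup>+y. ennreal ((v x - v y)^2 / dist x y powr (2 + 2 * \<sigma>)) \<partial>lebesgue_on G \<partial>lebesgue_on G)"

definition Hs :: "real \<Rightarrow> (real^2) set \<Rightarrow> sfun set" where
  "Hs s G = (let m = nat \<lfloor>s\<rfloor>; \<sigma> = frac s in
     {v \<in> L2d G. (\<forall>\<alpha>. length \<alpha> \<le> m \<longrightarrow> (\<exists>g. is_weak_pd G \<alpha> v g)) \<and>
        (\<sigma> \<noteq> 0 \<longrightarrow> (\<forall>\<alpha>. length \<alpha> = m \<longrightarrow> gagliardo_sq \<sigma> G (weak_pd G \<alpha> v) < \<infinity>))})"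

definition Hs_norm :: "real \<Rightarrow> (real^2) set \<Rightarrow> sfun \<Rightarrow> real" where
  "Hs_norm s G v = (let m = nat \<lfloor>s\<rfloor>; \<sigma> = frac s in
     sqrt ((\<Sum>\<alpha> | length \<alpha> \<le> m. (L2normd G (weak_pd G \<alpha> v))^2) +
       (if \<sigma> = 0 then 0
        else (1 - \<sigma>) * (\<Sum>\<alpha> | length \<alpha> = m. enn2real (gagliardo_sq \<sigma> G (weak_pd G \<alpha> v))))))"

definition H20 :: "(real^2) set \<Rightarrow> sfun set" where
  "H20 G = {v \<in> Hs 2 G. \<exists>\<phi>. (\<forall>n. \<phi> n \<in> test_functions G) \<and>
     (\<lambda>n. Hs_norm 2 G (\<phi> n - v)) \<longlonglongrightarrow> 0}"

definition aform :: "(real^2) set \<Rightarrow> sfun \<Rightarrow> sfun \<Rightarrow> real" where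
  "aform \<Omega> w v = (LINT x|lebesgue_on \<Omega>. (\<Sum>i\<in>UNIV. \<Sum>j\<in>UNIV.
     weak_pd \<Omega> [i, j] w x * weak_pd \<Omega> [i, j] v x))"


section \<open>The domain and the clamped biharmonic operator\<close>

definition polygonal_lipschitz_domain :: "(real^2) set \<Rightarrow> bool" where
  "polygonal_lipschitz_domain \<Omega> \<longleftrightarrow>
     open \<Omega> \<and> connected \<Omega> \<and> bounded \<Omega> \<and> \<Omega> \<noteq> {} \<and>
     (\<exists>S. finite S \<and> frontier \<Omega> = (\<Union>(a, b)\<in>S. closed_segment a b)) \<and>
     (\<forall>z\<in>frontier \<Omega>. \<exists>\<tau> \<nu> \<delta> \<epsilon> L g.
        norm \<tau> = 1 \<and> norm \<nu> = 1 \<and> \<tau> \<bullet> \<nu> = 0 \<and> \<delta> > 0 \<and> \<epsilon> > 0 \<and>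
        L-lipschitz_on {-\<delta><..<\<delta>} g \<and>
        (\<forall>s. \<bar>s\<bar> < \<delta> \<longrightarrow> \<bar>g s\<bar> < \<epsilon>) \<and>
        (\<forall>s y. \<bar>s\<bar> < \<delta> \<and> \<bar>y\<bar> < \<epsilon> \<longrightarrow>
           (z + s *\<^sub>R \<tau> + y *\<^sub>R \<nu> \<in> \<Omega> \<longleftrightarrow> g s < (y::real))))"

text \<open>\<open>\<Delta>\<^sup>2\<psi> = g\<close> in the sense of distributions, with \<open>g\<close> square integrable.\<close>

definition is_bilaplacian :: "(real^2) set \<Rightarrow> sfun \<Rightarrow> sfun \<Rightarrow> bool" where
  "is_bilaplacian \<Omega> \<psi> g \<longleftrightarrow> g \<in> L2d \<Omega> \<and>
     (\<forall>\<phi>\<in>test_functions \<Omega>.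
        ipd \<Omega> \<psi> (\<lambda>x. \<Sum>i\<in>UNIV. \<Sum>j\<in>UNIV. pd [i, i, j, j] \<phi> x) = ipd \<Omega> g \<phi>)"

definition dom_A :: "(real^2) set \<Rightarrow> sfun set" where
  "dom_A \<Omega> = {\<psi> \<in> H20 \<Omega>. \<exists>g. is_bilaplacian \<Omega> \<psi> g}"

definition eigenbasis_A :: "(real^2) set \<Rightarrow> (nat \<Rightarrow> real) \<Rightarrow> (nat \<Rightarrow> sfun) \<Rightarrow> bool" where
  "eigenbasis_A \<Omega> \<mu> \<psi> \<longleftrightarrow>
     (\<forall>n. \<psi> n \<in> dom_A \<Omega> \<and> is_bilaplacian \<Omega> (\<psi> n) (\<lambda>x. \<mu> n * \<psi> n x)) \<and>
     (\<forall>m n. ipd \<Omega> (\<psi> m) (\<psi> n) = (if m = n then 1 else 0)) \<and>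
     (\<forall>w\<in>L2d \<Omega>. (\<lambda>n. L2normd \<Omega> (\<lambda>x. w x - (\<Sum>i<n. ipd \<Omega> w (\<psi> i) * \<psi> i x))) \<longlonglongrightarrow> 0)"

definition dom_A_pow ::
    "(real^2) set \<Rightarrow> (nat \<Rightarrow> real) \<Rightarrow> (nat \<Rightarrow> sfun) \<Rightarrow> real \<Rightarrow> sfun set" where
  "dom_A_pow \<Omega> \<mu> \<psi> r = {w \<in> L2d \<Omega>. summable (\<lambda>n. \<mu> n powr (2 * r) * (ipd \<Omega> w (\<psi> n))^2)}"

text \<open>\<open>D(A)\<close>, with the graph norm, embeds continuously into \<open>H\<^sup>2\<^sup>+\<^sup>\<gamma>(\<Omega>)\<close>.\<close>

definition elliptic_regularity :: "(real^2) set \<Rightarrow> real \<Rightarrow> bool" where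
  "elliptic_regularity \<Omega> \<gamma> \<longleftrightarrow>
     (\<exists>c. \<forall>\<psi> g. \<psi> \<in> dom_A \<Omega> \<and> is_bilaplacian \<Omega> \<psi> g \<longrightarrow>
        \<psi> \<in> Hs (2 + \<gamma>) \<Omega> \<and> Hs_norm (2 + \<gamma>) \<Omega> \<psi> \<le> c * (L2normd \<Omega> \<psi> + L2normd \<Omega> g))"


section \<open>Functions of time\<close>

text \<open>
  A normed space of functions is given by its carrier \<open>X\<close> and its norm \<open>N\<close>.  The Bochner norms
  below are infinite exactly for the functions that do not belong to the Bochner space.
\<close>

definition strongly_measurable ::
    "sfun set \<Rightarrow> (sfun \<Rightarrow> real) \<Rightarrow> real \<Rightarrow> (real \<Rightarrow> sfun) \<Rightarrow> bool" where
  "strongly_measurable X N T \<phi> \<longleftrightarrow>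
     (AE t in lebesgue_on {0..T}. \<phi> t \<in> X) \<and>
     (\<exists>s. (\<forall>n. simple_function (lebesgue_on {0..T}) (s n) \<and> s n ` {0..T} \<subseteq> X) \<and>
          (AE t in lebesgue_on {0..T}. (\<lambda>n. N (\<phi> t - s n t)) \<longlonglongrightarrow> 0))"

definition Linf_norm :: "sfun set \<Rightarrow> (sfun \<Rightarrow> real) \<Rightarrow> real \<Rightarrow> (real \<Rightarrow> sfun) \<Rightarrow> ennreal" where
  "Linf_norm X N T \<phi> =
     (if strongly_measurable X N T \<phi>
      then esssup (lebesgue_on {0..T}) (\<lambda>t. ennreal (N (\<phi> t))) else \<infinity>)"

definition L2t_norm :: "sfun set \<Rightarrow> (sfun \<Rightarrow> real) \<Rightarrow> real \<Rightarrow> (real \<Rightarrow> sfun) \<Rightarrow> ennreal" where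
  "L2t_norm X N T \<phi> =
     (let I = \<integral>\<^sup>+t. ennreal ((N (\<phi> t))^2) \<partial>lebesgue_on {0..T} in
      if strongly_measurable X N T \<phi> \<and> I < \<infinity> then ennreal (sqrt (enn2real I)) else \<infinity>)"

definition C0_in :: "sfun set \<Rightarrow> (sfun \<Rightarrow> real) \<Rightarrow> real \<Rightarrow> (real \<Rightarrow> sfun) \<Rightarrow> bool" where
  "C0_in X N T \<phi> \<longleftrightarrow>
     (\<forall>t\<in>{0..T}. \<phi> t \<in> X \<and> ((\<lambda>s. N (\<phi> s - \<phi> t)) \<longlongrightarrow> 0) (at t within {0..T}))"

text \<open>
  \<open>\<phi>\<close> is the (absolutely) continuous representative of an element of \<open>W\<^sup>1\<^sup>,\<^sup>1(0,T;L\<^sup>2(\<Omega>))\<close> whose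
  weak time derivative is \<open>\<psi>\<close>: the identity \<open>\<phi>(t) = \<phi>(0) + \<integral>\<^sub>0\<^sup>t \<psi>\<close> holds in \<open>L\<^sup>2(\<Omega>)\<close> for every \<open>t\<close>.
\<close>

definition has_time_deriv ::
    "(real^2) set \<Rightarrow> real \<Rightarrow> (real \<Rightarrow> sfun) \<Rightarrow> (real \<Rightarrow> sfun) \<Rightarrow> bool" where
  "has_time_deriv \<Omega> T \<phi> \<psi> \<longleftrightarrow>
     (\<forall>t\<in>{0..T}. \<phi> t \<in> L2d \<Omega>) \<and>
     strongly_measurable (L2d \<Omega>) (L2normd \<Omega>) T \<psi> \<and>
     integrable (lebesgue_on {0..T}) (\<lambda>t. L2normd \<Omega> (\<psi> t)) \<and>
     (\<forall>v\<in>L2d \<Omega>. \<forall>t\<in>{0..T}.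
        ipd \<Omega> (\<phi> t - \<phi> 0) v = (LINT r|lebesgue_on {0..t}. ipd \<Omega> (\<psi> r) v))"

text \<open>
  The norm \<open>nrm\<close> of the \<open>j\<close>-th weak time derivative of \<open>\<phi>\<close>, infinite if that derivative does not
  exist.  The derivative is unique up to null sets, so the infimum is over representatives only.
\<close>

definition norm_dt ::
    "(real^2) set \<Rightarrow> real \<Rightarrow> ((real \<Rightarrow> sfun) \<Rightarrow> ennreal) \<Rightarrow> nat \<Rightarrow> (real \<Rightarrow> sfun) \<Rightarrow> ennreal" where
  "norm_dt \<Omega> T nrm j \<phi> = (INF \<psi>\<in>{\<psi>. (has_time_deriv \<Omega> T ^^ j) \<phi> \<psi>}. nrm \<psi>)"

text \<open>
  The weak solution of the biharmonic wave equation; \<open>(u\<^sub>t\<^sub>t, v)\<close> is the time derivative of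
  \<open>(u\<^sub>t, v)\<close>, which is a classical one since \<open>f\<close> is continuous with values in \<open>L\<^sup>2(\<Omega>)\<close>.
\<close>

definition weak_solution ::
    "(real^2) set \<Rightarrow> real \<Rightarrow> (real \<Rightarrow> sfun) \<Rightarrow> sfun \<Rightarrow> sfun \<Rightarrow> (real \<Rightarrow> sfun) \<Rightarrow> bool" where
  "weak_solution \<Omega> T f u0 v0 u \<longleftrightarrow>
     C0_in (H20 \<Omega>) (Hs_norm 2 \<Omega>) T u \<and>
     (\<exists>ut. C0_in (L2d \<Omega>) (L2normd \<Omega>) T ut \<and>
        (\<forall>t\<in>{0..T}. ((\<lambda>s. L2normd \<Omega> (\<lambda>x. (u s x - u t x) / (s - t) - ut t x)) \<longlongrightarrow> 0)
                       (at t within {0..T})) \<and>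
        (AE x in lebesgue_on \<Omega>. u 0 x = u0 x) \<and>
        (AE x in lebesgue_on \<Omega>. ut 0 x = v0 x) \<and>
        (\<forall>v\<in>H20 \<Omega>. \<forall>t\<in>{0..T}.
           ((\<lambda>s. ipd \<Omega> (ut s) v) has_real_derivative (ipd \<Omega> (f t) v - aform \<Omega> (u t) v))
             (at t within {0..T})))"

definition L_fu :: "(real^2) set \<Rightarrow> real \<Rightarrow> real \<Rightarrow> (real \<Rightarrow> sfun) \<Rightarrow> (real \<Rightarrow> sfun) \<Rightarrow> ennreal" where
  "L_fu \<Omega> T \<gamma> f u =
     (let LinfL2 = Linf_norm (L2d \<Omega>) (L2normd \<Omega>) T;
          L2L2 = L2t_norm (L2d \<Omega>) (L2normd \<Omega>) T;
          LinfH = Linf_norm (Hs (2 + \<gamma>) \<Omega>) (Hs_norm (2 + \<gamma>) \<Omega>) T;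
          L2H = L2t_norm (Hs (2 + \<gamma>) \<Omega>) (Hs_norm (2 + \<gamma>) \<Omega>) T
      in norm_dt \<Omega> T LinfL2 0 f + norm_dt \<Omega> T L2L2 1 f
         + norm_dt \<Omega> T LinfH 0 u + norm_dt \<Omega> T LinfH 1 u
         + norm_dt \<Omega> T LinfL2 2 u + norm_dt \<Omega> T L2H 2 u + norm_dt \<Omega> T L2L2 3 u)"

definition M_u :: "(real^2) set \<Rightarrow> real \<Rightarrow> (real \<Rightarrow> sfun) \<Rightarrow> ennreal" where
  "M_u \<Omega> T u = norm_dt \<Omega> T (Linf_norm (L2d \<Omega>) (L2normd \<Omega>) T) 3 u
              + norm_dt \<Omega> T (L2t_norm (L2d \<Omega>) (L2normd \<Omega>) T) 4 u"


section \<open>Meshes and piecewise functions\<close>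

definition mesh_of :: "(real^2) set \<Rightarrow> (real^2) set set \<Rightarrow> bool" where
  "mesh_of \<Omega> \<T> \<longleftrightarrow> triangulation \<T> \<and> (\<forall>K\<in>\<T>. 2 simplex K) \<and> \<Union>\<T> = closure \<Omega>"

definition mesh_size :: "(real^2) set set \<Rightarrow> real" where
  "mesh_size \<T> = Max (diameter ` \<T>)"

definition shape_regular :: "real \<Rightarrow> (real^2) set set \<Rightarrow> bool" where
  "shape_regular \<rho> \<T> \<longleftrightarrow> (\<forall>K\<in>\<T>. \<exists>z. cball z (\<rho> * diameter K) \<subseteq> K)"

definition quasi_uniform :: "real \<Rightarrow> (real^2) set set \<Rightarrow> bool" where
  "quasi_uniform \<kappa> \<T> \<longleftrightarrow> (\<forall>K\<in>\<T>. \<kappa> * mesh_size \<T> \<le> diameter K)"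

definition vertices_of :: "(real^2) set \<Rightarrow> (real^2) set" where
  "vertices_of K = {z. z extreme_point_of K}"

definition vertices :: "(real^2) set set \<Rightarrow> (real^2) set" where
  "vertices \<T> = (\<Union>K\<in>\<T>. vertices_of K)"

definition edges :: "(real^2) set set \<Rightarrow> (real^2) set set" where
  "edges \<T> = {e. \<exists>K\<in>\<T>. e edge_of K}"

definition vertex_patch :: "(real^2) set set \<Rightarrow> real^2 \<Rightarrow> (real^2) set set" where
  "vertex_patch \<T> z = {K \<in> \<T>. z \<in> K}"

definition edge_patch :: "(real^2) set set \<Rightarrow> (real^2) set \<Rightarrow> (real^2) set set" where
  "edge_patch \<T> e = {K \<in> \<T>. e edge_of K}"

text \<open>
  The jump of a quantity given on each triangle of the edge patch; on a boundary edge the patch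
  is a singleton and the jump is the trace.  The sign depends on the chosen triangle, but only
  absolute values of jumps are used.
\<close>

definition jump :: "(real^2) set set \<Rightarrow> (real^2) set \<Rightarrow> ((real^2) set \<Rightarrow> real) \<Rightarrow> real" where
  "jump \<T> e g = (let K = (SOME K. K \<in> edge_patch \<T> e) in g K - (\<Sum>K'\<in>edge_patch \<T> e - {K}. g K'))"

definition mean :: "'k set \<Rightarrow> ('k \<Rightarrow> real) \<Rightarrow> real" where
  "mean P g = (\<Sum>K\<in>P. g K) / real (card P)"

definition edge_normal :: "(real^2) set \<Rightarrow> real^2" where
  "edge_normal e = (SOME n. norm n = 1 \<and> (\<forall>x\<in>e. \<forall>y\<in>e. n \<bullet> (x - y) = 0))"

text \<open>Arc length measure on a segment.\<close>

definition edge_measure :: "(real^2) set \<Rightarrow> (real^2) measure" where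
  "edge_measure e = (let (a, b) = (SOME p. e = closed_segment (fst p) (snd p)) in
     scale_measure (ennreal (dist a b)) (distr (lebesgue_on {0..1}) borel (linepath a b)))"

text \<open>
  The value at a point of \<open>K\<close> of the continuous representative of \<open>g|\<^sub>K\<close>, which exists for
  \<open>g|\<^sub>K\<close> in \<open>H\<^sup>2(K)\<close>.
\<close>

definition point_value :: "(real^2) set \<Rightarrow> sfun \<Rightarrow> real^2 \<Rightarrow> real" where
  "point_value K g z =
     (THE c. \<exists>g'. continuous_on K g' \<and> (AE x in lebesgue_on K. g' x = g x) \<and> g' z = c)"

definition gradient_value :: "(real^2) set \<Rightarrow> sfun \<Rightarrow> real^2 \<Rightarrow> real^2" where
  "gradient_value K v z = (\<chi> i. point_value K (weak_pd (interior K) [i] v) z)"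

text \<open>The trace on the edge \<open>e\<close> of \<open>w\<close> in \<open>H\<^sup>1(K)\<close>: the continuous extension of restriction.\<close>

definition is_trace :: "(real^2) set \<Rightarrow> (real^2) set \<Rightarrow> sfun \<Rightarrow> sfun \<Rightarrow> bool" where
  "is_trace K e w \<tau> \<longleftrightarrow> \<tau> \<in> L2 (edge_measure e) \<and>
     (\<exists>\<phi>. (\<forall>n. smooth (\<phi> n)) \<and> (\<lambda>n. Hs_norm 1 (interior K) (\<phi> n - w)) \<longlonglongrightarrow> 0 \<and>
          (\<lambda>n. L2norm (edge_measure e) (\<phi> n - \<tau>)) \<longlonglongrightarrow> 0)"

definition trace_on :: "(real^2) set \<Rightarrow> (real^2) set \<Rightarrow> sfun \<Rightarrow> sfun" where
  "trace_on K e w = (SOME \<tau>. is_trace K e w \<tau>)"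

text \<open>\<open>\<integral>\<^sub>e \<partial>v/\<partial>n ds\<close> for \<open>v\<close> in \<open>H\<^sup>2(K)\<close>, traces being taken from inside \<open>K\<close>.\<close>

definition normal_deriv_integral :: "(real^2) set \<Rightarrow> (real^2) set \<Rightarrow> sfun \<Rightarrow> real" where
  "normal_deriv_integral K e v =
     (LINT x|edge_measure e.
       (\<Sum>i\<in>UNIV. edge_normal e $ i * trace_on K e (weak_pd (interior K) [i] v) x))"

definition Hs_pw :: "real \<Rightarrow> (real^2) set set \<Rightarrow> sfun set" where
  "Hs_pw s \<T> = {v. \<forall>K\<in>\<T>. v \<in> Hs s (interior K)}"

definition Hs_norm_pw :: "real \<Rightarrow> (real^2) set set \<Rightarrow> sfun \<Rightarrow> real" where
  "Hs_norm_pw s \<T> v = sqrt (\<Sum>K\<in>\<T>. (Hs_norm s (interior K) v)^2)"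

definition mesh_norm :: "(real^2) set set \<Rightarrow> sfun \<Rightarrow> real" where
  "mesh_norm \<T> v = sqrt (
     (\<Sum>K\<in>\<T>. \<Sum>i\<in>UNIV. \<Sum>j\<in>UNIV. (L2normd (interior K) (weak_pd (interior K) [i, j] v))^2)
   + (\<Sum>e\<in>edges \<T>. \<Sum>z\<in>vertices_of e.
        (jump \<T> e (\<lambda>K. point_value K v z))^2 / (diameter e)^2)
   + (\<Sum>e\<in>edges \<T>. (jump \<T> e (\<lambda>K. normal_deriv_integral K e v) / diameter e)^2))"

definition poly2 :: "nat \<Rightarrow> sfun set" where
  "poly2 r = {p. \<exists>c. \<forall>x. p x = (\<Sum>i\<le>r. \<Sum>j\<le>r - i. c i j * (x $ 1) ^ i * (x $ 2) ^ j)}"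

text \<open>
  Piecewise polynomials are normalised to vanish off the open triangles, so that they are equal as
  functions if they agree almost everywhere.
\<close>

definition poly_pw :: "nat \<Rightarrow> (real^2) set set \<Rightarrow> sfun set" where
  "poly_pw r \<T> = {w. (\<forall>K\<in>\<T>. \<exists>p\<in>poly2 r. \<forall>x\<in>interior K. w x = p x) \<and>
                     (\<forall>x. x \<notin> (\<Union>K\<in>\<T>. interior K) \<longrightarrow> w x = 0)}"

definition morley :: "(real^2) set \<Rightarrow> (real^2) set set \<Rightarrow> sfun set" where
  "morley \<Omega> \<T> = {w \<in> poly_pw 2 \<T>.
     (\<forall>z\<in>vertices \<T>. \<forall>K\<in>vertex_patch \<T> z. \<forall>K'\<in>vertex_patch \<T> z.
        (z \<in> \<Omega> \<longrightarrow> point_value K w z = point_value K' w z) \<and>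
        (z \<in> frontier \<Omega> \<longrightarrow> point_value K w z = 0)) \<and>
     (\<forall>e\<in>edges \<T>. \<forall>a b. e = closed_segment a b \<longrightarrow>
        (\<forall>K\<in>edge_patch \<T> e. \<forall>K'\<in>edge_patch \<T> e.
          (\<not> e \<subseteq> frontier \<Omega> \<longrightarrow>
             edge_normal e \<bullet> gradient_value K w (midpoint a b) =
             edge_normal e \<bullet> gradient_value K' w (midpoint a b)) \<and>
          (e \<subseteq> frontier \<Omega> \<longrightarrow> edge_normal e \<bullet> gradient_value K w (midpoint a b) = 0)))}"

definition morley_interpolation ::
    "(real^2) set \<Rightarrow> (real^2) set set \<Rightarrow> (sfun \<Rightarrow> sfun) \<Rightarrow> bool" where
  "morley_interpolation \<Omega> \<T> I \<longleftrightarrow> (\<forall>v\<in>Hs_pw 2 \<T>. I v \<in> morley \<Omega> \<T> \<and>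
     (\<forall>z\<in>vertices \<T> \<inter> \<Omega>. \<forall>K\<in>vertex_patch \<T> z.
        point_value K (I v) z = mean (vertex_patch \<T> z) (\<lambda>K'. point_value K' v z)) \<and>
     (\<forall>e\<in>edges \<T>. \<not> e \<subseteq> frontier \<Omega> \<longrightarrow> (\<forall>K\<in>edge_patch \<T> e.
        normal_deriv_integral K e (I v) =
        mean (edge_patch \<T> e) (\<lambda>K'. normal_deriv_integral K' e v))))"

definition centroid :: "(real^2) set \<Rightarrow> real^2" where
  "centroid K = (1 / 3) *\<^sub>R (\<Sum>z\<in>vertices_of K. z)"

text \<open>
  The Hsieh-Clough-Tocher space: conforming functions that are cubic on the three subtriangles
  obtained by joining the centroid of each triangle with its vertices.
\<close>

definition HCT :: "(real^2) set \<Rightarrow> (real^2) set set \<Rightarrow> sfun set" where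
  "HCT \<Omega> \<T> = {v \<in> H20 \<Omega>. \<forall>K\<in>\<T>. \<forall>e. e edge_of K \<longrightarrow>
     (\<exists>p\<in>poly2 3. AE x in lebesgue_on (convex hull insert (centroid K) e). v x = p x)}"

definition companion :: "(real^2) set \<Rightarrow> (real^2) set set \<Rightarrow> (sfun \<Rightarrow> sfun) \<Rightarrow> bool" where
  "companion \<Omega> \<T> J \<longleftrightarrow>
     (\<forall>w\<in>morley \<Omega> \<T>. \<forall>w'\<in>morley \<Omega> \<T>. \<forall>c d.
        AE x in lebesgue_on \<Omega>. J (\<lambda>y. c * w y + d * w' y) x = c * J w x + d * J w' x) \<and>
     (\<forall>w\<in>morley \<Omega> \<T>. J w \<in> H20 \<Omega> \<and>
        (\<exists>g\<in>HCT \<Omega> \<T>. \<exists>p\<in>poly_pw 8 \<T>. AE x in lebesgue_on \<Omega>. J w x = g x + p x) \<and>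
        (\<forall>z\<in>vertices \<T>. \<forall>K\<in>vertex_patch \<T> z. point_value K (J w) z = point_value K w z) \<and>
        (\<forall>z\<in>vertices \<T> \<inter> \<Omega>. \<forall>K\<in>vertex_patch \<T> z. \<forall>i.
           gradient_value K (J w) z $ i =
           mean (vertex_patch \<T> z) (\<lambda>K'. gradient_value K' w z $ i)) \<and>
        (\<forall>e\<in>edges \<T>. \<forall>K\<in>edge_patch \<T> e.
           normal_deriv_integral K e (J w) = normal_deriv_integral K e w))"


section \<open>The discretisation\<close>

definition fin_dim_subspace :: "sfun set \<Rightarrow> bool" where
  "fin_dim_subspace V \<longleftrightarrow> (\<exists>B. finite B \<and> V = {\<lambda>x. \<Sum>b\<in>B. c b * b x | c. True})"

definition sum_space :: "sfun set \<Rightarrow> sfun set \<Rightarrow> sfun set" where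
  "sum_space V W = {\<lambda>x. v x + w x | v w. v \<in> V \<and> w \<in> W}"

definition symmetric_bilinear_on :: "sfun set \<Rightarrow> (sfun \<Rightarrow> sfun \<Rightarrow> real) \<Rightarrow> bool" where
  "symmetric_bilinear_on V B \<longleftrightarrow>
     (\<forall>v\<in>V. \<forall>w\<in>V. B v w = B w v) \<and>
     (\<forall>v\<in>V. \<forall>v'\<in>V. \<forall>w\<in>V. \<forall>c d. B (\<lambda>x. c * v x + d * v' x) w = c * B v w + d * B v' w)"

definition half :: "(nat \<Rightarrow> sfun) \<Rightarrow> nat \<Rightarrow> sfun" where
  "half \<phi> n = (\<lambda>x. (\<phi> (n + 1) x + \<phi> n x) / 2)"

definition dbar :: "real \<Rightarrow> (nat \<Rightarrow> sfun) \<Rightarrow> nat \<Rightarrow> sfun" where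
  "dbar k \<phi> n = (\<lambda>x. (\<phi> (n + 1) x - \<phi> n x) / k)"

definition dbar2 :: "real \<Rightarrow> (nat \<Rightarrow> sfun) \<Rightarrow> nat \<Rightarrow> sfun" where
  "dbar2 k \<phi> n = (\<lambda>x. (\<phi> (n + 1) x - 2 * \<phi> n x + \<phi> (n - 1) x) / k^2)"

definition at_grid :: "real \<Rightarrow> (real \<Rightarrow> sfun) \<Rightarrow> nat \<Rightarrow> sfun" where
  "at_grid k \<phi> n = \<phi> (real n * k)"

definition ritz_projection ::
    "(real^2) set \<Rightarrow> sfun set \<Rightarrow> (sfun \<Rightarrow> sfun \<Rightarrow> real) \<Rightarrow> (sfun \<Rightarrow> sfun) \<Rightarrow> (sfun \<Rightarrow> sfun) \<Rightarrow> bool" where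
  "ritz_projection \<Omega> V ah Q R \<longleftrightarrow>
     (\<forall>w\<in>H20 \<Omega>. R w \<in> V \<and> (\<forall>v\<in>V. ah (R w) v = aform \<Omega> w (Q v)))"

definition explicit_scheme ::
    "(real^2) set \<Rightarrow> sfun set \<Rightarrow> (sfun \<Rightarrow> sfun \<Rightarrow> real) \<Rightarrow> (sfun \<Rightarrow> sfun) \<Rightarrow> real \<Rightarrow> nat \<Rightarrow>
     (real \<Rightarrow> sfun) \<Rightarrow> sfun \<Rightarrow> sfun \<Rightarrow> (nat \<Rightarrow> sfun) \<Rightarrow> bool" where
  "explicit_scheme \<Omega> V ah R k N f u0 v0 U \<longleftrightarrow>
     (\<forall>n\<le>N. U n \<in> V) \<and> U 0 = R u0 \<and>
     (\<forall>v\<in>V. 2 / k * ipd \<Omega> (dbar k U 0) v + ah (half U 0) v =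
             ipd \<Omega> (\<lambda>x. half (at_grid k f) 0 x + 2 / k * v0 x) v) \<and>
     (\<forall>n\<in>{1..N - 1}. \<forall>v\<in>V.
        ipd \<Omega> (dbar2 k U n) v + ah (U n) v = ipd \<Omega> (at_grid k f n) v)"

end

theory Submission
  imports Defs "HOL-Computational_Algebra.Polynomial"
begin

text \<open>
  Let \<open>\<theta>\<^sup>n = R u(t\<^sub>n) - U\<^sup>n\<close>.  Since \<open>\<Delta>\<^sup>2u = g\<close> with \<open>g = f - u\<^sub>t\<^sub>t\<close> in \<open>L\<^sup>2\<close>, the Ritz projection is consistent up to the
  functional \<open>e\<^sup>n(v) = (g(t\<^sub>n), Q v - v)\<close>, which is of order \<open>h\<^sup>2\<close> in the mesh-dependent norm.  Testing the error
  equation with \<open>\<theta>\<^sup>n\<^sup>+\<^sup>1 - \<theta>\<^sup>n\<^sup>-\<^sup>1\<close> gives a telescoping energy, coercive by the CFL condition; \<open>e\<^sup>n\<close> is summed by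
  parts, and comparison with the maximum of the error over all time steps replaces Gronwall's inequality.
  The error of the Ritz projection is bounded through elliptic regularity, which holds at every time.
  Bounds in \<open>H\<^sup>2\<^sup>+\<^sup>\<gamma>\<close> of difference quotients follow from those of the time derivatives because the
  Sobolev-Slobodeckij norm is a supremum of functionals on \<open>L\<^sup>2\<close>; each norm is bounded for its own
  representative of the time derivative, so that no representatives have to be compared.  The mesh-dependent norm is a
  seminorm up to a factor because point values and edge means of normal derivatives are linear on \<open>H\<^sup>2(K)\<close>; by
  Poincare's inequality for \<open>Q v\<close>, its null vectors in \<open>V\<^sub>h\<close> vanish, whence the Ritz projection is linear.
\<close>

subsection \<open>Square integrable functions\<close>

text \<open>Much of the analysis is forced by the encoding. Functions are total, and weak
  derivatives, traces and edge end points are values of a choice operator, so neither the Sobolev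
  norms nor the mesh-dependent norm are visibly subadditive: linearity holds up to null sets and
  must come from uniqueness of the object chosen. For point values and traces this rests on Sobolev
  and trace inequalities on a triangle, hence on density of smooth functions, hence on mollifiers.
  For the mesh-dependent norm n only n(c v + d w)^2 <= 2 c^2 n(v)^2 + 2 d^2 n(w)^2 is established;
  the lost factors go into the constant. Time derivatives are available only after testing with
  functions of L2, so a norm stronger than L2 must be expressed by such tests. The right-hand side
  of the theorem may be infinite; otherwise its last term supplies four time derivatives of u, which
  give the second one a meaning at each grid time. The data errors carry the powers h^2 and h^(2
  gamma); the surplus over h^gamma is bounded by powers of the diameter of the domain, which
  therefore enters the constant.\<close>

lemma L2_measurable: "v : L2 M ==> v : borel_measurable M"
  and L2_integrable_sq: "v : L2 M ==> integrable M (%x. (v x)^2)"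
  by (auto simp: L2_def)

lemma L2_integrable_mult:
  assumes "v : L2 M" "w : L2 M"
  shows "integrable M (%x. v x * w x)"
proof (rule Bochner_Integration.integrable_bound)
  show "integrable M (%x. (v x)^2 + (w x)^2)"
    using assms by (simp add: L2_integrable_sq)
  show "(%x. v x * w x) : borel_measurable M"
    using assms[THEN L2_measurable] by measurable
  have "\<bar>a * b\<bar> <= \<bar>a^2 + b^2\<bar>" for a b :: real
  proof -
    have "0 <= \<bar>a\<bar> * \<bar>b\<bar>" by simp
    moreover have "2 * \<bar>a\<bar> * \<bar>b\<bar> <= a^2 + b^2" using sum_squares_bound[of "\<bar>a\<bar>" "\<bar>b\<bar>"] by simp
    ultimately show ?thesis unfolding abs_mult by linarith
  qed
  then show "AE x in M. norm (v x * w x) <= norm ((v x)\<^sup>2 + (w x)\<^sup>2)"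
    by (intro AE_I2) simp
qed

lemma L2_lin:
  assumes "v : L2 M" "w : L2 M"
  shows "(%x. c * v x + d * w x) : L2 M"
proof -
  have "integrable M (%x. c^2 * (v x)^2 + 2 * c * d * (v x * w x) + d^2 * (w x)^2)"
    using assms by (intro Bochner_Integration.integrable_add integrable_mult_right
        L2_integrable_sq L2_integrable_mult) auto
  moreover have "(%x. (c * v x + d * w x)^2) = (%x. c^2 * (v x)^2 + 2 * c * d * (v x * w x) + d^2 * (w x)^2)"
    by (auto simp: power2_eq_square algebra_simps)
  ultimately show ?thesis
    using assms[THEN L2_measurable] by (auto simp: L2_def)
qed

lemma L2_zero [simp]: "(%x. 0) : L2 M"
  by (simp add: L2_def)

lemma L2_add: "v : L2 M ==> w : L2 M ==> (%x. v x + w x) : L2 M"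
  using L2_lin[of v M w 1 1] by simp

lemma L2_diff: "v : L2 M ==> w : L2 M ==> (%x. v x - w x) : L2 M"
  using L2_lin[of v M w 1 "-1"] by simp

lemma L2_cmult: "v : L2 M ==> (%x. c * v x) : L2 M"
  using L2_lin[of v M v c 0] by simp

lemma L2_divide: "v : L2 M ==> (%x. v x / c) : L2 M"
  using L2_cmult[of v M "1/c"] by simp

lemma L2_sum: "(\<And>i. i : I ==> v i : L2 M) ==> (%x. \<Sum>i\<in>I. v i x) : L2 M"
  by (induction I rule: infinite_finite_induct) (auto intro: L2_add)

lemma L2_bounded:
  assumes "finite_measure M" "v : borel_measurable M" "\<And>x. x : space M ==> \<bar>v x\<bar> <= B"
  shows "v : L2 M"
proof -
  interpret finite_measure M by fact
  have "integrable M (%x. (v x)^2)"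
  proof (rule integrable_const_bound)
    show "AE x in M. norm ((v x)\<^sup>2) <= B^2"
      using power_mono[OF assms(3) abs_ge_zero, of _ 2] by (intro AE_I2) simp
  qed (use assms in measurable)
  then show ?thesis using assms by (simp add: L2_def)
qed

lemma ip_commute: "ip M v w = ip M w v"
  by (simp add: ip_def mult.commute)

lemma ip_lin_left:
  assumes "v : L2 M" "w : L2 M" "z : L2 M"
  shows "ip M (%x. c * v x + d * w x) z = c * ip M v z + d * ip M w z"
proof -
  have "ip M (%x. c * v x + d * w x) z = (LINT x|M. c * (v x * z x) + d * (w x * z x))"
    unfolding ip_def by (simp add: algebra_simps)
  also have "... = c * ip M v z + d * ip M w z"
    unfolding ip_def using assms
    by (subst Bochner_Integration.integral_add) (auto intro: L2_integrable_mult)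
  finally show ?thesis .
qed

lemma ip_lin_right:
  assumes "v : L2 M" "w : L2 M" "z : L2 M"
  shows "ip M z (%x. c * v x + d * w x) = c * ip M z v + d * ip M z w"
  using ip_lin_left[OF assms] by (simp add: ip_commute)

lemma ip_add_left: "v : L2 M ==> w : L2 M ==> z : L2 M ==> ip M (%x. v x + w x) z = ip M v z + ip M w z"
  using ip_lin_left[of v M w z 1 1] by simp

lemma ip_diff_left: "v : L2 M ==> w : L2 M ==> z : L2 M ==> ip M (%x. v x - w x) z = ip M v z - ip M w z"
  using ip_lin_left[of v M w z 1 "-1"] by simp

lemma ip_add_right: "v : L2 M ==> w : L2 M ==> z : L2 M ==> ip M z (%x. v x + w x) = ip M z v + ip M z w"
  using ip_lin_right[of v M w z 1 1] by simp

lemma ip_diff_right: "v : L2 M ==> w : L2 M ==> z : L2 M ==> ip M z (%x. v x - w x) = ip M z v - ip M z w"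
  using ip_lin_right[of v M w z 1 "-1"] by simp

lemma ip_cmult_left: "ip M (%x. c * v x) z = c * ip M v z"
  by (simp add: ip_def mult.assoc)

lemma ip_cmult_right: "ip M z (%x. c * v x) = c * ip M z v"
  by (simp add: ip_commute[of M z] ip_cmult_left)

lemma ip_divide_left: "ip M (%x. v x / c) z = ip M v z / c"
  using ip_cmult_left[of M "1/c" v z] by simp

lemma ip_zero_left [simp]: "ip M (%x. 0) z = 0"
  by (simp add: ip_def)

lemma ip_sum_left:
  assumes "\<And>i. i : I ==> v i : L2 M" "z : L2 M"
  shows "ip M (%x. \<Sum>i\<in>I. v i x) z = (\<Sum>i\<in>I. ip M (v i) z)"
  using assms(1)
  by (induction I rule: infinite_finite_induct) (auto simp: ip_add_left L2_sum assms(2))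

lemma ip_sum_right:
  assumes "\<And>i. i : I ==> v i : L2 M" "z : L2 M"
  shows "ip M z (%x. \<Sum>i\<in>I. v i x) = (\<Sum>i\<in>I. ip M z (v i))"
  using ip_sum_left[OF assms] by (simp add: ip_commute)

lemma ip_self_nonneg: "0 <= ip M v v"
  by (simp add: ip_def)

lemma L2norm_nonneg [simp]: "0 <= L2norm M v"
  by (simp add: L2norm_def ip_self_nonneg)

lemma L2norm_sq: "(L2norm M v)^2 = ip M v v"
  by (simp add: L2norm_def ip_self_nonneg)

lemma L2norm_sq_integral: "(L2norm M v)^2 = (LINT x|M. (v x)^2)"
  unfolding L2norm_sq by (simp add: ip_def power2_eq_square)

lemma ip_AE_cong:
  assumes "AE x in M. v x = v' x" "AE x in M. w x = w' x"
    "v : borel_measurable M" "v' : borel_measurable M" "w : borel_measurable M" "w' : borel_measurable M"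
  shows "ip M v w = ip M v' w'"
  unfolding ip_def by (rule integral_cong_AE) (use assms in auto)

lemma L2norm_AE_cong:
  assumes "AE x in M. v x = v' x" "v : borel_measurable M" "v' : borel_measurable M"
  shows "L2norm M v = L2norm M v'"
  unfolding L2norm_def using ip_AE_cong assms by metis

lemma L2_AE_cong:
  assumes "AE x in M. v x = v' x" "v : L2 M" "v' : borel_measurable M"
  shows "v' : L2 M"
proof -
  have "integrable M (%x. (v' x)^2) \<longleftrightarrow> integrable M (%x. (v x)^2)"
    by (rule integrable_cong_AE) (use assms in \<open>auto simp: L2_def\<close>)
  then show ?thesis using assms by (auto simp: L2_def)
qed

lemma L2norm_cmult: "L2norm M (%x. c * v x) = \<bar>c\<bar> * L2norm M v"
  by (simp add: L2norm_def ip_cmult_left ip_cmult_right real_sqrt_mult real_sqrt_abs2 flip: mult.assoc)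

lemma ip_Cauchy_Schwarz:
  assumes v: "v : L2 M" and w: "w : L2 M"
  shows "\<bar>ip M v w\<bar> <= L2norm M v * L2norm M w"
proof -
  define a b c where "a = ip M v v" and "b = ip M v w" and "c = ip M w w"
  have q: "0 <= a + 2 * t * b + t^2 * c" for t
  proof -
    have "0 <= ip M (%x. v x + t * w x) (%x. v x + t * w x)" by (rule ip_self_nonneg)
    also have "... = a + 2 * t * b + t^2 * c"
      by (simp add: ip_add_left ip_add_right L2_cmult L2_add v w ip_cmult_left ip_cmult_right
          ip_commute[of M w v] a_def b_def c_def power2_eq_square algebra_simps)
    finally show ?thesis .
  qed
  have ac: "0 <= a" "0 <= c" by (simp_all add: a_def c_def ip_self_nonneg)
  have "b^2 <= a * c"
  proof (cases "c = 0")
    case True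
    have "b = 0"
    proof (rule ccontr)
      assume "b ~= 0"
      \<comment> \<open>With \<open>c = 0\<close> the quadratic is affine in t and takes the value
        -1 at this t.\<close>
      with q[of "-(a+1)/(2*b)"] True show False by (simp add: field_simps)
    qed
    then show ?thesis by (simp add: True)
  next
    case False
    with ac have "0 < c" by simp
    with q[of "-b/c"] show ?thesis by (simp add: field_simps power2_eq_square)
  qed
  then have "sqrt (b^2) <= sqrt (a * c)" by (rule real_sqrt_le_mono)
  then show ?thesis by (simp add: a_def b_def c_def L2norm_def real_sqrt_mult)
qed

lemma L2norm_triangle:
  assumes v: "v : L2 M" and w: "w : L2 M"
  shows "L2norm M (%x. v x + w x) <= L2norm M v + L2norm M w"
proof (rule power2_le_imp_le)
  have "(L2norm M (%x. v x + w x))^2 = ip M v v + 2 * ip M v w + ip M w w"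
    by (simp add: L2norm_sq ip_add_left ip_add_right v w L2_add ip_commute[of M w v])
  also have "... <= (L2norm M v + L2norm M w)^2"
    using ip_Cauchy_Schwarz[OF v w] by (simp add: power2_sum L2norm_sq)
  finally show "(L2norm M (%x. v x + w x))^2 <= (L2norm M v + L2norm M w)^2" .
qed simp

lemma L2norm_minus: "L2norm M (%x. - v x) = L2norm M v"
  using L2norm_cmult[of M "-1" v] by simp

lemma L2norm_triangle_diff:
  assumes v: "v : L2 M" and w: "w : L2 M"
  shows "L2norm M (%x. v x - w x) <= L2norm M v + L2norm M w"
  using L2norm_triangle[OF v L2_cmult[OF w, of "-1"]] by (simp add: L2norm_minus)

lemma L2norm_diff_commute: "L2norm M (%x. v x - w x) = L2norm M (%x. w x - v x)"
  using L2norm_minus[of M "%x. v x - w x"] by simp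

text \<open>Squared form, so that it can be summed over the terms of a norm that is itself the root
  of a sum of squares.\<close>

lemma L2norm_lin_sq:
  assumes v: "v : L2 M" and w: "w : L2 M"
  shows "(L2norm M (%x. c * v x + d * w x))^2 <= 2 * c^2 * (L2norm M v)^2 + 2 * d^2 * (L2norm M w)^2"
proof -
  have "L2norm M (%x. c * v x + d * w x) <= \<bar>c\<bar> * L2norm M v + \<bar>d\<bar> * L2norm M w"
    using L2norm_triangle[OF L2_cmult[OF v] L2_cmult[OF w]] by (simp add: L2norm_cmult)
  then have "(L2norm M (%x. c * v x + d * w x))^2 <= (\<bar>c\<bar> * L2norm M v + \<bar>d\<bar> * L2norm M w)^2"
    by (intro power_mono) auto
  also have "... <= 2 * (\<bar>c\<bar> * L2norm M v)^2 + 2 * (\<bar>d\<bar> * L2norm M w)^2"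
    using sum_squares_bound[of "\<bar>c\<bar> * L2norm M v" "\<bar>d\<bar> * L2norm M w"] by (simp add: power2_sum)
  finally show ?thesis by (simp add: power_mult_distrib)
qed

lemma L2norm_eq_0_AE:
  assumes "v : L2 M" "L2norm M v = 0"
  shows "AE x in M. v x = 0"
proof -
  have "(LINT x|M. (v x)^2) = 0" using assms(2) L2norm_sq_integral[of M v] by simp
  then show ?thesis
    using integral_nonneg_eq_0_iff_AE[OF L2_integrable_sq[OF assms(1)]] by simp
qed

lemma L2norm_nn_integral:
  assumes "v : L2 M"
  shows "ennreal ((L2norm M v)^2) = (\<integral>\<^sup>+x. ennreal ((v x)^2) \<partial>M)"
  unfolding L2norm_sq_integral using nn_integral_eq_integral[OF L2_integrable_sq[OF assms]] by simp

lemma L2_iff_nn_integral: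
  assumes "v : borel_measurable M"
  shows "v : L2 M \<longleftrightarrow> (\<integral>\<^sup>+x. ennreal ((v x)^2) \<partial>M) < \<infinity>"
  unfolding L2_def using assms by (auto simp: integrable_iff_bounded)

lemma ip_tendsto:
  assumes "\<And>n. v n : L2 M" "w : L2 M" "z : L2 M"
    and "(%n. L2norm M (%x. v n x - w x)) \<longlonglongrightarrow> 0"
  shows "(%n. ip M (v n) z) \<longlonglongrightarrow> ip M w z"
proof -
  have "(%n. ip M (v n) z - ip M w z) \<longlonglongrightarrow> 0"
  proof (rule Lim_null_comparison)
    show "\<forall>\<^sub>F n in sequentially. norm (ip M (v n) z - ip M w z) <= L2norm M (%x. v n x - w x) * L2norm M z"
      using ip_Cauchy_Schwarz[OF L2_diff[OF assms(1,2)] assms(3)] assms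
      by (auto simp: ip_diff_left)
    show "(%n. L2norm M (%x. v n x - w x) * L2norm M z) \<longlonglongrightarrow> 0"
      using tendsto_mult_left_zero[OF assms(4)] by simp
  qed
  then show ?thesis by (simp add: LIM_zero_iff)
qed

lemma L2norm_tendsto:
  assumes "\<And>n. v n : L2 M" "w : L2 M"
    and "(%n. L2norm M (%x. v n x - w x)) \<longlonglongrightarrow> 0"
  shows "(%n. L2norm M (v n)) \<longlonglongrightarrow> L2norm M w"
proof -
  have "(%n. L2norm M (v n) - L2norm M w) \<longlonglongrightarrow> 0"
  proof (rule Lim_null_comparison[OF _ assms(3)])
    have "norm (L2norm M (v n) - L2norm M w) <= L2norm M (%x. v n x - w x)" for n
      using L2norm_triangle[OF L2_diff[OF assms(1,2)] assms(2), of n]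
        L2norm_triangle[OF L2_diff[OF assms(2) assms(1)[of n]] assms(1)[of n]]
        L2norm_diff_commute[of M "v n" w] by simp
    then show "\<forall>\<^sub>F n in sequentially. norm (L2norm M (v n) - L2norm M w) <= L2norm M (%x. v n x - w x)"
      by simp
  qed
  then show ?thesis by (simp add: LIM_zero_iff)
qed

section \<open>Fatou's lemma and completeness of L2\<close>

text \<open>Fatou's lemma for the squares; it also yields square integrability of the limit, which
  convergence almost everywhere alone does not.\<close>

lemma L2norm_lim_AE_le:
  assumes v: "\<And>n. v n : L2 M" and w: "w : borel_measurable M"
    and lim: "AE x in M. (%n. v n x) \<longlonglongrightarrow> w x" and B: "\<forall>\<^sub>F n in sequentially. L2norm M (v n) <= B" and "0 <= B"
  shows "w : L2 M \<and> L2norm M w <= B"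
proof -
  have "(\<integral>\<^sup>+x. ennreal ((w x)^2) \<partial>M) = (\<integral>\<^sup>+x. liminf (%n. ennreal ((v n x)^2)) \<partial>M)"
  proof (rule nn_integral_cong_AE)
    show "AE x in M. ennreal ((w x)\<^sup>2) = liminf (%n. ennreal ((v n x)\<^sup>2))"
      using lim
    proof eventually_elim
      case (elim x)
      then have "(%n. ennreal ((v n x)^2)) \<longlonglongrightarrow> ennreal ((w x)^2)" by (intro tendsto_intros) auto
      from lim_imp_Liminf[OF _ this] show ?case by simp
    qed
  qed
  also have "... <= liminf (%n. \<integral>\<^sup>+x. ennreal ((v n x)^2) \<partial>M)"
    by (rule nn_integral_liminf) (use v in \<open>auto simp: L2_def\<close>)
  also have "... <= liminf (%n. ennreal (B^2))"
    by (rule Liminf_mono, rule eventually_mono[OF B])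
      (auto simp: L2norm_nn_integral[OF v, symmetric] intro!: ennreal_leI power_mono)
  also have "... = ennreal (B^2)" by (simp add: Liminf_const)
  finally have le: "(\<integral>\<^sup>+x. ennreal ((w x)^2) \<partial>M) <= ennreal (B^2)" .
  then have L: "w : L2 M" using w by (simp add: L2_iff_nn_integral order_le_less_trans)
  with le have "(L2norm M w)^2 <= B^2" by (simp add: L2norm_nn_integral[OF L, symmetric])
  with L \<open>0 <= B\<close> show ?thesis using power2_le_imp_le by blast
qed

text \<open>Riesz-Fischer, for an arbitrary measure: the limits needed later live on an edge with
  arc length measure, where traces are constructed.\<close>

lemma L2_complete:
  assumes v: "\<And>n. v n : L2 M"
    and C: "\<And>e. e > 0 ==> \<exists>N. \<forall>m\<ge>N. \<forall>n\<ge>N. L2norm M (%x. v m x - v n x) < e"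
  shows "\<exists>w\<in>L2 M. (%n. L2norm M (%x. v n x - w x)) \<longlonglongrightarrow> 0"
proof -
  have "\<exists>N. \<forall>i. \<forall>m\<ge>N i. \<forall>n\<ge>N i. L2norm M (%x. v m x - v n x) < (1/4)^i"
    using C by (intro choice allI) auto
  then obtain N0 where N0: "\<And>i m n. m \<ge> N0 i ==> n \<ge> N0 i ==> L2norm M (%x. v m x - v n x) < (1/4)^i"
    by blast
  \<comment> \<open>Partial sums plus i form an increasing sequence that dominates both
    \<open>N0\<close> and the identity.\<close>
  define N where "N i = (\<Sum>j\<le>i. N0 j) + i" for i
  have NN: "N0 i <= N i" "N i <= N (Suc i)" "i <= N i" for i
    using member_le_sum[of i "{..i}" N0] by (auto simp: N_def)
  have d: "L2norm M (%x. v (N (Suc i)) x - v (N i) x) <= (1/4)^i" for i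
    using N0[of i "N (Suc i)" "N i"] NN[of i] by (auto intro: less_imp_le)
  \<comment> \<open>The weight \<open>2^i\<close> makes \<open>\<Sum> 2^i |v(N(i+1)) - v(N i)|^2\<close> integrable, hence the increments
    are almost everywhere bounded by a geometric sequence.\<close>
  have vm: "(%x. ennreal (4^i * (v (N (Suc i)) x - v (N i) x)^2)) : borel_measurable M" for i
    using v[THEN L2_measurable] by measurable
  have vm2: "(%x. ennreal ((v (N (Suc i)) x - v (N i) x)^2)) : borel_measurable M" for i
    using v[THEN L2_measurable] by measurable
  have "(\<integral>\<^sup>+x. (\<Sum>i. ennreal (4^i * (v (N (Suc i)) x - v (N i) x)^2)) \<partial>M)
      = (\<Sum>i. \<integral>\<^sup>+x. ennreal (4^i * (v (N (Suc i)) x - v (N i) x)^2) \<partial>M)"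
    by (rule nn_integral_suminf) (rule vm)
  also have "... = (\<Sum>i. ennreal (4^i * (L2norm M (%x. v (N (Suc i)) x - v (N i) x))^2))"
    by (rule suminf_cong)
      (simp add: ennreal_mult' L2norm_nn_integral[OF L2_diff[OF v v]] nn_integral_cmult[OF vm2])
  also have "... <= (\<Sum>i. ennreal ((1/4)^i))"
  proof (rule suminf_le)
    fix i
    have "4^i * (L2norm M (%x. v (N (Suc i)) x - v (N i) x))^2 <= 4^i * ((1/4)^i)^2"
      by (intro mult_left_mono power_mono d) auto
    also have "... = (4 * (1/4) * (1/4))^i" unfolding power_mult_distrib power2_eq_square by simp
    also have "... = (1/4)^i" by simp
    finally show "ennreal (4^i * (L2norm M (%x. v (N (Suc i)) x - v (N i) x))^2) <= ennreal ((1/4)^i)"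
      by (rule ennreal_leI)
  qed auto
  also have "... = ennreal (\<Sum>i. (1/4)^i)" by (rule suminf_ennreal2) auto
  also have "... < \<infinity>" by simp
  finally have "AE x in M. (\<Sum>i. ennreal (4^i * (v (N (Suc i)) x - v (N i) x)^2)) ~= \<infinity>"
    by (intro nn_integral_PInf_AE borel_measurable_suminf_order vm) simp
  then have AEc: "AE x in M. convergent (%i. v (N i) x)"
  proof eventually_elim
    case (elim x)
    define S where "S = enn2real (\<Sum>i. ennreal (4^i * (v (N (Suc i)) x - v (N i) x)^2))"
    have b: "\<bar>v (N (Suc i)) x - v (N i) x\<bar> <= sqrt S * (1/2)^i" for i
    proof -
      define t where "t i = ennreal (4^i * (v (N (Suc i)) x - v (N i) x)^2)" for i
      have fin: "suminf t ~= \<infinity>" unfolding t_def by (rule elim)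
      have "sum t {i} <= suminf t" by (rule sum_le_suminf) auto
      also have "... = ennreal S" 
        unfolding S_def using fin unfolding t_def by (subst ennreal_enn2real) (simp_all only: less_top infinity_ennreal_def)
      finally have "ennreal (4^i * (v (N (Suc i)) x - v (N i) x)^2) <= ennreal S" by (simp add: t_def)
      then have "4^i * (v (N (Suc i)) x - v (N i) x)^2 <= S"
        by (subst (asm) ennreal_le_iff) (simp_all only: S_def enn2real_nonneg)
      moreover have "4^i = ((2::real)^i)^2" unfolding power2_eq_square power_mult_distrib[symmetric] by simp
      ultimately have "sqrt ((2^i * (v (N (Suc i)) x - v (N i) x))^2) <= sqrt S"
        by (intro real_sqrt_le_mono) (simp only: power_mult_distrib)
      then have "2^i * \<bar>v (N (Suc i)) x - v (N i) x\<bar> <= sqrt S" by (simp add: abs_mult)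
      then have "2^i * \<bar>v (N (Suc i)) x - v (N i) x\<bar> * (1/2)^i <= sqrt S * (1/2)^i" by (rule mult_right_mono) simp
      then show ?thesis by (simp add: power_one_over)
    qed
    have "summable (%i. v (N (Suc i)) x - v (N i) x)"
      by (rule summable_comparison_test'[of "%i. sqrt S * (1/2)^i" 0])
        (use b in \<open>auto intro!: summable_mult summable_geometric\<close>)
    then have "convergent (%n. \<Sum>i<n. v (N (Suc i)) x - v (N i) x)" by (simp add: summable_iff_convergent)
    then have "convergent (%n. v (N n) x - v (N 0) x)" by (simp only: sum_lessThan_telescope[of "%i. v (N i) x"])
    then have "convergent (%n. (v (N n) x - v (N 0) x) + v (N 0) x)"
      by (intro convergent_add convergent_const)
    then show ?case by simp
  qed
  define w where "w x = lim (%i. v (N i) x)" for x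
  have wm: "w : borel_measurable M" unfolding w_def by (intro borel_measurable_lim_metric L2_measurable v)
  have lim: "AE x in M. (%i. v (N i) x) \<longlonglongrightarrow> w x"
    using AEc by eventually_elim (simp add: w_def convergent_LIMSEQ_iff)
  \<comment> \<open>For fixed n, Fatou along the subsequence turns the Cauchy bound into a bound for
    the distance of \<open>v n\<close> to the limit; thus the whole sequence converges.\<close>
  have est: "(%x. v n x - w x) : L2 M \<and> L2norm M (%x. v n x - w x) <= (1/4)^i" if "n \<ge> N0 i" for n i
  proof (rule L2norm_lim_AE_le[where v = "%j x. v n x - v (N j) x"])
    show "AE x in M. (%j. v n x - v (N j) x) \<longlonglongrightarrow> v n x - w x"
      using lim by eventually_elim (intro tendsto_intros)
    show "\<forall>\<^sub>F j in sequentially. L2norm M (%x. v n x - v (N j) x) <= (1/4)^i"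
      using N0[OF that] NN by (intro eventually_sequentiallyI[of "N0 i"]) (meson le_trans less_imp_le)
  qed (use v wm in \<open>auto intro: L2_diff L2_measurable borel_measurable_diff[OF L2_measurable[OF v]]\<close>)
  have wL: "w : L2 M" using L2_diff[OF v[of "N0 0"] est[of 0 "N0 0", THEN conjunct1]] by simp
  have "(%n. L2norm M (%x. v n x - w x)) \<longlonglongrightarrow> 0"
  proof (rule LIMSEQ_I)
    fix r :: real assume "0 < r"
    then obtain i where "(1/4::real)^i < r" using real_arch_pow_inv[of r "1/4"] by auto
    then show "\<exists>no. \<forall>n\<ge>no. norm (L2norm M (%x. v n x - w x) - 0) < r"
      using est[of i] by (intro exI[of _ "N0 i"]) fastforce
  qed
  with wL show ?thesis by blast
qed

subsection \<open>Smooth functions\<close>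

lemma pd_append: "pd (al @ \<beta>) f = pd al (pd \<beta> f)"
  by (induction al) auto

lemma pd_Cons: "pd (i # al) f = pd [i] (pd al f)"
  by simp

declare pd.simps(2) [simp del]

lemma sum_axis: "(\<Sum>k\<in>UNIV. c * axis i (1::real) $ k * F k) = c * F i"
proof -
  have "(\<Sum>k\<in>UNIV. c * axis i (1::real) $ k * F k) = (\<Sum>k\<in>UNIV. if k = i then c * F i else 0)"
    by (rule sum.cong) (auto simp: axis_def)
  then show ?thesis by simp
qed

lemma has_derivative_pd:
  assumes "(f has_derivative f') (at x)"
  shows "pd [i] f x = f' (axis i 1)"
proof -
  have "((%t::real. x + t *\<^sub>R axis i 1) has_derivative (%t. t *\<^sub>R axis i 1)) (at 0)"
    by (auto intro!: derivative_eq_intros)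
  moreover have "(f has_derivative f') (at (x + 0 *\<^sub>R axis i 1))" using assms by simp
  ultimately have "((%t. f (x + t *\<^sub>R axis i 1)) has_derivative (%t. f' (t *\<^sub>R axis i 1))) (at 0)"
    by (rule has_derivative_compose)
  then have "((%t. f (x + t *\<^sub>R axis i 1)) has_derivative (%t. f' (axis i 1) * t)) (at 0)"
    using linear_scale[OF has_derivative_linear[OF assms]] by (simp add: mult.commute)
  then show ?thesis
    by (simp add: DERIV_imp_deriv has_field_derivative_def pd.simps)
qed

lemma differentiable_pd:
  assumes "f differentiable (at x)"
  shows "(f has_derivative (%h. \<Sum>i\<in>UNIV. h $ i * pd [i] f x)) (at x)"
proof -
  obtain f' where f': "(f has_derivative f') (at x)" using assms by (auto simp: differentiable_def)
  have "f' h = (\<Sum>i\<in>UNIV. h $ i * pd [i] f x)" for h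
  proof -
    have "f' h = f' (\<Sum>i\<in>UNIV. (h $ i) *\<^sub>R axis i 1)"
      using basis_expansion[of h] by (simp add: scalar_mult_eq_scaleR)
    then show ?thesis using has_derivative_linear[OF f']
      by (simp add: linear_sum linear_scale has_derivative_pd[OF f'])
  qed
  then have "f' = (%h. \<Sum>i\<in>UNIV. h $ i * pd [i] f x)" by blast
  with f' show ?thesis by simp
qed

lemma smooth_differentiable: "smooth f ==> f differentiable (at x)"
proof -
  assume "smooth f"
  then have "pd [] f differentiable (at x)" unfolding smooth_def by blast
  then show ?thesis by simp
qed

lemma smooth_pd: "smooth f ==> smooth (pd al f)"
  unfolding smooth_def by (simp flip: pd_append)

lemma smooth_continuous: "smooth f ==> continuous_on S f"
  by (intro continuous_at_imp_continuous_on ballI differentiable_imp_continuous_within smooth_differentiable)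

lemma smooth_has_derivative:
  "smooth f ==> (f has_derivative (%h. \<Sum>i\<in>UNIV. h $ i * pd [i] f x)) (at x)"
  by (rule differentiable_pd[OF smooth_differentiable])

lemma smooth_measurable [measurable_dest]: "smooth f ==> f : borel_measurable borel"
  by (rule borel_measurable_continuous_onI[OF smooth_continuous])

text \<open>\<open>smooth\<close> demands differentiability of all iterated partial derivatives at
  once. It suffices to exhibit an invariant: a class of differentiable functions that is closed
  under \<open>pd [i]\<close>.\<close>

lemma smooth_coinduct:
  assumes "f : F" and F: "\<And>f. f : F ==> (\<forall>x. f differentiable (at x)) \<and> (\<forall>i. pd [i] f : F)"
  shows "smooth f"
proof -
  have "pd al f : F" for al
  proof (induction al)
    case (Cons i al)
    show ?case unfolding pd_Cons[of i al] using F[OF Cons.IH] by blast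
  qed (simp add: assms(1))
  with F show ?thesis by (auto simp: smooth_def)
qed

lemma pd_const: "pd [i] (%x. c) = (%x. 0)"
  by (auto simp: fun_eq_iff pd.simps)

lemma smooth_const [simp]: "smooth (%x. c)"
  by (rule smooth_coinduct[of _ "range (%c x. c)"]) (auto simp: pd_const)

lemma has_derivative_nth: "((%x::real^2. x $ i) has_derivative (%h. h $ i)) F"
  by (rule bounded_linear_imp_has_derivative[OF bounded_linear_vec_nth])

lemma pd_nth: "pd [j] (%x. x $ i) = (%x. axis j 1 $ i)"
  using has_derivative_pd[OF has_derivative_nth] by blast

lemma smooth_nth [simp]: "smooth (%x. x $ i)"
proof (rule smooth_coinduct[of _ "insert (%x. x $ i) (range (%c x. c))"])
  fix f :: sfun assume "f : insert (%x. x $ i) (range (%c x. c))"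
  moreover have "(%x::real^2. x $ i) differentiable (at x)" for x
    using has_derivative_nth by (rule differentiableI)
  ultimately show "(\<forall>x. f differentiable (at x)) \<and> (\<forall>j. pd [j] f : insert (%x. x $ i) (range (%c x. c)))"
    by (auto simp: pd_nth pd_const)
qed simp

section \<open>Smooth functions of compact support\<close>

text \<open>
  The functions \<open>t \<mapsto> p(1/t) exp(-1/t)\<close> on \<open>t > 0\<close>, continued by \<open>0\<close>, form a class that is closed
  under differentiation.
\<close>

definition flat :: "real poly => real => real" where
  "flat p t = (if t > 0 then poly p (1/t) * exp (-1/t) else 0)"

lemma poly_exp_tendsto_0: "((%s::real. poly p s * exp (- s)) \<longlongrightarrow> 0) at_top"
proof -
  have "((%s::real. \<Sum>i\<le>degree p. coeff p i * (s ^ i / exp s)) \<longlongrightarrow> (\<Sum>i\<le>degree p. coeff p i * 0)) at_top"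
    by (intro tendsto_sum tendsto_mult tendsto_const tendsto_power_div_exp_0)
  moreover have "poly p s * exp (- s) = (\<Sum>i\<le>degree p. coeff p i * (s ^ i / exp s))" for s
    by (simp add: poly_altdef sum_distrib_right exp_minus divide_inverse mult.assoc)
  ultimately show ?thesis by simp
qed

text \<open>With s = 1/t one has ds/dt = - s^2, hence the derivative of p(s) exp(-s) is s^2 (p -
  p')(s) exp(-s); \<open>[:0, 0, 1:]\<close> is s^2. At t = 0 the two one-sided difference quotients
  are examined directly.\<close>

lemma flat_has_derivative:
  "(flat p has_real_derivative flat ([:0, 0, 1:] * (p - pderiv p)) t) (at t)"
proof (cases t "0::real" rule: linorder_cases)
  case less
  have "(flat p has_real_derivative 0) (at t)"
    by (rule has_field_derivative_transform_within_open[of "%_. 0" _ _ "{..<0}"])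
      (use less in \<open>auto simp: flat_def\<close>)
  then show ?thesis using less by (simp add: flat_def)
next
  case equal
  have "((%s. (flat p s - flat p 0) / (s - 0)) \<longlongrightarrow> 0) (at_right 0)"
  proof (rule Lim_transform_eventually)
    \<comment> \<open>The difference quotient at 0 carries an extra factor 1/t, so its polynomial is
      s p(s), which is \<open>pCons 0 p\<close>.\<close>
    show "((%s. poly (pCons 0 p) (inverse s) * exp (- inverse s)) \<longlongrightarrow> 0) (at_right (0::real))"
      by (rule filterlim_compose[OF poly_exp_tendsto_0 filterlim_inverse_at_top_right])
    show "\<forall>\<^sub>F s in at_right 0. poly (pCons 0 p) (inverse s) * exp (- inverse s) = (flat p s - flat p 0) / (s - 0)"
      by (auto simp: eventually_at_filter flat_def field_simps)
  qed
  moreover have "((%s. (flat p s - flat p 0) / (s - 0)) \<longlongrightarrow> 0) (at_left 0)"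
    by (rule tendsto_eventually) (auto simp: eventually_at_filter flat_def)
  ultimately have "((%s. (flat p s - flat p 0) / (s - 0)) \<longlongrightarrow> 0) (at 0)"
    by (simp add: filterlim_at_split)
  then show ?thesis unfolding equal has_field_derivative_iff by (simp add: flat_def)
next
  case greater
  have "((%t. poly p (1/t) * exp (-1/t)) has_real_derivative
      (poly (pderiv p) (1/t) * (- 1 / t^2)) * exp (-1/t) + poly p (1/t) * (exp (-1/t) * (1/t^2))) (at t)"
    using greater
    by (auto intro!: derivative_eq_intros DERIV_chain2[OF poly_DERIV] simp: power2_eq_square field_simps)
  then have "(flat p has_real_derivative
      (poly (pderiv p) (1/t) * (- 1 / t^2)) * exp (-1/t) + poly p (1/t) * (exp (-1/t) * (1/t^2))) (at t)"
    by (rule has_field_derivative_transform_within_open[of _ _ _ "{0<..}"])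
      (use greater in \<open>auto simp: flat_def\<close>)
  then show ?thesis using greater by (simp add: flat_def power2_eq_square field_simps)
qed

text \<open>The invariant class for \<open>smooth_coinduct\<close>: closed under the product rule
  and containing every \<open>flat p\<close> along a coordinate direction, which is what a product
  bump function is made of.\<close>

inductive_set smooth_alg :: "sfun set" where
  base: "smooth f ==> f : smooth_alg"
| flat: "(%x. flat p (a + c * x $ i)) : smooth_alg"
| add: "f : smooth_alg ==> g : smooth_alg ==> (%x. f x + g x) : smooth_alg"
| mult: "f : smooth_alg ==> g : smooth_alg ==> (%x. f x * g x) : smooth_alg"

lemma pd_add:
  assumes "\<And>x. f differentiable (at x)" "\<And>x. g differentiable (at x)"
  shows "pd [i] (%x. f x + g x) = (%x. pd [i] f x + pd [i] g x)"
proof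
  fix x
  show "pd [i] (%x. f x + g x) x = pd [i] f x + pd [i] g x"
    using has_derivative_pd[OF has_derivative_add[OF differentiable_pd[OF assms(1)] differentiable_pd[OF assms(2)]]]
      has_derivative_pd[OF differentiable_pd[OF assms(1)]] has_derivative_pd[OF differentiable_pd[OF assms(2)]]
    by metis
qed

lemma pd_mult:
  assumes "\<And>x. f differentiable (at x)" "\<And>x. g differentiable (at x)"
  shows "pd [i] (%x. f x * g x) = (%x. f x * pd [i] g x + pd [i] f x * g x)"
proof
  fix x
  show "pd [i] (%x. f x * g x) x = f x * pd [i] g x + pd [i] f x * g x"
    using has_derivative_pd[OF has_derivative_mult[OF differentiable_pd[OF assms(1)] differentiable_pd[OF assms(2)]]]
      has_derivative_pd[OF differentiable_pd[OF assms(1)]] has_derivative_pd[OF differentiable_pd[OF assms(2)]]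
    by metis
qed

lemma smooth_alg_smooth:
  assumes "f : smooth_alg" shows "smooth f"
proof (rule smooth_coinduct[OF assms])
  fix f assume "f : smooth_alg"
  then show "(\<forall>x. f differentiable (at x)) \<and> (\<forall>i. pd [i] f : smooth_alg)"
  proof induction
    case (base f)
    then show ?case by (auto intro: smooth_differentiable smooth_pd smooth_alg.base)
  next
    case (flat p a c i)
    have d: "((%x::real^2. flat p (a + c * x $ i)) has_derivative
        (%h. flat ([:0, 0, 1:] * (p - pderiv p)) (a + c * x $ i) * (c * h $ i))) (at x)" for x
    proof -
      have 1: "((%x::real^2. a + c * x $ i) has_derivative (%h. c * h $ i)) (at x)"
        by (auto intro!: derivative_eq_intros has_derivative_nth)
      show ?thesis
        using has_derivative_compose[OF 1 flat_has_derivative[of p "a + c * x $ i", unfolded has_field_derivative_def]]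
        by simp
    qed
    have "pd [j] (%x. flat p (a + c * x $ i)) =
        (%x. flat ([:0, 0, 1:] * (p - pderiv p)) (a + c * x $ i) * (c * axis j 1 $ i))" for j
      using has_derivative_pd[OF d] by blast
    then have "pd [j] (%x. flat p (a + c * x $ i)) : smooth_alg" for j
      by (simp only:) (intro smooth_alg.mult smooth_alg.flat smooth_alg.base smooth_const)
    moreover have "(%x::real^2. flat p (a + c * x $ i)) differentiable (at x)" for x
      using d by (rule differentiableI)
    ultimately show ?case by blast
  next
    case (add f g)
    then show ?case by (auto simp: pd_add intro: smooth_alg.add)
  next
    case (mult f g)
    then show ?case
      by (auto simp: pd_mult intro!: smooth_alg.add smooth_alg.mult)
  qed
qed

lemma smooth_add: "smooth f ==> smooth g ==> smooth (%x. f x + g x)"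
  by (rule smooth_alg_smooth[OF smooth_alg.add[OF smooth_alg.base smooth_alg.base]])

lemma smooth_mult: "smooth f ==> smooth g ==> smooth (%x. f x * g x)"
  by (rule smooth_alg_smooth[OF smooth_alg.mult[OF smooth_alg.base smooth_alg.base]])

lemma smooth_cmult: "smooth f ==> smooth (%x. c * f x)"
  by (rule smooth_mult) auto

lemma smooth_lin: "smooth f ==> smooth g ==> smooth (%x. c * f x + d * g x)"
  by (intro smooth_add smooth_cmult)

lemma pd_cmult1:
  assumes "smooth f" shows "pd [i] (%x. c * f x) = (%x. c * pd [i] f x)"
  using pd_mult[of "%x. c" f i] smooth_differentiable[OF assms] by (simp add: pd_const)

lemma pd_lin:
  assumes "smooth f" "smooth g"
  shows "pd al (%x. c * f x + d * g x) = (%x. c * pd al f x + d * pd al g x)"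
proof (induction al)
  case (Cons i al)
  have s: "smooth (pd al f)" "smooth (pd al g)" using assms by (auto intro: smooth_pd)
  have "pd (i # al) (%x. c * f x + d * g x) = pd [i] (%x. c * pd al f x + d * pd al g x)"
    using Cons.IH by (simp add: pd_Cons[of i al])
  also have "... = (%x. c * pd (i # al) f x + d * pd (i # al) g x)"
    unfolding pd_Cons[of i al] using s
    by (subst pd_add) (auto simp: pd_cmult1 intro!: smooth_differentiable smooth_cmult)
  finally show ?case .
qed simp

lemma pd_affine:
  assumes "smooth f"
  shows "pd al (%x. f (a + c *\<^sub>R x)) = (%x. c ^ length al * pd al f (a + c *\<^sub>R x))"
    and "smooth (%x. f (a + c *\<^sub>R x))"
proof -
  have d: "((%x. g (a + c *\<^sub>R x)) has_derivative (%h. \<Sum>i\<in>UNIV. (c *\<^sub>R h) $ i * pd [i] g (a + c *\<^sub>R x))) (at x)"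
    if "smooth g" for g x
    by (rule has_derivative_compose[where f = "%x. a + c *\<^sub>R x", OF _ smooth_has_derivative[OF that]])
      (auto intro!: derivative_eq_intros)
  have p1: "pd [i] (%x. g (a + c *\<^sub>R x)) = (%x. c * pd [i] g (a + c *\<^sub>R x))" if "smooth g" for g i
  proof
    fix x
    show "pd [i] (%x. g (a + c *\<^sub>R x)) x = c * pd [i] g (a + c *\<^sub>R x)"
      unfolding has_derivative_pd[OF d[OF that]]
      by (simp add: sum_axis)
  qed
  have df: "(%x. c ^ n * g (a + c *\<^sub>R x)) differentiable (at x)" if "smooth g" for g n x
    using d[OF that] by (intro differentiable_mult) (auto simp: differentiable_def)
  show s: "smooth (%x. f (a + c *\<^sub>R x))"
  proof (rule smooth_coinduct[of _ "{%x. c ^ n * g (a + c *\<^sub>R x) | n g. smooth g}"])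
    show "(%x. f (a + c *\<^sub>R x)) : {%x. c ^ n * g (a + c *\<^sub>R x) | n g. smooth g}"
      using assms by (auto intro!: exI[of _ 0])
    fix g assume "g : {%x. c ^ n * g (a + c *\<^sub>R x) | n g. smooth g}"
    then obtain n g' where g: "g = (%x. c ^ n * g' (a + c *\<^sub>R x))" "smooth g'" by blast
    have "pd [i] g = (%x. c ^ Suc n * pd [i] g' (a + c *\<^sub>R x))" for i
      unfolding g(1) using df[OF g(2), of 0]
      by (subst pd_mult) (auto simp: pd_const p1[OF g(2)])
    then have "pd [i] g : {%x. c ^ n * g (a + c *\<^sub>R x) | n g. smooth g}" for i
      using smooth_pd[OF g(2)] by blast
    then show "(\<forall>x. g differentiable at x) \<and> (\<forall>i. pd [i] g : {%x. c ^ n * g (a + c *\<^sub>R x) |n g. smooth g})"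
      using df[OF g(2)] g(1) by blast
  qed
  show "pd al (%x. f (a + c *\<^sub>R x)) = (%x. c ^ length al * pd al f (a + c *\<^sub>R x))"
  proof (induction al)
    case (Cons i al)
    have "pd (i # al) (%x. f (a + c *\<^sub>R x)) = pd [i] (%x. c ^ length al * pd al f (a + c *\<^sub>R x))"
      using Cons.IH by (simp add: pd_Cons[of i al])
    also have "... = (%x. c ^ length (i # al) * pd (i # al) f (a + c *\<^sub>R x))"
      using df[OF smooth_pd[OF assms], of 0]
      by (subst pd_mult) (auto simp: pd_const p1[OF smooth_pd[OF assms]] pd_Cons[of i al])
    finally show ?case .
  qed simp
qed

text \<open>Symmetry of second derivatives: both are limits of the same second difference quotient.\<close>

lemma pd_second_difference:
  assumes "smooth f" "h > 0"
  shows "\<exists>s t. 0 < s \<and> s < h \<and> 0 < t \<and> t < h \<and>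
    f (x + h *\<^sub>R axis i 1 + h *\<^sub>R axis j 1) - f (x + h *\<^sub>R axis i 1) - f (x + h *\<^sub>R axis j 1) + f x
    = h^2 * pd [j, i] f (x + s *\<^sub>R axis i 1 + t *\<^sub>R axis j 1)"
proof -
  have D: "((%s. g (y + s *\<^sub>R axis i 1)) has_real_derivative pd [i] g (y + s *\<^sub>R axis i 1)) (at s)"
    if "smooth g" for g y s i
  proof -
    have "((%s. g (y + s *\<^sub>R axis i 1)) has_derivative
        (%r. \<Sum>k\<in>UNIV. (r *\<^sub>R axis i 1) $ k * pd [k] g (y + s *\<^sub>R axis i 1))) (at s)"
      by (rule has_derivative_compose[where f = "%s. y + s *\<^sub>R axis i 1", OF _ smooth_has_derivative[OF that]])
        (auto intro!: derivative_eq_intros)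
    then show ?thesis by (simp add: has_field_derivative_def sum_axis mult_commute_abs)
  qed
  define F where "F s = f (x + h *\<^sub>R axis j 1 + s *\<^sub>R axis i 1) - f (x + s *\<^sub>R axis i 1)" for s
  have "\<exists>z>0. z < h \<and> F h - F 0 = (h - 0) *
      (pd [i] f (x + h *\<^sub>R axis j 1 + z *\<^sub>R axis i 1) - pd [i] f (x + z *\<^sub>R axis i 1))"
    unfolding F_def by (rule MVT2[OF assms(2)]) (intro DERIV_diff D assms(1))
  then obtain s where s: "0 < s" "s < h"
    "F h - F 0 = h * (pd [i] f (x + h *\<^sub>R axis j 1 + s *\<^sub>R axis i 1) - pd [i] f (x + s *\<^sub>R axis i 1))"
    by auto
  have "\<exists>z>0. z < h \<and> pd [i] f (x + s *\<^sub>R axis i 1 + h *\<^sub>R axis j 1) - pd [i] f (x + s *\<^sub>R axis i 1 + 0 *\<^sub>R axis j 1)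
      = (h - 0) * pd [j] (pd [i] f) (x + s *\<^sub>R axis i 1 + z *\<^sub>R axis j 1)"
    by (rule MVT2[OF assms(2)]) (rule D[OF smooth_pd[OF assms(1)]])
  then obtain t where t: "0 < t" "t < h"
    "pd [i] f (x + s *\<^sub>R axis i 1 + h *\<^sub>R axis j 1) - pd [i] f (x + s *\<^sub>R axis i 1)
      = h * pd [j, i] f (x + s *\<^sub>R axis i 1 + t *\<^sub>R axis j 1)"
    by (auto simp: pd_Cons[of j "[i]"])
  have "F h - F 0 = h^2 * pd [j, i] f (x + s *\<^sub>R axis i 1 + t *\<^sub>R axis j 1)"
    using s(3) t(3) by (simp add: algebra_simps power2_eq_square)
  then show ?thesis using s t
    by (intro exI[of _ s] exI[of _ t]) (simp add: F_def algebra_simps)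
qed

lemma pd_commute:
  assumes "smooth f" shows "pd [i, j] f = pd [j, i] f"
proof
  fix x
  define d where "d h = (f (x + h *\<^sub>R axis i 1 + h *\<^sub>R axis j 1) - f (x + h *\<^sub>R axis i 1) - f (x + h *\<^sub>R axis j 1) + f x) / h^2" for h
  \<comment> \<open>The second difference \<open>d\<close> is symmetric in i and j, so that one
    argument gives both mixed derivatives as its limit.\<close>
  have lim: "(d \<longlongrightarrow> pd [b, a] f x) (at_right 0)"
    if "{a, b} = {i, j}" for a b
  proof (rule tendstoI)
    fix e :: real assume "0 < e"
    have "isCont (pd [b, a] f) x"
      using smooth_continuous[OF smooth_pd[OF assms], of UNIV "[b,a]"] by (simp add: continuous_on_eq_continuous_at)
    then obtain r where r: "r > 0" "\<And>y. dist y x < r ==> dist (pd [b, a] f y) (pd [b, a] f x) < e"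
      unfolding continuous_at_eps_delta using \<open>0 < e\<close> by blast
    have "dist (d h) (pd [b, a] f x) < e" if h: "0 < h" "h < r/2" for h
    proof -
      obtain s t where st: "0 < s" "s < h" "0 < t" "t < h"
        "f (x + h *\<^sub>R axis a 1 + h *\<^sub>R axis b 1) - f (x + h *\<^sub>R axis a 1) - f (x + h *\<^sub>R axis b 1) + f x
          = h^2 * pd [b, a] f (x + s *\<^sub>R axis a 1 + t *\<^sub>R axis b 1)"
        using pd_second_difference[OF assms h(1)] by blast
      have "d h = pd [b, a] f (x + s *\<^sub>R axis a 1 + t *\<^sub>R axis b 1)"
        using st(5) \<open>{a, b} = {i, j}\<close> h(1) by (auto simp: d_def doubleton_eq_iff algebra_simps)
      moreover have "dist (x + s *\<^sub>R axis a 1 + t *\<^sub>R axis b 1) x < r"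
      proof -
        have "norm (s *\<^sub>R axis a (1::real) + t *\<^sub>R axis b 1) <= s + t"
          using norm_triangle_ineq[of "s *\<^sub>R axis a (1::real)" "t *\<^sub>R axis b 1"] st by simp
        then show ?thesis using st h by (simp add: dist_norm add.assoc)
      qed
      ultimately show ?thesis using r(2) by simp
    qed
    then show "\<forall>\<^sub>F h in at_right 0. dist (d h) (pd [b, a] f x) < e"
      using r(1) by (auto simp: eventually_at_right_field intro!: exI[of _ "r/2"])
  qed
  show "pd [i, j] f x = pd [j, i] f x"
    by (rule tendsto_unique[OF _ lim lim]) auto
qed

text \<open>Moving both second derivatives of the bilinear form onto a test function produces the
  order [i, j, i, j], whereas \<open>is_bilaplacian\<close> is written with [i, i, j, j].\<close>

lemma pd_bilaplace: 
  assumes "smooth f" shows "pd [i, j, i, j] f = pd [i, i, j, j] f"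
proof -
  have "pd [i, j, i, j] f = pd [i] (pd [j, i] (pd [j] f))" by (simp add: pd.simps)
  also have "... = pd [i] (pd [i, j] (pd [j] f))"
    by (rule arg_cong[OF pd_commute[OF smooth_pd[OF assms]]])
  also have "... = pd [i, i, j, j] f" by (simp add: pd.simps)
  finally show ?thesis .
qed

subsection \<open>Test functions and mollification\<close>

lemma test_functionsI:
  assumes "smooth f" "bounded {x. f x ~= 0}" "closure {x. f x ~= 0} \<subseteq> G"
  shows "f : test_functions G"
  using assms by (simp add: test_functions_def compact_closure)

lemma test_smooth: "f : test_functions G ==> smooth f"
  by (simp add: test_functions_def)

lemma test_mono: "f : test_functions G ==> G \<subseteq> G' ==> f : test_functions G'"
  by (auto simp: test_functions_def)

lemma test_outside: "f : test_functions G ==> x \<notin> G ==> f x = 0"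
  using closure_subset[of "{x. f x ~= 0}"] by (auto simp: test_functions_def)

lemma test_subset_support:
  assumes "f : test_functions G" "smooth g" "{x. g x ~= 0} \<subseteq> closure {x. f x ~= 0}"
  shows "g : test_functions G"
proof -
  have "closure {x. g x ~= 0} \<subseteq> closure {x. f x ~= 0}"
    using closure_minimal[OF assms(3)] by simp
  moreover have "bounded {x. g x ~= 0}"
    using assms by (intro bounded_subset[OF compact_imp_bounded assms(3)]) (simp add: test_functions_def)
  ultimately show ?thesis using assms(1,2) by (auto intro!: test_functionsI simp: test_functions_def)
qed

lemma pd1_support:
  assumes "smooth f" shows "{x. pd [i] f x ~= 0} \<subseteq> closure {x. f x ~= 0}"
proof (clarify, rule ccontr)
  fix x assume x: "pd [i] f x ~= 0" "x \<notin> closure {x. f x ~= 0}"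
  have "(f has_derivative (%h. 0)) (at x)"
  proof (rule has_derivative_transform_within_open[of "%x. 0"])
    show "open (- closure {x. f x ~= 0})" by (simp add: open_Compl)
    show "x : - closure {x. f x ~= 0}" using x by simp
    show "\<And>y. y : - closure {x. f x ~= 0} ==> 0 = f y"
      using closure_subset[of "{x. f x ~= 0}"] by auto
  qed auto
  from has_derivative_pd[OF this] x show False by simp
qed

lemma test_pd:
  assumes "f : test_functions G" shows "pd al f : test_functions G"
proof (induction al)
  case (Cons i al)
  show ?case unfolding pd_Cons[of i al]
    by (rule test_subset_support[OF Cons.IH])
      (auto intro!: smooth_pd test_smooth[OF assms] pd1_support[THEN subsetD])
qed (simp add: assms)

lemma test_lin:
  assumes f: "f : test_functions G" and g: "g : test_functions G"
  shows "(%x. c * f x + d * g x) : test_functions G"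
proof (rule test_functionsI)
  show "smooth (%x. c * f x + d * g x)" using assms by (auto intro: smooth_lin test_smooth)
  have s: "{x. c * f x + d * g x ~= 0} \<subseteq> {x. f x ~= 0} \<union> {x. g x ~= 0}" by auto
  show "closure {x. c * f x + d * g x ~= 0} \<subseteq> G"
    using closure_mono[OF s] f g by (auto simp: closure_Un test_functions_def)
  have "bounded ({x. f x ~= 0} \<union> {x. g x ~= 0})"
    using f g by (auto simp: test_functions_def compact_eq_bounded_closed intro: bounded_subset[OF _ closure_subset])
  then show "bounded {x. c * f x + d * g x ~= 0}" using s by (rule bounded_subset)
qed

lemma test_zero [simp]: "(%x. 0) : test_functions G"
  by (rule test_functionsI) auto

lemma test_mult_smooth:
  assumes "f : test_functions G" "smooth g" shows "(%x. g x * f x) : test_functions G"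
  by (rule test_subset_support[OF assms(1)])
    (use assms closure_subset[of "{x. f x ~= 0}"] in \<open>auto intro: smooth_mult test_smooth\<close>)

lemma test_bounded:
  assumes "f : test_functions G" obtains B where "B \<ge> 0" "\<And>x. \<bar>f x\<bar> <= B"
proof -
  have "compact (f ` closure {x. f x ~= 0})"
    using assms by (intro compact_continuous_image smooth_continuous) (auto simp: test_functions_def)
  then obtain B where B: "B > 0" "\<And>y. y : f ` closure {x. f x ~= 0} ==> norm y <= B"
    using compact_imp_bounded bounded_pos by metis
  have "\<bar>f x\<bar> <= B" for x
    using B closure_subset[of "{x. f x ~= 0}"] by (cases "f x = 0") auto
  with B that[of B] show ?thesis by auto
qed

lemma gradient_bound:
  fixes h :: "real^2" and p :: "2 => real"
  assumes "\<And>i. \<bar>p i\<bar> <= B" shows "\<bar>\<Sum>i\<in>UNIV. h $ i * p i\<bar> <= 2 * B * norm h"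
proof -
  have "\<bar>\<Sum>i\<in>UNIV. h $ i * p i\<bar> <= (\<Sum>i\<in>(UNIV :: 2 set). norm h * B)"
    by (rule order_trans[OF sum_abs])
      (intro sum_mono, simp only: abs_mult, intro mult_mono component_le_norm_cart assms, auto)
  then show ?thesis by (simp add: mult_ac)
qed

lemma test_gradient_bounded:
  assumes "f : test_functions G" obtains B where "B \<ge> 0" "\<And>i x. \<bar>pd [i] f x\<bar> <= B"
proof -
  have "\<forall>i. \<exists>B\<ge>0. \<forall>x. \<bar>pd [i] f x\<bar> <= B" using test_bounded[OF test_pd[OF assms]] by metis
  then obtain b where b: "\<And>i. b i \<ge> 0" "\<And>i x. \<bar>pd [i] f x\<bar> <= b i" by metis
  have "\<bar>pd [i] f x\<bar> <= (\<Sum>i\<in>UNIV. b i)" for i x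
    using b(2)[of i x] member_le_sum[of i UNIV b] b(1) by fastforce
  moreover have "0 <= (\<Sum>i\<in>UNIV. b i)" by (simp add: b sum_nonneg)
  ultimately show ?thesis using that by blast
qed

lemma test_lipschitz:
  assumes "f : test_functions G" obtains B where "B \<ge> 0" "\<And>x y. \<bar>f x - f y\<bar> <= B * norm (x - y)"
proof -
  obtain B where B: "B \<ge> 0" "\<And>i x. \<bar>pd [i] f x\<bar> <= B"
    using test_gradient_bounded[OF assms] by blast
  have "norm (f x - f y) <= 2 * B * norm (x - y)" for x y
  proof (rule differentiable_bound[of UNIV])
    show "(f has_derivative (%h. \<Sum>i\<in>UNIV. h $ i * pd [i] f z)) (at z within UNIV)" for z
      using smooth_has_derivative[OF test_smooth[OF assms]] by simp
    show "onorm (%h. \<Sum>i\<in>UNIV. h $ i * pd [i] f z) <= 2 * B" for z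
      by (rule onorm_le) (use gradient_bound[OF B(2)] in auto)
  qed auto
  then show ?thesis using that[of "2 * B"] B(1) by auto
qed

text \<open>The remainder bound is uniform in x and may therefore be integrated: against an
  integrable function it differentiates a convolution, and against 1 it shows that derivatives of
  test functions have integral 0.\<close>

lemma test_taylor:
  assumes "f : test_functions G"
  obtains B where "B \<ge> 0" "\<And>x h. \<bar>f (x + h) - f x - (\<Sum>i\<in>UNIV. h $ i * pd [i] f x)\<bar> <= B * (norm h)^2"
proof -
  have "\<forall>i. \<exists>B\<ge>0. \<forall>x y. \<bar>pd [i] f x - pd [i] f y\<bar> <= B * norm (x - y)"
    using test_lipschitz[OF test_pd[OF assms]] by metis
  then obtain b where b: "\<And>i. b i \<ge> 0" "\<And>i x y. \<bar>pd [i] f x - pd [i] f y\<bar> <= b i * norm (x - y)" by metis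
  define B where "B = (\<Sum>i\<in>UNIV. b i)"
  have B0: "0 <= B" by (simp add: b sum_nonneg B_def)
  have B: "\<bar>pd [i] f x - pd [i] f y\<bar> <= B * norm (x - y)" for i x y
  proof -
    have "b i <= B" unfolding B_def by (rule member_le_sum) (auto simp: b)
    then have "b i * norm (x - y) <= B * norm (x - y)" by (rule mult_right_mono) simp
    with b(2)[of i x y] show ?thesis by linarith
  qed
  have "\<bar>f (x + h) - f x - (\<Sum>i\<in>UNIV. h $ i * pd [i] f x)\<bar> <= 2 * B * (norm h)^2" for x h
  proof -
    let ?D = "%z h. \<Sum>i\<in>UNIV. h $ i * pd [i] f z"
    have "norm (f (x + h) - f x - ?D x ((x + h) - x)) <= norm ((x + h) - x) * (2 * (B * norm h))"
    proof (rule differentiable_bound_linearization[of _ _ "cball x (norm h)"])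
      show "x + t *\<^sub>R (x + h - x) : cball x (norm h)" if "t : {0..1}" for t
        using that mult_right_mono[of t 1 "norm h"] by (simp add: dist_norm)
      show "(f has_derivative ?D z) (at z within cball x (norm h))" for z
        by (rule has_derivative_at_withinI[OF smooth_has_derivative[OF test_smooth[OF assms]]])
      show "onorm (?D z - ?D x) <= 2 * (B * norm h)" if "z : cball x (norm h)" for z
      proof (rule onorm_le)
        fix k :: "real^2"
        have p: "\<bar>pd [i] f z - pd [i] f x\<bar> <= B * norm h" for i
        proof -
          have "B * norm (z - x) <= B * norm h"
            using that B0 by (intro mult_left_mono) (auto simp: dist_norm norm_minus_commute)
          with B[of i z x] show ?thesis by linarith
        qed
        have "(?D z - ?D x) k = (\<Sum>i\<in>UNIV. k $ i * (pd [i] f z - pd [i] f x))"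
          by (simp add: sum_subtractf right_diff_distrib)
        then show "norm ((?D z - ?D x) k) <= 2 * (B * norm h) * norm k"
          using gradient_bound[of "%i. pd [i] f z - pd [i] f x" "B * norm h" k, OF p] by simp
      qed
    qed auto
    then show ?thesis by (simp add: power2_eq_square mult_ac)
  qed
  then show ?thesis using that[of "2 * B"] B0 by auto
qed

lemma test_measurable: "f : test_functions G ==> f : borel_measurable borel"
  by (rule smooth_measurable[OF test_smooth])

section \<open>Convolution of an integrable function with a test function\<close>

lemma integrable_mult_bounded:
  assumes "integrable lborel W" "g : borel_measurable borel" "\<And>x. \<bar>g x\<bar> <= (B::real)"
  shows "integrable lborel (%y. W y * g (x - y :: real^2) :: real)"
proof (rule Bochner_Integration.integrable_bound)
  show "integrable lborel (%y. B * \<bar>W y\<bar>)" using assms(1) by simp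
  show "(%y. W y * g (x - y)) : borel_measurable lborel"
    using assms(1,2) by measurable
  have "\<bar>W y\<bar> * \<bar>g (x - y)\<bar> <= \<bar>B * \<bar>W y\<bar>\<bar>" for y
    using mult_left_mono[OF assms(3)[of "x - y"], of "\<bar>W y\<bar>"] by (simp add: mult.commute)
  then show "AE y in lborel. norm (W y * g (x - y)) <= norm (B * \<bar>W y\<bar>)"
    by (intro AE_I2) (simp add: abs_mult)
qed

definition conv :: "sfun => sfun => sfun" where
  "conv W g x = (LINT y|lborel. W y * g (x - y))"

lemma conv_integrable:
  "integrable lborel W ==> g : test_functions UNIV ==> integrable lborel (%y. W y * g (x - y))"
proof -
  assume W: "integrable lborel W" and g: "g : test_functions UNIV"
  obtain B where "\<And>x. \<bar>g x\<bar> <= B" using test_bounded[OF g] by blast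
  then show ?thesis by (rule integrable_mult_bounded[OF W test_measurable[OF g]])
qed

text \<open>The quadratic Taylor remainder of g, integrated against |W|, is at most C |h|^2. All
  derivatives fall on g, while W is merely integrable.\<close>

lemma conv_has_derivative:
  assumes W: "integrable lborel W" and g: "g : test_functions UNIV"
  shows "(conv W g has_derivative (%h. \<Sum>i\<in>UNIV. h $ i * conv W (pd [i] g) x)) (at x)"
proof -
  obtain B where B: "B \<ge> 0" "\<And>x h. \<bar>g (x + h) - g x - (\<Sum>i\<in>UNIV. h $ i * pd [i] g x)\<bar> <= B * (norm h)^2"
    using test_taylor[OF g] by blast
  define C where "C = B * (LINT y|lborel. \<bar>W y\<bar>)"
  have bnd: "\<bar>conv W g (x + h) - conv W g x - (\<Sum>i\<in>UNIV. h $ i * conv W (pd [i] g) x)\<bar> <= C * (norm h)^2" for h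
  proof -
    let ?r = "%y. g (x + h - y) - g (x - y) - (\<Sum>i\<in>UNIV. h $ i * pd [i] g (x - y))"
    have i: "integrable lborel (%y. W y * g (x + h - y))" "integrable lborel (%y. W y * g (x - y))"
      "integrable lborel (%y. W y * pd [i] g (x - y))" for i
      by (auto intro!: conv_integrable W g test_pd)
    have "conv W g (x + h) - conv W g x - (\<Sum>i\<in>UNIV. h $ i * conv W (pd [i] g) x) =
      (LINT y|lborel. W y * g (x + h - y) - W y * g (x - y) - (\<Sum>i\<in>UNIV. h $ i * (W y * pd [i] g (x - y))))"
      unfolding conv_def using i by simp
    also have "... = (LINT y|lborel. W y * ?r y)"
      by (rule Bochner_Integration.integral_cong) (auto simp: algebra_simps sum_distrib_left)
    finally have eq: "conv W g (x + h) - conv W g x - (\<Sum>i\<in>UNIV. h $ i * conv W (pd [i] g) x) = (LINT y|lborel. W y * ?r y)" .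
    have "\<bar>LINT y|lborel. W y * ?r y\<bar> <= (LINT y|lborel. \<bar>W y\<bar> * (B * (norm h)^2))"
    proof (rule order_trans[OF integral_abs_bound integral_mono])
      show "integrable lborel (%y. \<bar>W y * ?r y\<bar>)"
      proof -
        have "integrable lborel (%y. W y * g (x + h - y) - W y * g (x - y) - (\<Sum>i\<in>UNIV. h $ i * (W y * pd [i] g (x - y))))"
          using i by simp
        also have "(%y. W y * g (x + h - y) - W y * g (x - y) - (\<Sum>i\<in>UNIV. h $ i * (W y * pd [i] g (x - y)))) = (%y. W y * ?r y)"
          by (auto simp: algebra_simps sum_distrib_left)
        finally show ?thesis by (rule integrable_abs)
      qed
      show "integrable lborel (%y. \<bar>W y\<bar> * (B * (norm h)\<^sup>2))" using W by simp
      show "\<bar>W y * ?r y\<bar> <= \<bar>W y\<bar> * (B * (norm h)\<^sup>2)" for y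
        unfolding abs_mult using B(2)[of "x - y" h] by (intro mult_left_mono) (simp_all add: algebra_simps)
    qed
    then show ?thesis unfolding eq by (simp add: C_def mult_ac)
  qed
  have bl: "bounded_linear (%h. \<Sum>i\<in>UNIV. h $ i * conv W (pd [i] g) x)"
    by (intro bounded_linear_sum bounded_linear_mult_const bounded_linear_vec_nth)
  have "(%h. norm (conv W g (x + h) - conv W g x - (\<Sum>i\<in>UNIV. h $ i * conv W (pd [i] g) x)) / norm h) \<midarrow>0\<rightarrow> 0"
  proof (rule Lim_null_comparison)
    show "\<forall>\<^sub>F h in at 0. norm (norm (conv W g (x + h) - conv W g x - (\<Sum>i\<in>UNIV. h $ i * conv W (pd [i] g) x)) / norm h) <= C * norm h"
    proof (rule eventually_at_filter[THEN iffD2], rule always_eventually, intro allI impI)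
      fix h :: "real^2" assume "h ~= 0"
      then show "norm (norm (conv W g (x + h) - conv W g x - (\<Sum>i\<in>UNIV. h $ i * conv W (pd [i] g) x)) / norm h) <= C * norm h"
        using bnd[of h] by (simp add: power2_eq_square pos_divide_le_eq mult.assoc)
    qed
    have "((%h. C * norm h) \<longlongrightarrow> C * norm (0::real^2)) (at (0::real^2))"
      by (rule tendsto_mult[OF tendsto_const tendsto_norm[OF tendsto_ident_at]])
    then show "((%h. C * norm h) \<longlongrightarrow> 0) (at (0::real^2))" by simp
  qed
  then show ?thesis using bl unfolding has_derivative_at by blast
qed

lemma conv_smooth:
  assumes W: "integrable lborel W" and g: "g : test_functions UNIV"
  shows "smooth (conv W g)" and "pd al (conv W g) = conv W (pd al g)"
proof -
  have p: "pd [i] (conv W g) = conv W (pd [i] g)" if "g : test_functions UNIV" for i g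
  proof
    fix x show "pd [i] (conv W g) x = conv W (pd [i] g) x"
      using has_derivative_pd[OF conv_has_derivative[OF W that]] sum_axis[of 1 i] by simp
  qed
  show "smooth (conv W g)"
  proof (rule smooth_coinduct[of _ "conv W ` test_functions UNIV"])
    fix f assume "f : conv W ` test_functions UNIV"
    then show "(\<forall>x. f differentiable at x) \<and> (\<forall>i. pd [i] f : conv W ` test_functions UNIV)"
      using conv_has_derivative[OF W] by (auto simp: p differentiable_def intro!: imageI test_pd)
  qed (use g in auto)
  show "pd al (conv W g) = conv W (pd al g)"
  proof (induction al)
    case (Cons i al)
    show ?case unfolding pd_Cons[of i al] Cons.IH by (rule p[OF test_pd[OF g]])
  qed simp
qed

text \<open>The unit mass is stated for the nonnegative integral, so that integrability follows from
  it; it also excludes eps <= 0.\<close>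

definition mollifier :: "real => sfun => bool" where
  "mollifier eps g \<longleftrightarrow> g : test_functions UNIV \<and> (\<forall>x. 0 <= g x) \<and> (\<forall>x. g x ~= 0 \<longrightarrow> norm x < eps) \<and>
     (\<integral>\<^sup>+x. ennreal (g x) \<partial>lborel) = 1"

text \<open>The product of \<open>flat 1\<close> at eps/2 + x_i and at eps/2 - x_i is nonzero only
  on the open square of half side eps/2; there the sum of the moduli of the coordinates, hence the
  Euclidean norm, is below eps.\<close>

lemma mollifier_exists:
  assumes "eps > 0" shows "\<exists>g. mollifier eps g"
proof -
  define b where "b x = (\<Prod>i\<in>UNIV. flat 1 (eps/2 + 1 * x $ i) * flat 1 (eps/2 + (-1) * x $ i))" for x :: "real^2"
  have b2: "b x = (flat 1 (eps/2 + 1 * x $ 1) * flat 1 (eps/2 + (-1) * x $ 1)) *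
      (flat 1 (eps/2 + 1 * x $ 2) * flat 1 (eps/2 + (-1) * x $ 2))" for x
    by (simp add: b_def UNIV_2)
  have sb: "smooth b"
    unfolding b2[abs_def] by (intro smooth_alg_smooth smooth_alg.mult smooth_alg.flat)
  have f0: "0 <= flat 1 t" "flat 1 t > 0 \<longleftrightarrow> t > 0" "flat 1 t ~= 0 \<longleftrightarrow> t > 0" for t by (auto simp: flat_def)
  have b0: "0 <= b x" for x unfolding b_def by (intro prod_nonneg) (auto simp: f0)
  have supp: "norm x < eps" if "b x ~= 0" for x
  proof -
    have "\<bar>x $ i\<bar> < eps/2" for i
      using that exhaust_2[of i] unfolding b2 by (auto simp: f0)
    from this[of 1] this[of 2] have "(\<Sum>i\<in>UNIV. \<bar>x $ i\<bar>) < eps" by (simp add: sum_2)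
    then show ?thesis using norm_le_l1_cart[of x] by simp
  qed
  have tb: "b : test_functions UNIV"
    by (rule test_functionsI[OF sb]) (use supp in \<open>auto intro!: boundedI[of _ eps] less_imp_le\<close>)
  obtain B where B: "B \<ge> 0" "\<And>x. \<bar>b x\<bar> <= B" using test_bounded[OF tb] by blast
  define I where "I = (\<integral>\<^sup>+x. ennreal (b x) \<partial>lborel)"
  have "I <= (\<integral>\<^sup>+x. ennreal B * indicator (cball (0::real^2) eps) x \<partial>lborel)"
    unfolding I_def
  proof (intro nn_integral_mono)
    fix x :: "real^2" show "ennreal (b x) <= ennreal B * indicator (cball 0 eps) x"
      using supp[of x] B(2)[of x] b0[of x] by (cases "b x = 0") (auto intro!: ennreal_leI split: split_indicator)
  qed
  also have "... < \<infinity>"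
    by (subst nn_integral_cmult_indicator) (use emeasure_bounded_finite[OF bounded_cball, of "0 :: real^2" eps] in \<open>auto simp: ennreal_mult_less_top\<close>)
  finally have I1: "I < \<infinity>" .
  have bm: "b : borel_measurable borel" by (rule smooth_measurable[OF sb])
  \<comment> \<open>A continuous function that vanishes almost everywhere vanishes everywhere, but
    the bump is positive at 0.\<close>
  have I0: "I ~= 0"
  proof
    assume "I = 0"
    then have "AE x in lborel. b x = 0"
      unfolding I_def using bm b0 by (subst (asm) nn_integral_0_iff_AE) (auto simp: ennreal_eq_0_iff elim: eventually_mono intro: antisym)
    then have "AE x in lebesgue. x : {x. b x = 0}" by (simp add: AE_completion)
    moreover have "closed {x. b x = 0}"
      using continuous_closed_preimage_constant[OF smooth_continuous[OF sb] closed_UNIV] by simp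
    ultimately have "0 : {x. b x = 0}" by (rule mem_closed_if_AE_lebesgue[rotated])
    moreover have "b 0 > 0" unfolding b_def using assms by (intro prod_pos) (auto simp: f0)
    ultimately show False by simp
  qed
  define c where "c = enn2real I"
  have c: "c > 0" "ennreal c = I" using I0 I1 by (auto simp: c_def enn2real_positive_iff zero_less_iff_neq_zero)
  define g where "g x = (1/c) * b x" for x
  have "(\<integral>\<^sup>+x. ennreal (g x) \<partial>lborel) = ennreal (1/c) * I"
    unfolding g_def I_def using c bm b0 by (simp add: ennreal_mult' nn_integral_cmult del: times_divide_eq_left)
  also have "... = 1" using c by (simp flip: c(2) ennreal_mult')
  finally have "(\<integral>\<^sup>+x. ennreal (g x) \<partial>lborel) = 1" .
  moreover have "g : test_functions UNIV"
    unfolding g_def using test_lin[OF tb tb, of "1/c" 0] by simp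
  ultimately show ?thesis
    using supp b0 c by (intro exI[of _ g]) (auto simp: mollifier_def g_def)
qed

lemma nn_integral_lborel_affine:
  fixes f :: "real^2 => ennreal"
  assumes [measurable]: "f : borel_measurable borel" and c: "c ~= 0"
  shows "(\<integral>\<^sup>+x. f x \<partial>lborel) = ennreal (c^2) * (\<integral>\<^sup>+x. f (t + c *\<^sub>R x) \<partial>lborel)"
proof -
  have "(\<integral>\<^sup>+x. f x \<partial>lborel) = ennreal (\<bar>c\<bar>^2) * (\<integral>\<^sup>+x. f (t + c *\<^sub>R x) \<partial>lborel)"
    by (subst lborel_affine[OF c, of t])
      (simp add: nn_integral_density nn_integral_distr nn_integral_cmult)
  then show ?thesis by simp
qed

lemma mollifier_shift:
  assumes "mollifier eps g"
  shows "(\<integral>\<^sup>+y. ennreal (g (x - y)) \<partial>lborel) = 1" "(\<integral>\<^sup>+y. ennreal (g (y - x)) \<partial>lborel) = 1"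
    "integrable lborel (%y. g (x - y))" "(LINT y|lborel. g (x - y)) = 1"
proof -
  have m: "g : borel_measurable borel" using assms by (auto simp: mollifier_def test_measurable)
  show 1: "(\<integral>\<^sup>+y. ennreal (g (x - y)) \<partial>lborel) = 1"
    using nn_integral_lborel_affine[of "%x. ennreal (g x)" "-1" x] m assms by (simp add: mollifier_def)
  show "(\<integral>\<^sup>+y. ennreal (g (y - x)) \<partial>lborel) = 1"
    using nn_integral_lborel_affine[of "%x. ennreal (g x)" 1 "-x"] m assms by (simp add: mollifier_def)
  have m2: "(%y. g (x - y)) : borel_measurable lborel" using m by measurable
  have pos: "0 <= g z" for z using assms by (simp add: mollifier_def)
  have "has_bochner_integral lborel (%y. g (x - y)) 1"
    by (rule has_bochner_integral_nn_integral) (use 1 m2 pos in auto)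
  then show "integrable lborel (%y. g (x - y))" "(LINT y|lborel. g (x - y)) = 1"
    by (auto simp: has_bochner_integral_iff)
qed

text \<open>Young's inequality: \<open>g(x - \<cdot>)\<close> is a probability density.\<close>

lemma conv_L2:
  assumes W: "W : L2 lborel" "integrable lborel W" and g: "mollifier eps g"
  shows "conv W g : L2 lborel" "L2norm lborel (conv W g) <= L2norm lborel W"
proof -
  have Wm[measurable]: "W : borel_measurable borel" using L2_measurable[OF W(1)] by simp
  have gt: "g : test_functions UNIV" and pos: "\<And>x. 0 <= g x" using g by (auto simp: mollifier_def)
  have gm[measurable]: "g : borel_measurable borel" by (rule test_measurable[OF gt])
  have cm: "conv W g : borel_measurable borel" by (rule smooth_measurable[OF conv_smooth(1)[OF W(2) gt]])
  obtain B where B: "B \<ge> 0" "\<And>x. \<bar>g x\<bar> <= B" using test_bounded[OF gt] by blast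
  have pt: "ennreal ((conv W g x)^2) <= (\<integral>\<^sup>+y. ennreal ((W y)^2 * g (x - y)) \<partial>lborel)" for x
  proof -
    let ?v = "%y. W y * sqrt (g (x - y))" and ?w = "%y. sqrt (g (x - y))"
    have iv: "integrable lborel (%y. (W y)^2 * g (x - y))"
      by (rule integrable_mult_bounded[OF L2_integrable_sq[OF W(1)] gm B(2)])
    have vL: "?v : L2 lborel" using iv pos by (simp add: L2_def power_mult_distrib)
    have wL: "?w : L2 lborel" using mollifier_shift(3)[OF g] pos by (simp add: L2_def)
    have "conv W g x = ip lborel ?v ?w"
      unfolding conv_def ip_def using pos by (simp add: mult.assoc)
    then have "(conv W g x)^2 <= (L2norm lborel ?v * L2norm lborel ?w)^2"
      using ip_Cauchy_Schwarz[OF vL wL] power_mono[of "\<bar>conv W g x\<bar>" _ 2] by simp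
    also have "... = (LINT y|lborel. (W y)^2 * g (x - y))"
      using pos mollifier_shift(4)[OF g, of x] by (simp add: power_mult_distrib L2norm_sq_integral)
    finally have "ennreal ((conv W g x)^2) <= ennreal (LINT y|lborel. (W y)^2 * g (x - y))" by (rule ennreal_leI)
    also have "... = (\<integral>\<^sup>+y. ennreal ((W y)^2 * g (x - y)) \<partial>lborel)"
      by (rule nn_integral_eq_integral[symmetric, OF iv]) (simp add: pos)
    finally show ?thesis .
  qed
  have "(\<integral>\<^sup>+x. ennreal ((conv W g x)^2) \<partial>lborel) <= (\<integral>\<^sup>+x. (\<integral>\<^sup>+y. ennreal ((W y)^2 * g (x - y)) \<partial>lborel) \<partial>lborel)"
    by (rule nn_integral_mono) (rule pt)
  also have "... = (\<integral>\<^sup>+y. (\<integral>\<^sup>+x. ennreal ((W y)^2 * g (x - y)) \<partial>lborel) \<partial>lborel)"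
    by (rule lborel_pair.Fubini') measurable
  also have "... = (\<integral>\<^sup>+y. ennreal ((W y)^2) \<partial>lborel)"
    by (rule nn_integral_cong) (simp add: ennreal_mult' nn_integral_cmult mollifier_shift(2)[OF g])
  finally have le: "(\<integral>\<^sup>+x. ennreal ((conv W g x)^2) \<partial>lborel) <= ennreal ((L2norm lborel W)^2)"
    by (simp add: L2norm_nn_integral[OF W(1)])
  then show L: "conv W g : L2 lborel" using cm by (simp add: L2_iff_nn_integral order_le_less_trans)
  from le have "(L2norm lborel (conv W g))^2 <= (L2norm lborel W)^2"
    by (simp add: L2norm_nn_integral[OF L, symmetric])
  then show "L2norm lborel (conv W g) <= L2norm lborel W" by (rule power2_le_imp_le) simp
qed

section \<open>Convergence of mollifications in L2\<close>

lemma L2_dominated: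
  assumes v: "\<And>n. v n : borel_measurable M" and w: "w : L2 M"
    and b: "\<And>n. AE x in M. \<bar>v n x\<bar> <= \<bar>w x\<bar>" and l: "AE x in M. (%n. v n x) \<longlonglongrightarrow> 0"
  shows "v n : L2 M" "(%n. L2norm M (v n)) \<longlonglongrightarrow> 0"
proof -
  have b2: "AE x in M. norm ((v n x)^2) <= (w x)^2" for n
    using b[of n] by eventually_elim (simp add: abs_le_square_iff)
  have l2: "AE x in M. (%n. (v n x)^2) \<longlonglongrightarrow> 0"
    using l by eventually_elim (auto dest!: tendsto_power[where n = 2])
  have m: "(%x. (v n x)^2) : borel_measurable M" for n using v by measurable
  show "v n : L2 M" using integrable_dominated_convergence2[where f = "%x. 0" and s = "%n x. (v n x)^2" and w = "%x. (w x)^2",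
      OF borel_measurable_const m L2_integrable_sq[OF w] l2 b2] v by (simp add: L2_def)
  have "(%n. LINT x|M. (v n x)^2) \<longlonglongrightarrow> 0"
    using integral_dominated_convergence[where f = "%x. 0" and s = "%n x. (v n x)^2" and w = "%x. (w x)^2",
      OF borel_measurable_const m L2_integrable_sq[OF w] l2 b2] by simp
  then have "(%n. sqrt ((L2norm M (v n))^2)) \<longlonglongrightarrow> sqrt 0"
    unfolding L2norm_sq_integral by (rule tendsto_real_sqrt)
  then show "(%n. L2norm M (v n)) \<longlonglongrightarrow> 0" by simp
qed

lemma L2norm_le_bounded:
  assumes "v : borel_measurable lborel" "\<And>x :: real^2. \<bar>v x\<bar> <= b * indicator (cball 0 r) x" "0 <= b"
  shows "v : L2 lborel" "L2norm lborel v <= b * sqrt (measure lborel (cball (0::real^2) r))"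
proof -
  have fin: "emeasure lborel (cball (0::real^2) r) < \<infinity>" by (rule emeasure_lborel_cball_finite)
  have i: "integrable lborel (%x::real^2. b^2 * indicator (cball 0 r) x)" using fin by simp
  have b: "(v x)^2 <= b^2 * indicator (cball 0 r) x" for x
    using power_mono[OF assms(2)[of x], of 2] by (auto split: split_indicator)
  have "integrable lborel (%x. (v x)^2)"
    by (rule Bochner_Integration.integrable_bound[OF i]) (use assms b in \<open>auto intro!: AE_I2\<close>)
  then show L: "v : L2 lborel" using assms by (simp add: L2_def)
  have "(L2norm lborel v)^2 <= (LINT x|lborel. b^2 * indicator (cball (0::real^2) r) x)"
    unfolding L2norm_sq_integral by (rule integral_mono[OF L2_integrable_sq[OF L] i b])
  also have "... = b^2 * measure lborel (cball (0::real^2) r)" using fin by simp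
  also have "... = (b * sqrt (measure lborel (cball (0::real^2) r)))^2"
    by (simp add: power_mult_distrib)
  finally show "L2norm lborel v <= b * sqrt (measure lborel (cball (0::real^2) r))"
    by (rule power2_le_imp_le) (simp add: assms)
qed

lemma L2_bounded_support_integrable:
  assumes "W : L2 lborel" "\<And>x :: real^2. W x ~= 0 ==> norm x <= R"
  shows "integrable lborel W"
proof -
  have "indicat_real (cball (0::real^2) R) : borel_measurable lborel"
    by (intro borel_measurable_indicator) auto
  then have "indicat_real (cball (0::real^2) R) : L2 lborel"
    by (rule L2norm_le_bounded(1)[of _ 1]) auto
  from L2_integrable_mult[OF assms(1) this]
  have "integrable lborel (%x. W x * indicator (cball 0 R) x)" .
  also have "(%x. W x * indicator (cball 0 R) x) = W"
    using assms(2) by (auto simp: fun_eq_iff split: split_indicator)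
  finally show ?thesis .
qed

definition clip :: "real => real => real" where "clip b t = max (- b) (min b t)"

text \<open>Truncating the values reduces to bounded W. A Lebesgue measurable function is almost
  everywhere a limit of continuous ones; these are cut off in value and in space so that dominated
  convergence applies.\<close>

lemma L2_continuous_approx:
  fixes W :: sfun
  assumes W: "W : L2 lborel" "\<And>x. W x ~= 0 ==> norm x <= R" and "e > 0"
  obtains g where "continuous_on UNIV g" "\<And>x. g x ~= 0 ==> norm x <= R + 1" "g : L2 lborel"
    "L2norm lborel (%x. W x - g x) < e"
proof -
  have Wm[measurable]: "W : borel_measurable borel" using L2_measurable[OF W(1)] by simp
  have "(%n. L2norm lborel (%x. W x - clip (real n) (W x))) \<longlonglongrightarrow> 0"
  proof (rule L2_dominated(2)[OF _ W(1)])
    show "(%x. W x - clip (real n) (W x)) : borel_measurable lborel" for n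
      unfolding clip_def by measurable
    show "AE x in lborel. \<bar>W x - clip (real n) (W x)\<bar> <= \<bar>W x\<bar>" for n
      by (rule AE_I2) (auto simp: clip_def)
    show "AE x in lborel. (%n. W x - clip (real n) (W x)) \<longlonglongrightarrow> 0"
    proof (rule AE_I2)
      fix x
      obtain N where "\<bar>W x\<bar> <= real N" using real_arch_simple by blast
      then have "W x - clip (real n) (W x) = 0" if "n \<ge> N" for n
        using that by (auto simp: clip_def)
      then show "(%n. W x - clip (real n) (W x)) \<longlonglongrightarrow> 0"
        by (intro tendsto_eventually eventually_sequentiallyI[of N])
    qed
  qed
  then obtain n where n: "L2norm lborel (%x. W x - clip (real n) (W x)) < e/2"
    using \<open>e > 0\<close> by (metis (no_types, lifting) eventually_happens' half_gt_zero order_tendstoD(2) sequentially_bot)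
  define M where "M = real n"
  define V where "V x = clip M (W x)" for x
  have Vm[measurable]: "V : borel_measurable borel" unfolding V_def[abs_def] clip_def by measurable
  have VM: "\<bar>V x\<bar> <= M" "V x ~= 0 ==> norm x <= R" for x
    using W(2)[of x] by (auto simp: V_def clip_def M_def split: if_splits)
  have "V measurable_on UNIV"
    by (rule lebesgue_measurable_imp_measurable_on) (auto intro: measurable_completion)
  then obtain N g where N: "negligible N" "\<And>n. continuous_on UNIV (g n)"
      "\<And>x. x \<notin> N ==> (%n. g n x) \<longlonglongrightarrow> V x"
    unfolding measurable_on_def by auto
  \<comment> \<open>The clip keeps the sequence bounded by M; the second factor is a continuous
    cut-off, equal to 1 on the ball of radius R and to 0 beyond R + 1.\<close>
  define h where "h n x = clip M (g n x) * max 0 (min 1 (R + 1 - norm x))" for n x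
  have hc: "continuous_on UNIV (h n)" for n
    unfolding h_def clip_def by (intro continuous_intros N(2))
  then have hm: "h n : borel_measurable borel" for n by (rule borel_measurable_continuous_onI)
  have M0: "0 <= M" by (simp add: M_def)
  have hb: "\<bar>h n x\<bar> <= M * indicator (cball 0 (R+1)) x" for n x
  proof -
    have "\<bar>clip M (g n x)\<bar> * \<bar>max 0 (min 1 (R + 1 - norm x))\<bar> <= M * 1"
      using M0 by (intro mult_mono) (auto simp: clip_def)
    then show ?thesis by (auto simp: h_def abs_mult split: split_indicator)
  qed
  have Vb: "\<bar>V x\<bar> <= M * indicator (cball 0 (R+1)) x" for x
    using VM[of x] by (auto split: split_indicator) (metis norm_ge_zero add_increasing2 zero_le_one)
  define w where "w x = 2 * M * indicator (cball 0 (R+1)) x" for x :: "real^2"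
  have "w : borel_measurable lborel" 
    unfolding w_def[abs_def] by (intro borel_measurable_times borel_measurable_const borel_measurable_indicator) auto
  then have wL: "w : L2 lborel"
    by (rule L2norm_le_bounded(1)[of _ "2 * M" "R + 1"]) (use M0 in \<open>auto simp: abs_mult w_def\<close>)
  have "(%n. L2norm lborel (%x. V x - h n x)) \<longlonglongrightarrow> 0"
  proof (rule L2_dominated(2)[OF _ wL])
    show "(%x. V x - h n x) : borel_measurable lborel" for n using hm by measurable
    show "AE x in lborel. \<bar>V x - h n x\<bar> <= \<bar>w x\<bar>" for n
    proof (rule AE_I2)
      fix x
      have "\<bar>w x\<bar> = 2 * (M * indicator (cball 0 (R+1)) x)" using M0 by (simp add: w_def abs_mult)
      then show "\<bar>V x - h n x\<bar> <= \<bar>w x\<bar>"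
        using abs_triangle_ineq4[of "V x" "h n x"] Vb[of x] hb[of n x] by linarith
    qed
    have "N : null_sets lebesgue" using N(1) by (simp add: negligible_iff_null_sets)
    then have "AE x in lebesgue. x \<notin> N" by (rule AE_not_in)
    then have "AE x in lborel. x \<notin> N" by (simp add: AE_completion_iff)
    then show "AE x in lborel. (%n. V x - h n x) \<longlonglongrightarrow> 0"
    proof eventually_elim
      case (elim x)
      have "(%n. h n x) \<longlonglongrightarrow> clip M (V x) * max 0 (min 1 (R + 1 - norm x))"
        unfolding h_def clip_def by (intro tendsto_intros N(3) elim)
      moreover have "clip M (V x) * max 0 (min 1 (R + 1 - norm x)) = V x"
        using VM[of x] by (cases "V x = 0") (auto simp: clip_def)
      ultimately show ?case using tendsto_diff[OF tendsto_const, of "%n. h n x" "V x" sequentially "V x"] by simp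
    qed
  qed
  then obtain m where m: "L2norm lborel (%x. V x - h m x) < e/2"
    using \<open>e > 0\<close> by (metis (no_types, lifting) eventually_happens' half_gt_zero order_tendstoD(2) sequentially_bot)
  have hL: "h m : L2 lborel" by (rule L2norm_le_bounded(1)[OF _ hb M0]) (use hm in simp)
  have VL: "V : L2 lborel" by (rule L2norm_le_bounded(1)[OF _ Vb M0]) simp
  have "L2norm lborel (%x. W x - h m x) <= L2norm lborel (%x. W x - V x) + L2norm lborel (%x. V x - h m x)"
    using L2norm_triangle[OF L2_diff[OF W(1) VL] L2_diff[OF VL hL]] by simp
  also have "... < e" using n m by (simp add: V_def M_def)
  finally show ?thesis
    using that[OF hc _ hL] hb[of m] by (metis abs_le_zero_iff indicator_simps(2) mem_cball_0 mult_zero_right)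
qed

lemma compact_support_uniformly_continuous:
  fixes g :: sfun
  assumes "continuous_on UNIV g" "\<And>x. g x ~= 0 ==> norm x <= R" "e > 0"
  obtains d where "d > 0" "\<And>x y. norm (x - y) < d ==> \<bar>g x - g y\<bar> < e"
proof -
  have "uniformly_continuous_on (cball 0 (R+1)) g"
    by (rule compact_uniformly_continuous[OF continuous_on_subset[OF assms(1)]]) auto
  then obtain d where d: "d > 0" "\<And>x y. x : cball 0 (R+1) ==> y : cball 0 (R+1) ==> dist y x < d ==> dist (g y) (g x) < e"
    unfolding uniformly_continuous_on_def using \<open>e > 0\<close> by metis
  have "\<bar>g x - g y\<bar> < e" if xy: "norm (x - y) < min d 1" for x y
  proof (cases "norm x <= R + 1 \<and> norm y <= R + 1")
    case True
    then show ?thesis using d(2)[of y x] xy by (simp add: dist_norm dist_real_def)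
  next
    case False
    then have "norm x > R" "norm y > R"
      using xy norm_triangle_ineq3[of x y] by auto
    then have "g x = 0" "g y = 0" using assms(2)[of x] assms(2)[of y] by force+
    then show ?thesis using \<open>e > 0\<close> by simp
  qed
  then show ?thesis using that[of "min d 1"] d(1) by auto
qed

text \<open>In the plane, the substitution a + c x scales the squared norm by 1/c^2, hence the norm
  by 1/|c|; the rest is Young's inequality.\<close>

lemma conv_affine_L2:
  assumes W: "W : L2 lborel" "integrable lborel W" and g: "mollifier eps g" and c: "c ~= 0"
  shows "(%x. s * conv W g (a + c *\<^sub>R x)) : L2 lborel"
    "L2norm lborel (%x. s * conv W g (a + c *\<^sub>R x)) <= \<bar>s\<bar> / \<bar>c\<bar> * L2norm lborel W"
proof -
  have cm[measurable]: "conv W g : borel_measurable borel"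
    using L2_measurable[OF conv_L2(1)[OF W g]] by simp
  have eq: "ennreal ((L2norm lborel (conv W g))^2) = ennreal (c^2) * (\<integral>\<^sup>+x. ennreal ((conv W g (a + c *\<^sub>R x))^2) \<partial>lborel)"
    unfolding L2norm_nn_integral[OF conv_L2(1)[OF W g]]
    by (rule nn_integral_lborel_affine[OF _ c]) measurable
  then have "(\<integral>\<^sup>+x. ennreal ((conv W g (a + c *\<^sub>R x))^2) \<partial>lborel) < \<infinity>"
    using c by (cases "(\<integral>\<^sup>+x. ennreal ((conv W g (a + c *\<^sub>R x))^2) \<partial>lborel) = \<infinity>") (auto simp: ennreal_mult_top less_top)
  then have L: "(%x. conv W g (a + c *\<^sub>R x)) : L2 lborel"
    by (subst L2_iff_nn_integral) auto
  then show "(%x. s * conv W g (a + c *\<^sub>R x)) : L2 lborel" by (rule L2_cmult)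
  have "(L2norm lborel (conv W g))^2 = c^2 * (L2norm lborel (%x. conv W g (a + c *\<^sub>R x)))^2"
    using eq by (simp add: L2norm_nn_integral[OF L, symmetric] flip: ennreal_mult')
  then have "(L2norm lborel (conv W g))^2 = (\<bar>c\<bar> * L2norm lborel (%x. conv W g (a + c *\<^sub>R x)))^2"
    by (simp add: power_mult_distrib)
  then have "L2norm lborel (conv W g) = \<bar>c\<bar> * L2norm lborel (%x. conv W g (a + c *\<^sub>R x))"
    by (simp add: power2_eq_iff_nonneg)
  then have "L2norm lborel (%x. conv W g (a + c *\<^sub>R x)) <= L2norm lborel W / \<bar>c\<bar>"
    using conv_L2(2)[OF W g] c by (simp add: field_simps)
  from mult_left_mono[OF this, of "\<bar>s\<bar>"]
  show "L2norm lborel (%x. s * conv W g (a + c *\<^sub>R x)) <= \<bar>s\<bar> / \<bar>c\<bar> * L2norm lborel W"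
    by (simp add: L2norm_cmult)
qed

lemma conv_eq_0:
  assumes "\<And>y. W y ~= 0 ==> g (x - y) = 0" shows "conv W g x = 0"
proof -
  have "(%y. W y * g (x - y)) = (%y. 0)" using assms by (auto simp: fun_eq_iff)
  then show ?thesis by (simp add: conv_def)
qed

text \<open>As a function of y, \<open>g (x - y)\<close> is a probability density living on |x - y|
  < eps, so the mollification at x is an average of values of W near x.\<close>

lemma conv_close:
  assumes W: "integrable lborel W" and g: "mollifier eps g"
    and b: "\<And>y. norm (x - y) < eps ==> \<bar>W y - t\<bar> <= b"
  shows "\<bar>conv W g x - t\<bar> <= b"
proof -
  have gt: "g : test_functions UNIV" "\<And>x. 0 <= g x" "\<And>x. g x ~= 0 ==> norm x < eps"
    using g by (auto simp: mollifier_def)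
  note i = conv_integrable[OF W gt(1), of x] mollifier_shift(3)[OF g, of x]
  have "conv W g x - t = (LINT y|lborel. W y * g (x - y) - t * g (x - y))"
    unfolding conv_def using i mollifier_shift(4)[OF g, of x] by simp
  also have "\<bar>...\<bar> <= (LINT y|lborel. b * g (x - y))"
  proof (rule order_trans[OF integral_abs_bound integral_mono])
    show "integrable lborel (%y. \<bar>W y * g (x - y) - t * g (x - y)\<bar>)" "integrable lborel (%y. b * g (x - y))"
      using i by auto
    fix y
    show "\<bar>W y * g (x - y) - t * g (x - y)\<bar> <= b * g (x - y)"
    proof (cases "g (x - y) = 0")
      case False
      then have "\<bar>W y - t\<bar> * g (x - y) <= b * g (x - y)" using gt b by (intro mult_right_mono) auto
      then show ?thesis using gt(2)[of "x - y"] by (simp add: abs_mult flip: left_diff_distrib)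
    qed simp
  qed
  also have "... = b" using mollifier_shift(4)[OF g, of x] by simp
  finally show ?thesis .
qed

text \<open>Mollification combined with a vanishing affine perturbation of the argument; the latter makes
  room for the mollifier up to the boundary of a star-shaped domain.\<close>

lemma mollify_tendsto:
  fixes W :: sfun
  assumes W: "W : L2 lborel" "\<And>x. W x ~= 0 ==> norm x <= R"
    and g: "\<And>n. mollifier (eps n) (g n)" and eps: "eps \<longlonglongrightarrow> 0"
    and a: "a \<longlonglongrightarrow> 0" and c: "c \<longlonglongrightarrow> 1" and s: "s \<longlonglongrightarrow> 1"
  shows "(%n. L2norm lborel (%x. s n * conv W (g n) (a n + c n *\<^sub>R x) - W x)) \<longlonglongrightarrow> 0"
proof (rule tendstoI)
  fix e :: real assume e: "e > 0"
  have Wi: "integrable lborel W" by (rule L2_bounded_support_integrable[OF W])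
  obtain G where G: "continuous_on UNIV G" "\<And>x. G x ~= 0 ==> norm x <= R + 1" "G : L2 lborel"
    "L2norm lborel (%x. W x - G x) < e/8"
    using L2_continuous_approx[OF W, of "e/8"] e by auto
  have Gi: "integrable lborel G" by (rule L2_bounded_support_integrable[OF G(3,2)])
  define K where "K = \<bar>R\<bar> + 1"
  have GK: "G x ~= 0 ==> norm x <= K" for x using G(2)[of x] by (auto simp: K_def)
  \<comment> \<open>For |x| > r and c > 1/2 the vector c x has norm above K + 2. Shift and mollifier
    radius are each below 1, so the argument stays out of reach of the support of G.\<close>
  define r where "r = 2 * K + 4"
  define vol where "vol = sqrt (measure lborel (cball (0::real^2) r))"
  have vol: "0 <= vol" by (simp add: vol_def)
  \<comment> \<open>Chosen so that 3 \<omega> vol <= e/8; the error is split into 4 (e/8) + e/8 +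
    e/8.\<close>
  define \<omega> where "\<omega> = e / (24 * (vol + 1))"
  have \<omega>: "\<omega> > 0" using e vol by (simp add: \<omega>_def)
  obtain B where B: "\<And>x. \<bar>G x\<bar> <= B" "B \<ge> 0"
  proof -
    have "bounded (G ` cball 0 K)"
      by (intro compact_imp_bounded compact_continuous_image continuous_on_subset[OF G(1)]) auto
    then obtain B where "B > 0" "\<And>y. y : G ` cball 0 K ==> norm y <= B" by (auto simp: bounded_pos)
    then have "\<bar>G x\<bar> <= B" for x using GK[of x] by (cases "G x = 0") auto
    then show ?thesis using \<open>B > 0\<close> that[of B] by auto
  qed
  obtain d where d: "d > 0" "\<And>x y. norm (x - y) < d ==> \<bar>G x - G y\<bar> < \<omega>"
    using compact_support_uniformly_continuous[OF G(1) GK \<omega>] by blast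
  have "(%n. eps n + norm (a n) + \<bar>c n - 1\<bar> * r) \<longlonglongrightarrow> 0 + norm (0::real^2) + \<bar>1 - 1\<bar> * r"
    by (intro tendsto_intros eps a c)
  then have "\<forall>\<^sub>F n in sequentially. eps n + norm (a n) + \<bar>c n - 1\<bar> * r < min d 1"
    using d(1) by (intro order_tendstoD) auto
  moreover have "\<forall>\<^sub>F n in sequentially. c n > 1/2" using c by (rule order_tendstoD) simp
  moreover have "\<forall>\<^sub>F n in sequentially. \<bar>s n\<bar> < 2" 
    using tendsto_rabs[OF s] by (intro order_tendstoD) auto
  moreover have "\<forall>\<^sub>F n in sequentially. \<bar>s n - 1\<bar> * B < \<omega>"
  proof -
    have "(%n. \<bar>s n - 1\<bar> * B) \<longlonglongrightarrow> \<bar>1 - 1\<bar> * B" by (intro tendsto_intros s)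
    then show ?thesis using \<omega> by (intro order_tendstoD) auto
  qed
  ultimately show "\<forall>\<^sub>F n in sequentially.
    dist (L2norm lborel (%x. s n * conv W (g n) (a n + c n *\<^sub>R x) - W x)) 0 < e"
  proof eventually_elim
    case (elim n)
    have cn: "c n ~= 0" using elim by auto
    \<comment> \<open>For a radius <= 0 the kernel would vanish identically, contrary to its unit
      mass.\<close>
    have eps0: "0 < eps n"
    proof (rule ccontr)
      assume "\<not> 0 < eps n"
      then have "g n x = 0" for x using g[of n] norm_ge_zero[of x] unfolding mollifier_def by (metis dual_order.strict_trans2)
      then show False using g[of n] by (simp add: mollifier_def)
    qed
    have r0: "r \<ge> 0" by (simp add: r_def K_def)
    have small: "eps n < 1" "norm (a n) < 1"
      using elim(1) eps0 r0 norm_ge_zero[of "a n"] mult_nonneg_nonneg[of "\<bar>c n - 1\<bar>" r] by linarith+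
    let ?T = "%W x. s n * conv W (g n) (a n + c n *\<^sub>R x)"
    have pt: "\<bar>?T G x - G x\<bar> <= 3 * \<omega> * indicator (cball 0 r) x" for x
    proof (cases "norm x <= r")
      case True
      have "\<bar>conv G (g n) (a n + c n *\<^sub>R x) - G x\<bar> <= \<omega>"
      proof (rule conv_close[OF Gi g])
        fix y assume y: "norm (a n + c n *\<^sub>R x - y) < eps n"
        have "y - x = (a n + (c n - 1) *\<^sub>R x) - (a n + c n *\<^sub>R x - y)" by (simp add: algebra_simps)
        then have "norm (y - x) <= norm (a n + (c n - 1) *\<^sub>R x) + norm (a n + c n *\<^sub>R x - y)"
          by (metis norm_triangle_ineq4)
        also have "norm (a n + (c n - 1) *\<^sub>R x) <= norm (a n) + \<bar>c n - 1\<bar> * norm x"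
          using norm_triangle_ineq[of "a n" "(c n - 1) *\<^sub>R x"] by simp
        also have "\<bar>c n - 1\<bar> * norm x <= \<bar>c n - 1\<bar> * r" using True by (intro mult_left_mono) auto
        finally have "norm (y - x) < d" using y elim(1) by linarith
        then show "\<bar>G y - G x\<bar> <= \<omega>" using d(2)[of y x] by simp
      qed
      then have "\<bar>s n\<bar> * \<bar>conv G (g n) (a n + c n *\<^sub>R x) - G x\<bar> <= 2 * \<omega>"
        using elim(3) \<omega> by (intro mult_mono) auto
      moreover have "\<bar>s n - 1\<bar> * \<bar>G x\<bar> <= \<omega>"
        using mult_left_mono[OF B(1)[of x], of "\<bar>s n - 1\<bar>"] elim(4) by linarith
      moreover have "?T G x - G x = s n * (conv G (g n) (a n + c n *\<^sub>R x) - G x) + (s n - 1) * G x"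
        by (simp add: algebra_simps)
      ultimately show ?thesis using True abs_triangle_ineq[of "s n * (conv G (g n) (a n + c n *\<^sub>R x) - G x)" "(s n - 1) * G x"]
        by (simp add: abs_mult)
    next
      case False
      have G0: "G x = 0"
      proof (rule ccontr)
        assume "G x ~= 0"
        then have "norm x <= K" by (rule GK)
        with False show False by (simp add: r_def K_def)
      qed
      have "conv G (g n) (a n + c n *\<^sub>R x) = 0"
      proof (rule conv_eq_0)
        fix y assume "G y ~= 0"
        then have y: "norm y <= K" by (rule GK)
        have "norm (c n *\<^sub>R x) > r / 2"
          using mult_strict_mono[of "1/2" "c n" r "norm x"] elim(2) False r0 by simp
        moreover have "norm (c n *\<^sub>R x) <= norm (a n + c n *\<^sub>R x - y) + norm (a n) + norm y"
          using norm_triangle_ineq4[of "a n + c n *\<^sub>R x - y + y" "a n"] norm_triangle_ineq[of "a n + c n *\<^sub>R x - y" y] by simp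
        ultimately have "norm (a n + c n *\<^sub>R x - y) > eps n" using y small by (simp add: r_def)
        then show "g n (a n + c n *\<^sub>R x - y) = 0" using g[of n] unfolding mollifier_def by (metis less_asym)
      qed
      then show ?thesis using G0 False by simp
    qed
    note TW = conv_affine_L2[OF L2_diff[OF W(1) G(3)] Bochner_Integration.integrable_diff[OF Wi Gi] g[of n] cn, where s = "s n" and a = "a n"]
    have TG: "?T G : L2 lborel" by (rule conv_affine_L2(1)[OF G(3) Gi g cn])
    have gt: "g n : test_functions UNIV" using g by (simp add: mollifier_def)
    have lin: "conv (%x. W x - G x) (g n) z = conv W (g n) z - conv G (g n) z" for z
      unfolding conv_def using conv_integrable[OF Wi gt, of z] conv_integrable[OF Gi gt, of z]
      by (simp add: left_diff_distrib)
    \<comment> \<open>The classical three-term splitting: W is exchanged for its continuous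
      approximation G, at the price of \<open>?T (W - G)\<close>, which Young's inequality controls,
      and of G - W.\<close>
    have split: "(%x. ?T W x - W x) = (%x. (?T (%x. W x - G x) x + (?T G x - G x)) + (G x - W x))"
      by (simp add: lin algebra_simps)
    have bG: "(%x. ?T G x - G x) : L2 lborel" by (rule L2_diff[OF TG G(3)])
    have "L2norm lborel (%x. ?T W x - W x) <= L2norm lborel (?T (%x. W x - G x)) + L2norm lborel (%x. ?T G x - G x) + L2norm lborel (%x. G x - W x)"
      unfolding split
      using L2norm_triangle[OF L2_add[OF TW(1) bG] L2_diff[OF G(3) W(1)]] L2norm_triangle[OF TW(1) bG] by linarith
    also have "L2norm lborel (?T (%x. W x - G x)) <= 4 * (e/8)"
    proof -
      have "\<bar>s n\<bar> / \<bar>c n\<bar> <= 4" using elim(2,3) by (simp add: pos_divide_le_eq)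
      then have "\<bar>s n\<bar> / \<bar>c n\<bar> * L2norm lborel (%x. W x - G x) <= 4 * (e/8)"
        using G(4) by (intro mult_mono) auto
      with TW(2) show ?thesis by linarith
    qed
    also have "L2norm lborel (%x. ?T G x - G x) <= 3 * \<omega> * vol"
      unfolding vol_def by (rule L2norm_le_bounded(2)[OF _ pt]) (use \<omega> L2_measurable[OF bG] in auto)
    also have "3 * \<omega> * vol <= e/8"
      unfolding \<omega>_def using e vol by (simp add: field_simps)
    also have "L2norm lborel (%x. G x - W x) < e/8" using G(4) L2norm_diff_commute[of lborel G W] by simp
    finally have "L2norm lborel (%x. ?T W x - W x) < e" using e by simp
    then show ?case by simp
  qed
qed

subsection \<open>Density of test functions and weak derivatives\<close>

lemma L2_bound:
  assumes "v : borel_measurable M" "w : L2 M" "AE x in M. \<bar>v x\<bar> <= \<bar>w x\<bar>"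
  shows "v : L2 M"
proof -
  have "integrable M (%x. (v x)^2)"
  proof (rule Bochner_Integration.integrable_bound[OF L2_integrable_sq[OF assms(2)]])
    show "(%x. (v x)^2) : borel_measurable M" using assms(1) by measurable
    show "AE x in M. norm ((v x)\<^sup>2) <= norm ((w x)\<^sup>2)"
      using assms(3) by eventually_elim (simp add: abs_le_square_iff)
  qed
  then show ?thesis using assms(1) by (simp add: L2_def)
qed

section \<open>Passage between Lebesgue measure on a set and Borel functions on the plane\<close>

lemma borel_measurable_lebesgue_on:
  "f : borel_measurable borel ==> f : borel_measurable (lebesgue_on G)"
  by (simp add: measurable_completion measurable_restrict_space1)

lemma nn_integral_lebesgue_on:
  "G : sets lebesgue ==> (\<integral>\<^sup>+x. f x \<partial>lebesgue_on G) = (\<integral>\<^sup>+x. f x * indicator G x \<partial>lebesgue)"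
  by (subst nn_integral_restrict_space) auto

lemma lborel_L2d:
  fixes f :: sfun
  assumes G: "G : sets lebesgue" and f: "f : L2 lborel"
  shows "f : L2d G" "L2normd G f <= L2norm lborel f"
proof -
  have m: "f : borel_measurable (lebesgue_on G)"
    using L2_measurable[OF f] by (simp add: borel_measurable_lebesgue_on)
  have "(\<integral>\<^sup>+x. ennreal ((f x)^2) \<partial>lebesgue_on G) <= (\<integral>\<^sup>+x. ennreal ((f x)^2) \<partial>lebesgue)"
    unfolding nn_integral_lebesgue_on[OF G] by (rule nn_integral_mono) (auto split: split_indicator)
  also have "... = ennreal ((L2norm lborel f)^2)"
    by (simp add: nn_integral_completion L2norm_nn_integral[OF f])
  finally have le: "(\<integral>\<^sup>+x. ennreal ((f x)^2) \<partial>lebesgue_on G) <= ennreal ((L2norm lborel f)^2)" .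
  then show L: "f : L2d G" using m by (simp add: L2_iff_nn_integral order_le_less_trans)
  from le show "L2normd G f <= L2norm lborel f"
    by (simp add: L2norm_nn_integral[OF L, symmetric] abs_le_square_iff[symmetric] power_mono_iff)
qed

text \<open>Convolutions are formed with \<open>lborel\<close>, so a Lebesgue measurable function on
  G is exchanged for a Borel function on the plane that agrees almost everywhere with its extension
  by zero.\<close>

lemma L2d_to_lborel:
  fixes v :: sfun
  assumes G: "G : sets lebesgue" and v: "v : L2d G"
  obtains V where "V : L2 lborel" "AE x in lebesgue. V x = indicator G x * v x"
proof -
  have i: "integrable lebesgue (%x. indicator G x * (v x)^2)"
    using L2_integrable_sq[OF v] G by (subst (asm) integrable_restrict_space) auto
  have "(%x. indicator G x *\<^sub>R v x) : borel_measurable lebesgue"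
    using L2_measurable[OF v] G by (subst (asm) borel_measurable_restrict_space_iff) auto
  then obtain V where V: "V : borel_measurable lborel" "AE x in lborel. indicator G x *\<^sub>R v x = V x"
    using completion_ex_borel_measurable_real by blast
  have ae: "AE x in lebesgue. V x = indicator G x * v x"
    using AE_completion[OF V(2)] by (auto elim: eventually_mono)
  have "integrable lebesgue (%x. (V x)^2)"
  proof (rule integrable_cong_AE_imp[OF i])
    show "(%x. (V x)\<^sup>2) : borel_measurable lebesgue" using V(1) by (auto intro: measurable_completion)
    show "AE x in lebesgue. indicat_real G x * (v x)\<^sup>2 = (V x)\<^sup>2"
      using ae by eventually_elim (auto split: split_indicator)
  qed
  then have "V : L2 lborel" using V(1) by (simp add: L2_def integrable_completion)
  then show ?thesis using that ae by blast
qed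

lemma ip_lborel:
  fixes v :: sfun
  assumes G: "G : sets lebesgue" and v: "v : L2d G" and V: "V : L2 lborel" "AE x in lebesgue. V x = indicator G x * v x"
    and f: "f : borel_measurable borel"
  shows "ipd G v f = ip lborel V f"
proof -
  have "ipd G v f = (LINT x|lebesgue. indicator G x *\<^sub>R (v x * f x))"
    unfolding ip_def using G by (subst integral_restrict_space) auto
  also have "... = (LINT x|lebesgue. V x * f x)"
  proof (rule integral_cong_AE)
    have "(%x. v x * f x) : borel_measurable (lebesgue_on G)"
      using L2_measurable[OF v] borel_measurable_lebesgue_on[OF f] by measurable
    then show "(%x. indicator G x *\<^sub>R (v x * f x)) : borel_measurable lebesgue"
      using G by (subst (asm) borel_measurable_restrict_space_iff) auto
    show "(%x. V x * f x) : borel_measurable lebesgue"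
      using L2_measurable[OF V(1)] f by (intro measurable_completion) simp
    show "AE x in lebesgue. indicat_real G x *\<^sub>R (v x * f x) = V x * f x"
      using V(2) by eventually_elim auto
  qed
  also have "... = ip lborel V f"
    unfolding ip_def using L2_measurable[OF V(1)] f by (intro integral_completion) simp
  finally show ?thesis .
qed

lemma test_L2: "f : test_functions H ==> f : L2 lborel"
proof -
  assume f: "f : test_functions H"
  obtain B where B: "B \<ge> 0" "\<And>x. \<bar>f x\<bar> <= B" using test_bounded[OF f] by blast
  have "bounded {x. f x ~= 0}" using f
    by (auto simp: test_functions_def compact_eq_bounded_closed intro: bounded_subset[OF _ closure_subset])
  then obtain r where r: "\<And>x. f x ~= 0 ==> norm x <= r" by (auto simp: bounded_iff)
  show ?thesis
    by (rule L2norm_le_bounded(1)[OF _ _ B(1), of _ r])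
      (use test_measurable[OF f] B(2) r in \<open>auto split: split_indicator\<close>)
qed

lemma test_L2d: "f : test_functions H ==> G : sets lebesgue ==> f : L2d G"
  by (rule lborel_L2d(1)[OF _ test_L2])

lemma smooth_L2d:
  assumes "smooth f" "bounded G" "G : sets lebesgue" shows "f : L2d G"
proof -
  have "finite_measure (lebesgue_on G)"
    using assms bounded_set_imp_lmeasurable by (intro finite_measure_lebesgue_on) auto
  moreover obtain B where "\<And>x. x : closure G ==> \<bar>f x\<bar> <= B"
  proof -
    have "bounded (f ` closure G)"
      using assms by (intro compact_imp_bounded compact_continuous_image smooth_continuous) auto
    then show ?thesis using that by (auto simp: bounded_iff)
  qed
  ultimately show ?thesis
    using closure_subset[of G] by (intro L2_bounded[of _ _ B])
      (auto intro!: borel_measurable_lebesgue_on smooth_measurable assms)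
qed

text \<open>Exhaust G by compact sets, restrict to one of them, and mollify with a radius below half
  its distance to the complement, so that the support stays inside G.\<close>

lemma test_dense_L2:
  assumes G: "open G" and v: "v : L2d G" and e: "e > 0"
  obtains phi where "phi : test_functions G" "L2normd G (%x. v x - phi x) < e"
proof -
  have Gm: "G : sets lebesgue" using G by auto
  obtain V where V: "V : L2 lborel" "AE x in lebesgue. V x = indicator G x * v x"
    using L2d_to_lborel[OF Gm v] .
  define K where "K j = {x. \<forall>y. y \<notin> G \<longrightarrow> dist x y \<ge> 1 / real (Suc j)} \<inter> cball 0 (real j)" for j
  have Kc: "compact (K j)" for j
  proof -
    have "{x. \<forall>y. y \<notin> G \<longrightarrow> dist x y \<ge> 1 / real (Suc j)} = (\<Inter>y\<in>-G. {x. dist x y \<ge> 1 / real (Suc j)})" by auto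
    moreover have "closed ..." by (intro closed_INT ballI closed_Collect_le continuous_intros)
    ultimately show ?thesis unfolding K_def by (simp add: closed_Int_compact)
  qed
  have Km: "K j : sets borel" for j using Kc by (simp add: borel_compact)
  have KG: "K j \<subseteq> G" for j unfolding K_def by force
  have Kev: "\<forall>\<^sub>F j in sequentially. x : K j" if x: "x : G" for x
  proof -
    obtain r where r: "r > 0" "ball x r \<subseteq> G" using G x open_contains_ball by blast
    obtain j1 where j1: "1 / real (Suc j1) < r" using r(1) nat_approx_posE by (metis)
    obtain j2 where j2: "norm x <= real j2" using real_arch_simple by blast
    have "x : K j" if "j \<ge> max j1 j2" for j
    proof -
      have "1 / real (Suc j) <= 1 / real (Suc j1)" using that by (intro divide_left_mono) auto
      then have "1 / real (Suc j) < r" using j1 by linarith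
      moreover have "dist x y \<ge> r" if "y \<notin> G" for y using r(2) that by (meson in_mono mem_ball not_le)
      ultimately show ?thesis using j2 that unfolding K_def by force
    qed
    then show ?thesis by (rule eventually_sequentiallyI)
  qed
  define Vk where "Vk j x = indicator (K j) x * V x" for j x
  have Vm: "V : borel_measurable borel" using L2_measurable[OF V(1)] by simp
  have Vkm: "Vk j : borel_measurable borel" for j
    unfolding Vk_def[abs_def] using Km Vm by (intro borel_measurable_times borel_measurable_indicator)
  have "(%j. L2norm lborel (%x. V x - Vk j x)) \<longlonglongrightarrow> 0"
  proof (rule L2_dominated(2)[OF _ V(1)])
    show "(%x. V x - Vk j x) : borel_measurable lborel" for j using Vm Vkm by simp
    show "AE x in lborel. \<bar>V x - Vk j x\<bar> <= \<bar>V x\<bar>" for j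
      by (rule AE_I2) (auto simp: Vk_def split: split_indicator)
    have "AE x in lborel. V x = indicator G x * v x" using V(2) by (simp add: AE_completion_iff)
    then show "AE x in lborel. (%j. V x - Vk j x) \<longlonglongrightarrow> 0"
    proof eventually_elim
      case (elim x)
      show ?case
      proof (cases "x : G")
        case True
        from Kev[OF this] have "\<forall>\<^sub>F j in sequentially. V x - Vk j x = 0"
          by eventually_elim (simp add: Vk_def)
        then show ?thesis by (rule tendsto_eventually)
      next
        case False
        then show ?thesis using elim by (simp add: Vk_def)
      qed
    qed
  qed
  then have "\<forall>\<^sub>F j in sequentially. L2norm lborel (%x. V x - Vk j x) < e/2"
    using e by (intro order_tendstoD) auto
  then obtain j where j: "L2norm lborel (%x. V x - Vk j x) < e/2" using eventually_happens' sequentially_bot by blast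
  have VkL: "Vk j : L2 lborel"
    by (rule L2_bound[OF _ V(1)]) (use Vkm[of j] in \<open>auto simp: Vk_def split: split_indicator\<close>)
  have supp: "norm x <= real j" if "Vk j x ~= 0" for x
    using that by (auto simp: Vk_def K_def indicator_def split: if_splits)
  define eps where "eps n = 1 / real (Suc n)" for n
  have eps0: "eps n > 0" for n by (simp add: eps_def)
  have epsl: "eps \<longlonglongrightarrow> 0" unfolding eps_def by (rule LIMSEQ_Suc[OF lim_1_over_n])
  obtain g where g: "\<And>n. mollifier (eps n) (g n)" using mollifier_exists[OF eps0] by metis
  have "(%n. L2norm lborel (%x. 1 * conv (Vk j) (g n) (0 + 1 *\<^sub>R x) - Vk j x)) \<longlonglongrightarrow> 0"
    by (rule mollify_tendsto[OF VkL supp g epsl, where a = "%n. 0" and c = "%n. 1" and s = "%n. 1"]) auto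
  then have "\<forall>\<^sub>F n in sequentially. L2norm lborel (%x. conv (Vk j) (g n) x - Vk j x) < e/2"
    using e by (intro order_tendstoD) auto
  moreover have "\<forall>\<^sub>F n in sequentially. eps n < 1 / (2 * real (Suc j))"
    using epsl by (intro order_tendstoD) auto
  ultimately have "\<forall>\<^sub>F n in sequentially. L2norm lborel (%x. conv (Vk j) (g n) x - Vk j x) < e/2 \<and> eps n < 1 / (2 * real (Suc j))"
    by (rule eventually_conj)
  then obtain n where n: "L2norm lborel (%x. conv (Vk j) (g n) x - Vk j x) < e/2" "eps n < 1 / (2 * real (Suc j))"
    using eventually_happens' sequentially_bot by blast
  define phi where "phi = conv (Vk j) (g n)"
  have Vi: "integrable lborel (Vk j)" by (rule L2_bounded_support_integrable[OF VkL supp])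
  have gn: "g n : test_functions UNIV" using g by (simp add: mollifier_def)
  \<comment> \<open>Points at no less than half the distance to the complement that is guaranteed on
    \<open>K j\<close>; this closed subset of G receives the support of the mollification.\<close>
  define S where "S = {x. \<forall>y. y \<notin> G \<longrightarrow> dist x y \<ge> 1 / (2 * real (Suc j))}"
  have "S = (\<Inter>y\<in>-G. {x. dist x y \<ge> 1 / (2 * real (Suc j))})" by (auto simp: S_def)
  then have Sc: "closed S" by (simp only:) (intro closed_INT ballI closed_Collect_le continuous_intros)
  have SG: "S \<subseteq> G" unfolding S_def by force
  have phis: "x : S \<inter> cball 0 (real j + 1)" if nz: "phi x ~= 0" for x
  proof -
    obtain y where y: "Vk j y ~= 0" "g n (x - y) ~= 0"
      using conv_eq_0[of "Vk j" "g n" x] nz unfolding phi_def by blast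
    have yK: "y : K j" using y(1) by (auto simp: Vk_def indicator_def split: if_splits)
    have xy: "norm (x - y) < eps n" using y(2) g[of n] by (simp add: mollifier_def)
    have "dist x z \<ge> 1 / (2 * real (Suc j))" if "z \<notin> G" for z
    proof -
      have "1 / real (Suc j) <= dist y z" using yK that by (auto simp: K_def)
      also have "... <= norm (x - y) + dist x z" by (metis dist_commute dist_norm dist_triangle)
      finally have d: "1 / real (Suc j) <= norm (x - y) + dist x z" .
      define t where "t = 1 / (2 * real (Suc j))"
      have "2 * t = 1 / real (Suc j)" unfolding t_def by (simp add: field_simps)
      then have "t <= dist x z" using d xy n(2)[folded t_def] by linarith
      then show ?thesis by (simp only: t_def)
    qed
    moreover have "norm x <= real j + 1"
    proof -
      have "norm x <= norm y + norm (x - y)" by (metis norm_triangle_sub)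
      moreover have "eps n <= 1" by (simp add: eps_def)
      ultimately show ?thesis using xy supp[OF y(1)] by linarith
    qed
    ultimately show ?thesis by (simp add: S_def)
  qed
  have "phi : test_functions G"
  proof (rule test_functionsI)
    show "smooth phi" unfolding phi_def by (rule conv_smooth(1)[OF Vi gn])
    show "bounded {x. phi x ~= 0}" using phis by (intro bounded_subset[OF bounded_cball[of 0 "real j + 1"]]) auto
    have "closure {x. phi x ~= 0} \<subseteq> S" using phis Sc by (intro closure_minimal) auto
    then show "closure {x. phi x ~= 0} \<subseteq> G" using SG by blast
  qed
  moreover have "L2normd G (%x. v x - phi x) < e"
  proof -
    have phiL: "phi : L2 lborel" unfolding phi_def by (rule conv_L2(1)[OF VkL Vi g])
    have "L2normd G (%x. v x - phi x) = L2normd G (%x. V x - phi x)"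
    proof (rule L2norm_AE_cong)
      show "AE x in lebesgue_on G. v x - phi x = V x - phi x"
        using V(2) Gm by (simp add: AE_restrict_space_iff) (auto elim: eventually_mono)
    qed (use L2_measurable[OF lborel_L2d(1)[OF Gm L2_diff[OF V(1) phiL]]] L2_measurable[OF v]
        L2_measurable[OF lborel_L2d(1)[OF Gm phiL]] in auto)
    also have "... <= L2norm lborel (%x. V x - phi x)" by (rule lborel_L2d(2)[OF Gm L2_diff[OF V(1) phiL]])
    also have "... <= L2norm lborel (%x. V x - Vk j x) + L2norm lborel (%x. Vk j x - phi x)"
      using L2norm_triangle[OF L2_diff[OF V(1) VkL] L2_diff[OF VkL phiL]] by simp
    also have "... < e" using j n(1) L2norm_diff_commute[of lborel "Vk j" phi] by (simp add: phi_def)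
    finally show ?thesis .
  qed
  ultimately show ?thesis using that by blast
qed

lemma test_dense_L2_seq:
  assumes G: "open G" and v: "v : L2d G"
  obtains phi where "\<And>n. phi n : test_functions G" "(%n. L2normd G (%x. v x - phi n x)) \<longlonglongrightarrow> 0"
proof -
  have "\<exists>phi. phi : test_functions G \<and> L2normd G (%x. v x - phi x) < 1 / real (Suc n)" for n
    using test_dense_L2[OF G v, of "1 / real (Suc n)"] by auto
  then obtain phi where phi: "\<And>n. phi n : test_functions G" "\<And>n. L2normd G (%x. v x - phi n x) < 1 / real (Suc n)"
    by metis
  have "(%n. L2normd G (%x. v x - phi n x)) \<longlonglongrightarrow> 0"
    by (rule tendsto_sandwich[OF _ _ tendsto_const LIMSEQ_Suc[OF lim_1_over_n]])
      (simp, intro always_eventually allI less_imp_le phi(2))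
  then show ?thesis using that phi(1) by blast
qed

text \<open>Fundamental lemma of the calculus of variations: w is orthogonal to test functions that
  converge to w. Uniqueness of weak derivatives rests on it.\<close>

lemma L2_orthogonal_test_0:
  assumes G: "open G" and w: "w : L2d G" and o: "\<And>phi. phi : test_functions G ==> ipd G w phi = 0"
  shows "AE x in lebesgue_on G. w x = 0"
proof -
  have Gm: "G : sets lebesgue" using G by auto
  obtain phi where phi: "\<And>n. phi n : test_functions G" "(%n. L2normd G (%x. w x - phi n x)) \<longlonglongrightarrow> 0"
    using test_dense_L2_seq[OF G w] by blast
  have "(%n. ipd G (phi n) w) \<longlonglongrightarrow> ipd G w w"
    using phi(2) L2norm_diff_commute[of "lebesgue_on G" w] by (intro ip_tendsto test_L2d[OF phi(1) Gm] w) simp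
  moreover have "ipd G (phi n) w = 0" for n using o[OF phi(1)] by (simp add: ip_commute)
  ultimately have "ipd G w w = 0" by (simp add: LIMSEQ_const_iff)
  then show ?thesis using L2norm_eq_0_AE[OF w] by (simp add: L2norm_def)
qed

section \<open>Weak derivatives: uniqueness, linearity, restriction, integration by parts\<close>

lemma is_weak_pd_L2: "is_weak_pd G al v g ==> g : L2d G"
  by (simp add: is_weak_pd_def)

lemma is_weak_pd_ip: "is_weak_pd G al v g ==> phi : test_functions G ==> ipd G v (pd al phi) = (- 1) ^ length al * ipd G g phi"
  by (simp add: is_weak_pd_def)

lemma is_weak_pd_unique:
  assumes G: "open G" and "is_weak_pd G al v g" "is_weak_pd G al v g'"
  shows "AE x in lebesgue_on G. g x = g' x"
proof -
  have L: "g : L2d G" "g' : L2d G" using assms by (auto simp: is_weak_pd_def)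
  have "ipd G (%x. g x - g' x) phi = 0" if "phi : test_functions G" for phi
  proof -
    have "(- 1) ^ length al * ipd G g phi = (- 1) ^ length al * ipd G g' phi"
      using is_weak_pd_ip[OF assms(2) that] is_weak_pd_ip[OF assms(3) that] by simp
    then show ?thesis using L that G by (simp add: ip_diff_left test_L2d)
  qed
  from L2_orthogonal_test_0[OF G L2_diff[OF L] this] show ?thesis by simp
qed

lemma is_weak_pd_cong_fun:
  assumes G: "G : sets lebesgue" and "AE x in lebesgue_on G. v x = v' x" "v : borel_measurable (lebesgue_on G)" "v' : borel_measurable (lebesgue_on G)"
  shows "is_weak_pd G al v = is_weak_pd G al v'"
proof -
  have "ipd G v (pd al phi) = ipd G v' (pd al phi)" if "phi : test_functions G" for phi
    using assms that by (intro ip_AE_cong) (auto intro: borel_measurable_lebesgue_on[OF test_measurable[OF test_pd]])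
  then show ?thesis by (auto simp: is_weak_pd_def fun_eq_iff)
qed

lemma is_weak_pd_lin:
  assumes G: "G : sets lebesgue" and v: "v : L2d G" "w : L2d G" and "is_weak_pd G al v g" "is_weak_pd G al w h"
  shows "is_weak_pd G al (%x. c * v x + d * w x) (%x. c * g x + d * h x)"
proof -
  have "g : L2d G" "h : L2d G" using assms by (auto simp: is_weak_pd_def)
  then show ?thesis using assms
    by (auto simp: is_weak_pd_def ip_lin_left[OF v] ip_lin_left[of g _ h] L2_lin
        test_L2d[where H = G] test_pd algebra_simps)
qed

text \<open>A test function of the smaller set is one of the larger set and vanishes off the smaller
  one, so both sides of the defining identity are unchanged.\<close>

lemma is_weak_pd_subset:
  assumes "is_weak_pd G al v g" "H \<subseteq> G" and m: "G : sets lebesgue" "H : sets lebesgue" and v: "v : L2d G"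
  shows "is_weak_pd H al v g" "v : L2d H"
proof -
  have sub: "f : L2d H" if f: "f : L2d G" for f :: sfun
  proof -
    obtain F where F: "F : L2 lborel" "AE x in lebesgue. F x = indicator G x * f x" using L2d_to_lborel[OF m(1) f] .
    have "F : L2d H" by (rule lborel_L2d(1)[OF m(2) F(1)])
    moreover have ae: "AE x in lebesgue_on H. F x = f x"
      using F(2) m assms(2) by (simp add: AE_restrict_space_iff) (auto elim!: eventually_mono simp: indicator_def)
    moreover have "f : borel_measurable (lebesgue_on H)"
      using L2_measurable[OF f] assms(2) by (rule measurable_restrict_mono)
    ultimately show ?thesis using L2_AE_cong[OF ae] by blast
  qed
  show vH: "v : L2d H" by (rule sub[OF v])
  have gL: "g : L2d G" using assms(1) by (rule is_weak_pd_L2)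
  have eq: "ipd H f phi = ipd G f phi" if f: "f : L2d G" and phi: "phi : test_functions H" for f phi
  proof -
    have z: "indicator H x *\<^sub>R (f x * phi x) = indicator G x *\<^sub>R (f x * phi x)" for x
      using assms(2) test_outside[OF phi] by (auto split: split_indicator)
    show ?thesis unfolding ip_def using m by (simp add: integral_restrict_space z del: real_scaleR_def)
  qed
  show "is_weak_pd H al v g"
    unfolding is_weak_pd_def using is_weak_pd_ip[OF assms(1) test_mono[OF _ assms(2)]]
    by (auto simp: sub gL eq[OF v test_pd] eq[OF gL])
qed

text \<open>Integration by parts: the integral of a derivative vanishes because the integral of a
  difference quotient does.\<close>

lemma integral_pd_0:
  assumes f: "f : test_functions G" shows "(LINT x|lborel. pd [i] f x) = 0"
proof -
  let ?e = "axis i (1::real) :: real^2"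
  obtain B where B: "B \<ge> 0" "\<And>x h. \<bar>f (x + h) - f x - (\<Sum>i\<in>UNIV. h $ i * pd [i] f x)\<bar> <= B * (norm h)^2"
    using test_taylor[OF f] by blast
  have "bounded {x. f x ~= 0}" using f
    by (auto simp: test_functions_def compact_eq_bounded_closed intro: bounded_subset[OF _ closure_subset])
  then obtain r where r: "\<And>x. f x ~= 0 ==> norm x <= r" by (auto simp: bounded_iff)
  have r': "norm x <= r" if "pd [i] f x ~= 0" for x
  proof -
    have "closure {x. f x ~= 0} \<subseteq> cball 0 r" using r by (intro closure_minimal) auto
    then show ?thesis using pd1_support[OF test_smooth[OF f]] that by fastforce
  qed
  have fi: "integrable lborel f" by (rule L2_bounded_support_integrable[OF test_L2[OF f] r])
  have pi: "integrable lborel (pd [i] f)" by (rule L2_bounded_support_integrable[OF test_L2[OF test_pd[OF f]] r'])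
  have shift: "integrable lborel (%x. f (x + t *\<^sub>R ?e))" "(LINT x|lborel. f (x + t *\<^sub>R ?e)) = (LINT x|lborel. f x)" for t
  proof -
    have d: "distr lborel borel (%x. t *\<^sub>R ?e + x) = lborel"
      by (rule lborel_distr_plus)
    have m: "f : borel_measurable borel" by (rule test_measurable[OF f])
    show "integrable lborel (%x. f (x + t *\<^sub>R ?e))"
      using integrable_distr_eq[of "%x. t *\<^sub>R ?e + x" lborel borel f] m fi unfolding d by (simp add: add.commute)
    show "(LINT x|lborel. f (x + t *\<^sub>R ?e)) = (LINT x|lborel. f x)"
      using integral_distr[of "%x. t *\<^sub>R ?e + x" lborel borel f] m unfolding d by (simp add: add.commute)
  qed
  define vol where "vol = measure lborel (cball (0::real^2) (\<bar>r\<bar> + 1))"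
  have fin: "emeasure lborel (cball (0::real^2) (\<bar>r\<bar> + 1)) < \<infinity>" by (rule emeasure_lborel_cball_finite)
  have bnd: "\<bar>LINT x|lborel. pd [i] f x\<bar> <= B * t * vol" if t: "0 < t" "t < 1" for t
  proof -
    let ?d = "%x. f (x + t *\<^sub>R ?e) - f x - t * pd [i] f x"
    have "\<bar>?d x\<bar> <= B * t^2 * indicator (cball 0 (\<bar>r\<bar> + 1)) x" for x
    proof (cases "norm x <= \<bar>r\<bar> + 1")
      case True
      then show ?thesis using B(2)[of x "t *\<^sub>R ?e"] by (simp add: sum_axis)
    next
      case False
      have "norm x <= norm (x + t *\<^sub>R ?e) + norm (t *\<^sub>R ?e)" by (metis add_diff_cancel norm_triangle_ineq4)
      then have "norm (x + t *\<^sub>R ?e) > r" using False t by simp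
      then have "f (x + t *\<^sub>R ?e) = 0" using r[of "x + t *\<^sub>R ?e"] by force
      moreover have "f x = 0" "pd [i] f x = 0" using r[of x] r'[of x] False by force+
      ultimately show ?thesis using False by simp
    qed
    then have "(LINT x|lborel. \<bar>?d x\<bar>) <= (LINT x|lborel. B * t^2 * indicator (cball (0::real^2) (\<bar>r\<bar> + 1)) x)"
      using shift(1) fi pi fin by (intro integral_mono) auto
    also have "... = B * t^2 * vol" using fin by (simp add: vol_def)
    finally have "\<bar>LINT x|lborel. ?d x\<bar> <= B * t^2 * vol"
      using integral_abs_bound[of lborel ?d] by linarith
    also have "(LINT x|lborel. ?d x) = - t * (LINT x|lborel. pd [i] f x)"
      using shift fi pi by simp
    finally have "t * \<bar>LINT x|lborel. pd [i] f x\<bar> <= t * (B * t * vol)"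
      using t by (simp add: abs_mult power2_eq_square mult_ac)
    then show ?thesis using t by simp
  qed
  have "((%t. B * t * vol) \<longlongrightarrow> B * 0 * vol) (at_right 0)" by (intro tendsto_intros)
  moreover have "\<forall>\<^sub>F t in at_right 0. \<bar>LINT x|lborel. pd [i] f x\<bar> <= B * t * vol"
    using bnd by (auto simp: eventually_at_right_field intro!: exI[of _ 1])
  ultimately have "\<bar>LINT x|lborel. pd [i] f x\<bar> <= B * 0 * vol"
    by (intro tendsto_lowerbound) auto
  then show ?thesis by simp
qed

lemma ip_pd:
  assumes f: "smooth f" and g: "g : test_functions UNIV"
  shows "ip lborel f (pd al g) = (- 1) ^ length al * ip lborel (pd al f) g"
  using f g
proof (induction al arbitrary: f)
  case (Cons i al)
  have sg: "smooth (pd al g)" and tg: "pd al g : test_functions UNIV" using test_pd[OF Cons.prems(2)] test_smooth by auto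
  have t: "(%x. f x * pd al g x) : test_functions UNIV" by (rule test_mult_smooth[OF tg Cons.prems(1)])
  have tt: "(%x. f x * pd (i # al) g x) : test_functions UNIV" "(%x. pd [i] f x * pd al g x) : test_functions UNIV"
    using Cons.prems by (auto intro!: test_mult_smooth test_pd smooth_pd)
  have integ: "integrable lborel f" if f: "f : test_functions UNIV" for f
  proof -
    have "bounded {x. f x ~= 0}" using f
      by (auto simp: test_functions_def compact_eq_bounded_closed intro: bounded_subset[OF _ closure_subset])
    then obtain r where "\<And>x. f x ~= 0 ==> norm x <= r" by (auto simp: bounded_iff)
    then show ?thesis by (rule L2_bounded_support_integrable[OF test_L2[OF f]])
  qed
  have "0 = (LINT x|lborel. f x * pd (i # al) g x + pd [i] f x * pd al g x)"
    using integral_pd_0[OF t, of i] Cons.prems(1) sg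
    by (simp add: pd_mult smooth_differentiable pd_Cons[of i al])
  also have "... = ip lborel f (pd (i # al) g) + ip lborel (pd [i] f) (pd al g)"
    unfolding ip_def using integ[OF tt(1)] integ[OF tt(2)] by simp
  finally have "ip lborel f (pd (i # al) g) = - ip lborel (pd [i] f) (pd al g)" by simp
  also have "ip lborel (pd [i] f) (pd al g) = (- 1) ^ length al * ip lborel (pd (al @ [i]) f) g"
    using Cons.IH[OF smooth_pd[OF Cons.prems(1)] Cons.prems(2), of "[i]"] by (simp add: pd_append)
  \<comment> \<open>The direction i, outermost on g, has become innermost on f; symmetry of second
    derivatives carries it back to the front.\<close>
  also have "pd (al @ [i]) f = pd (i # al) f"
  proof (induction al)
    case (Cons j al)
    have "pd ((j # al) @ [i]) f = pd [j] (pd [i] (pd al f))"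
      using Cons pd_Cons[of j "al @ [i]" f] pd_Cons[of i al f] by simp
    also have "... = pd [i] (pd [j] (pd al f))"
      using pd_commute[OF smooth_pd[OF \<open>smooth f\<close>], of j i al] pd_Cons[of j "[i]"] pd_Cons[of i "[j]"] by simp
    finally show ?case using pd_Cons[of i "j # al" f] pd_Cons[of j al f] by simp
  qed simp
  finally show ?case by simp
qed simp

lemma smooth_is_weak_pd:
  assumes "smooth f" "bounded G" "G : sets lebesgue"
  shows "is_weak_pd G al f (pd al f)"
proof -
  have eq: "ipd G f phi = ip lborel f phi" if f: "smooth f" and phi: "phi : test_functions G" for f phi
  proof -
    have "ipd G f phi = (LINT x|lebesgue. indicator G x *\<^sub>R (f x * phi x))"
      unfolding ip_def using assms by (subst integral_restrict_space) auto
    also have "... = (LINT x|lebesgue. f x * phi x)"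
      by (rule Bochner_Integration.integral_cong) (use test_outside[OF phi] in \<open>auto split: split_indicator\<close>)
    also have "... = ip lborel f phi"
      unfolding ip_def using smooth_measurable[OF f] test_measurable[OF phi] by (intro integral_completion) simp
    finally show ?thesis .
  qed
  show ?thesis unfolding is_weak_pd_def
    using ip_pd[OF assms(1) test_mono[OF _ subset_UNIV]]
    by (auto simp: smooth_L2d smooth_pd assms eq test_pd)
qed

subsection \<open>Sobolev spaces of integer order\<close>

lemma weak_pd_is:
  "\<exists>g. is_weak_pd G al v g ==> is_weak_pd G al v (weak_pd G al v)"
  unfolding weak_pd_def by (rule someI_ex[of "is_weak_pd G al v"])

lemma weak_pd_L2: "\<exists>g. is_weak_pd G al v g ==> weak_pd G al v : L2d G"
  by (rule is_weak_pd_L2[OF weak_pd_is])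

lemma weak_pd_eq:
  "open G ==> is_weak_pd G al v g ==> AE x in lebesgue_on G. weak_pd G al v x = g x"
  by (rule is_weak_pd_unique[OF _ weak_pd_is]) auto

lemma finite_multi_index: "finite {al :: 2 list. length al <= m}" "finite {al :: 2 list. length al = m}"
  using finite_lists_length_le[of "UNIV :: 2 set" m] finite_lists_length_eq[of "UNIV :: 2 set" m] by simp_all

lemma Hs_nat:
  "v : Hs (real m) G \<longleftrightarrow> v : L2d G \<and> (\<forall>al. length al <= m \<longrightarrow> (\<exists>g. is_weak_pd G al v g))"
  by (simp add: Hs_def)

lemma Hs_norm_nat:
  "Hs_norm (real m) G v = sqrt (\<Sum>al | length al <= m. (L2normd G (weak_pd G al v))^2)"
  by (simp add: Hs_norm_def)

lemmas Hs_2 = Hs_nat[of _ 2, simplified] and Hs_norm_2 = Hs_norm_nat[of 2, simplified]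
  and Hs_1 = Hs_nat[of _ 1, simplified] and Hs_norm_1 = Hs_norm_nat[of 1, simplified]
  and Hs_norm_0 = Hs_norm_nat[of 0, simplified]

lemma Hs_L2d: "v : Hs s G ==> v : L2d G"
  by (simp add: Hs_def Let_def)

lemma weak_pd_lin:
  assumes G: "open G" and v: "v : L2d G" "w : L2d G"
    and ex: "\<exists>g. is_weak_pd G al v g" "\<exists>g. is_weak_pd G al w g"
  shows "AE x in lebesgue_on G. weak_pd G al (%x. c * v x + d * w x) x = c * weak_pd G al v x + d * weak_pd G al w x"
  using G by (intro weak_pd_eq is_weak_pd_lin[OF _ v weak_pd_is[OF ex(1)] weak_pd_is[OF ex(2)]]) auto

lemma L2norm_weak_pd_eq:
  assumes G: "open G" and g: "is_weak_pd G al v g"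
  shows "L2normd G (weak_pd G al v) = L2normd G g"
  using weak_pd_eq[OF G g] is_weak_pd_L2[OF weak_pd_is[OF exI, OF g]] is_weak_pd_L2[OF g]
  by (intro L2norm_AE_cong) (auto simp: L2_measurable)

lemma is_weak_pd_diff:
  assumes "G : sets lebesgue" "v : L2d G" "w : L2d G" "is_weak_pd G al v g" "is_weak_pd G al w h"
  shows "is_weak_pd G al (v - w) (%x. g x - h x)"
  using is_weak_pd_lin[OF assms, of 1 "-1"] by (simp add: fun_diff_def)

lemma L2norm_weak_pd_diff:
  assumes G: "open G" and v: "v : L2d G" "w : L2d G" and g: "is_weak_pd G al v g" "is_weak_pd G al w h"
  shows "L2normd G (weak_pd G al (v - w)) = L2normd G (%x. g x - h x)"
  using G by (intro L2norm_weak_pd_eq is_weak_pd_diff v g) auto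

lemma Hs_lin:
  assumes G: "open G" and v: "v : Hs (real m) G" "w : Hs (real m) G"
  shows "(%x. c * v x + d * w x) : Hs (real m) G"
proof -
  have L: "v : L2d G" "w : L2d G" using v by (auto simp: Hs_nat)
  have "\<exists>g. is_weak_pd G al (%x. c * v x + d * w x) g" if al: "length al <= m" for al
  proof -
    obtain g h where gh: "is_weak_pd G al v g" "is_weak_pd G al w h" using v al unfolding Hs_nat by blast
    have "is_weak_pd G al (%x. c * v x + d * w x) (%x. c * g x + d * h x)"
      by (rule is_weak_pd_lin[OF _ L gh]) (use G in auto)
    then show ?thesis by blast
  qed
  then show ?thesis by (auto simp: Hs_nat L2_lin L)
qed

lemma L2norm_weak_pd_le_Hs_norm:
  "length al <= m ==> L2normd G (weak_pd G al v) <= Hs_norm (real m) G v"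
  unfolding Hs_norm_nat
  by (rule real_le_rsqrt, rule member_le_sum) (auto simp: finite_multi_index)

text \<open>Convergence in the Sobolev norm can be read off from any weak derivatives at hand,
  instead of those selected by \<open>weak_pd\<close> for each difference.\<close>

lemma Hs_norm_tendsto_iff:
  assumes G: "open G" and v: "\<And>n. v n : L2d G" "w : L2d G"
    and g: "\<And>n al. length al <= m ==> is_weak_pd G al (v n) (g n al)" "\<And>al. length al <= m ==> is_weak_pd G al w (h al)"
  shows "(%n. Hs_norm (real m) G (v n - w)) \<longlonglongrightarrow> 0 \<longleftrightarrow>
    (\<forall>al. length al <= m \<longrightarrow> (%n. L2normd G (%x. g n al x - h al x)) \<longlonglongrightarrow> 0)"
proof -
  have eq: "L2normd G (weak_pd G al (v n - w)) = L2normd G (%x. g n al x - h al x)" if "length al <= m" for n al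
    by (rule L2norm_weak_pd_diff[OF G v g(1)[OF that] g(2)[OF that]])
  have N: "Hs_norm (real m) G (v n - w) = sqrt (\<Sum>al | length al <= m. (L2normd G (%x. g n al x - h al x))^2)" for n
    unfolding Hs_norm_nat by (simp add: eq)
  show ?thesis
  proof (intro iffI allI impI)
    fix al :: "2 list" assume l: "(%n. Hs_norm (real m) G (v n - w)) \<longlonglongrightarrow> 0" and al: "length al <= m"
    show "(%n. L2normd G (%x. g n al x - h al x)) \<longlonglongrightarrow> 0"
    proof (rule tendsto_sandwich[OF _ _ tendsto_const l])
      show "\<forall>\<^sub>F n in sequentially. L2normd G (%x. g n al x - h al x) <= Hs_norm (real m) G (v n - w)"
        unfolding eq[OF al, symmetric] using L2norm_weak_pd_le_Hs_norm[OF al] by simp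
    qed simp
  next
    assume l: "\<forall>al. length al <= m \<longrightarrow> (%n. L2normd G (%x. g n al x - h al x)) \<longlonglongrightarrow> 0"
    have "(%n. sqrt (\<Sum>al | length al <= m. (L2normd G (%x. g n al x - h al x))^2)) \<longlonglongrightarrow> sqrt (\<Sum>al\<in>{al::2 list. length al <= m}. 0^2)"
      using l by (intro tendsto_real_sqrt tendsto_sum tendsto_power) auto
    then show "(%n. Hs_norm (real m) G (v n - w)) \<longlonglongrightarrow> 0" by (simp add: N)
  qed
qed

lemma L2d_to_lborel_bounded:
  fixes v :: sfun
  assumes G: "G : sets lebesgue" "G \<subseteq> cball 0 R" and v: "v : L2d G"
  obtains V where "V : L2 lborel" "AE x in lebesgue. V x = indicator G x * v x" "\<And>x. V x ~= 0 ==> norm x <= R"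
proof -
  obtain V where V: "V : L2 lborel" "AE x in lebesgue. V x = indicator G x * v x"
    using L2d_to_lborel[OF G(1) v] .
  have m: "(%x. indicator (cball (0::real^2) R) x * V x) : borel_measurable lborel"
    using L2_measurable[OF V(1)] by (intro borel_measurable_times borel_measurable_indicator) auto
  have "(%x. indicator (cball 0 R) x * V x) : L2 lborel"
    by (rule L2_bound[OF m V(1)]) (auto split: split_indicator)
  moreover have "AE x in lebesgue. indicator (cball 0 R) x * V x = indicator G x * v x"
    using V(2) G(2) by (auto elim!: eventually_mono split: split_indicator)
  moreover have "norm x <= R" if "indicator (cball 0 R) x * V x ~= 0" for x
    using that by (cases "x : cball 0 R") auto
  ultimately show ?thesis by (rule that)
qed

text \<open>Approximation by smooth functions up to the boundary of a convex body: contract towards an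
  interior point, then mollify.  One sequence serves all weak derivatives.\<close>

lemma smooth_dense_convex:
  assumes K: "convex K" "compact K" "interior K ~= {}" and v: "v : L2d (interior K)"
  obtains phi where "\<And>n. smooth (phi n)"
    "\<And>al g. is_weak_pd (interior K) al v g ==> (%n. L2normd (interior K) (%x. pd al (phi n) x - g x)) \<longlonglongrightarrow> 0"
proof -
  let ?D = "interior K"
  have Dm: "?D : sets lebesgue" by auto
  obtain x0 where x0: "x0 : ?D" using K(3) by blast
  have "bounded ?D" by (rule bounded_subset[OF compact_imp_bounded[OF K(2)] interior_subset])
  then obtain R where R: "?D \<subseteq> cball 0 R" by (auto simp: bounded_iff subset_iff)
  define l where "l n = 1 - 1 / real (n + 2)" for n
  have l: "0 < l n" "l n < 1" for n by (simp_all add: l_def field_simps)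
  have l1: "l \<longlonglongrightarrow> 1"
    unfolding l_def using tendsto_diff[OF tendsto_const LIMSEQ_ignore_initial_segment[OF lim_1_over_n, of 2], of 1] by simp
  define a where "a n = (1 - l n) *\<^sub>R x0" for n
  have a0: "a \<longlonglongrightarrow> 0" 
    unfolding a_def using tendsto_scaleR[OF tendsto_diff[OF tendsto_const l1] tendsto_const, of 1 x0] by simp
  define S where "S n x = a n + l n *\<^sub>R x" for n x
  have SK: "S n x : ?D" if "x : K" for n x
  proof -
    have "S n x = x - (1 - l n) *\<^sub>R (x - x0)" by (simp add: S_def a_def algebra_simps)
    then show ?thesis using mem_interior_convex_shrink[OF K(1) x0 that, of "1 - l n"] l[of n] by simp
  qed
  \<comment> \<open>The contracted body is a compact subset of the open interior, hence at positive
    distance from its complement.\<close>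
  have "\<exists>\<delta>>0. \<forall>x\<in>K. cball (S n x) \<delta> \<subseteq> ?D" for n
  proof -
    have "compact (S n ` K)" unfolding S_def by (intro compact_continuous_image continuous_intros K)
    moreover have "S n ` K ~= {}" using x0 interior_subset by blast
    ultimately obtain e where e: "e > 0" "{x. infdist x (S n ` K) <= e} \<subseteq> ?D"
      using compact_in_open_separated[of "S n ` K" ?D] SK by auto
    have "cball (S n x) e \<subseteq> ?D" if "x : K" for x
    proof
      fix y assume "y : cball (S n x) e"
      then have "infdist y (S n ` K) <= e"
        using infdist_le[of "S n x" "S n ` K" y] that by (simp add: dist_commute)
      then show "y : ?D" using e(2) by blast
    qed
    then show ?thesis using e(1) by blast
  qed
  then obtain \<delta> where \<delta>: "\<And>n. \<delta> n > 0" "\<And>n x. x : K ==> cball (S n x) (\<delta> n) \<subseteq> ?D" by metis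
  define eps where "eps n = min (\<delta> n) (1 / real (Suc n))" for n
  have eps0: "eps n > 0" "eps n <= \<delta> n" for n using \<delta> by (auto simp: eps_def)
  have epsl: "eps \<longlonglongrightarrow> 0"
    by (rule tendsto_sandwich[OF _ _ tendsto_const LIMSEQ_Suc[OF lim_1_over_n]])
      (auto intro!: always_eventually less_imp_le[OF \<delta>(1)] simp: eps_def)
  obtain g where g: "\<And>n. mollifier (eps n) (g n)" using mollifier_exists[OF eps0(1)] by metis
  have gt: "g n : test_functions UNIV" for n using g by (simp add: mollifier_def)
  obtain V where V: "V : L2 lborel" "AE x in lebesgue. V x = indicator ?D x * v x" "\<And>x. V x ~= 0 ==> norm x <= R"
    using L2d_to_lborel_bounded[OF Dm R v] by blast
  have Vi: "integrable lborel V" by (rule L2_bounded_support_integrable[OF V(1,3)])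
  define phi where "phi n x = conv V (g n) (a n + l n *\<^sub>R x)" for n x
  have cs: "smooth (conv V (g n))" for n by (rule conv_smooth(1)[OF Vi gt])
  have "smooth (phi n)" for n unfolding phi_def[abs_def] by (rule pd_affine(2)[OF cs])
  moreover have "(%n. L2normd ?D (%x. pd al (phi n) x - w x)) \<longlonglongrightarrow> 0" if w: "is_weak_pd ?D al v w" for al w
  proof -
    have wL: "w : L2d ?D" by (rule is_weak_pd_L2[OF w])
    obtain W where W: "W : L2 lborel" "AE x in lebesgue. W x = indicator ?D x * w x" "\<And>x. W x ~= 0 ==> norm x <= R"
      using L2d_to_lborel_bounded[OF Dm R wL] by blast
    have Wi: "integrable lborel W" by (rule L2_bounded_support_integrable[OF W(1,3)])
    \<comment> \<open>Derivatives of the mollified v fall on the kernel. The kernel centred at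
      \<open>S n x\<close> is a test function of the interior, so the definition of w as a weak
      derivative applies and gives the mollified w. The power of \<open>l n\<close> is the chain
      rule for the contraction.\<close>
    have key: "pd al (phi n) x = l n ^ length al * conv W (g n) (a n + l n *\<^sub>R x)" if x: "x : ?D" for n x
    proof -
      let ?y = "S n x"
      define \<xi> where "\<xi> z = g n (?y + (-1) *\<^sub>R z)" for z
      have \<xi>s: "smooth \<xi>" unfolding \<xi>_def[abs_def] by (rule pd_affine(2)[OF test_smooth[OF gt]])
      have pd\<xi>: "pd al \<xi> = (%z. (- 1) ^ length al * pd al (g n) (?y - z))"
        unfolding \<xi>_def[abs_def] pd_affine(1)[OF test_smooth[OF gt]] by simp
      have sub: "{z. \<xi> z ~= 0} \<subseteq> cball ?y (eps n)"
        using g[of n] by (auto simp: \<xi>_def mollifier_def dist_norm less_imp_le)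
      have \<xi>t: "\<xi> : test_functions ?D"
      proof (rule test_functionsI[OF \<xi>s])
        show "bounded {z. \<xi> z ~= 0}" using sub bounded_cball bounded_subset by blast
        have "closure {z. \<xi> z ~= 0} \<subseteq> cball ?y (eps n)" by (rule closure_minimal[OF sub closed_cball])
        also have "... \<subseteq> cball ?y (\<delta> n)" using eps0(2) by (simp add: subset_cball)
        also have "... \<subseteq> ?D" using \<delta>(2) x interior_subset by blast
        finally show "closure {z. \<xi> z ~= 0} \<subseteq> ?D" .
      qed
      have "(- 1) ^ length al * conv V (pd al (g n)) ?y = ip lborel V (pd al \<xi>)"
      proof -
        have "ip lborel V (pd al \<xi>) = (LINT z|lborel. (- 1) ^ length al * (V z * pd al (g n) (?y - z)))"
          unfolding ip_def pd\<xi> by (rule Bochner_Integration.integral_cong) auto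
        then show ?thesis by (simp add: conv_def)
      qed
      also have "... = ipd ?D v (pd al \<xi>)"
        by (rule ip_lborel[OF Dm v V(1,2) test_measurable[OF test_pd[OF \<xi>t]], symmetric])
      also have "... = (- 1) ^ length al * ipd ?D w \<xi>" by (rule is_weak_pd_ip[OF w \<xi>t])
      also have "ipd ?D w \<xi> = ip lborel W \<xi>" by (rule ip_lborel[OF Dm wL W(1,2) test_measurable[OF \<xi>t]])
      also have "... = conv W (g n) ?y" by (simp add: conv_def ip_def \<xi>_def)
      finally have "conv V (pd al (g n)) ?y = conv W (g n) ?y" by simp
      then show ?thesis
        unfolding phi_def[abs_def] pd_affine(1)[OF cs] conv_smooth(2)[OF Vi gt] by (simp add: S_def)
    qed
    have ln: "(%n. l n ^ length al) \<longlonglongrightarrow> 1" using tendsto_power[OF l1, of "length al"] by simp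
    have lim: "(%n. L2norm lborel (%x. l n ^ length al * conv W (g n) (a n + l n *\<^sub>R x) - W x)) \<longlonglongrightarrow> 0"
      by (rule mollify_tendsto[OF W(1,3) g epsl a0 l1 ln])
    show ?thesis
    proof (rule tendsto_sandwich[OF _ _ tendsto_const lim])
      show "\<forall>\<^sub>F n in sequentially. L2normd ?D (%x. pd al (phi n) x - w x)
          <= L2norm lborel (%x. l n ^ length al * conv W (g n) (a n + l n *\<^sub>R x) - W x)"
      proof (rule always_eventually, rule allI)
        fix n
        have L: "(%x. l n ^ length al * conv W (g n) (a n + l n *\<^sub>R x) - W x) : L2 lborel"
          using l[of n] by (intro L2_diff W(1) conv_affine_L2(1)[OF W(1) Wi g]) auto
        have "L2normd ?D (%x. pd al (phi n) x - w x) = L2normd ?D (%x. l n ^ length al * conv W (g n) (a n + l n *\<^sub>R x) - W x)"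
        proof (rule L2norm_AE_cong)
          show "AE x in lebesgue_on ?D. pd al (phi n) x - w x = l n ^ length al * conv W (g n) (a n + l n *\<^sub>R x) - W x"
            using W(2) by (subst AE_restrict_space_iff) (auto elim!: eventually_mono simp: key)
          show "(%x. pd al (phi n) x - w x) : borel_measurable (lebesgue_on ?D)"
            by (rule borel_measurable_diff[OF borel_measurable_lebesgue_on[OF smooth_measurable[OF smooth_pd[OF \<open>smooth (phi n)\<close>]]] L2_measurable[OF wL]])
        qed (rule L2_measurable[OF lborel_L2d(1)[OF Dm L]])
        also have "... <= L2norm lborel (%x. l n ^ length al * conv W (g n) (a n + l n *\<^sub>R x) - W x)"
          by (rule lborel_L2d(2)[OF Dm L])
        finally show "L2normd ?D (%x. pd al (phi n) x - w x)
          <= L2norm lborel (%x. l n ^ length al * conv W (g n) (a n + l n *\<^sub>R x) - W x)" .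
      qed
    qed simp
  qed
  ultimately show ?thesis using that by blast
qed

subsection \<open>Sobolev and trace inequalities on triangles\<close>

lemma lborel_vec2: "lborel = distr (lborel \<Otimes>\<^sub>M lborel) borel (%(s, t). s *\<^sub>R axis 1 1 + t *\<^sub>R axis 2 1 :: real^2)"
proof (rule lborel_eqI)
  fix l u :: "real^2" assume le: "\<And>b. b : Basis ==> l \<bullet> b <= u \<bullet> b"
  have le': "l $ i <= u $ i" for i using le[of "axis i 1"] by (simp add: inner_axis)
  have B: "(Basis :: (real^2) set) = {axis 1 1, axis 2 1}"
    by (auto simp: Basis_vec_def UNIV_2)
  have ne: "axis 1 (1::real) ~= (axis 2 1 :: real^2)" by (simp add: axis_eq_axis)
  have [measurable]: "(%(s, t). s *\<^sub>R axis 1 1 + t *\<^sub>R axis 2 1 :: real^2) : borel_measurable (lborel \<Otimes>\<^sub>M lborel)"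
    by measurable
  have "(%(s, t). s *\<^sub>R axis 1 1 + t *\<^sub>R axis 2 1 :: real^2) -` box l u = {l $ 1<..<u $ 1} \<times> {l $ 2<..<u $ 2}"
    by (auto simp: mem_box_cart forall_2 axis_def)
  then have "emeasure (distr (lborel \<Otimes>\<^sub>M lborel) borel (%(s, t). s *\<^sub>R axis 1 1 + t *\<^sub>R axis 2 1 :: real^2)) (box l u)
      = emeasure (lborel \<Otimes>\<^sub>M lborel) ({l $ 1<..<u $ 1} \<times> {l $ 2<..<u $ 2})"
    by (subst emeasure_distr) (simp_all add: space_pair_measure)
  also have "... = ennreal (u $ 1 - l $ 1) * ennreal (u $ 2 - l $ 2)"
    using le' by (subst lborel.emeasure_pair_measure_Times) auto
  also have "... = ennreal (\<Prod>b\<in>Basis. (u - l) \<bullet> b)"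
    using le' ne by (simp add: B inner_axis ennreal_mult')
  finally show "emeasure (distr (lborel \<Otimes>\<^sub>M lborel) borel (%(s, t). s *\<^sub>R axis 1 1 + t *\<^sub>R axis 2 1 :: real^2)) (box l u)
      = ennreal (\<Prod>b\<in>Basis. (u - l) \<bullet> b)" .
qed simp

lemma nn_integral_vec2:
  assumes [measurable]: "f : borel_measurable borel"
  shows "(\<integral>\<^sup>+x. f x \<partial>lborel) = (\<integral>\<^sup>+s. \<integral>\<^sup>+t. f (s *\<^sub>R axis 1 1 + t *\<^sub>R axis 2 1 :: real^2) \<partial>lborel \<partial>lborel)"
proof -
  have [measurable]: "(%(s, t). s *\<^sub>R axis 1 1 + t *\<^sub>R axis 2 1 :: real^2) : borel_measurable (lborel \<Otimes>\<^sub>M lborel)"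
    by measurable
  have "(\<integral>\<^sup>+x. f x \<partial>lborel) = (\<integral>\<^sup>+p. f ((%(s, t). s *\<^sub>R axis 1 1 + t *\<^sub>R axis 2 1) p) \<partial>(lborel \<Otimes>\<^sub>M lborel))"
    by (subst lborel_vec2, subst nn_integral_distr) auto
  also have "... = (\<integral>\<^sup>+s. \<integral>\<^sup>+t. f (s *\<^sub>R axis 1 1 + t *\<^sub>R axis 2 1 :: real^2) \<partial>lborel \<partial>lborel)"
    by (subst lborel.nn_integral_fst[symmetric]) (auto simp: case_prod_beta)
  finally show ?thesis .
qed

text \<open>C is the modulus of the determinant of the inverse map; the scaled image measure is
  compared with Lebesgue measure on boxes.\<close>

lemma nn_integral_linear:
  fixes L :: "real^2 => real^2"
  assumes L: "linear L" "inj L"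
  obtains C where "C \<ge> 0" "\<And>f. f : borel_measurable borel ==> (\<integral>\<^sup>+x. f (L x) \<partial>lborel) = ennreal C * (\<integral>\<^sup>+x. f x \<partial>lborel)"
proof -
  obtain L' where L': "linear L'" "L' \<circ> L = id" using linear_injective_left_inverse[OF L] by blast
  have LL': "L (L' x) = x" "L' (L x) = x" for x
    using L' linear_inverse_left[OF L(1) L'(1)] by (auto simp: fun_eq_iff)
  define d where "d = \<bar>det (matrix L')\<bar>"
  have "inj L'" using LL' by (metis injI)
  then have d: "d > 0" using det_nz_iff_inj[OF L'(1)] by (simp add: d_def)
  have Lm[measurable]: "L : borel_measurable borel"
    by (intro borel_measurable_continuous_onI linear_continuous_on linear_conv_bounded_linear[THEN iffD1] L)
  have "lborel = scale_measure (ennreal (1/d)) (distr lborel borel L)"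
  proof (rule lborel_eqI)
    fix l u :: "real^2" assume le: "\<And>b. b : Basis ==> l \<bullet> b <= u \<bullet> b"
    have eq: "L -` box l u = L' ` box l u"
    proof (intro set_eqI iffI)
      fix x assume "x : L -` box l u"
      then have "L' (L x) : L' ` box l u" by blast
      then show "x : L' ` box l u" by (simp only: LL')
    next
      fix x assume "x : L' ` box l u"
      then obtain y where "y : box l u" "x = L' y" by blast
      then show "x : L -` box l u" by (simp add: LL')
    qed
    have A: "L -` box l u : lmeasurable" "measure lebesgue (L -` box l u) = d * measure lebesgue (box l u)"
      unfolding d_def eq by (rule measurable_linear_image[OF L'(1) lmeasurable_box], rule measure_linear_image[OF L'(1) lmeasurable_box])
    have B: "L -` box l u : sets lborel" using measurable_sets[OF Lm, of "box l u"] by simp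
    have "emeasure lborel (L -` box l u) = emeasure lebesgue (L -` box l u)"
      using B by simp
    also have "... = ennreal (d * measure lebesgue (box l u))"
      unfolding A(2)[symmetric] by (rule emeasure_eq_measure2[OF A(1)])
    also have "measure lebesgue (box l u) = (\<Prod>b\<in>Basis. (u - l) \<bullet> b)"
      using le by (simp add: measure_lborel_box_eq inner_diff_left)
    finally have "emeasure (distr lborel borel L) (box l u) = ennreal (d * (\<Prod>b\<in>Basis. (u - l) \<bullet> b))"
      by (simp add: emeasure_distr)
    then show "emeasure (scale_measure (ennreal (1/d)) (distr lborel borel L)) (box l u) = ennreal (\<Prod>b\<in>Basis. (u - l) \<bullet> b)"
      using d by (simp flip: ennreal_mult')
  qed simp
  note scale = this
  have "(\<integral>\<^sup>+x. f x \<partial>lborel) = ennreal (1/d) * (\<integral>\<^sup>+x. f (L x) \<partial>lborel)"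
    if f: "f : borel_measurable borel" for f
  proof -
    have "(\<integral>\<^sup>+x. f x \<partial>lborel) = (\<integral>\<^sup>+x. f x \<partial>scale_measure (ennreal (1/d)) (distr lborel borel L))"
      by (rule arg_cong[OF scale])
    also have "... = ennreal (1/d) * (\<integral>\<^sup>+x. f x \<partial>distr lborel borel L)"
      by (rule nn_integral_scale_measure) (use f in simp)
    also have "(\<integral>\<^sup>+x. f x \<partial>distr lborel borel L) = (\<integral>\<^sup>+x. f (L x) \<partial>lborel)"
      by (rule nn_integral_distr) (use f in simp_all)
    finally show ?thesis .
  qed
  note scaled = this
  have "(\<integral>\<^sup>+x. f (L x) \<partial>lborel) = ennreal d * (\<integral>\<^sup>+x. f x \<partial>lborel)"
    if f: "f : borel_measurable borel" for f
  proof -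
    have "ennreal d * (\<integral>\<^sup>+x. f x \<partial>lborel) = (ennreal d * ennreal (1/d)) * (\<integral>\<^sup>+x. f (L x) \<partial>lborel)"
      by (subst scaled[OF f]) (rule mult.assoc[symmetric])
    also have "ennreal d * ennreal (1/d) = 1" using d by (subst ennreal_mult[symmetric]) auto
    finally show ?thesis by simp
  qed
  then show ?thesis using d by (intro that[of d]) auto
qed

definition indep2 :: "real^2 => real^2 => bool" where
  "indep2 p q \<longleftrightarrow> (\<forall>s t. s *\<^sub>R p + t *\<^sub>R q = 0 \<longrightarrow> s = 0 \<and> t = 0)"

text \<open>The constant depends on p and q only. That it serves all base points z makes the
  estimates below uniform over a triangle.\<close>

lemma parallelogram_integral:
  assumes "indep2 p q"
  obtains C where "C \<ge> 0" "\<And>f z. f : borel_measurable borel ==>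
    (\<integral>\<^sup>+t. \<integral>\<^sup>+s. f (z + s *\<^sub>R p + t *\<^sub>R q) \<partial>lborel \<partial>lborel) = ennreal C * (\<integral>\<^sup>+x. f x \<partial>lborel)"
proof -
  \<comment> \<open>The first coordinate multiplies q, because the outer integral of
    \<open>nn_integral_vec2\<close> is the one over the first coordinate and has to become the one
    over t.\<close>
  define L where "L x = x $ 2 *\<^sub>R p + x $ 1 *\<^sub>R q" for x :: "real^2"
  have lin: "linear L" unfolding L_def by (rule linearI) (simp_all add: algebra_simps)
  have "inj L"
  proof (subst linear_injective_0[OF lin], intro allI impI)
    fix x assume "L x = 0"
    then have "x $ 2 = 0 \<and> x $ 1 = 0" using assms unfolding indep2_def L_def by blast
    then show "x = 0" by (simp add: vec_eq_iff forall_2)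
  qed
  then obtain C where C: "C \<ge> 0" "\<And>f. f : borel_measurable borel ==> (\<integral>\<^sup>+x. f (L x) \<partial>lborel) = ennreal C * (\<integral>\<^sup>+x. f x \<partial>lborel)"
    using nn_integral_linear[OF lin] by blast
  have Lm: "L : borel_measurable borel"
    by (intro borel_measurable_continuous_onI linear_continuous_on linear_conv_bounded_linear[THEN iffD1] lin)
  have "(\<integral>\<^sup>+t. \<integral>\<^sup>+s. f (z + s *\<^sub>R p + t *\<^sub>R q) \<partial>lborel \<partial>lborel) = ennreal C * (\<integral>\<^sup>+x. f x \<partial>lborel)"
    if f: "f : borel_measurable borel" for f z
  proof -
    have m: "(%x. f (z + x)) : borel_measurable borel" using f by measurable
    have m2: "(%x. f (z + L x)) : borel_measurable borel" using f Lm by measurable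
    have "(\<integral>\<^sup>+x. f x \<partial>lborel) = (\<integral>\<^sup>+x. f (z + x) \<partial>lborel)"
      using nn_integral_lborel_affine[OF f, of 1 z] by simp
    then have "ennreal C * (\<integral>\<^sup>+x. f x \<partial>lborel) = (\<integral>\<^sup>+x. f (z + L x) \<partial>lborel)"
      using C(2)[OF m] by simp
    also have "... = (\<integral>\<^sup>+t. \<integral>\<^sup>+s. f (z + L (t *\<^sub>R axis 1 1 + s *\<^sub>R axis 2 1)) \<partial>lborel \<partial>lborel)"
      by (rule nn_integral_vec2[OF m2])
    also have "... = (\<integral>\<^sup>+t. \<integral>\<^sup>+s. f (z + s *\<^sub>R p + t *\<^sub>R q) \<partial>lborel \<partial>lborel)"
      by (simp add: L_def axis_def add.assoc)
    finally show ?thesis ..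
  qed
  then show ?thesis using that C(1) by blast
qed

section \<open>Bounds for traces and point values of smooth functions\<close>

text \<open>Integrate the derivative of \<open>(1 - s) g(s)^2\<close> over the unit interval.\<close>

lemma endpoint_sq_bound:
  assumes g: "\<And>s. (g has_real_derivative g' s) (at s)" "continuous_on UNIV g'"
  shows "ennreal ((g 0)^2) <= (\<integral>\<^sup>+s. indicator {0..1} s * ennreal (2 * (g s)^2 + (g' s)^2) \<partial>lborel)"
proof -
  have gc: "continuous_on UNIV g" using g(1) by (meson DERIV_isCont continuous_at_imp_continuous_on)
  have d: "((%s. - (1 - s) * (g s)^2) has_vector_derivative ((g s)^2 - 2 * (1 - s) * g s * g' s)) (at s within {0..1})" for s
    unfolding has_real_derivative_iff_has_vector_derivative[symmetric]
    by (rule DERIV_subset[of _ _ _ UNIV])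
      (auto intro!: derivative_eq_intros g(1) simp: power2_eq_square algebra_simps)
  have I1: "((%s. (g s)^2 - 2 * (1 - s) * g s * g' s) has_integral (g 0)^2) {0..1}"
    using fundamental_theorem_of_calculus[OF _ d] by simp
  have "continuous_on {0..1} (%s. 2 * (g s)^2 + (g' s)^2)"
    by (intro continuous_intros continuous_on_subset[OF gc] continuous_on_subset[OF g(2)]) auto
  then have I2: "((%s. 2 * (g s)^2 + (g' s)^2) has_integral (integral {0..1} (%s. 2 * (g s)^2 + (g' s)^2))) {0..1}"
    by (intro integrable_integral integrable_continuous_interval)
  have "(g s)^2 - 2 * (1 - s) * g s * g' s <= 2 * (g s)^2 + (g' s)^2" if "s : {0..1}" for s
  proof -
    have "\<bar>2 * (1 - s) * g s * g' s\<bar> <= 2 * \<bar>g s\<bar> * \<bar>g' s\<bar>"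
      using that mult_right_mono[of "2 * (1 - s)" 2 "\<bar>g s\<bar> * \<bar>g' s\<bar>"] by (simp add: abs_mult mult.assoc)
    also have "... <= (g s)^2 + (g' s)^2" using sum_squares_bound[of "\<bar>g s\<bar>" "\<bar>g' s\<bar>"] by simp
    finally show ?thesis by linarith
  qed
  then have "(g 0)^2 <= integral {0..1} (%s. 2 * (g s)^2 + (g' s)^2)"
    by (rule has_integral_le[OF I1 I2])
  then have "ennreal ((g 0)^2) <= ennreal (integral {0..1} (%s. 2 * (g s)^2 + (g' s)^2))" by (rule ennreal_leI)
  also have "... = (\<integral>\<^sup>+s. ennreal (indicator {0..1} s * (2 * (g s)^2 + (g' s)^2)) \<partial>lborel)"
    by (rule nn_integral_has_integral_lebesgue[OF _ I2, symmetric]) simp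
  also have "... = (\<integral>\<^sup>+s. indicator {0..1} s * ennreal (2 * (g s)^2 + (g' s)^2) \<partial>lborel)"
    by (rule nn_integral_cong) (auto split: split_indicator)
  finally show ?thesis .
qed

lemma smooth_line_deriv:
  assumes "smooth f"
  shows "((%s. f (y + s *\<^sub>R p)) has_real_derivative (\<Sum>i\<in>UNIV. p $ i * pd [i] f (y + s *\<^sub>R p))) (at s)"
proof -
  have "((%s. f (y + s *\<^sub>R p)) has_derivative (%r. \<Sum>k\<in>UNIV. (r *\<^sub>R p) $ k * pd [k] f (y + s *\<^sub>R p))) (at s)"
    by (rule has_derivative_compose[where f = "%s. y + s *\<^sub>R p", OF _ smooth_has_derivative[OF assms]])
      (auto intro!: derivative_eq_intros)
  moreover have "(%r. \<Sum>k\<in>UNIV. (r *\<^sub>R p) $ k * pd [k] f (y + s *\<^sub>R p)) = (*) (\<Sum>i\<in>UNIV. p $ i * pd [i] f (y + s *\<^sub>R p))"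
    by (auto simp: fun_eq_iff sum_distrib_left mult_ac)
  ultimately show ?thesis by (simp add: has_field_derivative_def)
qed

lemma sum2_sq_bound: "((\<Sum>i\<in>(UNIV::2 set). p i * x i)::real)^2 <= 2 * (\<Sum>i\<in>UNIV. (p i)^2) * (\<Sum>i\<in>UNIV. (x i)^2)"
proof -
  have "(p 1 * x 1 + p 2 * x 2)^2 <= 2 * (p 1 * x 1)^2 + 2 * (p 2 * x 2)^2"
    using sum_squares_bound[of "p 1 * x 1" "p 2 * x 2"] by (simp add: power2_sum)
  also have "... <= 2 * ((p 1)^2 + (p 2)^2) * ((x 1)^2 + (x 2)^2)"
    by (simp add: power_mult_distrib algebra_simps)
  finally show ?thesis by (simp add: sum_2)
qed

text \<open>The squared Sobolev norm of order m with classical derivatives; for smooth functions no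
  choice of a weak derivative enters.\<close>

definition pd_sq :: "(real^2) set => nat => sfun => real" where
  "pd_sq D m f = (\<Sum>al | length al <= m. (L2normd D (pd al f))^2)"

lemma pd_sq_nonneg: "0 <= pd_sq D m f"
  by (simp add: pd_sq_def sum_nonneg)

lemma L2norm_pd_le_pd_sq: "length al <= m ==> (L2normd D (pd al f))^2 <= pd_sq D m f"
  unfolding pd_sq_def by (rule member_le_sum) (auto simp: finite_multi_index)

lemma pd_sq_pd: "pd_sq D m (pd \<beta> f) <= pd_sq D (m + length \<beta>) f"
proof -
  have "pd_sq D m (pd \<beta> f) = (\<Sum>al\<in>(%al. al @ \<beta>) ` {al. length al <= m}. (L2normd D (pd al f))^2)"
    unfolding pd_sq_def by (subst sum.reindex) (auto simp: inj_on_def pd_append)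
  also have "... <= pd_sq D (m + length \<beta>) f"
    unfolding pd_sq_def by (rule sum_mono2) (auto simp: finite_multi_index)
  finally show ?thesis .
qed

text \<open>The frontier of a convex set is a null set. Edges and corners are reached from the
  closed triangle, whereas the norms are taken over its interior.\<close>

lemma nn_integral_convex_body:
  fixes f :: sfun
  assumes K: "convex K" "compact K" and f: "smooth f"
  shows "(\<integral>\<^sup>+x. indicator K x * ennreal ((f x)^2) \<partial>lborel) = ennreal ((L2normd (interior K) f)^2)"
proof -
  have L: "f : L2d (interior K)"
    using K by (intro smooth_L2d f bounded_subset[OF compact_imp_bounded interior_subset]) auto
  have fm: "f : borel_measurable borel" by (rule smooth_measurable[OF f])
  have Kb: "K : sets borel" using K(2) by (simp add: borel_compact)
  have "negligible (frontier K)" by (rule negligible_convex_frontier[OF K(1)])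
  then have "AE x in lebesgue. x \<notin> frontier K" by (simp add: AE_not_in negligible_iff_null_sets)
  then have ae: "AE x in lebesgue. indicator K x * ennreal ((f x)^2) = ennreal ((f x)^2) * indicator (interior K) x"
  proof eventually_elim
    case (elim x)
    then have "x : K \<longleftrightarrow> x : interior K"
      using interior_subset[of K] closure_subset[of K] by (auto simp: frontier_def)
    then show ?case by (simp add: indicator_def)
  qed
  have "(\<integral>\<^sup>+x. indicator K x * ennreal ((f x)^2) \<partial>lborel) = (\<integral>\<^sup>+x. indicator K x * ennreal ((f x)^2) \<partial>lebesgue)"
    by (simp add: nn_integral_completion)
  also have "... = (\<integral>\<^sup>+x. ennreal ((f x)^2) * indicator (interior K) x \<partial>lebesgue)" by (rule nn_integral_cong_AE[OF ae])
  also have "... = (\<integral>\<^sup>+x. ennreal ((f x)^2) \<partial>lebesgue_on (interior K))" by (rule nn_integral_lebesgue_on[symmetric]) auto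
  also have "... = ennreal ((L2normd (interior K) f)^2)" by (rule L2norm_nn_integral[OF L, symmetric])
  finally show ?thesis .
qed

text \<open>From each point of the segment in direction q integrate inwards along p by
  \<open>endpoint_sq_bound\<close>; the integral over the segment then becomes one over a
  parallelogram inside K.\<close>

lemma trace_core:
  assumes "indep2 p q"
  obtains C where "C \<ge> 0" "\<And>f z K. smooth f ==> convex K ==> compact K ==>
    (\<And>s t. s : {0..1} ==> t : {0..1} ==> z + s *\<^sub>R p + t *\<^sub>R q : K) ==>
    (\<integral>\<^sup>+t. indicator {0..1} t * ennreal ((f (z + t *\<^sub>R q))^2) \<partial>lborel) <= ennreal (C * pd_sq (interior K) 1 f)"
proof -
  obtain C where C: "C \<ge> 0" "\<And>f z. f : borel_measurable borel ==>
    (\<integral>\<^sup>+t. \<integral>\<^sup>+s. f (z + s *\<^sub>R p + t *\<^sub>R q) \<partial>lborel \<partial>lborel) = ennreal C * (\<integral>\<^sup>+x. f x \<partial>lborel)"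
    using parallelogram_integral[OF assms] by blast
  \<comment> \<open>By \<open>sum2_sq_bound\<close>, the squared derivative along p is at most P
    times the sum of the squared partial derivatives.\<close>
  define P where "P = 2 * (\<Sum>i\<in>UNIV. (p $ i)^2)"
  have P: "P \<ge> 0" by (simp add: P_def sum_nonneg)
  have "(\<integral>\<^sup>+t. indicator {0..1} t * ennreal ((f (z + t *\<^sub>R q))^2) \<partial>lborel) <= ennreal (C * (2 + 2 * P) * pd_sq (interior K) 1 f)"
    if f: "smooth f" and K: "convex K" "compact K"
    and sub: "\<And>s t. s : {0..1} ==> t : {0..1} ==> z + s *\<^sub>R p + t *\<^sub>R q : K" for f z K
  proof -
    define F where "F x = 2 * (f x)^2 + (\<Sum>i\<in>UNIV. p $ i * pd [i] f x)^2" for x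
    have Kb[measurable]: "K : sets borel" using K(2) by (simp add: borel_compact)
    have [measurable]: "f : borel_measurable borel" "pd [i] f : borel_measurable borel" for i
      using f by (auto intro: smooth_measurable smooth_pd)
    have Fm[measurable]: "F : borel_measurable borel" unfolding F_def[abs_def] by measurable
    have Km: "(%x. indicator K x * ennreal (F x)) : borel_measurable borel" by measurable
    have "(\<integral>\<^sup>+t. indicator {0..1} t * ennreal ((f (z + t *\<^sub>R q))^2) \<partial>lborel)
      <= (\<integral>\<^sup>+t. \<integral>\<^sup>+s. indicator K (z + s *\<^sub>R p + t *\<^sub>R q) * ennreal (F (z + s *\<^sub>R p + t *\<^sub>R q)) \<partial>lborel \<partial>lborel)"
    proof (rule nn_integral_mono)
      fix t :: real
      show "indicator {0..1} t * ennreal ((f (z + t *\<^sub>R q))^2)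
        <= (\<integral>\<^sup>+s. indicator K (z + s *\<^sub>R p + t *\<^sub>R q) * ennreal (F (z + s *\<^sub>R p + t *\<^sub>R q)) \<partial>lborel)"
      proof (cases "t : {0..1}")
        case True
        let ?y = "z + t *\<^sub>R q"
        have c: "continuous_on UNIV (%s. \<Sum>i\<in>UNIV. p $ i * pd [i] f (?y + s *\<^sub>R p))"
          by (intro continuous_intros continuous_on_compose2[OF smooth_continuous[OF smooth_pd[OF f], of UNIV]]) auto
        have "ennreal ((f (?y + 0 *\<^sub>R p))^2) <= (\<integral>\<^sup>+s. indicator {0..1} s * ennreal (F (?y + s *\<^sub>R p)) \<partial>lborel)"
          unfolding F_def by (rule endpoint_sq_bound[OF smooth_line_deriv[OF f] c])
        also have "... <= (\<integral>\<^sup>+s. indicator K (z + s *\<^sub>R p + t *\<^sub>R q) * ennreal (F (z + s *\<^sub>R p + t *\<^sub>R q)) \<partial>lborel)"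
          using sub[OF _ True] by (intro nn_integral_mono) (auto simp: add_ac split: split_indicator)
        finally show ?thesis using True by simp
      qed simp
    qed
    also have "... = ennreal C * (\<integral>\<^sup>+x. indicator K x * ennreal (F x) \<partial>lborel)"
      using C(2)[OF Km, of z] by simp
    also have "(\<integral>\<^sup>+x. indicator K x * ennreal (F x) \<partial>lborel)
      <= (\<integral>\<^sup>+x. ennreal 2 * (indicator K x * ennreal ((f x)^2)) + (\<Sum>i\<in>UNIV. ennreal P * (indicator K x * ennreal ((pd [i] f x)^2))) \<partial>lborel)"
    proof (rule nn_integral_mono)
      fix x
      have "F x <= 2 * (f x)^2 + (\<Sum>i\<in>UNIV. P * (pd [i] f x)^2)"
        using sum2_sq_bound[of "%i. p $ i" "%i. pd [i] f x"] unfolding F_def P_def sum_distrib_left[symmetric] by simp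
      then have "ennreal (F x) <= ennreal (2 * (f x)^2 + (\<Sum>i\<in>UNIV. P * (pd [i] f x)^2))" by (rule ennreal_leI)
      also have "... = ennreal 2 * ennreal ((f x)^2) + (\<Sum>i\<in>UNIV. ennreal P * ennreal ((pd [i] f x)^2))"
        using P by (simp add: ennreal_mult' sum_nonneg flip: sum_ennreal)
      finally show "indicator K x * ennreal (F x) <= ennreal 2 * (indicator K x * ennreal ((f x)^2)) + (\<Sum>i\<in>UNIV. ennreal P * (indicator K x * ennreal ((pd [i] f x)^2)))"
        by (cases "x : K") auto
    qed
    also have "... = ennreal 2 * ennreal ((L2normd (interior K) f)^2) + (\<Sum>i\<in>UNIV. ennreal P * ennreal ((L2normd (interior K) (pd [i] f))^2))"
      by (subst nn_integral_add, measurable, subst nn_integral_sum, measurable)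
        (simp add: nn_integral_cmult nn_integral_convex_body[OF K] f smooth_pd)
    also have "... = ennreal (2 * (L2normd (interior K) f)^2 + (\<Sum>i\<in>UNIV. P * (L2normd (interior K) (pd [i] f))^2))"
    proof -
      have "(\<Sum>i\<in>(UNIV::2 set). ennreal P * ennreal ((L2normd (interior K) (pd [i] f))^2))
          = ennreal (\<Sum>i\<in>UNIV. P * (L2normd (interior K) (pd [i] f))^2)"
        using P by (subst sum_ennreal[symmetric]) (auto simp: ennreal_mult')
      then show ?thesis using P by (simp add: ennreal_mult' sum_nonneg)
    qed
    also have "... <= ennreal ((2 + 2 * P) * pd_sq (interior K) 1 f)"
    proof (rule ennreal_leI)
      have "(L2normd (interior K) f)^2 <= pd_sq (interior K) 1 f" using L2norm_pd_le_pd_sq[of "[]"] by simp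
      moreover have "(\<Sum>i\<in>(UNIV::2 set). P * (L2normd (interior K) (pd [i] f))^2) <= (\<Sum>i\<in>(UNIV::2 set). P * pd_sq (interior K) 1 f)"
        using P by (intro sum_mono mult_left_mono L2norm_pd_le_pd_sq) auto
      ultimately show "2 * (L2normd (interior K) f)^2 + (\<Sum>i\<in>UNIV. P * (L2normd (interior K) (pd [i] f))^2) <= (2 + 2 * P) * pd_sq (interior K) 1 f"
        by (simp add: algebra_simps)
    qed
    finally show ?thesis using C(1) by (simp add: ennreal_mult' mult.assoc mult_left_mono)
  qed
  moreover have "0 <= C * (2 + 2 * P)" using C P by simp
  ultimately show ?thesis using that by blast
qed

text \<open>The same device twice: a point value is bounded by integrals of f and its gradient over
  a segment along q, and these by \<open>trace_core\<close>. Each use costs one derivative, whence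
  the order 2.\<close>

lemma sobolev_corner:
  assumes "indep2 p q"
  obtains C where "C \<ge> 0" "\<And>f z K. smooth f ==> convex K ==> compact K ==>
    (\<And>s t. s : {0..1} ==> t : {0..1} ==> z + s *\<^sub>R p + t *\<^sub>R q : K) ==> (f z)^2 <= C * pd_sq (interior K) 2 f"
proof -
  obtain C where C: "C \<ge> 0" "\<And>f z K. smooth f ==> convex K ==> compact K ==>
    (\<And>s t. s : {0..1} ==> t : {0..1} ==> z + s *\<^sub>R p + t *\<^sub>R q : K) ==>
    (\<integral>\<^sup>+t. indicator {0..1} t * ennreal ((f (z + t *\<^sub>R q))^2) \<partial>lborel) <= ennreal (C * pd_sq (interior K) 1 f)"
    using trace_core[OF assms] by blast
  define P where "P = 2 * (\<Sum>i\<in>UNIV. (q $ i)^2)"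
  have P: "P \<ge> 0" by (simp add: P_def sum_nonneg)
  have "(f z)^2 <= (C * (2 + 2 * P)) * pd_sq (interior K) 2 f"
    if f: "smooth f" and K: "convex K" "compact K"
    and sub: "\<And>s t. s : {0..1} ==> t : {0..1} ==> z + s *\<^sub>R p + t *\<^sub>R q : K" for f z K
  proof -
    have [measurable]: "f : borel_measurable borel" "pd [i] f : borel_measurable borel" for i
      using f by (auto intro: smooth_measurable smooth_pd)
    let ?I = "%g. (\<integral>\<^sup>+t. indicator {0..1} t * ennreal ((g (z + t *\<^sub>R q))^2) \<partial>lborel)"
    have c: "continuous_on UNIV (%s. \<Sum>i\<in>UNIV. q $ i * pd [i] f (z + s *\<^sub>R q))"
      by (intro continuous_intros continuous_on_compose2[OF smooth_continuous[OF smooth_pd[OF f], of UNIV]]) auto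
    have "ennreal ((f z)^2) <= (\<integral>\<^sup>+s. indicator {0..1} s * ennreal (2 * (f (z + s *\<^sub>R q))^2 + (\<Sum>i\<in>UNIV. q $ i * pd [i] f (z + s *\<^sub>R q))^2) \<partial>lborel)"
      using endpoint_sq_bound[OF smooth_line_deriv[OF f] c] by simp
    also have "... <= (\<integral>\<^sup>+s. ennreal 2 * (indicator {0..1} s * ennreal ((f (z + s *\<^sub>R q))^2)) + (\<Sum>i\<in>UNIV. ennreal P * (indicator {0..1} s * ennreal ((pd [i] f (z + s *\<^sub>R q))^2))) \<partial>lborel)"
    proof (rule nn_integral_mono)
      fix s :: real
      let ?x = "z + s *\<^sub>R q"
      have "2 * (f ?x)^2 + (\<Sum>i\<in>UNIV. q $ i * pd [i] f ?x)^2 <= 2 * (f ?x)^2 + (\<Sum>i\<in>UNIV. P * (pd [i] f ?x)^2)"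
        using sum2_sq_bound[of "%i. q $ i" "%i. pd [i] f ?x"] unfolding P_def sum_distrib_left[symmetric] by simp
      then have "ennreal (2 * (f ?x)^2 + (\<Sum>i\<in>UNIV. q $ i * pd [i] f ?x)^2) <= ennreal (2 * (f ?x)^2 + (\<Sum>i\<in>UNIV. P * (pd [i] f ?x)^2))" by (rule ennreal_leI)
      also have "... = ennreal 2 * ennreal ((f ?x)^2) + (\<Sum>i\<in>UNIV. ennreal P * ennreal ((pd [i] f ?x)^2))"
        using P by (simp add: ennreal_mult' sum_nonneg flip: sum_ennreal)
      finally show "indicator {0..1} s * ennreal (2 * (f ?x)^2 + (\<Sum>i\<in>UNIV. q $ i * pd [i] f ?x)^2)
        <= ennreal 2 * (indicator {0..1} s * ennreal ((f ?x)^2)) + (\<Sum>i\<in>UNIV. ennreal P * (indicator {0..1} s * ennreal ((pd [i] f ?x)^2)))"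
        by (cases "s : {0..1}") auto
    qed
    also have "... = ennreal 2 * ?I f + (\<Sum>i\<in>UNIV. ennreal P * ?I (pd [i] f))"
      by (subst nn_integral_add, measurable, subst nn_integral_sum, measurable) (simp add: nn_integral_cmult)
    also have "... <= ennreal 2 * ennreal (C * pd_sq (interior K) 2 f) + (\<Sum>i\<in>(UNIV::2 set). ennreal P * ennreal (C * pd_sq (interior K) 2 f))"
    proof (intro add_mono mult_left_mono sum_mono)
      have "pd_sq (interior K) 1 f <= pd_sq (interior K) 2 f"
        unfolding pd_sq_def by (rule sum_mono2) (auto simp: finite_multi_index)
      then show "?I f <= ennreal (C * pd_sq (interior K) 2 f)"
        by (intro order_trans[OF C(2)[OF f K sub]] ennreal_leI mult_left_mono C(1))
      show "?I (pd [i] f) <= ennreal (C * pd_sq (interior K) 2 f)" for i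
        using pd_sq_pd[of "interior K" 1 "[i]" f, simplified, folded numeral_2_eq_2 One_nat_def]
        by (intro order_trans[OF C(2)[OF smooth_pd[OF f] K sub]] ennreal_leI mult_left_mono C(1)) simp_all
    qed auto
    also have "... = ennreal ((C * (2 + 2 * P)) * pd_sq (interior K) 2 f)"
    proof -
      define Q where "Q = C * pd_sq (interior K) 2 f"
      have Q: "0 <= Q" using C(1) pd_sq_nonneg by (simp add: Q_def)
      have "ennreal 2 * ennreal Q + (\<Sum>i\<in>(UNIV::2 set). ennreal P * ennreal Q)
          = ennreal (2 * Q) + (ennreal (P * Q) + ennreal (P * Q))"
        unfolding sum_2 using P Q by (simp only: ennreal_mult)
      also have "... = ennreal (2 * Q + (P * Q + P * Q))"
        using P Q by (simp only: ennreal_plus mult_nonneg_nonneg add_nonneg_nonneg zero_le_numeral)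
      also have "2 * Q + (P * Q + P * Q) = (C * (2 + 2 * P)) * pd_sq (interior K) 2 f"
        by (simp add: Q_def algebra_simps)
      finally show ?thesis by (simp only: Q_def)
    qed
    finally show ?thesis using P C pd_sq_nonneg[of "interior K" 2 f] by (subst (asm) ennreal_le_iff) auto
  qed
  moreover have "0 <= C * (2 + 2 * P)" using C P by simp
  ultimately show ?thesis using that by blast
qed

section \<open>Triangles, their vertices and their edges\<close>

lemma indep2_scale: "indep2 p q ==> x ~= 0 ==> y ~= 0 ==> indep2 (x *\<^sub>R p) (y *\<^sub>R q)"
  unfolding indep2_def by (metis mult_eq_0_iff scaleR_scaleR)

lemma indep2_commute: "indep2 p q ==> indep2 q p"
  unfolding indep2_def by (metis add.commute)

lemma indep2_rotate: "indep2 (b - a) (c - a) ==> indep2 (c - b) (a - b)"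
  unfolding indep2_def
proof (intro allI impI)
  fix s t assume i: "\<forall>s t. s *\<^sub>R (b - a) + t *\<^sub>R (c - a) = 0 \<longrightarrow> s = 0 \<and> t = 0"
    and "s *\<^sub>R (c - b) + t *\<^sub>R (a - b) = 0"
  then have "(- (s + t)) *\<^sub>R (b - a) + s *\<^sub>R (c - a) = 0" by (simp add: algebra_simps)
  with i have "- (s + t) = 0 \<and> s = 0" by blast
  then show "s = 0 \<and> t = 0" by simp
qed

definition is_triangle :: "real^2 => real^2 => real^2 => (real^2) set => bool" where
  "is_triangle a b c K \<longleftrightarrow> K = convex hull {a, b, c} \<and> indep2 (b - a) (c - a) \<and> interior K ~= {}"

lemma triangle_rotate: "is_triangle a b c K ==> is_triangle b c a K"
  by (auto simp: is_triangle_def insert_commute intro: indep2_rotate)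

lemma triangle_swap: "is_triangle a b c K ==> is_triangle a c b K"
  by (auto simp: is_triangle_def insert_commute intro: indep2_commute)

lemma triangle_body: "is_triangle a b c K ==> convex K \<and> compact K \<and> interior K ~= {}"
  by (auto simp: is_triangle_def finite_imp_compact_convex_hull)

lemma independent_indep2:
  assumes "\<not> affine_dependent {a, b, c}" "a ~= b" "b ~= c" "a ~= c"
  shows "indep2 (b - a) (c - a)"
proof -
  have "independent ((%x. - a + x) ` {b, c})"
    using assms affine_dependent_iff_dependent[of a "{b, c}"] by auto
  then have ind: "independent {b - a, c - a}" by simp
  have ne: "b - a ~= c - a" using assms by simp
  show ?thesis unfolding indep2_def
  proof (intro allI impI)
    fix s t assume st: "s *\<^sub>R (b - a) + t *\<^sub>R (c - a) = 0"
    define u where "u v = (if v = b - a then s else t)" for v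
    have "(\<Sum>v\<in>{b - a, c - a}. u v *\<^sub>R v) = 0" using ne st by (simp add: u_def)
    then have "u (b - a) = 0" "u (c - a) = 0"
      using independentD[OF ind, of "{b - a, c - a}" u] by auto
    then show "s = 0 \<and> t = 0" using ne by (auto simp: u_def)
  qed
qed

lemma simplex_triangle:
  fixes K :: "(real^2) set"
  assumes "2 simplex K"
  obtains a b c where "is_triangle a b c K" "\<not> affine_dependent {a, b, c}" "a ~= b" "b ~= c" "a ~= c"
proof -
  obtain C where C: "\<not> affine_dependent C" "int (card C) = 2 + 1" "K = convex hull C"
    using assms unfolding simplex_def by blast
  then have "card C = 3" by simp
  then obtain a b c where abc: "C = {a, b, c}" "a ~= b" "b ~= c" "a ~= c" by (auto simp: card_3_iff)
  have "interior (convex hull C) ~= {}"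
    using interior_convex_hull_eq_empty[of C] C(1) \<open>card C = 3\<close> by simp
  then show ?thesis
    using that[of a b c] abc C independent_indep2[of a b c] by (auto simp: is_triangle_def)
qed

text \<open>The trace estimates are anchored at the first vertex, so an edge is presented as the
  segment between the first two vertices of a suitably ordered triangle; all six orderings
  occur.\<close>

lemma edge_triangle:
  assumes "2 simplex K" "e edge_of K"
  obtains a b c where "is_triangle a b c K" "e = closed_segment a b"
proof -
  obtain a b c where abc: "is_triangle a b c K" "\<not> affine_dependent {a, b, c}" "a ~= b" "b ~= c" "a ~= c"
    using simplex_triangle[OF assms(1)] by blast
  have "e face_of (convex hull {a, b, c})" "aff_dim e = 1"
    using assms(2) abc(1) by (auto simp: edge_of_def is_triangle_def)
  then obtain d where d: "d \<subseteq> {a, b, c}" "e = convex hull d"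
    using face_of_convex_hull_affine_independent[OF abc(2)] by blast
  have "\<not> affine_dependent d" using abc(2) d(1) affine_dependent_subset by blast
  then have "aff_dim d = int (card d) - 1" using aff_dim_affine_independent[of d] by simp
  then have "card d = 2" using \<open>aff_dim e = 1\<close> d(2) by (simp add: aff_dim_convex_hull)
  then obtain x y where xy: "d = {x, y}" "x ~= y" by (auto simp: card_2_iff)
  have e: "e = closed_segment x y" using d xy by (simp add: segment_convex_hull)
  note that_triangle = that
  note t = abc(1) triangle_rotate[OF abc(1)] triangle_rotate[OF triangle_rotate[OF abc(1)]]
    triangle_swap[OF abc(1)] triangle_swap[OF triangle_rotate[OF abc(1)]]
    triangle_swap[OF triangle_rotate[OF triangle_rotate[OF abc(1)]]]
  have "(x = a \<and> y = b) \<or> (x = b \<and> y = c) \<or> (x = c \<and> y = a) \<or> (x = b \<and> y = a) \<or> (x = c \<and> y = b) \<or> (x = a \<and> y = c)"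
    using d(1) xy by auto
  moreover have ?thesis if uv: "is_triangle u v w K" "x = u \<and> y = v" for u v w
    using that_triangle[OF uv(1)] uv(2) e by blast
  ultimately show ?thesis using t by blast
qed

lemma triangle_corner_mem:
  assumes "is_triangle a b c K" and z: "z = u *\<^sub>R a + v *\<^sub>R b + w *\<^sub>R c" "0 <= v" "0 <= w" "u + v + w = 1"
    and st: "0 <= s" "0 <= t" "s + t <= u"
  shows "z + s *\<^sub>R (b - a) + t *\<^sub>R (c - a) : K"
proof -
  have "z + s *\<^sub>R (b - a) + t *\<^sub>R (c - a) = (u - s - t) *\<^sub>R a + (v + s) *\<^sub>R b + (w + t) *\<^sub>R c"
    unfolding z by (simp add: algebra_simps)
  moreover have "0 <= u - s - t" "0 <= v + s" "0 <= w + t" "(u - s - t) + (v + s) + (w + t) = 1"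
    using assms by auto
  ultimately show ?thesis using assms(1) unfolding is_triangle_def convex_hull_3 by blast
qed

text \<open>One barycentric coordinate of each point is at least 1/3. From such a point a
  parallelogram whose sides are one sixth of the two edges leaving that vertex stays in the
  triangle, since it lowers this coordinate by at most 1/3.\<close>

lemma sobolev_triangle:
  assumes K: "is_triangle a b c K"
  obtains C where "C \<ge> 0" "\<And>f z. smooth f ==> z : K ==> (f z)^2 <= C * pd_sq (interior K) 2 f"
proof -
  have "\<exists>C\<ge>0. \<forall>f z u v w. smooth f \<and> z = u *\<^sub>R a + v *\<^sub>R b + w *\<^sub>R c \<and> 1/3 <= u \<and> 0 <= v \<and> 0 <= w \<and> u + v + w = 1 \<longrightarrow>
      (f z)^2 <= C * pd_sq (interior K) 2 f" if K: "is_triangle a b c K" for a b c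
  proof -
    have "indep2 ((1/6) *\<^sub>R (b - a)) ((1/6) *\<^sub>R (c - a))"
      using K by (intro indep2_scale) (auto simp: is_triangle_def)
    then obtain C where C: "C \<ge> 0" "\<And>f z K. smooth f ==> convex K ==> compact K ==>
      (\<And>s t. s : {0..1} ==> t : {0..1} ==> z + s *\<^sub>R ((1/6) *\<^sub>R (b - a)) + t *\<^sub>R ((1/6) *\<^sub>R (c - a)) : K) ==> (f z)^2 <= C * pd_sq (interior K) 2 f"
      using sobolev_corner by blast
    have "(f z)^2 <= C * pd_sq (interior K) 2 f"
      if "smooth f" "z = u *\<^sub>R a + v *\<^sub>R b + w *\<^sub>R c" "1/3 <= u" "0 <= v" "0 <= w" "u + v + w = 1" for f z u v w
    proof (rule C(2))
      show "z + s *\<^sub>R ((1/6) *\<^sub>R (b - a)) + t *\<^sub>R ((1/6) *\<^sub>R (c - a)) : K" if "s : {0..1}" "t : {0..1}" for s t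
        using triangle_corner_mem[OF K \<open>z = _\<close> \<open>0 <= v\<close> \<open>0 <= w\<close> \<open>u + v + w = 1\<close>, of "s/6" "t/6"] that \<open>1/3 <= u\<close> by simp
    qed (use that triangle_body[OF K] in auto)
    with C(1) show ?thesis by blast
  qed
  note corner = this
  obtain C1 where C1: "C1 \<ge> 0" "\<And>f z u v w. smooth f ==> z = u *\<^sub>R a + v *\<^sub>R b + w *\<^sub>R c ==> 1/3 <= u ==> 0 <= v ==> 0 <= w ==> u + v + w = 1 ==>
      (f z)^2 <= C1 * pd_sq (interior K) 2 f" using corner[OF K] by blast
  obtain C2 where C2: "C2 \<ge> 0" "\<And>f z u v w. smooth f ==> z = u *\<^sub>R b + v *\<^sub>R c + w *\<^sub>R a ==> 1/3 <= u ==> 0 <= v ==> 0 <= w ==> u + v + w = 1 ==>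
      (f z)^2 <= C2 * pd_sq (interior K) 2 f" using corner[OF triangle_rotate[OF K]] by blast
  obtain C3 where C3: "C3 \<ge> 0" "\<And>f z u v w. smooth f ==> z = u *\<^sub>R c + v *\<^sub>R a + w *\<^sub>R b ==> 1/3 <= u ==> 0 <= v ==> 0 <= w ==> u + v + w = 1 ==>
      (f z)^2 <= C3 * pd_sq (interior K) 2 f" using corner[OF triangle_rotate[OF triangle_rotate[OF K]]] by blast
  have "(f z)^2 <= (C1 + C2 + C3) * pd_sq (interior K) 2 f" if f: "smooth f" and z: "z : K" for f z
  proof -
    obtain u v w where uvw: "z = u *\<^sub>R a + v *\<^sub>R b + w *\<^sub>R c" "0 <= u" "0 <= v" "0 <= w" "u + v + w = 1"
      using z K unfolding is_triangle_def convex_hull_3 by blast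
    define Q where "Q = pd_sq (interior K) 2 f"
    have Q: "0 <= C1 * Q" "0 <= C2 * Q" "0 <= C3 * Q" using pd_sq_nonneg C1(1) C2(1) C3(1) by (auto simp: Q_def)
    consider "1/3 <= u" | "1/3 <= v" | "1/3 <= w" using uvw by linarith
    then have "(f z)^2 <= C1 * Q \<or> (f z)^2 <= C2 * Q \<or> (f z)^2 <= C3 * Q"
    proof cases
      case 1 then show ?thesis using C1(2)[OF f uvw(1)] uvw by (simp add: Q_def)
    next
      case 2
      have "z = v *\<^sub>R b + w *\<^sub>R c + u *\<^sub>R a" using uvw(1) by (simp add: add_ac)
      then show ?thesis using C2(2)[OF f _ 2 uvw(4) uvw(2)] uvw(5) by (simp add: Q_def)
    next
      case 3
      have "z = w *\<^sub>R c + u *\<^sub>R a + v *\<^sub>R b" using uvw(1) by (simp add: add_ac)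
      then show ?thesis using C3(2)[OF f _ 3 uvw(2) uvw(3)] uvw(5) by (simp add: Q_def)
    qed
    then show ?thesis using Q unfolding Q_def[symmetric] by (auto simp: algebra_simps)
  qed
  then show ?thesis using that[of "C1 + C2 + C3"] C1(1) C2(1) C3(1) by simp
qed

section \<open>Continuous representatives and point values\<close>

lemma pd_sq_diff_le:
  assumes D: "bounded D" "D : sets lebesgue" and f: "smooth f" "smooth g" and w: "\<And>al. length al <= m ==> w al : L2d D"
  shows "pd_sq D m (%x. f x - g x) <= 2 * (\<Sum>al | length al <= m. (L2normd D (%x. pd al f x - w al x))^2)
      + 2 * (\<Sum>al | length al <= m. (L2normd D (%x. pd al g x - w al x))^2)"
proof -
  have "(L2normd D (pd al (%x. f x - g x)))^2 <= 2 * (L2normd D (%x. pd al f x - w al x))^2 + 2 * (L2normd D (%x. pd al g x - w al x))^2"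
    if "length al <= m" for al
  proof -
    have "pd al (%x. f x - g x) = (%x. 1 * (pd al f x - w al x) + (-1) * (pd al g x - w al x))"
      using pd_lin[OF f, of al 1 "-1"] by simp
    moreover have "(%x. pd al f x - w al x) : L2d D" "(%x. pd al g x - w al x) : L2d D"
      using f by (auto intro!: L2_diff w that smooth_L2d D smooth_pd)
    ultimately show ?thesis using L2norm_lin_sq[of "%x. pd al f x - w al x" _ "%x. pd al g x - w al x" 1 "-1"] by simp
  qed
  then show ?thesis unfolding pd_sq_def sum_distrib_left sum.distrib[symmetric] by (intro sum_mono) auto
qed

lemma pd_sq_Cauchy:
  assumes D: "bounded D" "D : sets lebesgue" and f: "\<And>n. smooth (f n)" and w: "\<And>al. length al <= m ==> w al : L2d D"
    and l: "\<And>al. length al <= m ==> (%n. L2normd D (%x. pd al (f n) x - w al x)) \<longlonglongrightarrow> 0" and "e > 0"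
  shows "\<exists>N. \<forall>i\<ge>N. \<forall>j\<ge>N. pd_sq D m (%x. f i x - f j x) < e"
proof -
  have "(%n. \<Sum>al | length al <= m. (L2normd D (%x. pd al (f n) x - w al x))^2) \<longlonglongrightarrow> (\<Sum>al\<in>{al::2 list. length al <= m}. 0^2)"
    by (intro tendsto_sum tendsto_power l) auto
  then have "\<forall>\<^sub>F n in sequentially. (\<Sum>al | length al <= m. (L2normd D (%x. pd al (f n) x - w al x))^2) < e/4"
    using \<open>e > 0\<close> by (intro order_tendstoD) auto
  then obtain N where N: "\<And>n. n \<ge> N ==> (\<Sum>al | length al <= m. (L2normd D (%x. pd al (f n) x - w al x))^2) < e/4"
    by (auto simp: eventually_sequentially)
  have "pd_sq D m (%x. f i x - f j x) < e" if "i \<ge> N" "j \<ge> N" for i j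
  proof -
    have "pd_sq D m (%x. f i x - f j x) <= 2 * (\<Sum>al | length al <= m. (L2normd D (%x. pd al (f i) x - w al x))^2)
        + 2 * (\<Sum>al | length al <= m. (L2normd D (%x. pd al (f j) x - w al x))^2)"
      by (rule pd_sq_diff_le[OF D f f w])
    then show ?thesis using N[OF that(1)] N[OF that(2)] by linarith
  qed
  then show ?thesis by blast
qed

lemma AE_convex_body:
  assumes K: "convex K" "compact (K :: (real^2) set)"
  shows "(AE x in lebesgue_on K. P x) \<longleftrightarrow> (AE x in lebesgue_on (interior K). P x)"
proof -
  have Kb: "K : sets lebesgue" using K(2) by (simp add: borel_compact)
  have "AE x in lebesgue. x \<notin> frontier K"
    using negligible_convex_frontier[OF K(1)] by (simp add: AE_not_in negligible_iff_null_sets)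
  then have "AE x in lebesgue. x : K \<longleftrightarrow> x : interior K"
  proof eventually_elim
    case (elim x)
    then show ?case using interior_subset[of K] closure_subset[of K] by (auto simp: frontier_def)
  qed
  then have "(AE x in lebesgue. x : K \<longrightarrow> P x) \<longleftrightarrow> (AE x in lebesgue. x : interior K \<longrightarrow> P x)"
    by (intro iffI) (auto elim!: AE_mp)
  then show ?thesis using Kb by (simp add: AE_restrict_space_iff)
qed

text \<open>Smooth approximants that converge together with their weak derivatives up to order 2 are
  uniformly Cauchy on the closed triangle by \<open>sobolev_triangle\<close>; the uniform limit is
  the continuous representative.\<close>

lemma sobolev_embedding:
  assumes K: "is_triangle a b c K" and v: "v : Hs 2 (interior K)"
  obtains g where "continuous_on K g" "AE x in lebesgue_on K. g x = v x"
proof -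
  let ?D = "interior K"
  have body: "convex K" "compact K" "?D ~= {}" using triangle_body[OF K] by auto
  have Db: "bounded ?D" "?D : sets lebesgue"
    using bounded_subset[OF compact_imp_bounded[OF body(2)] interior_subset] by auto
  have vL: "v : L2d ?D" using v by (simp add: Hs_2)
  obtain f where f: "\<And>n. smooth (f n)" "\<And>al g. is_weak_pd ?D al v g ==> (%n. L2normd ?D (%x. pd al (f n) x - g x)) \<longlonglongrightarrow> 0"
    using smooth_dense_convex[OF body vL] by blast
  have wk: "is_weak_pd ?D al v (weak_pd ?D al v)" if "length al <= 2" for al
    using v that by (intro weak_pd_is) (simp add: Hs_2)
  obtain C where C: "C \<ge> 0" "\<And>f z. smooth f ==> z : K ==> (f z)^2 <= C * pd_sq ?D 2 f"
    using sobolev_triangle[OF K] by blast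
  have "uniformly_Cauchy_on K f"
    unfolding uniformly_Cauchy_on_def
  proof (intro allI impI)
    fix e :: real assume e: "e > 0"
    have "e^2 / (C + 1) > 0" using e C(1) by simp
    then obtain N where N: "\<forall>i\<ge>N. \<forall>j\<ge>N. pd_sq ?D 2 (%x. f i x - f j x) < e^2 / (C + 1)"
      using pd_sq_Cauchy[where w = "%al. weak_pd ?D al v", OF Db f(1) is_weak_pd_L2[OF wk] f(2)[OF wk]] by blast
    have "dist (f i x) (f j x) < e" if "x : K" "i \<ge> N" "j \<ge> N" for x i j
    proof -
      have s: "smooth (%x. f i x - f j x)" using smooth_lin[OF f(1)[of i] f(1)[of j], of 1 "-1"] by simp
      have "(f i x - f j x)^2 <= C * pd_sq ?D 2 (%x. f i x - f j x)" by (rule C(2)[OF s that(1)])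
      also have "... <= C * (e^2 / (C + 1))" using N that C(1) by (intro mult_left_mono) (auto intro: less_imp_le)
      also have "... < e^2" using C(1) e by (simp add: field_simps)
      finally have "\<bar>f i x - f j x\<bar>^2 < e^2" by simp
      then show ?thesis using power2_less_imp_less[of "\<bar>f i x - f j x\<bar>" e] e by (simp add: dist_real_def)
    qed
    then show "\<exists>M. \<forall>x\<in>K. \<forall>m\<ge>M. \<forall>n\<ge>M. dist (f m x) (f n x) < e" by blast
  qed
  then obtain g where g: "uniform_limit K f g sequentially"
    using uniformly_convergent_eq_Cauchy uniformly_convergent_on_def by metis
  have gc: "continuous_on K g"
    by (rule uniform_limit_theorem[OF always_eventually g]) (auto intro: smooth_continuous f)
  have fm: "finite_measure (lebesgue_on ?D)"
    by (rule finite_measure_lebesgue_on[OF bounded_set_imp_lmeasurable[OF Db]])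
  define \<mu> where "\<mu> = sqrt (measure (lebesgue_on ?D) ?D)"
  have \<mu>: "0 <= \<mu>" by (simp add: \<mu>_def)
  have bnd: "L2normd ?D u <= B * \<mu> \<and> u : L2d ?D" if "u : borel_measurable (lebesgue_on ?D)" "\<And>x. x : ?D ==> \<bar>u x\<bar> <= B" "0 <= B" for u B
  proof -
    interpret finite_measure "lebesgue_on ?D" by (rule fm)
    have L: "u : L2d ?D" by (rule L2_bounded[OF fm that(1), of B]) (use that(2) in auto)
    have "(L2normd ?D u)^2 <= (LINT x|lebesgue_on ?D. B^2)"
      unfolding L2norm_sq_integral
    proof (rule integral_mono[OF L2_integrable_sq[OF L] integrable_const])
      fix x assume "x : space (lebesgue_on ?D)"
      then have "\<bar>u x\<bar> <= B" using that(2) by simp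
      from power_mono[OF this abs_ge_zero, of 2] show "(u x)^2 <= B^2" by simp
    qed
    also have "... = (B * \<mu>)^2"
      unfolding \<mu>_def power_mult_distrib by (simp only: lebesgue_integral_const real_scaleR_def
          space_lebesgue_on real_sqrt_pow2 measure_nonneg mult.commute)
    finally have "L2normd ?D u <= B * \<mu>"
      by (rule power2_le_imp_le[OF _ mult_nonneg_nonneg[OF that(3) \<mu>]])
    with L show ?thesis by blast
  qed
  have gm: "g : borel_measurable (lebesgue_on ?D)"
    by (intro continuous_imp_measurable_on_sets_lebesgue continuous_on_subset[OF gc interior_subset]) auto
  have vm: "v : borel_measurable (lebesgue_on ?D)" by (rule L2_measurable[OF vL])
  have fmeas: "f n : borel_measurable (lebesgue_on ?D)" for n
    by (rule borel_measurable_lebesgue_on[OF smooth_measurable[OF f(1)]])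
  have est: "L2normd ?D (%x. g x - v x) < e \<and> (%x. g x - v x) : L2d ?D" if e: "e > 0" for e
  proof -
    have "is_weak_pd ?D [] v (weak_pd ?D [] v)" by (rule wk) simp
    then have "(%n. L2normd ?D (%x. f n x - v x)) \<longlonglongrightarrow> 0"
      using f(2)[of "[]" v] vL by (simp add: is_weak_pd_def)
    then have "\<forall>\<^sub>F n in sequentially. L2normd ?D (%x. f n x - v x) < e/2" using e by (intro order_tendstoD) auto
    moreover have "\<forall>\<^sub>F n in sequentially. \<forall>x\<in>K. dist (f n x) (g x) < e / (4 * (\<mu> + 1))"
      using e \<mu> by (intro uniform_limitD[OF g]) simp
    ultimately have "\<forall>\<^sub>F n in sequentially. L2normd ?D (%x. f n x - v x) < e/2 \<and> (\<forall>x\<in>K. dist (f n x) (g x) < e / (4 * (\<mu> + 1)))"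
      by (rule eventually_conj)
    then obtain n where n: "L2normd ?D (%x. f n x - v x) < e/2" "\<And>x. x : K ==> dist (f n x) (g x) < e / (4 * (\<mu> + 1))"
      using eventually_happens' sequentially_bot by blast
    have gf: "L2normd ?D (%x. g x - f n x) <= e / (4 * (\<mu> + 1)) * \<mu> \<and> (%x. g x - f n x) : L2d ?D"
      using n(2) interior_subset[of K] e \<mu>
      by (intro bnd borel_measurable_diff gm fmeas) (auto simp: dist_real_def abs_minus_commute intro!: less_imp_le)
    have fv: "(%x. f n x - v x) : L2d ?D" by (intro L2_diff vL smooth_L2d f(1) Db)
    have "L2normd ?D (%x. g x - v x) <= L2normd ?D (%x. g x - f n x) + L2normd ?D (%x. f n x - v x)"
      using L2norm_triangle[OF conjunct2[OF gf] fv] by simp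
    also have "... < e / (4 * (\<mu> + 1)) * \<mu> + e/2" using gf n(1) by linarith
    also have "... <= e/2 + e/2" using e \<mu> by (simp add: field_simps)
    finally show ?thesis using L2_add[OF conjunct2[OF gf] fv] by simp
  qed
  have "L2normd ?D (%x. g x - v x) = 0"
  proof (rule ccontr)
    assume "L2normd ?D (%x. g x - v x) ~= 0"
    then have "0 < L2normd ?D (%x. g x - v x)" by (simp add: order_less_le)
    from est[OF this] show False by simp
  qed
  then have "AE x in lebesgue_on ?D. g x - v x = 0"
    by (rule L2norm_eq_0_AE[OF conjunct2[OF est[OF zero_less_one]]])
  then have "AE x in lebesgue_on K. g x = v x" unfolding AE_convex_body[OF body(1,2)] by simp
  then show ?thesis using that gc by blast
qed

text \<open>The coincidence set is closed and contains the interior, and a convex body is the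
  closure of its interior.\<close>

lemma continuous_AE_eq:
  assumes K: "convex K" "compact (K :: (real^2) set)" "interior K ~= {}" and g: "continuous_on K g" "continuous_on K h"
    and ae: "AE x in lebesgue_on K. g x = (h x :: real)" and z: "z : K"
  shows "g z = h z"
proof -
  have c: "continuous_on K (%x. g x - h x)" by (intro continuous_intros g)
  have cl: "closed {x : K. g x - h x = 0}"
    by (rule continuous_closed_preimage_constant[OF c compact_imp_closed[OF K(2)]])
  have "AE x in lebesgue_on (interior K). g x = h x" using ae AE_convex_body[OF K(1,2)] by blast
  then have "AE x\<in>interior K in lebesgue. x : {x : K. g x - h x = 0}"
    by (subst (asm) AE_restrict_space_iff) (auto elim!: eventually_mono simp: interior_subset[THEN subsetD])
  then have "x : {x : K. g x - h x = 0}" if "x : interior K" for x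
    using mem_closed_if_AE_lebesgue_open[OF open_interior cl _ that] by blast
  then have "closure (interior K) \<subseteq> {x : K. g x - h x = 0}" using cl by (intro closure_minimal) auto
  moreover have "closure (interior K) = K"
    using convex_closure_interior[OF K(1,3)] K(2) by (simp add: compact_imp_closed)
  ultimately show ?thesis using z by auto
qed

text \<open>Two continuous representatives agree at every point of K, so that the definite
  description in \<open>point_value\<close> denotes.\<close>

lemma point_value_eq:
  assumes K: "convex K" "compact K" "interior K ~= {}" and g: "continuous_on K g" "AE x in lebesgue_on K. g x = v x" and z: "z : K"
  shows "point_value K v z = g z"
  unfolding point_value_def
proof (rule the_equality)
  show "\<exists>g'. continuous_on K g' \<and> (AE x in lebesgue_on K. g' x = v x) \<and> g' z = g z" using g by blast
  fix c assume "\<exists>g'. continuous_on K g' \<and> (AE x in lebesgue_on K. g' x = v x) \<and> g' z = c"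
  then obtain g' where g': "continuous_on K g'" "AE x in lebesgue_on K. g' x = v x" "g' z = c" by blast
  have "AE x in lebesgue_on K. g' x = g x" using g'(2) g(2) by eventually_elim simp
  then show "c = g z" using continuous_AE_eq[OF K g'(1) g(1) _ z] g'(3) by simp
qed

lemma point_value_lin:
  assumes K: "2 simplex K" and v: "v : Hs 2 (interior K)" "w : Hs 2 (interior K)" and z: "z : K"
  shows "point_value K (%x. c * v x + d * w x) z = c * point_value K v z + d * point_value K w z"
proof -
  obtain a1 a2 a3 where t: "is_triangle a1 a2 a3 K" using simplex_triangle[OF K] by blast
  have body: "convex K" "compact K" "interior K ~= {}" using triangle_body[OF t] by auto
  obtain g where g: "continuous_on K g" "AE x in lebesgue_on K. g x = v x" using sobolev_embedding[OF t v(1)] by blast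
  obtain h where h: "continuous_on K h" "AE x in lebesgue_on K. h x = w x" using sobolev_embedding[OF t v(2)] by blast
  have "continuous_on K (%x. c * g x + d * h x)" by (intro continuous_intros g h)
  moreover have "AE x in lebesgue_on K. c * g x + d * h x = c * v x + d * w x" using g(2) h(2) by eventually_elim simp
  ultimately have "point_value K (%x. c * v x + d * w x) z = c * g z + d * h z"
    by (rule point_value_eq[OF body _ _ z])
  then show ?thesis by (simp add: point_value_eq[OF body g z] point_value_eq[OF body h z])
qed

section \<open>Integrals and traces on edges\<close>

text \<open>The end points selected inside \<open>edge_measure\<close> may come in either
  order.\<close>

lemma edge_measure_segment:
  assumes "e = closed_segment a0 b0"
  obtains a b where "{a, b} = {a0, b0}"
    "edge_measure e = scale_measure (ennreal (dist a b)) (distr (lebesgue_on {0..1}) borel (linepath a b))"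
proof -
  define p where "p = (SOME p. e = closed_segment (fst p) (snd p))"
  have "e = closed_segment (fst p) (snd p)"
    unfolding p_def by (rule someI[of _ "(a0, b0)"]) (simp add: assms)
  then have "{fst p, snd p} = {a0, b0}" using assms by simp
  then show ?thesis
    using that[of "fst p" "snd p"] unfolding edge_measure_def p_def[symmetric] by (simp add: case_prod_beta)
qed

lemma nn_integral_edge:
  assumes "edge_measure e = scale_measure (ennreal (dist a b)) (distr (lebesgue_on {0..1}) borel (linepath a b))"
    and F: "F : borel_measurable borel"
  shows "(\<integral>\<^sup>+x. F x \<partial>edge_measure e) = ennreal (dist a b) * (\<integral>\<^sup>+t. indicator {0..1} t * F (a + t *\<^sub>R (b - a)) \<partial>lborel)"
proof -
  have lm: "linepath a b : borel_measurable borel"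
    by (intro borel_measurable_continuous_onI) (simp add: continuous_on_linepath)
  have lm': "linepath a b : lebesgue_on {0..1} \<rightarrow>\<^sub>M borel"
    using lm by (simp add: measurable_completion measurable_restrict_space1)
  have "(\<integral>\<^sup>+x. F x \<partial>distr (lebesgue_on {0..1}) borel (linepath a b)) = (\<integral>\<^sup>+t. F (linepath a b t) \<partial>lebesgue_on {0..1})"
    by (rule nn_integral_distr[OF lm']) (use F in simp)
  also have "... = (\<integral>\<^sup>+t. F (linepath a b t) * indicator {0..1} t \<partial>lebesgue)"
    by (rule nn_integral_lebesgue_on) simp
  also have "... = (\<integral>\<^sup>+t. indicator {0..1} t * F (a + t *\<^sub>R (b - a)) \<partial>lborel)"
    unfolding nn_integral_completion
    by (rule nn_integral_cong) (simp add: linepath_def algebra_simps)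
  finally have I: "(\<integral>\<^sup>+x. F x \<partial>distr (lebesgue_on {0..1}) borel (linepath a b))
    = (\<integral>\<^sup>+t. indicator {0..1} t * F (a + t *\<^sub>R (b - a)) \<partial>lborel)" .
  have "(\<integral>\<^sup>+x. F x \<partial>edge_measure e) = ennreal (dist a b) * (\<integral>\<^sup>+x. F x \<partial>distr (lebesgue_on {0..1}) borel (linepath a b))"
    unfolding assms(1) by (rule nn_integral_scale_measure) (use F in simp)
  then show ?thesis unfolding I .
qed

lemma sets_edge_measure: "sets (edge_measure e) = sets borel"
  by (simp add: edge_measure_def case_prod_beta Let_def)

lemma measurable_edge_measure: "f : borel_measurable borel ==> f : borel_measurable (edge_measure e)"
  using measurable_cong_sets[OF sets_edge_measure refl] by blast

lemma finite_edge_measure: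
  assumes "e = closed_segment a0 b0" shows "finite_measure (edge_measure e)"
proof -
  obtain a b where ab: "edge_measure e = scale_measure (ennreal (dist a b)) (distr (lebesgue_on {0..1}) borel (linepath a b))"
    using edge_measure_segment[OF assms] by blast
  have "emeasure (edge_measure e) (space (edge_measure e)) = (\<integral>\<^sup>+x. 1 \<partial>edge_measure e)" by simp
  also have "... = ennreal (dist a b) * (\<integral>\<^sup>+t. indicator {0..1::real} t * 1 \<partial>lborel)"
    by (rule nn_integral_edge[OF ab]) simp
  also have "... = ennreal (dist a b)" by simp
  finally show ?thesis by (intro finite_measureI) simp
qed

text \<open>A parallelogram with a side on an edge, anchored at a vertex, fits into the triangle
  only along part of that edge; each half is therefore treated from its own end point.\<close>

lemma half_segment_integral:
  fixes F :: "real => ennreal"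
  assumes [measurable]: "F : borel_measurable borel"
  shows "(\<integral>\<^sup>+t. indicator {0..1} t * F t \<partial>lborel)
    <= ennreal (1/2) * (\<integral>\<^sup>+t. indicator {0..1} t * F (t / 2) \<partial>lborel) + ennreal (1/2) * (\<integral>\<^sup>+t. indicator {0..1} t * F (1 - t / 2) \<partial>lborel)"
proof -
  have "(\<integral>\<^sup>+t. indicator {0..1} t * F t \<partial>lborel) <= (\<integral>\<^sup>+t. indicator {0..1/2} t * F t + indicator {1/2..1} t * F t \<partial>lborel)"
    by (rule nn_integral_mono) (auto split: split_indicator)
  also have "... = (\<integral>\<^sup>+t. indicator {0..1/2} t * F t \<partial>lborel) + (\<integral>\<^sup>+t. indicator {1/2..1} t * F t \<partial>lborel)"
    by (rule nn_integral_add) measurable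
  also have "(\<integral>\<^sup>+t. indicator {0..1/2} t * F t \<partial>lborel) = ennreal \<bar>1/2\<bar> * (\<integral>\<^sup>+t. indicator {0..1/2} (0 + 1/2 * t) * F (0 + 1/2 * t) \<partial>lborel)"
    by (rule nn_integral_real_affine) auto
  also have "(\<integral>\<^sup>+t. indicator {0..1/2} (0 + 1/2 * t) * F (0 + 1/2 * t) \<partial>lborel) = (\<integral>\<^sup>+t. indicator {0..1} t * F (t / 2) \<partial>lborel)"
    by (rule nn_integral_cong) (auto split: split_indicator)
  also have "(\<integral>\<^sup>+t. indicator {1/2..1} t * F t \<partial>lborel) = ennreal \<bar>-1/2\<bar> * (\<integral>\<^sup>+t. indicator {1/2..1} (1 + (-1/2) * t) * F (1 + (-1/2) * t) \<partial>lborel)"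
    by (rule nn_integral_real_affine) auto
  also have "(\<integral>\<^sup>+t. indicator {1/2..1} (1 + (-1/2) * t) * F (1 + (-1/2) * t) \<partial>lborel) = (\<integral>\<^sup>+t. indicator {0..1} t * F (1 - t / 2) \<partial>lborel)"
    by (rule nn_integral_cong) (auto split: split_indicator)
  finally show ?thesis by simp
qed

lemma trace_half_edge:
  assumes K: "is_triangle a b c K"
  obtains C where "C \<ge> 0" "\<And>f. smooth f ==>
    (\<integral>\<^sup>+t. indicator {0..1} t * ennreal ((f (a + (t / 2) *\<^sub>R (b - a)))^2) \<partial>lborel) <= ennreal (C * pd_sq (interior K) 1 f)"
proof -
  have "indep2 ((1/2) *\<^sub>R (c - a)) ((1/2) *\<^sub>R (b - a))"
    using K by (intro indep2_scale indep2_commute[of "b - a"]) (auto simp: is_triangle_def)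
  then obtain C where C: "C \<ge> 0" "\<And>f z K. smooth f ==> convex K ==> compact K ==>
    (\<And>s t. s : {0..1} ==> t : {0..1} ==> z + s *\<^sub>R ((1/2) *\<^sub>R (c - a)) + t *\<^sub>R ((1/2) *\<^sub>R (b - a)) : K) ==>
    (\<integral>\<^sup>+t. indicator {0..1} t * ennreal ((f (z + t *\<^sub>R ((1/2) *\<^sub>R (b - a))))^2) \<partial>lborel) <= ennreal (C * pd_sq (interior K) 1 f)"
    using trace_core by blast
  have mem: "a + s *\<^sub>R ((1/2) *\<^sub>R (c - a)) + t *\<^sub>R ((1/2) *\<^sub>R (b - a)) : K" if "s : {0..1}" "t : {0..1}" for s t
    using triangle_corner_mem[OF K, of a 1 0 0 "t/2" "s/2"] that by (simp add: add_ac)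
  have "(\<integral>\<^sup>+t. indicator {0..1} t * ennreal ((f (a + (t / 2) *\<^sub>R (b - a)))^2) \<partial>lborel) <= ennreal (C * pd_sq (interior K) 1 f)"
    if "smooth f" for f
    using C(2)[OF that _ _ mem] triangle_body[OF K] by simp
  then show ?thesis using that C(1) by blast
qed

lemma trace_inequality:
  assumes K: "2 simplex K" and e: "e edge_of K"
  obtains C where "C \<ge> 0" "\<And>f. smooth f ==> f : L2 (edge_measure e)"
    "\<And>f. smooth f ==> (L2norm (edge_measure e) f)^2 <= C * pd_sq (interior K) 1 f"
proof -
  obtain a0 b0 c where t0: "is_triangle a0 b0 c K" and e0: "e = closed_segment a0 b0"
    using edge_triangle[OF K e] by blast
  obtain a b where ab: "{a, b} = {a0, b0}"
    "edge_measure e = scale_measure (ennreal (dist a b)) (distr (lebesgue_on {0..1}) borel (linepath a b))"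
    using edge_measure_segment[OF e0] by blast
  have "(a = a0 \<and> b = b0) \<or> (a = b0 \<and> b = a0)" using ab(1) by (auto simp: doubleton_eq_iff)
  then have t: "is_triangle a b c K"
    using t0 triangle_swap[OF triangle_rotate[OF t0]] by blast
  obtain C1 where C1: "C1 \<ge> 0" "\<And>f. smooth f ==>
    (\<integral>\<^sup>+t. indicator {0..1} t * ennreal ((f (a + (t / 2) *\<^sub>R (b - a)))^2) \<partial>lborel) <= ennreal (C1 * pd_sq (interior K) 1 f)"
    using trace_half_edge[OF t] by blast
  obtain C2 where C2: "C2 \<ge> 0" "\<And>f. smooth f ==>
    (\<integral>\<^sup>+t. indicator {0..1} t * ennreal ((f (b + (t / 2) *\<^sub>R (a - b)))^2) \<partial>lborel) <= ennreal (C2 * pd_sq (interior K) 1 f)"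
    using trace_half_edge[OF triangle_swap[OF triangle_rotate[OF t]]] by blast
  define C where "C = dist a b * (1/2 * C1 + 1/2 * C2)"
  have C0: "C \<ge> 0" using C1(1) C2(1) by (simp add: C_def)
  have est: "(\<integral>\<^sup>+x. ennreal ((f x)^2) \<partial>edge_measure e) <= ennreal (C * pd_sq (interior K) 1 f)" if f: "smooth f" for f
  proof -
    define Q where "Q = pd_sq (interior K) 1 f"
    have Q: "0 <= Q" by (simp add: Q_def pd_sq_nonneg)
    have fm[measurable]: "f : borel_measurable borel" by (rule smooth_measurable[OF f])
    have "(\<integral>\<^sup>+x. ennreal ((f x)^2) \<partial>edge_measure e)
      = ennreal (dist a b) * (\<integral>\<^sup>+t. indicator {0..1} t * ennreal ((f (a + t *\<^sub>R (b - a)))^2) \<partial>lborel)"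
      by (rule nn_integral_edge[OF ab(2)]) measurable
    also have "(\<integral>\<^sup>+t. indicator {0..1} t * ennreal ((f (a + t *\<^sub>R (b - a)))^2) \<partial>lborel)
      <= ennreal (1/2) * (\<integral>\<^sup>+t. indicator {0..1} t * ennreal ((f (a + (t / 2) *\<^sub>R (b - a)))^2) \<partial>lborel)
        + ennreal (1/2) * (\<integral>\<^sup>+t. indicator {0..1} t * ennreal ((f (a + (1 - t / 2) *\<^sub>R (b - a)))^2) \<partial>lborel)"
      by (rule half_segment_integral) measurable
    also have "(%t. a + (1 - t / 2) *\<^sub>R (b - a)) = (%t. b + (t / 2) *\<^sub>R (a - b))"
      by (auto simp: algebra_simps)
    also have "ennreal (1/2) * (\<integral>\<^sup>+t. indicator {0..1} t * ennreal ((f (a + (t / 2) *\<^sub>R (b - a)))^2) \<partial>lborel)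
        + ennreal (1/2) * (\<integral>\<^sup>+t. indicator {0..1} t * ennreal ((f (b + (t / 2) *\<^sub>R (a - b)))^2) \<partial>lborel)
        <= ennreal (1/2) * ennreal (C1 * Q) + ennreal (1/2) * ennreal (C2 * Q)"
      unfolding Q_def by (intro add_mono mult_left_mono C1(2) C2(2) f) auto
    also have "... = ennreal ((1/2 * C1 + 1/2 * C2) * Q)"
      using C1(1) C2(1) Q
      by (subst (1 2) ennreal_mult[symmetric], simp_all, subst ennreal_plus[symmetric], simp_all add: algebra_simps)
    finally have "(\<integral>\<^sup>+x. ennreal ((f x)^2) \<partial>edge_measure e) <= ennreal (dist a b) * ennreal ((1/2 * C1 + 1/2 * C2) * Q)"
      by (simp add: mult_left_mono)
    also have "... = ennreal (C * Q)"
      using C1(1) C2(1) Q by (subst ennreal_mult[symmetric]) (simp_all add: C_def mult.assoc)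
    finally show ?thesis by (simp add: Q_def)
  qed
  have L: "f : L2 (edge_measure e)" if f: "smooth f" for f
  proof -
    have "f : borel_measurable (edge_measure e)" by (rule measurable_edge_measure[OF smooth_measurable[OF f]])
    then show ?thesis using est[OF f] by (simp add: L2_iff_nn_integral order_le_less_trans)
  qed
  have "(L2norm (edge_measure e) f)^2 <= C * pd_sq (interior K) 1 f" if f: "smooth f" for f
    using est[OF f] pd_sq_nonneg C0 unfolding L2norm_nn_integral[OF L[OF f], symmetric]
    by (subst (asm) ennreal_le_iff) auto
  then show ?thesis using that C0 L by blast
qed

lemma simplex_body:
  assumes "2 simplex (K :: (real^2) set)"
  shows "convex K" "compact K" "interior K ~= {}" "bounded (interior K)" "interior K : sets lebesgue"
proof -
  obtain a b c where "is_triangle a b c K" using simplex_triangle[OF assms] by blast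
  from triangle_body[OF this] show K: "convex K" "compact K" "interior K ~= {}" by auto
  show "bounded (interior K)" by (rule bounded_subset[OF compact_imp_bounded[OF K(2)] interior_subset])
  show "interior K : sets lebesgue" by auto
qed

lemma Hs_norm_smooth_tendsto_iff:
  assumes D: "open D" "bounded D" and f: "\<And>n. smooth (f n)" and w: "w : Hs (real m) D"
    and h: "\<And>al. length al <= m ==> is_weak_pd D al w (h al)"
  shows "(%n. Hs_norm (real m) D (f n - w)) \<longlonglongrightarrow> 0 \<longleftrightarrow>
    (\<forall>al. length al <= m \<longrightarrow> (%n. L2normd D (%x. pd al (f n) x - h al x)) \<longlonglongrightarrow> 0)"
proof -
  have Dm: "D : sets lebesgue" using D by auto
  show ?thesis
    by (rule Hs_norm_tendsto_iff[OF D(1)])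
      (use w h f in \<open>auto simp: Hs_nat intro: smooth_L2d D Dm smooth_is_weak_pd\<close>)
qed

text \<open>By the trace inequality the restrictions of the approximants to the edge form a Cauchy
  sequence; its limit is the trace.\<close>

lemma trace_exists:
  assumes K: "2 simplex K" and e: "e edge_of K" and w: "w : Hs 1 (interior K)"
    and f: "\<And>n. smooth (f n)" "(%n. Hs_norm 1 (interior K) (f n - w)) \<longlonglongrightarrow> 0"
  shows "\<exists>\<tau>. is_trace K e w \<tau>"
proof -
  note body = simplex_body[OF K]
  obtain C where C: "C \<ge> 0" "\<And>f. smooth f ==> f : L2 (edge_measure e)"
    "\<And>f. smooth f ==> (L2norm (edge_measure e) f)^2 <= C * pd_sq (interior K) 1 f"
    using trace_inequality[OF K e] by blast
  have wk: "is_weak_pd (interior K) al w (weak_pd (interior K) al w)" if "length al <= 1" for al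
    using w that by (intro weak_pd_is) (simp add: Hs_1)
  have lim: "(%n. L2normd (interior K) (%x. pd al (f n) x - weak_pd (interior K) al w x)) \<longlonglongrightarrow> 0" if "length al <= 1" for al
    using Hs_norm_smooth_tendsto_iff[of "interior K" f w 1, OF open_interior body(4) f(1) _ wk] w f(2) that by simp
  have "\<exists>\<tau>\<in>L2 (edge_measure e). (%n. L2norm (edge_measure e) (%x. f n x - \<tau> x)) \<longlonglongrightarrow> 0"
  proof (rule L2_complete)
    show "f n : L2 (edge_measure e)" for n by (rule C(2)[OF f(1)])
    fix d :: real assume d: "d > 0"
    have "d^2 / (C + 1) > 0" using d C(1) by simp
    then obtain N where N: "\<forall>i\<ge>N. \<forall>j\<ge>N. pd_sq (interior K) 1 (%x. f i x - f j x) < d^2 / (C + 1)"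
      using pd_sq_Cauchy[where w = "%al. weak_pd (interior K) al w" and m = 1, OF body(4,5) f(1) is_weak_pd_L2[OF wk] lim] by blast
    have "L2norm (edge_measure e) (%x. f i x - f j x) < d" if "i \<ge> N" "j \<ge> N" for i j
    proof -
      have s: "smooth (%x. f i x - f j x)" using smooth_lin[OF f(1)[of i] f(1)[of j], of 1 "-1"] by simp
      have "(L2norm (edge_measure e) (%x. f i x - f j x))^2 <= C * pd_sq (interior K) 1 (%x. f i x - f j x)" by (rule C(3)[OF s])
      also have "... <= C * (d^2 / (C + 1))" using N that C(1) by (intro mult_left_mono) (auto intro: less_imp_le)
      also have "... < d^2" using C(1) d by (simp add: field_simps)
      finally show ?thesis by (rule power2_less_imp_less) (use d in simp)
    qed
    then show "\<exists>N. \<forall>m\<ge>N. \<forall>n\<ge>N. L2norm (edge_measure e) (%x. f m x - f n x) < d" by blast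
  qed
  then show ?thesis using f unfolding is_trace_def by (auto simp: fun_diff_def)
qed

text \<open>Two approximating sequences both converge to w in H^1, so by the trace inequality their
  restrictions to the edge approach each other, and so do the traces.\<close>

lemma is_trace_unique:
  assumes K: "2 simplex K" and e: "e edge_of K" and w: "w : Hs 1 (interior K)"
    and t: "is_trace K e w \<tau>" "is_trace K e w \<tau>'"
  shows "AE x in edge_measure e. \<tau> x = \<tau>' x"
proof -
  note body = simplex_body[OF K]
  obtain C where C: "C \<ge> 0" "\<And>f. smooth f ==> f : L2 (edge_measure e)"
    "\<And>f. smooth f ==> (L2norm (edge_measure e) f)^2 <= C * pd_sq (interior K) 1 f"
    using trace_inequality[OF K e] by blast
  have tL: "\<tau> : L2 (edge_measure e)" "\<tau>' : L2 (edge_measure e)" using t by (auto simp: is_trace_def)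
  obtain f g where fg: "\<And>n. smooth (f n)" "(%n. Hs_norm 1 (interior K) (f n - w)) \<longlonglongrightarrow> 0"
      "(%n. L2norm (edge_measure e) (f n - \<tau>)) \<longlonglongrightarrow> 0"
    "\<And>n. smooth (g n)" "(%n. Hs_norm 1 (interior K) (g n - w)) \<longlonglongrightarrow> 0"
      "(%n. L2norm (edge_measure e) (g n - \<tau>')) \<longlonglongrightarrow> 0"
    using t unfolding is_trace_def by blast
  have wk: "is_weak_pd (interior K) al w (weak_pd (interior K) al w)" if "length al <= 1" for al
    using w that by (intro weak_pd_is) (simp add: Hs_1)
  define E where "E f n = (\<Sum>al | length al <= 1. (L2normd (interior K) (%x. pd al (f n) x - weak_pd (interior K) al w x))^2)" for f and n :: nat
  have E0: "E f \<longlonglongrightarrow> 0" if "\<And>n. smooth (f n)" "(%n. Hs_norm 1 (interior K) (f n - w)) \<longlonglongrightarrow> 0" for f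
  proof -
    have "(%n. L2normd (interior K) (%x. pd al (f n) x - weak_pd (interior K) al w x)) \<longlonglongrightarrow> 0" if "length al <= 1" for al
      using Hs_norm_smooth_tendsto_iff[of "interior K" f w 1, OF open_interior body(4) \<open>\<And>n. smooth (f n)\<close> _ wk] w
        \<open>(%n. Hs_norm 1 (interior K) (f n - w)) \<longlonglongrightarrow> 0\<close> that by simp
    then have "E f \<longlonglongrightarrow> (\<Sum>al\<in>{al::2 list. length al <= 1}. 0^2)"
      unfolding E_def by (intro tendsto_sum tendsto_power) auto
    then show ?thesis by simp
  qed
  have "L2norm (edge_measure e) (%x. \<tau> x - \<tau>' x) <= L2norm (edge_measure e) (f n - \<tau>) + sqrt (C * (2 * E f n + 2 * E g n)) + L2norm (edge_measure e) (g n - \<tau>')" for n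
  proof -
    have s: "smooth (%x. f n x - g n x)" using smooth_lin[OF fg(1)[of n] fg(4)[of n], of 1 "-1"] by simp
    have fL: "f n : L2 (edge_measure e)" "g n : L2 (edge_measure e)" using C(2) fg(1,4) by auto
    have "(L2norm (edge_measure e) (%x. f n x - g n x))^2 <= C * pd_sq (interior K) 1 (%x. f n x - g n x)" by (rule C(3)[OF s])
    also have "... <= C * (2 * E f n + 2 * E g n)"
      unfolding E_def by (intro mult_left_mono C(1) pd_sq_diff_le body fg is_weak_pd_L2[OF wk])
    finally have 1: "L2norm (edge_measure e) (%x. f n x - g n x) <= sqrt (C * (2 * E f n + 2 * E g n))" by (rule real_le_rsqrt)
    have "L2norm (edge_measure e) (%x. \<tau> x - \<tau>' x) <= L2norm (edge_measure e) (%x. \<tau> x - f n x) + L2norm (edge_measure e) (%x. f n x - \<tau>' x)"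
      using L2norm_triangle[OF L2_diff[OF tL(1) fL(1)] L2_diff[OF fL(1) tL(2)]] by simp
    moreover have "L2norm (edge_measure e) (%x. f n x - \<tau>' x) <= L2norm (edge_measure e) (%x. f n x - g n x) + L2norm (edge_measure e) (%x. g n x - \<tau>' x)"
      using L2norm_triangle[OF L2_diff[OF fL] L2_diff[OF fL(2) tL(2)]] by simp
    moreover have "L2norm (edge_measure e) (%x. \<tau> x - f n x) = L2norm (edge_measure e) (f n - \<tau>)"
      using L2norm_diff_commute[of _ \<tau>] by (simp add: fun_diff_def)
    moreover have "L2norm (edge_measure e) (%x. g n x - \<tau>' x) = L2norm (edge_measure e) (g n - \<tau>')" by (simp add: fun_diff_def)
    ultimately show ?thesis using 1 by linarith
  qed
  moreover have "(%n. L2norm (edge_measure e) (f n - \<tau>) + sqrt (C * (2 * E f n + 2 * E g n)) + L2norm (edge_measure e) (g n - \<tau>')) \<longlonglongrightarrow> 0 + sqrt (C * (2 * 0 + 2 * 0)) + 0"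
    by (intro tendsto_intros fg E0)
  ultimately have "L2norm (edge_measure e) (%x. \<tau> x - \<tau>' x) <= 0"
    by (intro LIMSEQ_le_const[where a = "L2norm (edge_measure e) (%x. \<tau> x - \<tau>' x)"]) auto
  then have "L2norm (edge_measure e) (%x. \<tau> x - \<tau>' x) = 0" by (simp add: antisym)
  from L2norm_eq_0_AE[OF L2_diff[OF tL] this] show ?thesis by simp
qed

text \<open>w agrees with the combination only almost everywhere, since the weak derivative selected
  for a sum need not be the sum of the selected ones.\<close>

lemma is_trace_lin:
  assumes K: "2 simplex K" and w: "w1 : Hs 1 (interior K)" "w2 : Hs 1 (interior K)" "w : Hs 1 (interior K)"
    and ae: "AE x in lebesgue_on (interior K). w x = c * w1 x + d * w2 x"
    and t: "is_trace K e w1 \<tau>1" "is_trace K e w2 \<tau>2" and sL: "\<And>f. smooth f ==> f : L2 (edge_measure e)"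
  shows "is_trace K e w (%x. c * \<tau>1 x + d * \<tau>2 x)"
proof -
  note body = simplex_body[OF K]
  let ?D = "interior K"
  have tL: "\<tau>1 : L2 (edge_measure e)" "\<tau>2 : L2 (edge_measure e)" using t by (auto simp: is_trace_def)
  obtain f g where fg: "\<And>n. smooth (f n)" "(%n. Hs_norm 1 ?D (f n - w1)) \<longlonglongrightarrow> 0"
      "(%n. L2norm (edge_measure e) (f n - \<tau>1)) \<longlonglongrightarrow> 0"
    "\<And>n. smooth (g n)" "(%n. Hs_norm 1 ?D (g n - w2)) \<longlonglongrightarrow> 0"
      "(%n. L2norm (edge_measure e) (g n - \<tau>2)) \<longlonglongrightarrow> 0"
    using t unfolding is_trace_def by blast
  have wk: "is_weak_pd ?D al v (weak_pd ?D al v)" if "v : Hs 1 ?D" "length al <= 1" for al v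
    using that by (intro weak_pd_is) (simp add: Hs_1)
  have wL: "w1 : L2d ?D" "w2 : L2d ?D" "w : L2d ?D" using w by (auto simp: Hs_1)
  have wlin: "is_weak_pd ?D al w (%x. c * weak_pd ?D al w1 x + d * weak_pd ?D al w2 x)" if "length al <= 1" for al
    using is_weak_pd_lin[OF body(5) wL(1,2) wk[OF w(1) that] wk[OF w(2) that], of c d]
      is_weak_pd_cong_fun[OF body(5) ae L2_measurable[OF wL(3)] L2_measurable[OF L2_lin[OF wL(1,2)]], of al] by simp
  define h where "h n x = c * f n x + d * g n x" for n x
  have hs: "smooth (h n)" for n unfolding h_def[abs_def] by (intro smooth_lin fg)
  have sandwich: "(%n. L2norm M (%x. c * (F n x - F0 x) + d * (G n x - G0 x))) \<longlonglongrightarrow> 0"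
    if "\<And>n. F n : L2 M" "\<And>n. G n : L2 M" "F0 : L2 M" "G0 : L2 M"
      "(%n. L2norm M (%x. F n x - F0 x)) \<longlonglongrightarrow> 0" "(%n. L2norm M (%x. G n x - G0 x)) \<longlonglongrightarrow> 0" for F G F0 G0 and M :: "(real^2) measure"
  proof (rule tendsto_sandwich[OF _ _ tendsto_const])
    have "(%n. \<bar>c\<bar> * L2norm M (%x. F n x - F0 x) + \<bar>d\<bar> * L2norm M (%x. G n x - G0 x)) \<longlonglongrightarrow> \<bar>c\<bar> * 0 + \<bar>d\<bar> * 0"
      by (intro tendsto_intros that)
    then show "(%n. \<bar>c\<bar> * L2norm M (%x. F n x - F0 x) + \<bar>d\<bar> * L2norm M (%x. G n x - G0 x)) \<longlonglongrightarrow> 0" by simp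
    show "\<forall>\<^sub>F n in sequentially. L2norm M (%x. c * (F n x - F0 x) + d * (G n x - G0 x)) <= \<bar>c\<bar> * L2norm M (%x. F n x - F0 x) + \<bar>d\<bar> * L2norm M (%x. G n x - G0 x)"
    proof (rule always_eventually, rule allI)
      fix n
      show "L2norm M (%x. c * (F n x - F0 x) + d * (G n x - G0 x)) <= \<bar>c\<bar> * L2norm M (%x. F n x - F0 x) + \<bar>d\<bar> * L2norm M (%x. G n x - G0 x)"
        using L2norm_triangle[OF L2_cmult[OF L2_diff[OF that(1) that(3)], of c n] L2_cmult[OF L2_diff[OF that(2) that(4)], of d n]]
        by (simp add: L2norm_cmult)
    qed
  qed simp
  have "(%n. Hs_norm (real 1) ?D (h n - w)) \<longlonglongrightarrow> 0"
  proof (subst Hs_norm_smooth_tendsto_iff[OF open_interior body(4) hs _ wlin], safe)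
    show "w : Hs (real 1) ?D" using w by simp
    fix al :: "2 list" assume al: "length al <= 1"
    have l: "(%n. L2normd ?D (%x. pd al (f n) x - weak_pd ?D al w1 x)) \<longlonglongrightarrow> 0"
      "(%n. L2normd ?D (%x. pd al (g n) x - weak_pd ?D al w2 x)) \<longlonglongrightarrow> 0"
      using Hs_norm_smooth_tendsto_iff[of ?D f w1 1, OF open_interior body(4) fg(1) _ wk[OF w(1)]]
        Hs_norm_smooth_tendsto_iff[of ?D g w2 1, OF open_interior body(4) fg(4) _ wk[OF w(2)]] w fg(2,5) al by simp_all
    have "(%n. L2normd ?D (%x. c * (pd al (f n) x - weak_pd ?D al w1 x) + d * (pd al (g n) x - weak_pd ?D al w2 x))) \<longlonglongrightarrow> 0"
      by (rule sandwich[OF _ _ _ _ l])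
        (auto intro!: smooth_L2d smooth_pd fg body is_weak_pd_L2[OF wk[OF _ al]] w)
    moreover have "(%x. pd al (h n) x - (c * weak_pd ?D al w1 x + d * weak_pd ?D al w2 x)) =
       (%x. c * (pd al (f n) x - weak_pd ?D al w1 x) + d * (pd al (g n) x - weak_pd ?D al w2 x))" for n
      unfolding h_def[abs_def] pd_lin[OF fg(1) fg(4)] by (auto simp: algebra_simps)
    ultimately show "(%n. L2normd ?D (%x. pd al (h n) x - (c * weak_pd ?D al w1 x + d * weak_pd ?D al w2 x))) \<longlonglongrightarrow> 0" by simp
  qed
  moreover have "(%n. L2norm (edge_measure e) (h n - (%x. c * \<tau>1 x + d * \<tau>2 x))) \<longlonglongrightarrow> 0"
  proof -
    have "(%n. L2norm (edge_measure e) (%x. c * (f n x - \<tau>1 x) + d * (g n x - \<tau>2 x))) \<longlonglongrightarrow> 0"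
      by (rule sandwich) (use fg tL sL in \<open>auto simp: fun_diff_def\<close>)
    then show ?thesis by (simp add: h_def fun_diff_def algebra_simps)
  qed
  ultimately show ?thesis unfolding is_trace_def using hs L2_lin[OF tL] by auto
qed

lemma weak_pd_Cons_is:
  assumes v: "v : Hs 2 D" and D: "D : sets lebesgue"
  shows "weak_pd D [i] v : Hs 1 D" "\<And>al. length al <= 1 ==> is_weak_pd D al (weak_pd D [i] v) (weak_pd D (i # al) v)"
proof -
  have wk: "is_weak_pd D al v (weak_pd D al v)" if "length al <= 2" for al
    using v that by (intro weak_pd_is) (simp add: Hs_2)
  show *: "is_weak_pd D al (weak_pd D [i] v) (weak_pd D (i # al) v)" if "length al <= 1" for al
    unfolding is_weak_pd_def
  proof (intro conjI ballI)
    show "weak_pd D (i # al) v : L2d D" using that by (intro is_weak_pd_L2[OF wk]) simp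
    fix phi assume phi: "phi : test_functions D"
    have "ipd D v (pd (i # al) phi) = - ipd D (weak_pd D [i] v) (pd al phi)"
      using is_weak_pd_ip[OF wk[of "[i]"] test_pd[OF phi, of al]] pd_Cons[of i al phi] by simp
    moreover have "ipd D v (pd (i # al) phi) = - ((- 1) ^ length al * ipd D (weak_pd D (i # al) v) phi)"
      using is_weak_pd_ip[OF wk[of "i # al"] phi] that by simp
    ultimately show "ipd D (weak_pd D [i] v) (pd al phi) = (- 1) ^ length al * ipd D (weak_pd D (i # al) v) phi" by simp
  qed
  have "weak_pd D [i] v : L2d D" by (rule is_weak_pd_L2[OF wk]) simp
  then show "weak_pd D [i] v : Hs 1 D" using * by (auto simp: Hs_1)
qed

lemma trace_on_is:
  assumes K: "2 simplex K" and e: "e edge_of K" and v: "v : Hs 2 (interior K)"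
  shows "is_trace K e (weak_pd (interior K) [i] v) (trace_on K e (weak_pd (interior K) [i] v))"
proof -
  note body = simplex_body[OF K]
  let ?D = "interior K"
  have vL: "v : L2d ?D" using v by (simp add: Hs_2)
  have wk: "is_weak_pd ?D al v (weak_pd ?D al v)" if "length al <= 2" for al
    using v that by (intro weak_pd_is) (simp add: Hs_2)
  obtain f where f: "\<And>n. smooth (f n)" "\<And>al g. is_weak_pd ?D al v g ==> (%n. L2normd ?D (%x. pd al (f n) x - g x)) \<longlonglongrightarrow> 0"
    using smooth_dense_convex[OF body(1-3) vL] by blast
  note w = weak_pd_Cons_is[OF v body(5), where i = i]
  have "(%n. Hs_norm (real 1) ?D (pd [i] (f n) - weak_pd ?D [i] v)) \<longlonglongrightarrow> 0"
  proof (subst Hs_norm_smooth_tendsto_iff[OF open_interior body(4) smooth_pd[OF f(1)] _ w(2)], safe)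
    show "weak_pd ?D [i] v : Hs (real 1) ?D" using w(1) by simp
    fix al :: "2 list" assume al: "length al <= 1"
    \<comment> \<open>\<open>pd\<close> differentiates in the last direction of the list first, hence the commuted order.\<close>
    have "pd al (pd [i] (f n)) = pd (i # al) (f n)" for n
    proof (cases al)
      case (Cons j \<beta>)
      then have "al = [j]" using al by simp
      then show ?thesis using pd_commute[OF f(1)[of n], of j i] pd_Cons[of j "[i]" "f n"] by simp
    qed simp
    moreover have "(%n. L2normd ?D (%x. pd (i # al) (f n) x - weak_pd ?D (i # al) v x)) \<longlonglongrightarrow> 0"
      using al by (intro f(2) wk) simp
    ultimately show "(%n. L2normd ?D (%x. pd al (pd [i] (f n)) x - weak_pd ?D (i # al) v x)) \<longlonglongrightarrow> 0" by simp
  qed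
  then have "\<exists>\<tau>. is_trace K e (weak_pd ?D [i] v) \<tau>"
    using trace_exists[OF K e w(1) smooth_pd[OF f(1)]] by simp
  then show ?thesis unfolding trace_on_def by (rule someI_ex)
qed

text \<open>By uniqueness the selected traces are linear up to null sets of the edge, and
  integration over the edge removes these.\<close>

lemma normal_deriv_integral_lin:
  assumes K: "2 simplex K" and e: "e edge_of K" and v: "v : Hs 2 (interior K)" "w : Hs 2 (interior K)"
  shows "normal_deriv_integral K e (%x. c * v x + d * w x) = c * normal_deriv_integral K e v + d * normal_deriv_integral K e w"
proof -
  note body = simplex_body[OF K]
  let ?D = "interior K" and ?M = "edge_measure e"
  define u where "u x = c * v x + d * w x" for x
  have u: "u : Hs 2 ?D" using Hs_lin[OF open_interior, of v 2 K w c d] v by (simp add: u_def[abs_def])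
  let ?t = "%v i. trace_on K e (weak_pd ?D [i] v)"
  obtain C where sL: "\<And>f. smooth f ==> f : L2 ?M" using trace_inequality[OF K e] by blast
  obtain a b c' where "e = closed_segment a b" using edge_triangle[OF K e] by blast
  then have fin: "finite_measure ?M" by (rule finite_edge_measure)
  have one: "(%x. 1) : L2 ?M" by (rule L2_bounded[OF fin, of _ 1]) auto
  have tL: "?t z i : L2 ?M" if "z : Hs 2 ?D" for z i
    using trace_on_is[OF K e that] by (simp add: is_trace_def)
  have ti: "integrable ?M (?t z i)" if "z : Hs 2 ?D" for z i
    using L2_integrable_mult[OF tL[OF that] one] by simp
  have ae: "AE x in ?M. ?t u i x = c * ?t v i x + d * ?t w i x" for i
  proof -
    have ex: "\<exists>g. is_weak_pd ?D [i] z g" if "z : Hs 2 ?D" for z using that by (simp add: Hs_2)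
    have "AE x in lebesgue_on ?D. weak_pd ?D [i] u x = c * weak_pd ?D [i] v x + d * weak_pd ?D [i] w x"
      unfolding u_def[abs_def] by (rule weak_pd_lin[OF open_interior _ _ ex ex]) (use v in \<open>auto simp: Hs_2\<close>)
    then have "is_trace K e (weak_pd ?D [i] u) (%x. c * ?t v i x + d * ?t w i x)"
      by (intro is_trace_lin[OF K _ _ _ _ trace_on_is[OF K e v(1)] trace_on_is[OF K e v(2)] sL] weak_pd_Cons_is v u body)
    then show ?thesis
      by (rule is_trace_unique[OF K e weak_pd_Cons_is(1)[OF u body(5)] trace_on_is[OF K e u]])
  qed
  have "normal_deriv_integral K e u = (LINT x|?M. (\<Sum>i\<in>UNIV. edge_normal e $ i * (c * ?t v i x + d * ?t w i x)))"
    unfolding normal_deriv_integral_def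
  proof (rule integral_cong_AE)
    have "AE x in ?M. \<forall>i\<in>UNIV. ?t u i x = c * ?t v i x + d * ?t w i x"
      using ae by (intro AE_finite_allI) auto
    then show "AE x in ?M. (\<Sum>i\<in>UNIV. edge_normal e $ i * ?t u i x) = (\<Sum>i\<in>UNIV. edge_normal e $ i * (c * ?t v i x + d * ?t w i x))"
      by eventually_elim simp
  qed (use ti[THEN borel_measurable_integrable] u v in \<open>auto intro!: borel_measurable_sum borel_measurable_times borel_measurable_add\<close>)
  also have "... = (LINT x|?M. c * (\<Sum>i\<in>UNIV. edge_normal e $ i * ?t v i x) + d * (\<Sum>i\<in>UNIV. edge_normal e $ i * ?t w i x))"
    by (rule Bochner_Integration.integral_cong) (auto simp: sum_distrib_left sum.distrib algebra_simps)
  also have "... = c * normal_deriv_integral K e v + d * normal_deriv_integral K e w"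
    unfolding normal_deriv_integral_def using ti v by (subst Bochner_Integration.integral_add) auto
  finally show ?thesis by (simp add: u_def[abs_def])
qed

subsection \<open>The mesh-dependent norm\<close>

lemma sq_lin_bound: "((c * x + d * y)::real)^2 <= 2 * c^2 * x^2 + 2 * d^2 * y^2"
  using sum_squares_bound[of "c * x" "d * y"] by (simp add: power2_sum power_mult_distrib)

lemma jump_lin:
  assumes "e : edges \<T>" "\<And>K. K : edge_patch \<T> e ==> g K = c * g1 K + d * g2 K"
  shows "jump \<T> e g = c * jump \<T> e g1 + d * jump \<T> e g2"
proof -
  have "\<exists>K. K : edge_patch \<T> e" using assms(1) by (auto simp: edges_def edge_patch_def)
  then have "(SOME K. K : edge_patch \<T> e) : edge_patch \<T> e" by (rule someI_ex)
  moreover have "(\<Sum>K'\<in>edge_patch \<T> e - {K}. g K') = c * (\<Sum>K'\<in>edge_patch \<T> e - {K}. g1 K') + d * (\<Sum>K'\<in>edge_patch \<T> e - {K}. g2 K')" for K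
    using assms(2) by (simp add: sum.distrib sum_distrib_left)
  ultimately show ?thesis unfolding jump_def Let_def using assms(2) by (simp add: algebra_simps)
qed

text \<open>Every term is the square of a norm or modulus of something linear in the function, so (a
  + b)^2 <= 2 a^2 + 2 b^2 applies termwise; the loss of a factor is absorbed by the final
  constant.\<close>

lemma mesh_norm_lin_sq:
  assumes m: "mesh_of Om \<T>" and v: "v : Hs_pw 2 \<T>" "w : Hs_pw 2 \<T>"
  shows "(mesh_norm \<T> (%x. c * v x + d * w x))^2 <= 2 * c^2 * (mesh_norm \<T> v)^2 + 2 * d^2 * (mesh_norm \<T> w)^2"
proof -
  have simp: "2 simplex K" if "K : \<T>" for K using m that by (simp add: mesh_of_def)
  have vK: "v : Hs 2 (interior K)" "w : Hs 2 (interior K)" if "K : \<T>" for K using v that by (auto simp: Hs_pw_def)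
  have patch: "K : \<T>" "e edge_of K" if "K : edge_patch \<T> e" for K e using that by (auto simp: edge_patch_def)
  define A where "A v = (\<Sum>K\<in>\<T>. \<Sum>i\<in>UNIV. \<Sum>j\<in>UNIV. (L2normd (interior K) (weak_pd (interior K) [i, j] v))^2)" for v
  define B where "B v = (\<Sum>e\<in>edges \<T>. \<Sum>z\<in>vertices_of e. (jump \<T> e (%K. point_value K v z))^2 / (diameter e)^2)" for v
  define D where "D v = (\<Sum>e\<in>edges \<T>. (jump \<T> e (%K. normal_deriv_integral K e v) / diameter e)^2)" for v
  have N: "(mesh_norm \<T> v)^2 = A v + B v + D v" for v
    unfolding mesh_norm_def A_def B_def D_def by (rule real_sqrt_pow2) (intro add_nonneg_nonneg sum_nonneg; simp)
  let ?u = "%x. c * v x + d * w x"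
  have "A ?u <= 2 * c^2 * A v + 2 * d^2 * A w"
    unfolding A_def sum_distrib_left sum.distrib[symmetric]
  proof (intro sum_mono)
    fix K i j assume K: "K : \<T>"
    let ?D = "interior K"
    have ex: "\<exists>g. is_weak_pd ?D [i,j] v g" "\<exists>g. is_weak_pd ?D [i,j] w g" using vK[OF K] by (auto simp: Hs_2)
    have L: "v : L2d ?D" "w : L2d ?D" using vK[OF K] by (auto simp: Hs_2)
    have "L2normd ?D (weak_pd ?D [i,j] ?u) = L2normd ?D (%x. c * weak_pd ?D [i,j] v x + d * weak_pd ?D [i,j] w x)"
      by (intro L2norm_weak_pd_eq is_weak_pd_lin[OF _ L weak_pd_is[OF ex(1)] weak_pd_is[OF ex(2)]]) auto
    then show "(L2normd ?D (weak_pd ?D [i,j] ?u))^2 <= 2 * c^2 * (L2normd ?D (weak_pd ?D [i,j] v))^2 + 2 * d^2 * (L2normd ?D (weak_pd ?D [i,j] w))^2"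
      using L2norm_lin_sq[OF weak_pd_L2[OF ex(1)] weak_pd_L2[OF ex(2)]] by simp
  qed
  moreover have "B ?u <= 2 * c^2 * B v + 2 * d^2 * B w"
    unfolding B_def sum_distrib_left sum.distrib[symmetric]
  proof (intro sum_mono)
    fix e z assume e: "e : edges \<T>" and z: "z : vertices_of e"
    have "jump \<T> e (%K. point_value K ?u z) = c * jump \<T> e (%K. point_value K v z) + d * jump \<T> e (%K. point_value K w z)"
    proof (rule jump_lin[OF e])
      fix K assume K: "K : edge_patch \<T> e"
      have "z : K" using z edge_of_imp_subset[OF patch(2)[OF K]] by (auto simp: vertices_of_def extreme_point_of_def)
      then show "point_value K ?u z = c * point_value K v z + d * point_value K w z"
        by (intro point_value_lin simp vK patch(1)[OF K])
    qed
    then show "(jump \<T> e (%K. point_value K ?u z))^2 / (diameter e)^2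
      <= 2 * c^2 * ((jump \<T> e (%K. point_value K v z))^2 / (diameter e)^2) + 2 * d^2 * ((jump \<T> e (%K. point_value K w z))^2 / (diameter e)^2)"
      using divide_right_mono[OF sq_lin_bound, of "(diameter e)^2" c _ d] by (simp add: add_divide_distrib)
  qed
  moreover have "D ?u <= 2 * c^2 * D v + 2 * d^2 * D w"
    unfolding D_def sum_distrib_left sum.distrib[symmetric]
  proof (intro sum_mono)
    fix e assume e: "e : edges \<T>"
    have "jump \<T> e (%K. normal_deriv_integral K e ?u) = c * jump \<T> e (%K. normal_deriv_integral K e v) + d * jump \<T> e (%K. normal_deriv_integral K e w)"
      by (rule jump_lin[OF e]) (intro normal_deriv_integral_lin simp vK patch)
    then show "(jump \<T> e (%K. normal_deriv_integral K e ?u) / diameter e)^2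
      <= 2 * c^2 * (jump \<T> e (%K. normal_deriv_integral K e v) / diameter e)^2 + 2 * d^2 * (jump \<T> e (%K. normal_deriv_integral K e w) / diameter e)^2"
      unfolding power_divide using divide_right_mono[OF sq_lin_bound, of "(diameter e)^2" c _ d] by (simp add: add_divide_distrib)
  qed
  ultimately show ?thesis unfolding N by (simp add: algebra_simps)
qed

lemma mesh_norm_nonneg: "0 <= mesh_norm \<T> v"
  unfolding mesh_norm_def by (intro real_sqrt_ge_zero add_nonneg_nonneg sum_nonneg) auto

subsection \<open>The Sobolev-Slobodeckij norm as a supremum of continuous functionals on \<open>L\<^sup>2\<close>\<close>

text \<open>The Gagliardo kernel cut off near the diagonal: bounded for each j, which makes the
  truncated form continuous on L2, and increasing in j to the full kernel.\<close>

definition trunc_kernel :: "real => nat => real^2 => real^2 => real" where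
  "trunc_kernel \<sigma> j x y = (if 1 / real (Suc j) <= dist x y then 1 / dist x y powr (2 + 2 * \<sigma>) else 0)"

lemma trunc_kernel_nonneg: "0 <= trunc_kernel \<sigma> j x y"
  and trunc_kernel_commute: "trunc_kernel \<sigma> j x y = trunc_kernel \<sigma> j y x"
  by (simp_all add: trunc_kernel_def dist_commute)

lemma trunc_kernel_le:
  assumes "0 <= \<sigma>" shows "trunc_kernel \<sigma> j x y <= real (Suc j) powr (2 + 2 * \<sigma>)"
proof (cases "1 / real (Suc j) <= dist x y")
  case True
  have "(1 / real (Suc j)) powr (2 + 2 * \<sigma>) <= dist x y powr (2 + 2 * \<sigma>)"
    using assms True by (intro powr_mono2) auto
  then have "1 / dist x y powr (2 + 2 * \<sigma>) <= 1 / (1 / real (Suc j)) powr (2 + 2 * \<sigma>)"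
    by (intro divide_left_mono mult_pos_pos) (auto intro: less_le_trans[of 0 "(1 / real (Suc j)) powr (2 + 2 * \<sigma>)"])
  also have "... = real (Suc j) powr (2 + 2 * \<sigma>)" by (simp add: powr_divide)
  finally show ?thesis using True by (simp add: trunc_kernel_def)
qed (simp add: trunc_kernel_def)

lemma trunc_kernel_mono: "i <= j ==> trunc_kernel \<sigma> i x y <= trunc_kernel \<sigma> j x y"
  unfolding trunc_kernel_def using frac_le[of 1 1 "real (Suc i)" "real (Suc j)"] by auto

lemma trunc_kernel_tendsto:
  "(%j. trunc_kernel \<sigma> j x y * (v x - v y)^2) \<longlonglongrightarrow> (v x - v y)^2 / dist x y powr (2 + 2 * \<sigma>)"
proof (cases "x = y")
  case False
  then obtain j where j: "1 / real (Suc j) < dist x y" using nat_approx_posE[of "dist x y"] by auto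
  have "trunc_kernel \<sigma> i x y * (v x - v y)^2 = (v x - v y)^2 / dist x y powr (2 + 2 * \<sigma>)" if "i \<ge> j" for i
  proof -
    have "1 / real (Suc i) <= 1 / real (Suc j)" using that by (intro divide_left_mono) auto
    then show ?thesis using j by (simp add: trunc_kernel_def)
  qed
  then show ?thesis by (intro tendsto_eventually eventually_sequentiallyI[of j])
qed simp

locale finite_domain =
  fixes Om :: "(real^2) set"
  assumes open_Om: "open Om" and bounded_Om: "bounded Om"
begin

abbreviation "M \<equiv> lebesgue_on Om"
abbreviation "P \<equiv> M \<Otimes>\<^sub>M M"

lemma Om_sets [simp]: "Om : sets lebesgue"
  using open_Om by auto

lemma finite_M: "finite_measure M"
  by (rule finite_measure_lebesgue_on[OF bounded_set_imp_lmeasurable[OF bounded_Om Om_sets]])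

sublocale M: finite_measure M by (rule finite_M)
sublocale PP: pair_sigma_finite M M ..
sublocale FP: finite_measure P
  by (rule finite_measureI) (simp add: M.emeasure_pair_measure_Times space_pair_measure ennreal_mult_eq_top_iff)

lemma const_L2 [simp]: "(%x. c) : L2d Om"
  by (rule L2_bounded[OF finite_M, of _ "\<bar>c\<bar>"]) auto

lemma L2_fst: assumes "v : L2d Om" shows "(%p. v (fst p)) : L2 P"
proof -
  have m[measurable]: "v : borel_measurable M" by (rule L2_measurable[OF assms])
  have "(\<integral>\<^sup>+p. ennreal ((v (fst p))^2) \<partial>P) = (\<integral>\<^sup>+x. \<integral>\<^sup>+y. ennreal ((v x)^2) \<partial>M \<partial>M)"
    by (subst M.nn_integral_fst[symmetric]) auto
  also have "... = ennreal ((L2normd Om v)^2) * emeasure M (space M)"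
    by (simp add: nn_integral_multc L2norm_nn_integral[OF assms])
  also have "... < \<infinity>" using M.emeasure_finite[of "space M"] by (simp only: ennreal_mult_less_top infinity_ennreal_def less_top ennreal_less_top) (simp flip: less_top)
  finally show ?thesis by (subst L2_iff_nn_integral) auto
qed

lemma L2_snd: assumes "v : L2d Om" shows "(%p. v (snd p)) : L2 P"
proof -
  have m[measurable]: "v : borel_measurable M" by (rule L2_measurable[OF assms])
  have "(\<integral>\<^sup>+p. ennreal ((v (snd p))^2) \<partial>P) = (\<integral>\<^sup>+x. \<integral>\<^sup>+y. ennreal ((v y)^2) \<partial>M \<partial>M)"
    by (subst M.nn_integral_fst[symmetric]) auto
  also have "... = ennreal ((L2normd Om v)^2) * emeasure M (space M)"
    by (simp add: L2norm_nn_integral[OF assms])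
  also have "... < \<infinity>" using M.emeasure_finite[of "space M"] by (simp only: ennreal_mult_less_top infinity_ennreal_def less_top ennreal_less_top) (simp flip: less_top)
  finally show ?thesis by (subst L2_iff_nn_integral) auto
qed

lemma dist_measurable: "(%p. dist (fst p) (snd p)) : borel_measurable P"
proof -
  have i: "(%x. x) : borel_measurable M" using id_borel_measurable_lebesgue_on by (simp add: id_def)
  have "(%p. fst p) : borel_measurable P" "(%p. snd p) : borel_measurable P"
    by (rule measurable_compose[OF measurable_fst[of M M] i], rule measurable_compose[OF measurable_snd[of M M] i])
  then show ?thesis by (rule borel_measurable_dist)
qed

lemma trunc_kernel_measurable: "(%p. trunc_kernel \<sigma> j (fst p) (snd p)) : borel_measurable P"
  unfolding trunc_kernel_def using dist_measurable by measurable

lemma L2_mult_bounded: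
  assumes "f : L2 M'" "k : borel_measurable M'" "\<And>x. \<bar>k x\<bar> <= B"
  shows "(%x. k x * f x) : L2 M'"
proof (rule L2_bound[OF _ L2_cmult[OF assms(1), of B]])
  show "(%x. k x * f x) : borel_measurable M'" using assms(2) L2_measurable[OF assms(1)] by measurable
  have "\<bar>k x\<bar> * \<bar>f x\<bar> <= \<bar>B\<bar> * \<bar>f x\<bar>" for x using assms(3)[of x] by (intro mult_right_mono) auto
  then show "AE x in M'. \<bar>k x * f x\<bar> <= \<bar>B * f x\<bar>" by (simp add: abs_mult)
qed

text \<open>Its norm in L2 of the product is the truncated Gagliardo seminorm, so that
  Cauchy-Schwarz becomes available for it.\<close>

definition quot :: "real => nat => sfun => (real^2) \<times> (real^2) => real" where
  "quot \<sigma> j v p = sqrt (trunc_kernel \<sigma> j (fst p) (snd p)) * (v (fst p) - v (snd p))"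

lemma quot_L2:
  assumes "0 <= \<sigma>" "v : L2d Om" shows "quot \<sigma> j v : L2 P"
  unfolding quot_def[abs_def]
proof (rule L2_mult_bounded)
  show "(%p. v (fst p) - v (snd p)) : L2 P" by (intro L2_diff L2_fst L2_snd assms)
  show "(%p. sqrt (trunc_kernel \<sigma> j (fst p) (snd p))) : borel_measurable P"
    using trunc_kernel_measurable by measurable
  show "\<bar>sqrt (trunc_kernel \<sigma> j (fst p) (snd p))\<bar> <= sqrt (real (Suc j) powr (2 + 2 * \<sigma>))" for p
    using trunc_kernel_le[OF assms(1), of j] by (simp add: trunc_kernel_nonneg)
qed

lemma gagliardo_P:
  assumes "v : borel_measurable M"
  shows "gagliardo_sq \<sigma> Om v = (\<integral>\<^sup>+p. ennreal ((v (fst p) - v (snd p))^2 / dist (fst p) (snd p) powr (2 + 2 * \<sigma>)) \<partial>P)"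
proof -
  note [measurable] = assms dist_measurable
  have m: "(%p. ennreal ((v (fst p) - v (snd p))^2 / dist (fst p) (snd p) powr (2 + 2 * \<sigma>))) : borel_measurable P" by measurable
  show ?thesis unfolding gagliardo_sq_def by (subst M.nn_integral_fst[OF m, symmetric]) simp
qed

lemma quot_norm_nn:
  assumes "0 <= \<sigma>" "v : L2d Om"
  shows "ennreal ((L2norm P (quot \<sigma> j v))^2) = (\<integral>\<^sup>+p. ennreal (trunc_kernel \<sigma> j (fst p) (snd p) * (v (fst p) - v (snd p))^2) \<partial>P)"
  unfolding L2norm_nn_integral[OF quot_L2[OF assms]] quot_def
  by (simp add: power_mult_distrib trunc_kernel_nonneg)

lemma quot_norm_le:
  assumes "0 <= \<sigma>" "v : L2d Om" "gagliardo_sq \<sigma> Om v < \<infinity>"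
  shows "(L2norm P (quot \<sigma> j v))^2 <= enn2real (gagliardo_sq \<sigma> Om v)"
proof -
  have "ennreal ((L2norm P (quot \<sigma> j v))^2) <= gagliardo_sq \<sigma> Om v"
    unfolding quot_norm_nn[OF assms(1,2)] gagliardo_P[OF L2_measurable[OF assms(2)]]
  proof (intro nn_integral_mono ennreal_leI)
    fix p :: "(real^2) \<times> (real^2)"
    show "trunc_kernel \<sigma> j (fst p) (snd p) * (v (fst p) - v (snd p))^2 <= (v (fst p) - v (snd p))^2 / dist (fst p) (snd p) powr (2 + 2 * \<sigma>)"
      by (simp add: trunc_kernel_def)
  qed
  then show ?thesis using assms(3) by (metis enn2real_ennreal enn2real_mono zero_le_power2 infinity_ennreal_def)
qed

lemma quot_norm_tendsto:
  assumes "0 <= \<sigma>" "v : L2d Om" "gagliardo_sq \<sigma> Om v < \<infinity>"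
  shows "(%j. (L2norm P (quot \<sigma> j v))^2) \<longlonglongrightarrow> enn2real (gagliardo_sq \<sigma> Om v)"
proof -
  note [measurable] = L2_measurable[OF assms(2)] trunc_kernel_measurable
  have "(%j. \<integral>\<^sup>+p. ennreal (trunc_kernel \<sigma> j (fst p) (snd p) * (v (fst p) - v (snd p))^2) \<partial>P) \<longlonglongrightarrow> gagliardo_sq \<sigma> Om v"
    unfolding gagliardo_P[OF L2_measurable[OF assms(2)]]
  proof (rule nn_integral_LIMSEQ)
    show "incseq (%j p. ennreal (trunc_kernel \<sigma> j (fst p) (snd p) * (v (fst p) - v (snd p))\<^sup>2))"
      by (auto simp: incseq_def le_fun_def intro!: ennreal_leI mult_right_mono trunc_kernel_mono)
    show "(%j. ennreal (trunc_kernel \<sigma> j (fst p) (snd p) * (v (fst p) - v (snd p))\<^sup>2))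
        \<longlonglongrightarrow> ennreal ((v (fst p) - v (snd p))\<^sup>2 / dist (fst p) (snd p) powr (2 + 2 * \<sigma>))" for p
      by (rule tendsto_ennrealI[OF trunc_kernel_tendsto])
  qed measurable
  then have "(%j. ennreal ((L2norm P (quot \<sigma> j v))^2)) \<longlonglongrightarrow> gagliardo_sq \<sigma> Om v"
    by (simp add: quot_norm_nn[OF assms(1,2)])
  then have "(%j. enn2real (ennreal ((L2norm P (quot \<sigma> j v))^2))) \<longlonglongrightarrow> enn2real (gagliardo_sq \<sigma> Om v)"
    using assms(3) by (intro tendsto_enn2real) (auto simp: less_top)
  then show ?thesis by simp
qed

text \<open>Swapping the variables changes the sign of k(x, y) (w x - w y), so the term with v(y)
  doubles the one with v(x): the representer is twice the integral of k(x, y) (w x - w y) over y,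
  square integrable because k is bounded.\<close>

lemma quot_ip_repr:
  assumes \<sigma>: "0 <= \<sigma>" and w: "w : L2d Om"
  obtains g where "g : L2d Om" "\<And>v. v : L2d Om ==> ip P (quot \<sigma> j v) (quot \<sigma> j w) = ipd Om v g"
proof -
  define k where "k = (%p. trunc_kernel \<sigma> j (fst p) (snd p))"
  define B where "B = real (Suc j) powr (2 + 2 * \<sigma>)"
  have km: "k : borel_measurable P" unfolding k_def by (rule trunc_kernel_measurable)
  have kB: "\<bar>k p\<bar> <= B" for p
    unfolding k_def B_def using trunc_kernel_le[OF \<sigma>] trunc_kernel_nonneg by simp
  define h where "h p = k p * (w (fst p) - w (snd p))" for p
  have hL: "h : L2 P" unfolding h_def[abs_def] by (intro L2_mult_bounded[OF _ km kB] L2_diff L2_fst L2_snd w)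
  have hm[measurable]: "h : borel_measurable P" by (rule L2_measurable[OF hL])
  have wm[measurable]: "w : borel_measurable M" by (rule L2_measurable[OF w])
  define g where "g x = 2 * (LINT y|M. h (x, y))" for x
  have gm: "g : borel_measurable M" unfolding g_def by measurable
  have wi: "integrable M w" using L2_integrable_mult[OF w const_L2[of 1]] by simp
  have gb: "\<bar>g x\<bar> <= \<bar>2 * B * measure M (space M) * \<bar>w x\<bar> + 2 * B * (LINT y|M. \<bar>w y\<bar>)\<bar>" for x
  proof -
    have hb: "\<bar>h (x, y)\<bar> <= B * (\<bar>w x\<bar> + \<bar>w y\<bar>)" for y
      unfolding h_def abs_mult using kB[of "(x, y)"] by (intro mult_mono) auto
    have ib: "integrable M (%y. B * (\<bar>w x\<bar> + \<bar>w y\<bar>))" using wi by (intro integrable_mult_right Bochner_Integration.integrable_add) auto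
    have "\<bar>LINT y|M. h (x, y)\<bar> <= (LINT y|M. B * (\<bar>w x\<bar> + \<bar>w y\<bar>))"
    proof (cases "integrable M (%y. h (x, y))")
      case True
      then show ?thesis by (intro order_trans[OF integral_abs_bound integral_mono] ib hb) auto
    next
      case False
      have "0 <= B" by (simp add: B_def)
      then show ?thesis using not_integrable_integral_eq[OF False] by (simp add: integral_nonneg_AE)
    qed
    also have "... = B * (measure M (space M) * \<bar>w x\<bar> + (LINT y|M. \<bar>w y\<bar>))"
      using wi by (simp only: integral_mult_right_zero, subst Bochner_Integration.integral_add) (auto simp only: integrable_const integrable_abs lebesgue_integral_const real_scaleR_def)
    finally show ?thesis unfolding g_def by (simp add: abs_mult algebra_simps)
  qed
  have gL: "g : L2d Om"
  proof (rule L2_bound[OF gm])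
    have "(%x. \<bar>w x\<bar>) : L2d Om" using w by (simp add: L2_def)
    then show "(%x. 2 * B * measure M (space M) * \<bar>w x\<bar> + 2 * B * (LINT y|M. \<bar>w y\<bar>)) : L2d Om"
      by (intro L2_add L2_cmult const_L2)
    show "AE x in M. \<bar>g x\<bar> <= \<bar>2 * B * measure M (space M) * \<bar>w x\<bar> + 2 * B * (LINT y|M. \<bar>w y\<bar>)\<bar>" using gb by simp
  qed
  have "ip P (quot \<sigma> j v) (quot \<sigma> j w) = ipd Om v g" if v: "v : L2d Om" for v
  proof -
    have vm[measurable]: "v : borel_measurable M" by (rule L2_measurable[OF v])
    have i1: "integrable P (%p. v (fst p) * h p)" by (rule L2_integrable_mult[OF L2_fst[OF v] hL])
    have i2: "integrable P (%p. v (snd p) * h p)" by (rule L2_integrable_mult[OF L2_snd[OF v] hL])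
    have "ip P (quot \<sigma> j v) (quot \<sigma> j w) = (LINT p|P. v (fst p) * h p - v (snd p) * h p)"
      unfolding ip_def quot_def h_def k_def
      by (rule Bochner_Integration.integral_cong) (auto simp: trunc_kernel_nonneg algebra_simps simp flip: real_sqrt_mult mult.assoc)
    also have "... = (LINT p|P. v (fst p) * h p) - (LINT p|P. v (snd p) * h p)"
      by (rule Bochner_Integration.integral_diff[OF i1 i2])
    also have "(LINT p|P. v (snd p) * h p) = (LINT p|P. - (v (fst p) * h p))"
    proof -
      have "(LINT p|P. v (snd p) * h p) = (LINT (x, y)|P. v (snd (y, x)) * h (y, x))"
        by (rule PP.integral_product_swap[symmetric]) measurable
      also have "... = (LINT p|P. - (v (fst p) * h p))"
        by (rule Bochner_Integration.integral_cong)
          (auto simp: h_def k_def case_prod_beta trunc_kernel_commute[of \<sigma> j] algebra_simps)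
      finally show ?thesis .
    qed
    also have "(LINT p|P. v (fst p) * h p) - (LINT p|P. - (v (fst p) * h p)) = 2 * (LINT p|P. v (fst p) * h p)" by simp
    also have "(LINT p|P. v (fst p) * h p) = (LINT x|M. LINT y|M. v x * h (x, y))"
      using PP.integral_fst'[OF i1] by simp
    also have "2 * ... = ipd Om v g"
      unfolding ip_def g_def by (simp flip: integral_mult_right_zero) (simp add: mult_ac)
    finally show ?thesis .
  qed
  then show ?thesis using that gL by blast
qed

text \<open>The inner product with w, normalised, attains the norm, but it involves derivatives and
  a singular kernel. Truncating the kernel makes its representers elements of L2; replacing these by
  test functions moves all derivatives away from z. Both changes cost at most e. Bounds in time,
  known only for products with elements of L2, thus reach the norm.\<close>

lemma Hs_norm_dual:
  assumes s: "0 <= s" and w: "w : Hs s Om" and e: "0 < e"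
  obtains v where "v : L2d Om" "\<And>z. z : Hs s Om ==> \<bar>ipd Om z v\<bar> <= Hs_norm s Om z"
    "Hs_norm s Om w <= ipd Om w v + e"
proof (cases "Hs_norm s Om w <= e")
  case True
  have "0 <= Hs_norm s Om z" for z
    unfolding Hs_norm_def Let_def by (auto intro!: add_nonneg_nonneg sum_nonneg mult_nonneg_nonneg simp: frac_lt_1 less_imp_le)
  then show ?thesis using True that[of "%x. 0"] by (simp add: ip_commute[of _ _ "%x. 0"])
next
  case False
  define m where "m = nat \<lfloor>s\<rfloor>"
  define \<sigma> where "\<sigma> = frac s"
  have \<sigma>: "0 <= \<sigma>" "\<sigma> < 1" by (simp_all add: \<sigma>_def frac_lt_1)
  \<comment> \<open>For integer s there is no Gagliardo term, hence the empty index set.\<close>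
  let ?A = "{al :: 2 list. length al <= m}" and ?B = "if \<sigma> = 0 then {} else {al :: 2 list. length al = m}"
  have fin: "finite ?A" "finite ?B" by (auto simp: finite_multi_index)
  have BA: "?B \<subseteq> ?A" by auto
  let ?D = "%al z. weak_pd Om al z"
  have wk: "is_weak_pd Om al z (?D al z)" if "z : Hs s Om" "al : ?A" for z al
    using that by (intro weak_pd_is) (auto simp: Hs_def m_def Let_def)
  have DL: "?D al z : L2d Om" if "z : Hs s Om" "al : ?A" for z al by (rule is_weak_pd_L2[OF wk[OF that]])
  have gag: "gagliardo_sq \<sigma> Om (?D al z) < \<infinity>" if "z : Hs s Om" "al : ?B" for z al
    using that by (auto simp: Hs_def m_def \<sigma>_def Let_def split: if_splits)
  have N: "Hs_norm s Om z = sqrt ((\<Sum>al\<in>?A. (L2normd Om (?D al z))^2) + (\<Sum>al\<in>?B. (1 - \<sigma>) * enn2real (gagliardo_sq \<sigma> Om (?D al z))))" for z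
    by (simp add: Hs_norm_def m_def \<sigma>_def Let_def sum_distrib_left)
  have N0: "0 <= Hs_norm s Om z" for z
    unfolding N using \<sigma> by (intro real_sqrt_ge_zero add_nonneg_nonneg sum_nonneg) auto
  have Nsq: "(Hs_norm s Om z)^2 = (\<Sum>al\<in>?A. (L2normd Om (?D al z))^2) + (\<Sum>al\<in>?B. (1 - \<sigma>) * enn2real (gagliardo_sq \<sigma> Om (?D al z)))" for z
    unfolding N using \<sigma> by (intro real_sqrt_pow2 add_nonneg_nonneg sum_nonneg) auto
  \<comment> \<open>The squared norm with the truncated kernel: below the squared norm for every z,
    and approaching it at w.\<close>
  define b where "b j z = (\<Sum>al\<in>?A. (L2normd Om (?D al z))^2) + (\<Sum>al\<in>?B. (1 - \<sigma>) * (L2norm P (quot \<sigma> j (?D al z)))^2)" for j z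
  have b0: "0 <= b j z" for j z unfolding b_def using \<sigma> by (intro add_nonneg_nonneg sum_nonneg) auto
  have bN: "b j z <= (Hs_norm s Om z)^2" if "z : Hs s Om" for j z
    unfolding b_def Nsq using \<sigma> BA
    by (intro add_left_mono sum_mono mult_left_mono quot_norm_le DL gag that) auto
  have "(%j. b j w) \<longlonglongrightarrow> (Hs_norm s Om w)^2"
    unfolding b_def Nsq using \<sigma> BA
    by (intro tendsto_intros quot_norm_tendsto DL gag w) auto
  then have "(%j. sqrt (b j w)) \<longlonglongrightarrow> sqrt ((Hs_norm s Om w)^2)" by (rule tendsto_real_sqrt)
  then have "\<forall>\<^sub>F j in sequentially. Hs_norm s Om w - e/2 < sqrt (b j w)"
    using e N0[of w] by (intro order_tendstoD) auto
  then obtain j where j: "Hs_norm s Om w - e/2 < sqrt (b j w)" using eventually_happens' sequentially_bot by blast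
  define \<beta> where "\<beta> = sqrt (b j w)"
  have \<beta>: "\<beta> > Hs_norm s Om w - e/2" "\<beta> > 0" "2 * \<beta> \<ge> Hs_norm s Om w" "\<beta>^2 = b j w"
  proof -
    show 1: "\<beta> > Hs_norm s Om w - e/2" using j by (simp add: \<beta>_def)
    show "\<beta> > 0" "2 * \<beta> \<ge> Hs_norm s Om w" using 1 False e by linarith+
    show "\<beta>^2 = b j w" using b0[of j w] by (simp add: \<beta>_def)
  qed
  have "\<forall>al\<in>?A. \<exists>g. g : L2d Om \<and> (\<forall>z\<in>Hs s Om. ipd Om (?D al z) g =
      ipd Om (?D al z) (?D al w) + (if al : ?B then (1 - \<sigma>) * ip P (quot \<sigma> j (?D al z)) (quot \<sigma> j (?D al w)) else 0))"
  proof
    fix al assume al: "al : ?A"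
    obtain g where g: "g : L2d Om" "\<And>v. v : L2d Om ==> ip P (quot \<sigma> j v) (quot \<sigma> j (?D al w)) = ipd Om v g"
      using quot_ip_repr[OF \<sigma>(1) DL[OF w al]] by blast
    let ?g = "%x. 1 * ?D al w x + (if al : ?B then 1 - \<sigma> else 0) * g x"
    have "?g : L2d Om" by (intro L2_lin DL w al g)
    moreover have "ipd Om (?D al z) ?g = ipd Om (?D al z) (?D al w) + (if al : ?B then (1 - \<sigma>) * ip P (quot \<sigma> j (?D al z)) (quot \<sigma> j (?D al w)) else 0)"
      if "z : Hs s Om" for z
      by (subst ip_lin_right[OF DL[OF w al] g(1) DL[OF that al]]) (simp add: g(2)[OF DL[OF that al]])
    ultimately show "\<exists>g. g : L2d Om \<and> (\<forall>z\<in>Hs s Om. ipd Om (?D al z) g =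
      ipd Om (?D al z) (?D al w) + (if al : ?B then (1 - \<sigma>) * ip P (quot \<sigma> j (?D al z)) (quot \<sigma> j (?D al w)) else 0))"
      by blast
  qed
  then obtain g where g: "\<And>al. al : ?A ==> g al : L2d Om"
    "\<And>al z. al : ?A ==> z : Hs s Om ==> ipd Om (?D al z) (g al) =
      ipd Om (?D al z) (?D al w) + (if al : ?B then (1 - \<sigma>) * ip P (quot \<sigma> j (?D al z)) (quot \<sigma> j (?D al w)) else 0)"
    by metis
  \<comment> \<open>The inner product belonging to \<open>b j\<close>, with w in its second slot;
    hence F w = \<beta>^2 and |F z| <= \<beta> times the norm of z.\<close>
  define F where "F z = (\<Sum>al\<in>?A. ipd Om (?D al z) (g al))" for z
  have F: "F z = (\<Sum>al\<in>?A. ipd Om (?D al z) (?D al w)) + (\<Sum>al\<in>?B. (1 - \<sigma>) * ip P (quot \<sigma> j (?D al z)) (quot \<sigma> j (?D al w)))"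
    if "z : Hs s Om" for z
  proof -
    have "F z = (\<Sum>al\<in>?A. ipd Om (?D al z) (?D al w)) + (\<Sum>al\<in>?A. if al : ?B then (1 - \<sigma>) * ip P (quot \<sigma> j (?D al z)) (quot \<sigma> j (?D al w)) else 0)"
      unfolding F_def by (subst sum.distrib[symmetric], rule sum.cong) (auto simp only: g(2) that)
    also have "(\<Sum>al\<in>?A. if al : ?B then (1 - \<sigma>) * ip P (quot \<sigma> j (?D al z)) (quot \<sigma> j (?D al w)) else 0)
      = (\<Sum>al\<in>?B. (1 - \<sigma>) * ip P (quot \<sigma> j (?D al z)) (quot \<sigma> j (?D al w)))"
      using BA by (simp only: sum.inter_restrict[OF fin(1), symmetric] Int_absorb1)
    finally show ?thesis .
  qed
  have Fw: "F w = \<beta>^2" unfolding F[OF w] \<beta>(4) b_def by (simp only: L2norm_sq)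
  have Fz: "\<bar>F z\<bar> <= Hs_norm s Om z * \<beta>" if z: "z : Hs s Om" for z
  proof -
    \<comment> \<open>A disjoint union of the two index sets gives a single finite sum, to which
      Cauchy-Schwarz for finite sums applies.\<close>
    define I where "I = Inl ` ?A \<union> Inr ` ?B"
    define p where "p i z = (case i of Inl al => L2normd Om (?D al z) | Inr al => sqrt (1 - \<sigma>) * L2norm P (quot \<sigma> j (?D al z)))" for i and z :: sfun
    have finI: "finite I" using fin by (simp add: I_def)
    have sumI: "(\<Sum>i\<in>I. f i) = (\<Sum>al\<in>?A. f (Inl al)) + (\<Sum>al\<in>?B. f (Inr al))" for f :: "_ => real"
      unfolding I_def by (subst sum.union_disjoint) (auto simp: fin sum.reindex simp del: if_split)
    have psq: "(\<Sum>i\<in>I. (p i y)^2) = b j y" for y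
      unfolding sumI b_def p_def using \<sigma> by (simp add: power_mult_distrib)
    have "\<bar>F z\<bar> <= (\<Sum>al\<in>?A. \<bar>ipd Om (?D al z) (?D al w)\<bar>) + (\<Sum>al\<in>?B. \<bar>(1 - \<sigma>) * ip P (quot \<sigma> j (?D al z)) (quot \<sigma> j (?D al w))\<bar>)"
      unfolding F[OF z] by (intro order_trans[OF abs_triangle_ineq] add_mono sum_abs)
    also have "... <= (\<Sum>i\<in>I. \<bar>p i z\<bar> * \<bar>p i w\<bar>)"
      unfolding sumI
    proof (intro add_mono sum_mono)
      fix al assume "al : ?A"
      then show "\<bar>ipd Om (?D al z) (?D al w)\<bar> <= \<bar>p (Inl al) z\<bar> * \<bar>p (Inl al) w\<bar>"
        using ip_Cauchy_Schwarz[OF DL[OF z] DL[OF w]] by (simp add: p_def)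
    next
      fix al assume al: "al : ?B"
      then have "\<bar>ip P (quot \<sigma> j (?D al z)) (quot \<sigma> j (?D al w))\<bar> <= L2norm P (quot \<sigma> j (?D al z)) * L2norm P (quot \<sigma> j (?D al w))"
        using BA by (intro ip_Cauchy_Schwarz quot_L2 DL z w \<sigma>) auto
      then have "(1 - \<sigma>) * \<bar>ip P (quot \<sigma> j (?D al z)) (quot \<sigma> j (?D al w))\<bar> <= (1 - \<sigma>) * (L2norm P (quot \<sigma> j (?D al z)) * L2norm P (quot \<sigma> j (?D al w)))"
        using \<sigma> by (intro mult_left_mono) auto
      also have "... = \<bar>p (Inr al) z\<bar> * \<bar>p (Inr al) w\<bar>"
        using \<sigma> by (simp add: p_def abs_mult mult_ac flip: mult.assoc[of "sqrt _" "sqrt _"])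
      finally show "\<bar>(1 - \<sigma>) * ip P (quot \<sigma> j (?D al z)) (quot \<sigma> j (?D al w))\<bar> <= \<bar>p (Inr al) z\<bar> * \<bar>p (Inr al) w\<bar>"
        using \<sigma> by (simp add: abs_mult)
    qed
    also have "... <= L2_set (%i. p i z) I * L2_set (%i. p i w) I" by (rule L2_set_mult_ineq)
    also have "... = sqrt (b j z) * \<beta>" unfolding L2_set_def psq \<beta>_def ..
    also have "... <= Hs_norm s Om z * \<beta>"
      using bN[OF z] N0[of z] \<beta>(2) by (intro mult_right_mono real_le_lsqrt) (auto simp: b0)
    finally show ?thesis .
  qed
  define n where "n = real (card ?A) + 1"
  \<comment> \<open>The total perturbation is n \<delta> = e/6 times the norm of z, half of what the
    closing inequality needs after the loss of e/2 in the truncation is multiplied out.\<close>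
  define \<delta> where "\<delta> = e / (6 * n)"
  have n: "n > 0" by (simp add: n_def)
  then have \<delta>: "\<delta> > 0" "n * \<delta> = e / 6" unfolding \<delta>_def using e by simp_all
  have "\<forall>al\<in>?A. \<exists>phi. phi : test_functions Om \<and> L2normd Om (%x. g al x - phi x) < \<delta>"
    using test_dense_L2[OF open_Om g(1) \<delta>(1)] by blast
  then obtain phi where phi: "\<And>al. al : ?A ==> phi al : test_functions Om" "\<And>al. al : ?A ==> L2normd Om (%x. g al x - phi al x) < \<delta>"
    by metis
  \<comment> \<open>Integration by parts: (z, V) is the sum of the inner products of the weak
    derivatives of z with the test functions \<open>phi al\<close>.\<close>
  define V where "V x = (\<Sum>al\<in>?A. (- 1) ^ length al * pd al (phi al) x)" for x
  have VL: "V : L2d Om" unfolding V_def[abs_def]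
    by (intro L2_sum L2_cmult test_L2d[OF test_pd[OF phi(1)]]) auto
  have FV: "\<bar>F z - ipd Om z V\<bar> <= n * \<delta> * Hs_norm s Om z" if z: "z : Hs s Om" for z
  proof -
    have zL: "z : L2d Om" by (rule Hs_L2d[OF z])
    have "ipd Om z V = (\<Sum>al\<in>?A. (- 1) ^ length al * ipd Om z (pd al (phi al)))"
      unfolding V_def[abs_def]
      by (subst ip_sum_right) (auto intro!: L2_cmult test_L2d[OF test_pd[OF phi(1)]] zL simp: ip_cmult_right)
    also have "... = (\<Sum>al\<in>?A. ipd Om (?D al z) (phi al))"
      by (rule sum.cong) (simp_all add: is_weak_pd_ip[OF wk[OF z] phi(1)] flip: power_add mult.assoc)
    finally have zV: "ipd Om z V = (\<Sum>al\<in>?A. ipd Om (?D al z) (phi al))" .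
    have "F z - ipd Om z V = (\<Sum>al\<in>?A. ipd Om (?D al z) (g al) - ipd Om (?D al z) (phi al))"
      unfolding F_def zV sum_subtractf ..
    also have "... = (\<Sum>al\<in>?A. ipd Om (?D al z) (%x. g al x - phi al x))"
      by (rule sum.cong[OF refl], rule ip_diff_right[symmetric]) (auto intro!: DL z g(1) test_L2d[OF phi(1)])
    finally have e1: "F z - ipd Om z V = (\<Sum>al\<in>?A. ipd Om (?D al z) (%x. g al x - phi al x))" .
    have "\<bar>F z - ipd Om z V\<bar> <= (\<Sum>al\<in>?A. Hs_norm s Om z * \<delta>)"
      unfolding e1
    proof (rule order_trans[OF sum_abs sum_mono])
      fix al assume al: "al : ?A"
      have "\<bar>ipd Om (?D al z) (%x. g al x - phi al x)\<bar> <= L2normd Om (?D al z) * L2normd Om (%x. g al x - phi al x)"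
        by (intro ip_Cauchy_Schwarz DL z al L2_diff g test_L2d[OF phi(1)]) auto
      also have "L2normd Om (?D al z) <= Hs_norm s Om z"
      proof (rule power2_le_imp_le[OF _ N0])
        have "(L2normd Om (?D al z))^2 <= (\<Sum>al\<in>?A. (L2normd Om (?D al z))^2)"
          by (rule member_le_sum[OF al]) (auto simp: fin)
        also have "... <= b j z" unfolding b_def using \<sigma> by (auto intro!: sum_nonneg)
        finally show "(L2normd Om (?D al z))^2 <= (Hs_norm s Om z)^2" using bN[OF z, of j] by linarith
      qed
      finally show "\<bar>ipd Om (?D al z) (%x. g al x - phi al x)\<bar> <= Hs_norm s Om z * \<delta>"
        using phi(2)[OF al] N0[of z] by (smt (verit) L2norm_nonneg mult_left_mono mult_right_mono)
    qed
    also have "... <= n * \<delta> * Hs_norm s Om z" using N0[of z] \<delta>(1) by (simp add: n_def algebra_simps)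
    finally show ?thesis .
  qed
  define t where "t = n * \<delta>"
  have t: "t > 0" "t = e/6" using \<delta> e by (simp_all add: t_def)
  \<comment> \<open>Dividing by \<beta> + t rather than \<beta> restores the exact domination by the
    norm after the perturbation of size t.\<close>
  define v where "v x = 1 / (\<beta> + t) * V x" for x
  have ipv: "ipd Om z v = ipd Om z V / (\<beta> + t)" for z unfolding v_def[abs_def] ip_cmult_right by simp
  show ?thesis
  proof (rule that)
    show "v : L2d Om" unfolding v_def[abs_def] by (rule L2_cmult[OF VL])
    fix z assume z: "z : Hs s Om"
    have "\<bar>ipd Om z V\<bar> <= Hs_norm s Om z * (\<beta> + t)"
      using Fz[OF z] FV[OF z] by (simp add: t_def algebra_simps)
    then show "\<bar>ipd Om z v\<bar> <= Hs_norm s Om z"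
      unfolding ipv using \<beta>(2) t(1) by (simp add: pos_divide_le_eq)
  next
    define W where "W = Hs_norm s Om w"
    have 1: "ipd Om w V \<ge> \<beta>^2 - t * W" using FV[OF w] by (simp add: Fw t_def W_def)
    have "(W - e) * (\<beta> + t) <= \<beta>^2 - t * W"
    proof -
      \<comment> \<open>\<beta> exceeds W - e/2, and e/2 = 3 t.\<close>
      have "W - e <= \<beta> - 3 * t" using \<beta>(1) t(2) by (simp add: W_def)
      then have "(W - e) * (\<beta> + t) <= (\<beta> - 3 * t) * (\<beta> + t)" using \<beta>(2) t(1) by (intro mult_right_mono) auto
      also have "... = \<beta>^2 - 2 * \<beta> * t - 3 * t^2" by (simp add: power2_eq_square algebra_simps)
      also have "... <= \<beta>^2 - t * W" proof -
        have "t * W <= t * (2 * \<beta>)" using \<beta>(3) t(1) by (simp add: W_def)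
        then have "t * W <= t * (2 * \<beta>) + 3 * t^2" by (rule order_trans) simp
        then show ?thesis by (simp add: algebra_simps)
      qed
      finally show ?thesis .
    qed
    then have "W - e <= ipd Om w v" unfolding ipv using 1 \<beta>(2) t(1) by (simp add: pos_le_divide_eq)
    then show "Hs_norm s Om w <= ipd Om w v + e" by (simp add: W_def)
  qed
qed

end

subsection \<open>The space \<open>H\<^sup>2\<^sub>0\<close> and the bilinear form\<close>

lemma L2norm_lin_tendsto:
  assumes "\<And>n. v n : L2 M" "v' : L2 M" "\<And>n. w n : L2 M" "w' : L2 M"
    and "(%n. L2norm M (%x. v n x - v' x)) \<longlonglongrightarrow> 0" "(%n. L2norm M (%x. w n x - w' x)) \<longlonglongrightarrow> 0"
  shows "(%n. L2norm M (%x. (c * v n x + d * w n x) - (c * v' x + d * w' x))) \<longlonglongrightarrow> 0"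
proof (rule tendsto_sandwich[OF _ _ tendsto_const])
  show "\<forall>\<^sub>F n in sequentially. L2norm M (%x. (c * v n x + d * w n x) - (c * v' x + d * w' x))
      <= \<bar>c\<bar> * L2norm M (%x. v n x - v' x) + \<bar>d\<bar> * L2norm M (%x. w n x - w' x)"
  proof (intro always_eventually allI)
    fix n
    have "(%x. (c * v n x + d * w n x) - (c * v' x + d * w' x)) = (%x. c * (v n x - v' x) + d * (w n x - w' x))"
      by (auto simp: algebra_simps)
    then show "L2norm M (%x. (c * v n x + d * w n x) - (c * v' x + d * w' x))
      <= \<bar>c\<bar> * L2norm M (%x. v n x - v' x) + \<bar>d\<bar> * L2norm M (%x. w n x - w' x)"
      using L2norm_triangle[of "%x. c * (v n x - v' x)" M "%x. d * (w n x - w' x)"] assms(1-4)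
      by (simp only: L2norm_cmult L2_cmult L2_diff)
  qed
  show "(%n. \<bar>c\<bar> * L2norm M (%x. v n x - v' x) + \<bar>d\<bar> * L2norm M (%x. w n x - w' x)) \<longlonglongrightarrow> 0"
    using tendsto_add[OF tendsto_mult_right_zero[OF assms(5)] tendsto_mult_right_zero[OF assms(6)]] by simp
qed simp

context finite_domain
begin

lemma test_weak_pd: "phi : test_functions Om ==> is_weak_pd Om al phi (pd al phi)"
  by (intro smooth_is_weak_pd test_smooth[of _ Om] bounded_Om Om_sets)

lemma test_L2Om: "phi : test_functions Om ==> phi : L2d Om"
  by (rule test_L2d) auto

lemma H20_Hs: "v : H20 Om ==> v : Hs 2 Om"
  by (simp add: H20_def)

lemma Hs2_L2: "v : Hs 2 Om ==> v : L2d Om" by (rule Hs_L2d)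

lemma Hs2_weak_pd: "v : Hs 2 Om ==> length al <= 2 ==> is_weak_pd Om al v (weak_pd Om al v)"
  by (rule weak_pd_is) (simp add: Hs_2)

lemma H20_L2: "v : H20 Om ==> v : L2d Om" by (intro Hs2_L2 H20_Hs)

lemma H20_iff:
  "v : H20 Om \<longleftrightarrow> v : Hs 2 Om \<and> (\<exists>phi. (\<forall>n. phi n : test_functions Om) \<and>
    (\<forall>al. length al <= 2 \<longrightarrow> (%n. L2normd Om (%x. pd al (phi n) x - weak_pd Om al v x)) \<longlonglongrightarrow> 0))"
proof -
  have "(%n. Hs_norm 2 Om (phi n - v)) \<longlonglongrightarrow> 0 \<longleftrightarrow>
      (\<forall>al. length al <= 2 \<longrightarrow> (%n. L2normd Om (%x. pd al (phi n) x - weak_pd Om al v x)) \<longlonglongrightarrow> 0)"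
    if "v : Hs 2 Om" "\<forall>n. phi n : test_functions Om" for phi
    using Hs_norm_tendsto_iff[OF open_Om, of phi v 2 "%n al. pd al (phi n)" "%al. weak_pd Om al v"] that
    by (simp add: test_L2Om test_weak_pd Hs2_L2 Hs2_weak_pd)
  then show ?thesis unfolding H20_def by (simp cong: conj_cong)
qed

lemma H20_test: "phi : test_functions Om ==> phi : H20 Om"
proof -
  assume t: "phi : test_functions Om"
  have "L2normd Om (%x. pd al phi x - weak_pd Om al phi x) = 0" for al
  proof -
    have w: "is_weak_pd Om al phi (weak_pd Om al phi)" using test_weak_pd[OF t] weak_pd_is by blast
    have "AE x in M. pd al phi x - weak_pd Om al phi x = 0" using is_weak_pd_unique[OF open_Om w test_weak_pd[OF t]] by auto
    moreover have "(%x. pd al phi x - weak_pd Om al phi x) : borel_measurable M"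
      by (intro L2_measurable[OF L2_diff] test_L2Om test_pd t is_weak_pd_L2[OF w])
    ultimately have "L2normd Om (%x. pd al phi x - weak_pd Om al phi x) = L2normd Om (%x. 0)" by (intro L2norm_AE_cong) auto
    then show ?thesis by (simp add: L2norm_def)
  qed
  moreover have "phi : Hs 2 Om" using test_weak_pd[OF t] test_L2Om[OF t] by (auto simp: Hs_2)
  ultimately show ?thesis unfolding H20_iff using t by (auto intro!: exI[of _ "%n. phi"])
qed

lemma weak_pd_lin_H2:
  assumes "v : Hs 2 Om" "w : Hs 2 Om" "length al <= 2"
  shows "AE x in M. weak_pd Om al (%x. c * v x + d * w x) x = c * weak_pd Om al v x + d * weak_pd Om al w x"
  using assms by (intro weak_pd_lin open_Om) (auto simp: Hs_2)

lemma Hs2_lin: "v : Hs 2 Om ==> w : Hs 2 Om ==> (%x. c * v x + d * w x) : Hs 2 Om"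
  using Hs_lin[OF open_Om, of v 2 w c d] by simp

lemma H20_lin:
  assumes v: "v : H20 Om" and w: "w : H20 Om"
  shows "(%x. c * v x + d * w x) : H20 Om"
proof -
  obtain phi where p: "\<And>n. phi n : test_functions Om"
    "\<And>al. length al <= 2 ==> (%n. L2normd Om (%x. pd al (phi n) x - weak_pd Om al v x)) \<longlonglongrightarrow> 0"
    using v unfolding H20_iff by blast
  obtain psi where q: "\<And>n. psi n : test_functions Om"
    "\<And>al. length al <= 2 ==> (%n. L2normd Om (%x. pd al (psi n) x - weak_pd Om al w x)) \<longlonglongrightarrow> 0"
    using w unfolding H20_iff by blast
  note vH = H20_Hs[OF v] and wH = H20_Hs[OF w]
  let ?u = "%x. c * v x + d * w x"
  have uH: "?u : Hs 2 Om" by (rule Hs2_lin[OF vH wH])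
  have "(%n. L2normd Om (%x. pd al (%x. c * phi n x + d * psi n x) x - weak_pd Om al ?u x)) \<longlonglongrightarrow> 0" if a: "length al <= 2" for al
  proof -
    have L1: "\<And>n. pd al (phi n) : L2d Om" "\<And>n. pd al (psi n) : L2d Om"
      by (intro test_L2Om test_pd p(1) q(1))+
    have "weak_pd Om al v : L2d Om" "weak_pd Om al w : L2d Om" "weak_pd Om al ?u : L2d Om"
      by (intro is_weak_pd_L2[OF Hs2_weak_pd] vH wH uH a)+
    note L = L1 this
    have "L2normd Om (%x. pd al (%x. c * phi n x + d * psi n x) x - weak_pd Om al ?u x) =
      L2normd Om (%x. (c * pd al (phi n) x + d * pd al (psi n) x) - (c * weak_pd Om al v x + d * weak_pd Om al w x))" for n
      unfolding pd_lin[OF test_smooth[OF p(1)] test_smooth[OF q(1)]]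
      using weak_pd_lin_H2[OF vH wH a, of c d]
      by (intro L2norm_AE_cong L2_measurable[OF L2_diff] L2_lin L) auto
    then show ?thesis using L2norm_lin_tendsto[OF L(1,3,2,4) p(2)[OF a] q(2)[OF a], of c d] by simp
  qed
  then show ?thesis unfolding H20_iff using uH p(1) q(1)
    by (intro conjI exI[of _ "%n x. c * phi n x + d * psi n x"]) (auto intro: test_lin)
qed

lemma weak_pd_AE_cong:
  assumes "AE x in M. v x = w x" "v : L2d Om" "w : L2d Om"
  shows "weak_pd Om al v = weak_pd Om al w" "is_weak_pd Om al v = is_weak_pd Om al w"
  using is_weak_pd_cong_fun[OF Om_sets assms(1) L2_measurable[OF assms(2)] L2_measurable[OF assms(3)], of al]
  by (simp_all add: weak_pd_def)

text \<open>The initial datum agrees with \<open>u 0\<close> only almost everywhere; these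
  equivalences carry membership, norms and the bilinear form across.\<close>

lemma Hs_AE_cong:
  assumes "AE x in M. v x = w x" "v : L2d Om" "w : L2d Om"
  shows "v : Hs s Om \<longleftrightarrow> w : Hs s Om" "Hs_norm s Om v = Hs_norm s Om w" "v : H20 Om \<longleftrightarrow> w : H20 Om"
    "aform Om v z = aform Om w z"
  by (simp_all add: Hs_def Hs_norm_def H20_iff aform_def Let_def weak_pd_AE_cong[OF assms] assms(2,3))

lemma aform_eq:
  assumes "w : Hs 2 Om" "v : Hs 2 Om"
  shows "aform Om w v = (\<Sum>i\<in>UNIV. \<Sum>j\<in>UNIV. ipd Om (weak_pd Om [i, j] w) (weak_pd Om [i, j] v))"
proof -
  have "integrable M (%x. weak_pd Om [i, j] w x * weak_pd Om [i, j] v x)" for i j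
    by (intro L2_integrable_mult is_weak_pd_L2[OF Hs2_weak_pd] assms) simp_all
  then show ?thesis unfolding aform_def ip_def
    by (subst Bochner_Integration.integral_sum, simp, intro sum.cong refl, subst Bochner_Integration.integral_sum) auto
qed

lemma aform_lin_left:
  assumes "v : Hs 2 Om" "w : Hs 2 Om" "z : Hs 2 Om"
  shows "aform Om (%x. c * v x + d * w x) z = c * aform Om v z + d * aform Om w z"
proof -
  have L: "u : Hs 2 Om ==> weak_pd Om [i, j] u : L2d Om" for u i j
    by (intro is_weak_pd_L2[OF Hs2_weak_pd]) simp_all
  have "ipd Om (weak_pd Om [i, j] (%x. c * v x + d * w x)) (weak_pd Om [i, j] z)
    = c * ipd Om (weak_pd Om [i, j] v) (weak_pd Om [i, j] z) + d * ipd Om (weak_pd Om [i, j] w) (weak_pd Om [i, j] z)" for i j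
  proof -
    have "ipd Om (weak_pd Om [i, j] (%x. c * v x + d * w x)) (weak_pd Om [i, j] z)
      = ipd Om (%x. c * weak_pd Om [i, j] v x + d * weak_pd Om [i, j] w x) (weak_pd Om [i, j] z)"
      by (intro ip_AE_cong weak_pd_lin_H2 L2_measurable[OF L] L2_measurable[OF L2_lin] L Hs2_lin assms) auto
    then show ?thesis by (simp only: ip_lin_left[OF L[OF assms(1)] L[OF assms(2)] L[OF assms(3)]])
  qed
  then show ?thesis
    by (simp only: aform_eq Hs2_lin assms sum.distrib sum_distrib_left)
qed

lemma aform_test:
  assumes w: "w : Hs 2 Om" and t: "phi : test_functions Om"
  shows "aform Om w phi = ipd Om w (%x. \<Sum>i\<in>UNIV. \<Sum>j\<in>UNIV. pd [i, i, j, j] phi x)"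
proof -
  have "ipd Om (weak_pd Om [i, j] w) (weak_pd Om [i, j] phi) = ipd Om w (pd [i, i, j, j] phi)" for i j
  proof -
    have p: "is_weak_pd Om [i, j] phi (weak_pd Om [i, j] phi)" by (intro Hs2_weak_pd H20_Hs H20_test t) simp
    have "ipd Om (weak_pd Om [i, j] w) (weak_pd Om [i, j] phi) = ipd Om (weak_pd Om [i, j] w) (pd [i, j] phi)"
      by (intro ip_AE_cong is_weak_pd_unique[OF open_Om p] test_weak_pd t
         L2_measurable[OF is_weak_pd_L2[OF p]] L2_measurable[OF test_L2Om[OF test_pd]]
         L2_measurable[OF is_weak_pd_L2[OF Hs2_weak_pd]] w) simp_all
    also have "... = ipd Om w (pd [i, j] (pd [i, j] phi))"
      using is_weak_pd_ip[OF Hs2_weak_pd[OF w, of "[i, j]"] test_pd[OF t, of "[i, j]"]] by simp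
    also have "pd [i, j] (pd [i, j] phi) = pd [i, i, j, j] phi"
      using pd_append[of "[i, j]" "[i, j]" phi] pd_bilaplace[OF test_smooth[OF t], of i j] by simp
    finally show ?thesis .
  qed
  then show ?thesis
    using Hs2_L2[OF w] by (simp add: aform_eq[OF w H20_Hs[OF H20_test[OF t]]] ip_sum_right L2_sum test_L2Om test_pd t)
qed

text \<open>Converts the equation tested with H20 into the distributional one on which elliptic
  regularity operates.\<close>

lemma is_bilaplacianI:
  assumes "w : Hs 2 Om" "g : L2d Om" "\<And>v. v : H20 Om ==> aform Om w v = ipd Om g v"
  shows "is_bilaplacian Om w g"
  unfolding is_bilaplacian_def using assms(2,3) aform_test[OF assms(1)] H20_test by auto

text \<open>Since the derivative of x_i phi in direction i is phi + x_i times that of phi,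
  integration by parts gives |phi|^2 = - 2 (x_i phi, d_i phi), and |x_i| <= D on the domain.\<close>

lemma Poincare_test:
  assumes t: "phi : test_functions Om" and D: "Om \<subseteq> cball 0 D" "0 <= D"
  shows "L2normd Om phi <= 2 * D * L2normd Om (pd [i] phi)"
proof -
  let ?f = "%x. x $ i * phi x"
  have sm: "smooth phi" and tf: "?f : test_functions Om" by (auto intro: test_smooth[OF t] test_mult_smooth[OF t])
  have pf: "pd [i] ?f = (%x. x $ i * pd [i] phi x + phi x)"
    by (subst pd_mult) (auto simp: pd_nth axis_def smooth_differentiable sm simp del: pd.simps)
  have L: "phi : L2d Om" "pd [i] phi : L2d Om" "(%x. x $ i * pd [i] phi x) : L2d Om"
    by (intro test_L2Om t test_pd test_mult_smooth smooth_nth)+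
  have "ipd Om ?f (pd [i] phi) = - ipd Om (%x. x $ i * pd [i] phi x + phi x) phi"
    using is_weak_pd_ip[OF test_weak_pd[OF tf, of "[i]"] t] unfolding pf by simp
  also have "... = - ipd Om (%x. x $ i * pd [i] phi x) phi - (L2normd Om phi)^2"
    by (simp add: ip_add_left L L2norm_sq)
  also have "ipd Om (%x. x $ i * pd [i] phi x) phi = ipd Om ?f (pd [i] phi)" by (simp add: ip_def mult_ac)
  finally have "(L2normd Om phi)^2 = - 2 * ipd Om ?f (pd [i] phi)" by simp
  also have "... <= 2 * (L2normd Om ?f * L2normd Om (pd [i] phi))"
    using abs_le_D2[OF ip_Cauchy_Schwarz[OF test_L2Om[OF tf] L(2)]] by linarith
  finally have 1: "(L2normd Om phi)^2 <= 2 * (L2normd Om ?f * L2normd Om (pd [i] phi))" .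
  have "(L2normd Om ?f)^2 <= (L2normd Om (%x. D * phi x))^2"
    unfolding L2norm_sq_integral
  proof (rule integral_mono)
    show "integrable M (%x. (?f x)^2)" "integrable M (%x. (D * phi x)^2)"
      by (intro L2_integrable_sq test_L2Om tf L2_cmult L)+
    show "(?f x)^2 <= (D * phi x)^2" if "x : space M" for x
    proof -
      have "\<bar>x $ i\<bar> <= D" using component_le_norm_cart[of x i] D(1) that by (auto simp: subset_iff)
      then have "\<bar>?f x\<bar> <= \<bar>D * phi x\<bar>" using D(2) by (simp add: abs_mult mult_right_mono)
      then show ?thesis by (simp only: abs_le_square_iff)
    qed
  qed
  then have "L2normd Om ?f <= D * L2normd Om phi"
    unfolding L2norm_cmult abs_of_nonneg[OF D(2)] by (rule power2_le_imp_le) (intro mult_nonneg_nonneg D(2) L2norm_nonneg)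
  then have "L2normd Om ?f * L2normd Om (pd [i] phi) <= D * L2normd Om phi * L2normd Om (pd [i] phi)"
    by (rule mult_right_mono) (rule L2norm_nonneg)
  then have "2 * (L2normd Om ?f * L2normd Om (pd [i] phi)) <= 2 * (D * L2normd Om phi * L2normd Om (pd [i] phi))"
    by (rule mult_left_mono) (rule zero_le_numeral)
  from order_trans[OF 1 this]
  have 2: "L2normd Om phi * L2normd Om phi <= L2normd Om phi * (2 * D * L2normd Om (pd [i] phi))"
    unfolding power2_eq_square by (simp only: mult_ac)
  show ?thesis
  proof (cases "L2normd Om phi = 0")
    case True
    then show ?thesis using D(2) by (metis L2norm_nonneg mult_nonneg_nonneg zero_le_numeral)
  next
    case False
    then have "0 < L2normd Om phi" using L2norm_nonneg[of M phi] by linarith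
    then show ?thesis by (rule mult_left_le_imp_le[OF 2])
  qed
qed

text \<open>Poincare's inequality twice in the same direction, passed to the limit along test
  functions.\<close>

lemma Poincare_null:
  assumes v: "v : H20 Om" and z: "L2normd Om (weak_pd Om [i, i] v) = 0"
  shows "L2normd Om v = 0"
proof -
  obtain D where D: "Om \<subseteq> cball (0::real^2) D" "0 < D"
    using bounded_subset_ballD[OF bounded_Om, of 0] ball_subset_cball by blast
  obtain phi where p: "\<And>n. phi n : test_functions Om"
    "\<And>al. length al <= 2 ==> (%n. L2normd Om (%x. pd al (phi n) x - weak_pd Om al v x)) \<longlonglongrightarrow> 0"
    using v unfolding H20_iff by blast
  have lim: "(%n. L2normd Om (pd al (phi n))) \<longlonglongrightarrow> L2normd Om (weak_pd Om al v)" if "length al <= 2" for al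
    by (intro L2norm_tendsto p(2) that test_L2Om test_pd p(1) is_weak_pd_L2[OF Hs2_weak_pd] H20_Hs v)
  have "L2normd Om (phi n) <= (2 * D)^2 * L2normd Om (pd [i, i] (phi n))" for n
  proof -
    have "L2normd Om (phi n) <= 2 * D * L2normd Om (pd [i] (phi n))" using Poincare_test[OF p(1) D(1)] D(2) by simp
    also have "L2normd Om (pd [i] (phi n)) <= 2 * D * L2normd Om (pd [i, i] (phi n))"
      using Poincare_test[OF test_pd[OF p(1)] D(1), of "[i]" n i] D(2) pd_append[of "[i]" "[i]" "phi n"] by simp
    finally show ?thesis using D(2) by (simp add: power2_eq_square mult_ac)
  qed
  then have "L2normd Om (weak_pd Om [] v) <= (2 * D)^2 * L2normd Om (weak_pd Om [i, i] v)"
    using lim[of "[]"] by (intro LIMSEQ_le[OF _ tendsto_mult_left[OF lim[of "[i, i]"]]]) auto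
  then have "L2normd Om (weak_pd Om [] v) = 0" using z L2norm_nonneg[of M "weak_pd Om [] v"] by simp
  moreover have "is_weak_pd Om [] v v" using H20_L2[OF v] by (simp add: is_weak_pd_def)
  ultimately show ?thesis using L2norm_weak_pd_eq[OF open_Om] by metis
qed

end

subsection \<open>Polygonal domains and triangulations\<close>

lemma orthonormal_expand:
  fixes \<tau> \<nu> v :: "real^2"
  assumes "norm \<tau> = 1" "norm \<nu> = 1" "\<tau> \<bullet> \<nu> = 0"
  shows "v = (v \<bullet> \<tau>) *\<^sub>R \<tau> + (v \<bullet> \<nu>) *\<^sub>R \<nu>"
proof -
  have 1: "\<tau> $ 1 * \<tau> $ 1 + \<tau> $ 2 * \<tau> $ 2 = 1" "\<nu> $ 1 * \<nu> $ 1 + \<nu> $ 2 * \<nu> $ 2 = 1" "\<tau> $ 1 * \<nu> $ 1 + \<tau> $ 2 * \<nu> $ 2 = 0"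
    using assms by (simp_all add: norm_eq_1 inner_vec_def sum_2)
  have "v $ 1 = (v $ 1 * \<tau> $ 1 + v $ 2 * \<tau> $ 2) * \<tau> $ 1 + (v $ 1 * \<nu> $ 1 + v $ 2 * \<nu> $ 2) * \<nu> $ 1"
    "v $ 2 = (v $ 1 * \<tau> $ 1 + v $ 2 * \<tau> $ 2) * \<tau> $ 2 + (v $ 1 * \<nu> $ 1 + v $ 2 * \<nu> $ 2) * \<nu> $ 2"
    using 1 by algebra+
  then show ?thesis by (simp add: vec_eq_iff forall_2 inner_vec_def sum_2)
qed

text \<open>Excludes slits. At a boundary point the domain lies above a Lipschitz graph, so a small
  ball below the graph misses it and cannot meet its closure in the centre. This places the
  interiors of the triangles inside the domain.\<close>

lemma lipschitz_domain_interior_closure: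
  assumes "polygonal_lipschitz_domain Om"
  shows "interior (closure Om) \<subseteq> Om"
proof
  fix x assume x: "x : interior (closure Om)"
  have op: "open Om" using assms by (simp add: polygonal_lipschitz_domain_def)
  show "x : Om"
  proof (rule ccontr)
    assume xn: "x \<notin> Om"
    then have "x : frontier Om" using x interior_subset op by (auto simp: frontier_def interior_open)
    then obtain \<tau> \<nu> \<delta> eps L g where g: "norm \<tau> = 1" "norm \<nu> = 1" "\<tau> \<bullet> \<nu> = 0" "\<delta> > 0" "eps > 0"
        "L-lipschitz_on {-\<delta><..<\<delta>} g"
      and gr: "\<And>s y. \<bar>s\<bar> < \<delta> ==> \<bar>y\<bar> < eps ==> (x + s *\<^sub>R \<tau> + y *\<^sub>R \<nu> : Om \<longleftrightarrow> g s < (y::real))"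
      using assms unfolding polygonal_lipschitz_domain_def by metis
    have g0: "0 <= g 0" using gr[of 0 0] g(4,5) xn by auto
    have L: "0 <= L" by (rule lipschitz_on_nonneg[OF g(6)])
    obtain r where r: "r > 0" "ball x r \<subseteq> closure Om" using x by (auto simp: mem_interior)
    \<comment> \<open>p lies at distance y below x. Within \<eta> of p the height is below \<eta> -
      y <= - L \<eta>, while the graph stays above - L \<eta>, so no point of the domain is that
      close to p.\<close>
    define y where "y = min eps r / 3"
    define p where "p = x - y *\<^sub>R \<nu>"
    define \<eta> where "\<eta> = min \<delta> (y / (L + 1))"
    have y: "0 < y" "3 * y <= eps" "3 * y <= r" using g(5) r(1) by (auto simp: y_def)
    have "\<eta> <= y / (L + 1)" by (simp add: \<eta>_def)
    then have "\<eta> * (L + 1) <= y" using L by (simp add: pos_le_divide_eq)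
    then have \<eta>: "0 < \<eta>" "\<eta> <= \<delta>" "\<eta> * (L + 1) <= y" using g(4) y(1) L by (simp_all add: \<eta>_def)
    have "0 <= L * \<eta>" using L \<eta>(1) by simp
    then have \<eta>y: "\<eta> <= y" using \<eta>(3) by (simp add: algebra_simps)
    have "p : ball x r" using y g(2) by (simp add: p_def dist_norm)
    then have "p : closure Om" using r(2) by blast
    then obtain q where q: "q : Om" "dist q p < \<eta>" using \<eta>(1) by (auto simp: closure_approachable)
    define s t where "s = (q - x) \<bullet> \<tau>" and "t = (q - x) \<bullet> \<nu>"
    have "(q - p) \<bullet> \<tau> = s" "(q - p) \<bullet> \<nu> = t + y"
      using g(2,3) by (simp_all add: s_def t_def p_def inner_simps norm_eq_1 inner_commute)
    then have st: "\<bar>s\<bar> < \<eta>" "\<bar>t + y\<bar> < \<eta>"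
      using Cauchy_Schwarz_ineq2[of "q - p" \<tau>] Cauchy_Schwarz_ineq2[of "q - p" \<nu>] q(2) g(1,2) by (auto simp: dist_norm)
    have "x + s *\<^sub>R \<tau> + t *\<^sub>R \<nu> = q"
      using orthonormal_expand[OF g(1-3), of "q - x"] by (simp add: s_def t_def algebra_simps)
    moreover have "\<bar>t\<bar> < eps" "\<bar>s\<bar> < \<delta>" using st \<eta>(2) \<eta>y y by linarith+
    ultimately have gt: "g s < t" using gr q(1) by blast
    have "dist (g s) (g 0) <= L * dist s 0" using st(1) \<eta>(2) g(4) by (intro lipschitz_onD[OF g(6)]) auto
    also have "... <= L * \<eta>" using st(1) L by (simp add: dist_real_def mult_left_mono)
    finally have "- (L * \<eta>) <= g s" using g0 by (simp add: dist_real_def)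
    moreover have "t < - (L * \<eta>)" using st(2) \<eta>(3) by (simp add: algebra_simps)
    ultimately show False using gt by linarith
  qed
qed

lemma lebesgue_on_null_measurable:
  assumes "negligible N" shows "f : borel_measurable (lebesgue_on N)"
proof (rule measurableI)
  fix S
  have "negligible (f -` S \<inter> N)" using assms by (rule negligible_subset) auto
  then show "f -` S \<inter> space (lebesgue_on N) : sets (lebesgue_on N)"
    using assms by (simp add: sets_restrict_space_iff negligible_imp_sets Int_commute)
qed simp

lemma AE_lebesgue_on_subset:
  assumes "AE x in lebesgue_on G. P x" "H \<subseteq> G" "G : sets lebesgue" "H : sets lebesgue"
  shows "AE x in lebesgue_on H. P x"
  using assms by (auto simp: AE_restrict_space_iff elim!: eventually_mono)

locale mesh_domain = finite_domain +
  fixes \<T> :: "(real^2) set set"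
  assumes mesh: "mesh_of Om \<T>" and nonempty: "Om ~= {}" and interior_closure: "interior (closure Om) \<subseteq> Om"
begin

lemma finite_\<T>: "finite \<T>" and simplex_\<T>: "K : \<T> ==> 2 simplex K" and Union_\<T>: "\<Union>\<T> = closure Om"
  using mesh by (auto simp: mesh_of_def triangulation_def)

lemmas body = simplex_body[OF simplex_\<T>]

lemma interior_Om: "K : \<T> ==> interior K \<subseteq> Om"
  using Union_\<T> interior_closure interior_mono[of K "closure Om"] by blast

lemma off_interiors_negligible: "negligible {x : Om. \<not> (\<exists>K\<in>\<T>. x : interior K)}"
proof (rule negligible_subset)
  show "negligible (\<Union>(frontier ` \<T>))"
    by (intro negligible_Union finite_imageI finite_\<T>) (auto intro: negligible_convex_frontier body)
  show "{x : Om. \<not> (\<exists>K\<in>\<T>. x : interior K)} \<subseteq> \<Union>(frontier ` \<T>)"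
  proof safe
    fix x assume x: "x : Om" "\<not> (\<exists>K\<in>\<T>. x : interior K)"
    then obtain K where K: "K : \<T>" "x : K" using Union_\<T> closure_subset by blast
    then show "x : \<Union>(frontier ` \<T>)" using x(2) closure_subset[of K] by (auto simp: frontier_def)
  qed
qed

lemma AE_interior: "AE x in M. \<exists>K\<in>\<T>. x : interior K"
proof -
  have "AE x in lebesgue. x \<notin> {x : Om. \<not> (\<exists>K\<in>\<T>. x : interior K)}"
    using off_interiors_negligible by (intro AE_not_in) (simp add: negligible_iff_null_sets)
  then show ?thesis by (auto simp: AE_restrict_space_iff elim: eventually_mono)
qed

text \<open>Measurability is glued from the finitely many interiors and the null set left over, on
  which completeness of the measure makes every function measurable.\<close>

lemma L2_piecewise:
  assumes v: "\<And>K. K : \<T> ==> v : L2d (interior K)"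
  shows "v : L2d Om" "(L2normd Om v)^2 <= (\<Sum>K\<in>\<T>. (L2normd (interior K) v)^2)"
proof -
  define N where "N = {x : Om. \<not> (\<exists>K\<in>\<T>. x : interior K)}"
  have N: "negligible N" unfolding N_def by (rule off_interiors_negligible)
  have "v : borel_measurable M"
  proof (rule measurable_piecewise_restrict[of "insert N (interior ` \<T>)"])
    show "countable (insert N (interior ` \<T>))" using finite_\<T> by (simp add: countable_finite)
    show "space M \<subseteq> \<Union> (insert N (interior ` \<T>))" by (auto simp: N_def)
  next
    fix A assume A: "A : insert N (interior ` \<T>)"
    have sub: "A \<subseteq> Om" using A interior_Om by (auto simp: N_def)
    have As: "A : sets lebesgue" using A N negligible_imp_sets body(5) by auto
    then show "A \<inter> space M : sets M" using sub As by (simp add: sets_restrict_space_iff Int_absorb2)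
    have "restrict_space M A = lebesgue_on A" using sub As by (simp add: restrict_restrict_space Int_absorb1)
    then show "v : borel_measurable (restrict_space M A)"
      using A lebesgue_on_null_measurable[OF N] L2_measurable[OF v] by auto
  qed
  note m = this
  have vm: "(%x. ennreal ((v x)^2)) : borel_measurable M" using m by measurable
  have "(\<integral>\<^sup>+x. ennreal ((v x)^2) \<partial>M) <= (\<integral>\<^sup>+x. (\<Sum>K\<in>\<T>. ennreal ((v x)^2) * indicator (interior K) x) \<partial>M)"
  proof (rule nn_integral_mono_AE)
    show "AE x in M. ennreal ((v x)^2) <= (\<Sum>K\<in>\<T>. ennreal ((v x)^2) * indicator (interior K) x)"
      using AE_interior
    proof (rule eventually_mono)
      fix x assume "\<exists>K\<in>\<T>. x : interior K"
      then obtain K where K: "K : \<T>" "x : interior K" by blast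
      have "ennreal ((v x)^2) = ennreal ((v x)^2) * indicator (interior K) x" using K by simp
      also have "... <= (\<Sum>K\<in>\<T>. ennreal ((v x)^2) * indicator (interior K) x)"
        by (rule member_le_sum[OF K(1)]) (simp_all add: finite_\<T>)
      finally show "ennreal ((v x)^2) <= (\<Sum>K\<in>\<T>. ennreal ((v x)^2) * indicator (interior K) x)" .
    qed
  qed
  also have "... = (\<Sum>K\<in>\<T>. \<integral>\<^sup>+x. ennreal ((v x)^2) * indicator (interior K) x \<partial>M)"
  proof (rule nn_integral_sum)
    fix K assume K: "K : \<T>"
    have "interior K : sets M" using K body(5) interior_Om by (simp add: sets_restrict_space_iff)
    then show "(%x. ennreal ((v x)^2) * indicator (interior K) x) : borel_measurable M" using vm by measurable
  qed
  also have "... = (\<Sum>K\<in>\<T>. ennreal ((L2normd (interior K) v)^2))"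
  proof (rule sum.cong[OF refl])
    fix K assume K: "K : \<T>"
    have "(\<integral>\<^sup>+x. ennreal ((v x)^2) * indicator (interior K) x \<partial>M)
      = (\<integral>\<^sup>+x. ennreal ((v x)^2) * indicator (interior K) x * indicator Om x \<partial>lebesgue)"
      by (rule nn_integral_lebesgue_on[OF Om_sets])
    also have "... = (\<integral>\<^sup>+x. ennreal ((v x)^2) * indicator (interior K) x \<partial>lebesgue)"
      using interior_Om[OF K] by (intro nn_integral_cong) (auto simp: indicator_def)
    also have "... = (\<integral>\<^sup>+x. ennreal ((v x)^2) \<partial>lebesgue_on (interior K))"
      by (rule nn_integral_lebesgue_on[OF body(5)[OF K], symmetric])
    finally show "(\<integral>\<^sup>+x. ennreal ((v x)^2) * indicator (interior K) x \<partial>M) = ennreal ((L2normd (interior K) v)^2)"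
      using L2norm_nn_integral[OF v[OF K]] by simp
  qed
  also have "... = ennreal (\<Sum>K\<in>\<T>. (L2normd (interior K) v)^2)" by (rule sum_ennreal) simp
  finally have le: "(\<integral>\<^sup>+x. ennreal ((v x)^2) \<partial>M) <= ennreal (\<Sum>K\<in>\<T>. (L2normd (interior K) v)^2)" .
  then have "(\<integral>\<^sup>+x. ennreal ((v x)^2) \<partial>M) < \<infinity>" by (rule le_less_trans) simp
  then show L: "v : L2d Om" using L2_iff_nn_integral[OF m] by blast
  show "(L2normd Om v)^2 <= (\<Sum>K\<in>\<T>. (L2normd (interior K) v)^2)"
    using le unfolding L2norm_nn_integral[OF L, symmetric] by (subst (asm) ennreal_le_iff) (auto intro: sum_nonneg)
qed

lemma Hs_pw_L2: "v : Hs_pw s \<T> ==> v : L2d Om"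
  by (rule L2_piecewise) (auto simp: Hs_pw_def intro: Hs_L2d)

lemma L2norm_le_Hs_norm_pw:
  assumes "v : Hs_pw 0 \<T>" shows "L2normd Om v <= Hs_norm_pw 0 \<T> v"
proof -
  have L: "K : \<T> ==> v : L2d (interior K)" for K using assms by (auto simp: Hs_pw_def intro: Hs_L2d)
  have "Hs_norm 0 (interior K) v = L2normd (interior K) v" if "K : \<T>" for K
  proof -
    have "is_weak_pd (interior K) [] v v" using L[OF that] by (simp add: is_weak_pd_def)
    from L2norm_weak_pd_eq[OF open_interior this] show ?thesis by (simp add: Hs_norm_0)
  qed
  then show ?thesis using L2_piecewise(2)[OF L] by (simp add: Hs_norm_pw_def real_le_rsqrt)
qed

lemma is_weak_pd_interior:
  "K : \<T> ==> is_weak_pd Om al v g ==> v : L2d Om ==> is_weak_pd (interior K) al v g"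
  by (rule is_weak_pd_subset(1)) (auto simp: interior_Om body(5))

lemma H2_pw: "v : Hs 2 Om ==> v : Hs_pw 2 \<T>"
  unfolding Hs_pw_def Hs_2
proof safe
  fix K assume v: "v : L2d Om" "\<forall>al. length al <= 2 \<longrightarrow> (\<exists>g. is_weak_pd Om al v g)" and K: "K : \<T>"
  have "is_weak_pd Om [] v v" using v(1) by (simp add: is_weak_pd_def)
  then show "v : L2d (interior K)" by (rule is_weak_pd_subset(2)) (auto simp: interior_Om body(5) K v(1))
  show "\<exists>g. is_weak_pd (interior K) al v g" if "length al <= 2" for al
    using v that is_weak_pd_interior[OF K] by blast
qed

lemma mesh_norm_0D:
  assumes "mesh_norm \<T> v = 0" "K : \<T>"
  shows "L2normd (interior K) (weak_pd (interior K) [i, j] v) = 0"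
proof -
  define A where "A = (\<Sum>K\<in>\<T>. \<Sum>i\<in>UNIV. \<Sum>j\<in>UNIV. (L2normd (interior K) (weak_pd (interior K) [i, j] v))^2)"
  have "A <= 0" using assms(1) unfolding mesh_norm_def A_def[symmetric] real_sqrt_eq_zero_cancel_iff
    by (smt (verit) sum_nonneg zero_le_divide_iff zero_le_power2)
  have "(\<Sum>i\<in>UNIV. \<Sum>j\<in>UNIV. (L2normd (interior K) (weak_pd (interior K) [i, j] v))^2) <= A"
    unfolding A_def by (rule member_le_sum[OF assms(2)]) (auto intro!: sum_nonneg simp: finite_\<T>)
  moreover have "(\<Sum>j\<in>UNIV. (L2normd (interior K) (weak_pd (interior K) [i, j] v))^2)
     <= (\<Sum>i\<in>UNIV. \<Sum>j\<in>UNIV. (L2normd (interior K) (weak_pd (interior K) [i, j] v))^2)"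
    by (rule member_le_sum) (auto intro!: sum_nonneg)
  moreover have "(L2normd (interior K) (weak_pd (interior K) [i, j] v))^2
     <= (\<Sum>j\<in>UNIV. (L2normd (interior K) (weak_pd (interior K) [i, j] v))^2)"
    by (rule member_le_sum) auto
  ultimately have "(L2normd (interior K) (weak_pd (interior K) [i, j] v))^2 <= 0" using \<open>A <= 0\<close> by linarith
  then show ?thesis by simp
qed

text \<open>v coincides almost everywhere with the conforming q, whose derivative [1, 1] vanishes on
  each triangle because that of v does, hence on the whole domain; Poincare's inequality then
  applies to q.\<close>

lemma mesh_null_imp_null:
  assumes v: "v : Hs_pw 2 \<T>" and q: "q : H20 Om" and vq: "L2normd Om (%x. v x - q x) = 0" and z: "mesh_norm \<T> v = 0"
  shows "L2normd Om v = 0"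
proof -
  note vL = Hs_pw_L2[OF v] and qL = H20_L2[OF q]
  have ae: "AE x in M. v x = q x" using L2norm_eq_0_AE[OF L2_diff[OF vL qL] vq] by simp
  let ?D = "weak_pd Om [1, 1] q"
  have w: "is_weak_pd Om [1, 1] q ?D" by (rule Hs2_weak_pd[OF H20_Hs[OF q]]) simp
  have K: "?D : L2d (interior K)" "L2normd (interior K) ?D = 0" if K: "K : \<T>" for K
  proof -
    have wK: "is_weak_pd (interior K) [1, 1] q ?D" by (rule is_weak_pd_interior[OF K w qL])
    then show "?D : L2d (interior K)" by (rule is_weak_pd_L2)
    have "AE x in lebesgue_on (interior K). v x = q x"
      by (rule AE_lebesgue_on_subset[OF ae interior_Om[OF K]]) (auto simp: body(5) K)
    moreover have "v : L2d (interior K)" using v K by (auto simp: Hs_pw_def intro: Hs_L2d)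
    moreover have "q : L2d (interior K)" using H2_pw[OF H20_Hs[OF q]] K by (auto simp: Hs_pw_def intro: Hs_L2d)
    ultimately have "is_weak_pd (interior K) [1, 1] v = is_weak_pd (interior K) [1, 1] q"
      by (intro is_weak_pd_cong_fun L2_measurable) (auto simp: body(5) K)
    then have "L2normd (interior K) (weak_pd (interior K) [1, 1] v) = L2normd (interior K) ?D"
      using wK by (intro L2norm_weak_pd_eq) auto
    then show "L2normd (interior K) ?D = 0" using mesh_norm_0D[OF z K] by simp
  qed
  have "(L2normd Om ?D)^2 <= 0" using L2_piecewise(2)[OF K(1)] K(2) by simp
  then have "L2normd Om q = 0" by (intro Poincare_null[OF q, of 1]) simp
  then show ?thesis using L2norm_AE_cong[OF ae L2_measurable[OF vL] L2_measurable[OF qL]] by simp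
qed

lemma mesh_size: "0 < mesh_size \<T>" "mesh_size \<T> <= diameter (closure Om)"
proof -
  have T: "\<T> ~= {}" using Union_\<T> nonempty closure_subset[of Om] by auto
  have fin: "finite (diameter ` \<T>)" "diameter ` \<T> ~= {}" using finite_\<T> T by auto
  have "diameter K <= diameter (closure Om)" if "K : \<T>" for K
    using that Union_\<T> by (intro diameter_subset bounded_closure bounded_Om) auto
  then show "mesh_size \<T> <= diameter (closure Om)" unfolding mesh_size_def using fin by (subst Max_le_iff) auto
  obtain K where K: "K : \<T>" using T by blast
  obtain z e where "e > 0" "ball z e \<subseteq> K" using body(3)[OF K] by (auto simp: mem_interior)
  then have "diameter (ball z e) <= diameter K" using compact_imp_bounded[OF body(2)[OF K]] by (intro diameter_subset) auto
  moreover have "diameter (ball z e) = 2 * e" using \<open>e > 0\<close> by (simp add: diameter_ball)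
  ultimately have "0 < diameter K" using \<open>e > 0\<close> by linarith
  also have "diameter K <= mesh_size \<T>" unfolding mesh_size_def using fin K by (intro Max_ge) auto
  finally show "0 < mesh_size \<T>" .
qed

end

subsection \<open>The discrete energy estimate\<close>

text \<open>
  The energy \<open>\<parallel>D\<^sup>n\<parallel>\<^sup>2 + a(\<theta>\<^sup>n, \<theta>\<^sup>n\<^sup>+\<^sup>1)\<close>, with \<open>D\<^sup>n\<close> the difference quotient, equals
  \<open>\<parallel>D\<^sup>n\<parallel>\<^sup>2 + a(H\<^sup>n, H\<^sup>n) - k\<^sup>2/4 a(D\<^sup>n, D\<^sup>n)\<close> with \<open>H\<^sup>n\<close> the average, so that the CFL condition makes it
  coercive.  The functionals \<open>e n\<close> are controlled by the norm of \<open>H\<^sup>n\<close> only, hence they are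
  summed by parts.
\<close>

locale discrete_energy =
  fixes M :: "(real^2) measure" and V :: "sfun set" and a :: "sfun => sfun => real" and nrm :: "sfun => real"
    and al k :: real
  assumes V_L2: "v : V ==> v : L2 M"
    and V_lin: "v : V ==> w : V ==> (%x. c * v x + d * w x) : V"
    and a_sym: "v : V ==> w : V ==> a v w = a w v"
    and a_lin: "v : V ==> v' : V ==> w : V ==> a (%x. c * v x + d * v' x) w = c * a v w + d * a v' w"
    and coercive: "v : V ==> al * (nrm v)^2 <= a v v"
    and cfl: "v : V ==> k^2 * a v v <= (L2norm M v)^2"
    and pos: "al > 0" "k > 0" and nrm_nonneg: "0 <= nrm v"
begin

lemma a_lin_right: "v : V ==> v' : V ==> w : V ==> a w (%x. c * v x + d * v' x) = c * a w v + d * a w v'"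
  using a_lin[of v v' w c d] a_sym[of w] V_lin by simp

text \<open>The data are split by the norm that controls them: r in L2, e in the energy norm only.
  The test function \<theta>(n+1) - \<theta>(n-1) equals both k (D n + D (n-1)) and 2 (H n - H
  (n-1)); r is paired with the first form, e with the second.\<close>

lemma energy_estimate:
  fixes \<theta> :: "nat => sfun" and e r :: "nat => sfun => real"
  assumes \<theta>: "\<And>n. n <= N ==> \<theta> n : V" and \<theta>0: "\<theta> 0 = (%x. 0)" and N: "N \<ge> 1"
    and e_lin: "\<And>n v w c d. n <= N ==> v : V ==> w : V ==> e n (%x. c * v x + d * w x) = c * e n v + d * e n w"
    and e_bd: "\<And>n v. n <= N ==> v : V ==> \<bar>e n v\<bar> <= eps * nrm v"
    and e_diff: "\<And>n v. n < N ==> v : V ==> \<bar>e (Suc n) v - e n v\<bar> <= \<delta> n * nrm v"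
    and step: "\<And>n v. 1 <= n ==> n < N ==> v : V ==> ip M (dbar2 k \<theta> n) v + a (\<theta> n) v = r n v + e n v"
    and r_bd: "\<And>n v. 1 <= n ==> n < N ==> v : V ==> \<bar>r n v\<bar> <= \<rho> n * L2norm M v"
    and init: "\<And>v. v : V ==> 2 / k * ip M (dbar k \<theta> 0) v + a (half \<theta> 0) v = 2 / k * s v + (e 0 v + e 1 v) / 2"
    and s_bd: "\<And>v. v : V ==> \<bar>s v\<bar> <= S * L2norm M v"
    and nn: "0 <= eps" "0 <= S" "\<And>n. 0 <= \<rho> n" "\<And>n. 0 <= \<delta> n"
    and m: "m < N"
  shows "L2norm M (dbar k \<theta> m) + nrm (half \<theta> m)
    <= 2 / min (3/4) al * (S + 5 * eps + 2 * k * (\<Sum>n=1..<N. \<rho> n) + 2 * (\<Sum>n=1..<N. \<delta> n))"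
proof -
  define D where "D = dbar k \<theta>"
  define H where "H = half \<theta>"
  define y where "y n = L2norm M (D n) + nrm (H n)" for n
  define E where "E n = (L2norm M (D n))^2 + a (\<theta> n) (\<theta> (Suc n))" for n
  \<comment> \<open>CFL costs a quarter of the kinetic part, which leaves 3/4; the halving pays for
    bounding the square of the sum \<open>y n\<close> by twice the sum of squares.\<close>
  define c0 where "c0 = min (3/4) al / 2"
  have c0: "c0 > 0" using pos by (simp add: c0_def)
  have Deq: "D n = (%x. 1 / k * \<theta> (Suc n) x + (- 1 / k) * \<theta> n x)" for n by (auto simp: D_def dbar_def diff_divide_distrib)
  have Heq: "H n = (%x. 1 / 2 * \<theta> (Suc n) x + 1 / 2 * \<theta> n x)" for n by (auto simp: H_def half_def add_divide_distrib)
  have DV: "D n : V" and HV: "H n : V" if "n < N" for n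
    unfolding Deq Heq using that by (intro V_lin \<theta>; simp)+
  have lower: "c0 * (y n)^2 <= E n" if n: "n < N" for n
  proof -
    have t: "\<theta> n = (%x. 1 * H n x + (- k / 2) * D n x)" "\<theta> (Suc n) = (%x. 1 * H n x + (k / 2) * D n x)"
      using pos(2) by (auto simp: Heq Deq field_simps)
    have V: "(%x. 1 * H n x + (k / 2) * D n x) : V" by (intro V_lin DV HV n)
    have "a (\<theta> n) (\<theta> (Suc n)) = a (H n) (H n) - k^2 / 4 * a (D n) (D n)"
      unfolding t a_lin[OF HV[OF n] DV[OF n] V] a_lin_right[OF HV[OF n] DV[OF n] HV[OF n]] a_lin_right[OF HV[OF n] DV[OF n] DV[OF n]]
      using a_sym[OF HV[OF n] DV[OF n]] by (simp add: algebra_simps power2_eq_square)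
    then have "E n \<ge> 3/4 * (L2norm M (D n))^2 + al * (nrm (H n))^2"
      using coercive[OF HV[OF n]] cfl[OF DV[OF n]] by (simp add: E_def)
    moreover have "3/4 * (L2norm M (D n))^2 + al * (nrm (H n))^2 \<ge> 2 * c0 * (L2norm M (D n))^2 + 2 * c0 * (nrm (H n))^2"
      by (intro add_mono mult_right_mono) (auto simp: c0_def)
    moreover have "(y n)^2 <= 2 * (L2norm M (D n))^2 + 2 * (nrm (H n))^2"
      using sum_squares_bound[of "L2norm M (D n)" "nrm (H n)"] by (simp add: y_def power2_sum)
    then have "c0 * (y n)^2 <= c0 * (2 * (L2norm M (D n))^2 + 2 * (nrm (H n))^2)" using c0 by (intro mult_left_mono) auto
    ultimately show ?thesis by (simp add: algebra_simps)
  qed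
  \<comment> \<open>All right-hand sides are linear in this largest error, whereas the energy at the
    step attaining it is quadratic.\<close>
  define Y where "Y = Max (y ` {..<N})"
  have fin: "finite (y ` {..<N})" "y ` {..<N} ~= {}" using N by (auto simp: lessThan_empty_iff)
  have yY: "y n <= Y" if "n < N" for n unfolding Y_def using fin that by (intro Max_ge) auto
  have DY: "L2norm M (D n) <= Y" and HY: "nrm (H n) <= Y" if "n < N" for n
    using yY[OF that] nrm_nonneg[of "H n"] L2norm_nonneg[of M "D n"] unfolding y_def by linarith+
  have Y0: "0 <= Y" using order_trans[OF nrm_nonneg HY[of 0]] N by simp
  have e_Y: "\<bar>e n (H j)\<bar> <= eps * Y" if "n <= N" "j < N" for n j
    using e_bd[OF that(1) HV[OF that(2)]] HY[OF that(2)] nn(1) by (meson mult_left_mono order_trans)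
  \<comment> \<open>Test the starting equation with \<open>D 0\<close>. As \<open>\<theta> 0\<close>
    vanishes, \<open>H 0\<close> is k/2 times \<open>D 0\<close> and the mixed term a(\<theta> 0,
    \<theta> 1) of the energy is zero.\<close>
  have E0: "E 0 <= S * Y + eps * Y"
  proof -
    have N0: "0 < N" using N by simp
    have th: "\<theta> 1 = (%x. k * D 0 x + 0 * D 0 x)" "H 0 = (%x. k / 2 * D 0 x + 0 * D 0 x)" "\<theta> 0 = (%x. 0 * D 0 x + 0 * D 0 x)"
      using pos(2) by (auto simp: Deq Heq \<theta>0)
    have a0: "a (\<theta> 0) (\<theta> 1) = 0"
      unfolding th(3) by (subst a_lin[OF DV[OF N0] DV[OF N0] \<theta>]) (use N in auto)
    have aH: "a (H 0) (D 0) = k / 2 * a (D 0) (D 0)" unfolding th(2) by (simp only: a_lin[OF DV[OF N0] DV[OF N0] DV[OF N0]])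
    have eH: "e n (H 0) = k / 2 * e n (D 0)" if "n <= N" for n unfolding th(2) by (simp only: e_lin[OF that DV[OF N0] DV[OF N0]])
    have aD: "0 <= a (D 0) (D 0)" using coercive[OF DV[OF N0]] pos(1) by (smt (verit) mult_nonneg_nonneg zero_le_power2)
    have "2 / k * (L2norm M (D 0))^2 + k / 2 * a (D 0) (D 0) = 2 / k * s (D 0) + (e 0 (D 0) + e 1 (D 0)) / 2"
      using init[OF DV[OF N0]] aH by (simp add: L2norm_sq flip: D_def H_def)
    then have "2 * (L2norm M (D 0))^2 + k^2 / 2 * a (D 0) (D 0) = 2 * s (D 0) + (e 0 (H 0) + e 1 (H 0))"
      using pos(2) N by (simp add: eH field_simps power2_eq_square)
    moreover have "0 <= k^2 / 2 * a (D 0) (D 0)" using aD by simp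
    ultimately have "2 * (L2norm M (D 0))^2 <= 2 * s (D 0) + (e 0 (H 0) + e 1 (H 0))" by linarith
    moreover have "s (D 0) <= S * Y"
      using s_bd[OF DV[OF N0]] mult_left_mono[OF DY[OF N0] nn(2)] by linarith
    ultimately show ?thesis unfolding E_def using e_Y[of 0 0] e_Y[of 1 0] N a0 by simp
  qed
  have Estep: "E n - E (n - 1) <= 2 * k * \<rho> n * Y + 2 * (e n (H n) - e n (H (n - 1)))" if n: "1 <= n" "n < N" for n
  proof -
    define p where "p = (%x. 1 * \<theta> (Suc n) x + (- 1) * \<theta> (n - 1) x)"
    have V: "\<theta> n : V" "\<theta> (Suc n) : V" "\<theta> (n - 1) : V" "D n : V" "D (n - 1) : V" "H n : V" "H (n - 1) : V"
      using n by (auto intro: \<theta> DV HV)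
    have pV: "p : V" unfolding p_def by (intro V_lin V)
    have S1: "Suc (n - 1) = n" using n by simp
    have pD: "p = (%x. k * D n x + k * D (n - 1) x)" using pos(2) S1 by (auto simp: p_def Deq field_simps)
    have pH: "p = (%x. 2 * H n x + (- 2) * H (n - 1) x)" using S1 by (auto simp: p_def Heq field_simps)
    have d2: "dbar2 k \<theta> n = (%x. 1 / k * D n x + (- 1 / k) * D (n - 1) x)"
      using pos(2) S1 by (auto simp: dbar2_def Deq power2_eq_square field_simps)
    have L: "D n : L2 M" "D (n - 1) : L2 M" by (intro V_L2 V)+
    have "ip M (dbar2 k \<theta> n) p = (L2norm M (D n))^2 - (L2norm M (D (n - 1)))^2"
      unfolding d2 pD ip_lin_left[OF L L2_lin[OF L]] ip_lin_right[OF L L(1)] ip_lin_right[OF L L(2)] L2norm_sq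
      using pos(2) ip_commute[of M "D n" "D (n - 1)"] by (simp add: field_simps)
    moreover have "a (\<theta> n) p = a (\<theta> n) (\<theta> (Suc n)) - a (\<theta> (n - 1)) (\<theta> n)"
      unfolding p_def a_lin_right[OF V(2,3,1)] using a_sym[OF V(1,3)] by simp
    moreover have "e n p = 2 * (e n (H n) - e n (H (n - 1)))"
      unfolding pH using n by (subst e_lin[OF _ V(6,7)]) auto
    moreover have "r n p <= 2 * k * \<rho> n * Y"
    proof -
      have "L2norm M p <= k * L2norm M (D n) + k * L2norm M (D (n - 1))"
        unfolding pD using L2norm_triangle[OF L2_cmult[OF L(1), of k] L2_cmult[OF L(2), of k]] pos(2) by (simp add: L2norm_cmult)
      also have "... <= k * Y + k * Y" using pos(2) n by (intro add_mono mult_left_mono DY) auto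
      finally have "\<rho> n * L2norm M p <= \<rho> n * (k * Y + k * Y)" by (rule mult_left_mono[OF _ nn(3)])
      then show ?thesis using r_bd[OF n pV] by (simp add: algebra_simps)
    qed
    ultimately show ?thesis using step[OF n pV] S1 by (simp add: E_def)
  qed
  \<comment> \<open>Summation by parts: the terms e(n) applied to H(n) - H(n-1) leave two boundary
    terms and the increments of e applied to H(n), so no difference of the H is ever
    estimated.\<close>
  have sum: "E (Suc i) <= E 0 + (\<Sum>n=1..<Suc (Suc i). 2 * k * \<rho> n * Y) + 2 * (e (Suc i) (H (Suc i)) - e 1 (H 0)) + 2 * (\<Sum>n=1..<Suc i. \<delta> n * Y)"
    if "Suc i < N" for i
    using that
  proof (induction i)
    case 0
    then show ?case using Estep[of 1] by simp
  next
    case (Suc i)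
    let ?j = "Suc i"
    have "e ?j (H ?j) - e (Suc ?j) (H ?j) <= \<delta> ?j * nrm (H ?j)" using e_diff[of ?j "H ?j"] HV[of ?j] Suc.prems by simp
    also have "... <= \<delta> ?j * Y" using Suc.prems by (intro mult_left_mono HY nn) auto
    finally have "e ?j (H ?j) - e (Suc ?j) (H ?j) <= \<delta> ?j * Y" .
    moreover have "E (Suc ?j) - E ?j <= 2 * k * \<rho> (Suc ?j) * Y + 2 * (e (Suc ?j) (H (Suc ?j)) - e (Suc ?j) (H ?j))"
      using Estep[of "Suc ?j"] Suc.prems by simp
    moreover have "(\<Sum>n=1..<Suc (Suc ?j). 2 * k * \<rho> n * Y) = (\<Sum>n=1..<Suc ?j. 2 * k * \<rho> n * Y) + 2 * k * \<rho> (Suc ?j) * Y"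
      "(\<Sum>n=1..<Suc ?j. \<delta> n * Y) = (\<Sum>n=1..<?j. \<delta> n * Y) + \<delta> ?j * Y"
      by simp_all
    moreover have "E2 <= E0 + S1' + 2 * (b2 - b0) + 2 * S2'"
      if "E1 <= E0 + S1 + 2 * (b1 - b0) + 2 * S2" "b1 - b1' <= q" "E2 - E1 <= p + 2 * (b2 - b1')" "S1' = S1 + p" "S2' = S2 + q"
      for E0 E1 E2 S1 S1' S2 S2' b0 b1 b1' b2 p q :: real
      using that by simp
    ultimately show ?case using Suc.IH[OF Suc_lessD[OF Suc.prems]] by blast
  qed
  \<comment> \<open>Of the five eps, one comes from \<open>E 0\<close> and two from each of the
    boundary terms \<open>e j (H j)\<close> and \<open>e 1 (H 0)\<close>.\<close>
  define A where "A = S + 5 * eps + 2 * k * (\<Sum>n=1..<N. \<rho> n) + 2 * (\<Sum>n=1..<N. \<delta> n)"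
  have A0: "0 <= A" unfolding A_def using nn pos(2) by (intro add_nonneg_nonneg mult_nonneg_nonneg sum_nonneg) auto
  have EA: "E j <= A * Y" if j: "j < N" for j
  proof (cases j)
    case 0
    have "0 <= (5 * eps - eps + 2 * k * (\<Sum>n=1..<N. \<rho> n) + 2 * (\<Sum>n=1..<N. \<delta> n)) * Y"
      using nn pos(2) Y0 by (intro add_nonneg_nonneg mult_nonneg_nonneg sum_nonneg) auto
    then show ?thesis using E0 0 by (simp add: A_def algebra_simps)
  next
    case (Suc i)
    have "(\<Sum>n=1..<Suc j. 2 * k * \<rho> n * Y) <= (\<Sum>n=1..<N. 2 * k * \<rho> n * Y)"
      using j nn pos(2) Y0 by (intro sum_mono2) auto
    moreover have "(\<Sum>n=1..<j. \<delta> n * Y) <= (\<Sum>n=1..<N. \<delta> n * Y)"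
      using j nn Y0 by (intro sum_mono2) auto
    moreover have "e j (H j) <= eps * Y" "- e 1 (H 0) <= eps * Y" using e_Y[of j j] e_Y[of 1 0] j by auto
    moreover have "E j <= E 0 + (\<Sum>n=1..<Suc j. 2 * k * \<rho> n * Y) + 2 * (e j (H j) - e 1 (H 0)) + 2 * (\<Sum>n=1..<j. \<delta> n * Y)"
      using sum[of i] j unfolding Suc by blast
    moreover have "A * Y = S * Y + 5 * (eps * Y) + (\<Sum>n=1..<N. 2 * k * \<rho> n * Y) + 2 * (\<Sum>n=1..<N. \<delta> n * Y)"
      by (simp add: A_def algebra_simps sum_distrib_left sum_distrib_right)
    ultimately show ?thesis using E0 by (simp only: right_diff_distrib)
  qed
  have "Y : y ` {..<N}" unfolding Y_def using fin by (rule Max_in)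
  then obtain j where j: "j < N" "Y = y j" by auto
  \<comment> \<open>Quadratic against linear at the maximising index; one factor Y cancels, and no
    Gronwall factor arises.\<close>
  have "c0 * Y^2 <= A * Y" using order_trans[OF lower[OF j(1)] EA[OF j(1)]] j(2) by simp
  then have "Y * (c0 * Y) <= Y * A" by (simp add: power2_eq_square mult_ac)
  then have "c0 * Y <= A" using Y0 A0 by (cases "Y = 0") auto
  then have "Y <= 2 / min (3/4) al * A" using c0 pos by (simp add: c0_def field_simps)
  then show ?thesis using yY[OF m] by (simp add: y_def D_def H_def A_def)
qed

end

subsection \<open>Integration in time\<close>

lemma borel_measurable_lebesgue_on_AE:
  fixes f g :: "'a::euclidean_space => real"
  assumes f: "f : borel_measurable (lebesgue_on S)" and S: "S : sets lebesgue" and ae: "AE x in lebesgue_on S. f x = g x"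
  shows "g : borel_measurable (lebesgue_on S)"
proof -
  have "(%x. if x : S then f x else 0) : borel_measurable lebesgue" using f S by (simp add: borel_measurable_if)
  moreover have "AE x in lebesgue. (if x : S then f x else 0) = (if x : S then g x else 0)"
    using ae S by (auto simp: AE_restrict_space_iff elim: eventually_mono)
  ultimately have "(%x. if x : S then g x else 0) : borel_measurable lebesgue" by (rule borel_measurable_AE)
  then show ?thesis using S by (simp add: borel_measurable_if)
qed

text \<open>What remains of a weak time derivative after taking the inner product with a fixed v: an
  absolutely continuous scalar function with its integrable density.\<close>

definition antideriv :: "real => (real => real) => (real => real) => bool" where
  "antideriv T y z \<longleftrightarrow> integrable (lebesgue_on {0..T}) z \<and>
    (\<forall>s t. 0 <= s \<and> s <= t \<and> t <= T \<longrightarrow> y t - y s = integral {s..t} z)"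

lemma integrable_subinterval:
  assumes "integrable (lebesgue_on {0..T}) (z :: real => real)" "0 <= s" "t <= T"
  shows "integrable (lebesgue_on {s..t}) z" "z integrable_on {s..t}"
proof -
  show 1: "integrable (lebesgue_on {s..t}) z"
    using set_integrable_subset[of lebesgue "{0..T}" z "{s..t}"] assms by (simp add: set_integrable_def integrable_restrict_space)
  then show "z integrable_on {s..t}" by (rule integrable_on_lebesgue_on) simp
qed

lemma antideriv_continuous:
  assumes "antideriv T y z" shows "continuous_on {0..T} y"
proof -
  have "z integrable_on {0..T}" using assms integrable_on_lebesgue_on[of "{0..T}" z] by (simp add: antideriv_def)
  then have "continuous_on {0..T} (%t. y 0 + integral {0..t} z)"
    by (intro continuous_intros indefinite_integral_continuous_1)
  moreover have "y t = y 0 + integral {0..t} z" if "t : {0..T}" for t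
    using assms that unfolding antideriv_def by (metis add_diff_cancel_left' atLeastAtMost_iff diff_add_cancel order_refl add.commute)
  ultimately show ?thesis using continuous_on_cong[OF refl, of "{0..T}" y "%t. y 0 + integral {0..t} z"] by blast
qed

text \<open>In general z is only integrable. It is continuous as soon as it has a density itself, so
  along a chain of weak derivatives all but the last are classical.\<close>

lemma antideriv_derivative:
  assumes a: "antideriv T y z" and c: "continuous_on {0..T} z" and t: "t : {0..T}"
  shows "(y has_real_derivative z t) (at t within {0..T})"
proof -
  have d: "((%t. y 0 + integral {0..t} z) has_real_derivative 0 + z t) (at t within {0..T})"
    by (intro DERIV_add integral_has_real_derivative c t) simp
  have e: "y 0 + integral {0..t} z = y t" if "t : {0..T}" for t
    using a that unfolding antideriv_def by (metis add_diff_cancel_left' atLeastAtMost_iff diff_add_cancel order_refl add.commute)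
  show ?thesis using has_field_derivative_transform_within[OF d zero_less_one t e] by simp
qed

lemma antideriv_bound:
  assumes a: "antideriv T y z" and n: "integrable (lebesgue_on {0..T}) n" "AE r in lebesgue_on {0..T}. \<bar>z r\<bar> <= n r"
    and st: "0 <= s" "s <= t" "t <= T"
  shows "\<bar>y t - y s\<bar> <= integral {s..t} n"
proof -
  have z: "integrable (lebesgue_on {0..T}) z" using a by (simp add: antideriv_def)
  note zi = integrable_subinterval[OF z st(1,3)] and ni = integrable_subinterval[OF n(1) st(1,3)]
  have ae: "AE r in lebesgue_on {s..t}. \<bar>z r\<bar> <= n r"
    by (rule AE_lebesgue_on_subset[OF n(2)]) (use st in auto)
  have "\<bar>LINT r|lebesgue_on {s..t}. z r\<bar> <= (LINT r|lebesgue_on {s..t}. \<bar>z r\<bar>)" by (rule integral_abs_bound)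
  also have "... <= (LINT r|lebesgue_on {s..t}. n r)" using ae zi(1) ni(1) by (intro integral_mono_AE) auto
  finally show ?thesis
    using a st by (simp add: antideriv_def lebesgue_integral_eq_integral zi(1) ni(1))
qed

lemma antideriv_bound_const:
  assumes a: "antideriv T y z" and "AE r in lebesgue_on {0..T}. \<bar>z r\<bar> <= B" and st: "0 <= s" "s <= t" "t <= T"
  shows "\<bar>y t - y s\<bar> <= B * (t - s)"
proof -
  have "integrable (lebesgue_on {0..T}) (%r. B)" by (intro continuous_imp_integrable_real continuous_intros)
  from antideriv_bound[OF a this assms(2) st] show ?thesis using st by (simp add: mult.commute)
qed

lemma deriv_within_bound:
  fixes q :: "real => real"
  assumes "\<And>r. r : {p..p'} ==> (q has_real_derivative d r) (at r within S)" "{p..p'} \<subseteq> S" "\<And>r. r : {p..p'} ==> \<bar>d r\<bar> <= B"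
    "x : {p..p'}" "a : {p..p'}"
  shows "\<bar>q x - q a\<bar> <= B * \<bar>x - a\<bar>"
proof -
  have "norm (q x - q a) <= B * norm (x - a)"
  proof (rule field_differentiable_bound[of "{p..p'}" q d])
    show "(q has_real_derivative d r) (at r within {p..p'})" if "r : {p..p'}" for r
      by (rule DERIV_subset[OF assms(1)[OF that] assms(2)])
    show "norm (d r) <= B" if "r : {p..p'}" for r using assms(3)[OF that] by simp
  qed (use assms(4,5) in auto)
  then show ?thesis by simp
qed

section \<open>Taylor estimates for difference quotients\<close>

text \<open>On the window \<open>y1\<close> varies by at most E, and the affine part
  \<open>y1 a * (x - a)\<close> cancels in the second difference.\<close>

lemma second_difference_bound:
  assumes y: "antideriv T y0 y1" "antideriv T y1 y2"
    and n: "integrable (lebesgue_on {0..T}) n" "AE r in lebesgue_on {0..T}. \<bar>y2 r\<bar> <= n r" "\<And>r. 0 <= n r"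
    and a: "0 <= a - k" "a + k <= T" "k > 0"
  shows "\<bar>y0 (a + k) - 2 * y0 a + y0 (a - k)\<bar> <= 2 * k * integral {a - k..a + k} n"
proof -
  define E where "E = integral {a - k..a + k} n"
  have y1: "\<bar>y1 r - y1 a\<bar> <= E" if r: "r : {a - k..a + k}" for r
  proof -
    have "\<bar>y1 (max r a) - y1 (min r a)\<bar> <= integral {min r a..max r a} n"
      using a r by (intro antideriv_bound[OF y(2) n(1,2)]) auto
    also have "... <= E" unfolding E_def
      using a r n(3) by (intro integral_subset_le integrable_subinterval(2)[OF n(1)]) auto
    finally show ?thesis by (simp add: max_def min_def split: if_splits)
  qed
  have "\<bar>(y0 x - y1 a * (x - a)) - (y0 a - y1 a * (a - a))\<bar> <= E * \<bar>x - a\<bar>" if "x : {a - k..a + k}" for x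
  proof (rule deriv_within_bound[where S = "{0..T}" and d = "%r. y1 r - y1 a * (1 - 0)"])
    fix r assume "r : {a - k..a + k}"
    then show "((%x. y0 x - y1 a * (x - a)) has_real_derivative y1 r - y1 a * (1 - 0)) (at r within {0..T})"
      using a by (intro DERIV_diff DERIV_cmult antideriv_derivative[OF y(1) antideriv_continuous[OF y(2)]] DERIV_ident DERIV_const) auto
  qed (use that a y1 in auto)
  from this[of "a + k"] this[of "a - k"] show ?thesis using a(3) by (simp add: E_def abs_le_iff algebra_simps)
qed

text \<open>The cubic Taylor polynomial at a is subtracted and the bound for the third derivative is
  integrated three times; the odd powers cancel in the symmetric sum.\<close>

lemma second_difference_taylor:
  assumes y: "antideriv T y0 y1" "antideriv T y1 y2" "antideriv T y2 y3" "antideriv T y3 y4"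
    and n: "integrable (lebesgue_on {0..T}) n" "AE r in lebesgue_on {0..T}. \<bar>y4 r\<bar> <= n r" "\<And>r. 0 <= n r"
    and a: "0 <= a - k" "a + k <= T" "k > 0"
  shows "\<bar>y0 (a + k) - 2 * y0 a + y0 (a - k) - k^2 * y2 a\<bar> <= 2 * k^3 * integral {a - k..a + k} n"
proof -
  define E where "E = integral {a - k..a + k} n"
  have E0: "0 <= E" unfolding E_def using n(3) a by (intro integral_nonneg integrable_subinterval(2)[OF n(1)]) auto
  have d: "r : {a - k..a + k} ==> (y0 has_real_derivative y1 r) (at r within {0..T})"
    "r : {a - k..a + k} ==> (y1 has_real_derivative y2 r) (at r within {0..T})"
    "r : {a - k..a + k} ==> (y2 has_real_derivative y3 r) (at r within {0..T})" for r
    using a by (auto intro!: antideriv_derivative[OF y(1) antideriv_continuous[OF y(2)]]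
      antideriv_derivative[OF y(2) antideriv_continuous[OF y(3)]] antideriv_derivative[OF y(3) antideriv_continuous[OF y(4)]])
  have y3: "\<bar>y3 r - y3 a\<bar> <= E" if r: "r : {a - k..a + k}" for r
  proof -
    have "\<bar>y3 (max r a) - y3 (min r a)\<bar> <= integral {min r a..max r a} n"
      using a r by (intro antideriv_bound[OF y(4) n(1,2)]) auto
    also have "... <= E" unfolding E_def
      using a r n(3) by (intro integral_subset_le integrable_subinterval(2)[OF n(1)]) auto
    finally show ?thesis by (simp add: max_def min_def split: if_splits)
  qed
  have ak: "E' * \<bar>x - a\<bar> <= E' * k" if "x : {a - k..a + k}" "0 <= E'" for x E'
    using that by (intro mult_left_mono) auto
  define q2 where "q2 r = y2 r - y2 a - y3 a * (r - a)" for r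
  define q1 where "q1 r = y1 r - y1 a - y2 a * (r - a) - y3 a * (r - a)^2 / 2" for r
  define q0 where "q0 r = y0 r - y0 a - y1 a * (r - a) - y2 a * (r - a)^2 / 2 - y3 a * (r - a)^3 / 6" for r
  have q2: "\<bar>q2 x\<bar> <= E * k" if x: "x : {a - k..a + k}" for x
  proof -
    have "\<bar>q2 x - q2 a\<bar> <= E * \<bar>x - a\<bar>"
    proof (rule deriv_within_bound[where S = "{0..T}" and d = "%r. y3 r - y3 a"])
      show "(q2 has_real_derivative y3 r - y3 a) (at r within {0..T})" if "r : {a - k..a + k}" for r
        unfolding q2_def[abs_def] by (rule derivative_eq_intros d[OF that] refl | simp)+
    qed (use x a y3 in auto)
    then show ?thesis using ak[OF x E0] by (simp add: q2_def)
  qed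
  have q1: "\<bar>q1 x\<bar> <= E * k * k" if x: "x : {a - k..a + k}" for x
  proof -
    have "\<bar>q1 x - q1 a\<bar> <= E * k * \<bar>x - a\<bar>"
    proof (rule deriv_within_bound[where S = "{0..T}" and d = q2])
      show "(q1 has_real_derivative q2 r) (at r within {0..T})" if "r : {a - k..a + k}" for r
        unfolding q1_def[abs_def] q2_def by (rule derivative_eq_intros d[OF that] refl | simp)+
    qed (use x a q2 in auto)
    then show ?thesis using ak[OF x, of "E * k"] E0 a(3) by (simp add: q1_def)
  qed
  have q0: "\<bar>q0 x\<bar> <= E * k * k * k" if x: "x : {a - k..a + k}" for x
  proof -
    have "\<bar>q0 x - q0 a\<bar> <= E * k * k * \<bar>x - a\<bar>"
    proof (rule deriv_within_bound[where S = "{0..T}" and d = q1])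
      show "(q0 has_real_derivative q1 r) (at r within {0..T})" if "r : {a - k..a + k}" for r
        unfolding q0_def[abs_def] q1_def by (rule derivative_eq_intros d[OF that] refl | simp)+
    qed (use x a q1 in auto)
    then show ?thesis using ak[OF x, of "E * k * k"] E0 a(3) by (simp add: q0_def)
  qed
  have "y0 (a + k) - 2 * y0 a + y0 (a - k) - k^2 * y2 a = q0 (a + k) + q0 (a - k)"
    by (simp add: q0_def algebra_simps)
  also have "\<bar>...\<bar> <= 2 * (E * k * k * k)" using q0[of "a + k"] q0[of "a - k"] a(3) by (simp add: abs_le_iff)
  finally show ?thesis by (simp add: E_def power3_eq_cube mult_ac)
qed

text \<open>Half the consistency error of the starting step, times k. The average of the second
  derivatives at 0 and k, in place of its value at 0, changes the Taylor remainder by k/4 (y2 k - y2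
  0), again of order k^2.\<close>

lemma initial_taylor:
  assumes y: "antideriv T y0 y1" "antideriv T y1 y2" "antideriv T y2 y3"
    and n: "AE r in lebesgue_on {0..T}. \<bar>y3 r\<bar> <= B" "0 <= B" and k: "0 < k" "k <= T"
  shows "\<bar>(y0 k - y0 0) / k - y1 0 - k / 4 * (y2 0 + y2 k)\<bar> <= 2 * B * k^2"
proof -
  have d: "r : {0..k} ==> (y0 has_real_derivative y1 r) (at r within {0..T})"
    "r : {0..k} ==> (y1 has_real_derivative y2 r) (at r within {0..T})" for r
    using k by (auto intro!: antideriv_derivative[OF y(1) antideriv_continuous[OF y(2)]]
      antideriv_derivative[OF y(2) antideriv_continuous[OF y(3)]])
  have q2: "\<bar>y2 r - y2 0\<bar> <= B * k" if r: "r : {0..k}" for r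
  proof -
    have "\<bar>y2 r - y2 0\<bar> <= B * (r - 0)" using r k by (intro antideriv_bound_const[OF y(3) n(1)]) auto
    also have "... <= B * k" using r n(2) by (intro mult_left_mono) auto
    finally show ?thesis .
  qed
  define q1 where "q1 r = y1 r - y1 0 - y2 0 * r" for r
  define q0 where "q0 r = y0 r - y0 0 - y1 0 * r - y2 0 * r^2 / 2" for r
  have q1: "\<bar>q1 x\<bar> <= B * k * k" if x: "x : {0..k}" for x
  proof -
    have "\<bar>q1 x - q1 0\<bar> <= B * k * \<bar>x - 0\<bar>"
    proof (rule deriv_within_bound[where S = "{0..T}" and d = "%r. y2 r - y2 0"])
      show "(q1 has_real_derivative y2 r - y2 0) (at r within {0..T})" if "r : {0..k}" for r
        unfolding q1_def[abs_def] by (rule derivative_eq_intros d[OF that] refl | simp)+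
    qed (use x k q2 in auto)
    also have "... <= B * k * k" using x k n(2) by (intro mult_left_mono) auto
    finally show ?thesis by (simp add: q1_def)
  qed
  have q0: "\<bar>q0 k\<bar> <= B * k * k * k"
  proof -
    have "\<bar>q0 k - q0 0\<bar> <= B * k * k * \<bar>k - 0\<bar>"
    proof (rule deriv_within_bound[where S = "{0..T}" and d = q1])
      show "(q0 has_real_derivative q1 r) (at r within {0..T})" if "r : {0..k}" for r
        unfolding q0_def[abs_def] q1_def by (rule derivative_eq_intros d[OF that] refl | simp)+
    qed (use k q1 in auto)
    then show ?thesis using k by (simp add: q0_def)
  qed
  have e: "(y0 k - y0 0) / k - y1 0 - k / 4 * (y2 0 + y2 k) = q0 k / k - k / 4 * (y2 k - y2 0)"
    using k by (simp add: q0_def field_simps power2_eq_square)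
  have "\<bar>q0 k / k\<bar> <= B * k * k" using q0 k by (simp add: pos_divide_le_eq mult_ac)
  moreover have "\<bar>k / 4 * (y2 k - y2 0)\<bar> <= k / 4 * (B * k)" using q2[of k] k by (simp add: abs_mult mult_left_mono)
  moreover have "k / 4 * (B * k) <= B * k * k" using n(2) k by simp
  ultimately have "\<bar>q0 k / k - k / 4 * (y2 k - y2 0)\<bar> <= 2 * (B * k * k)"
    using abs_triangle_ineq4[of "q0 k / k" "k / 4 * (y2 k - y2 0)"] by linarith
  then show ?thesis unfolding e by (simp add: power2_eq_square mult_ac)
qed

lemma continuous_AE_bound:
  fixes y :: "real => real"
  assumes c: "continuous_on {0..T} y" and ae: "AE r in lebesgue_on {0..T}. \<bar>y r\<bar> <= B" and t: "t : {0..T}" and T: "0 < T"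
  shows "\<bar>y t\<bar> <= B"
proof -
  let ?C = "{r : {0..T}. \<bar>y r\<bar> <= B}"
  have cl: "closed ?C" by (intro continuous_on_closed_Collect_le continuous_on_rabs c continuous_on_const closed_atLeastAtMost)
  have "AE r in lebesgue. r : {0..T} \<longrightarrow> \<bar>y r\<bar> <= B" using ae by (simp add: AE_restrict_space_iff)
  then have "AE r\<in>{0<..<T} in lebesgue. r : ?C" by (rule eventually_mono) auto
  then have "r : ?C" if "r : {0<..<T}" for r using mem_closed_if_AE_lebesgue_open[of "{0<..<T}" ?C r] cl that by simp
  then have "closure {0<..<T} \<subseteq> ?C" using cl by (intro closure_minimal) auto
  then show ?thesis using t T by auto
qed

lemma L2norm_le_dual:
  assumes "x : L2 M" "\<And>v. v : L2 M ==> \<bar>ip M x v\<bar> <= c * L2norm M v" "0 <= c"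
  shows "L2norm M x <= c"
proof (cases "L2norm M x = 0")
  case False
  have "L2norm M x * L2norm M x <= c * L2norm M x" using assms(2)[OF assms(1)] by (simp add: L2norm_sq[symmetric] power2_eq_square)
  then show ?thesis using False L2norm_nonneg[of M x] by simp
qed (use assms in simp)

section \<open>Cauchy-Schwarz in time and sums over the time grid\<close>

lemma integral_le_L2t_norm:
  assumes n: "n : borel_measurable (lebesgue_on {0..T})" "\<And>r. 0 <= n r" and T: "0 < T"
    and I: "(\<integral>\<^sup>+r. ennreal ((n r)^2) \<partial>lebesgue_on {0..T}) <= ennreal (c^2)" "0 <= c"
  shows "integrable (lebesgue_on {0..T}) n" "integral {0..T} n <= sqrt T * c"
proof -
  let ?I = "lebesgue_on {0..T}"
  have nL: "n : L2 ?I" using I le_less_trans[OF I(1)] by (simp add: L2_iff_nn_integral[OF n(1)])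
  have 1: "(%r. 1) : L2 ?I" by (simp add: L2_def)
  show i: "integrable ?I n" using L2_integrable_mult[OF nL 1] by simp
  have "ennreal ((L2norm ?I n)^2) <= ennreal (c^2)" using I(1) L2norm_nn_integral[OF nL] by simp
  then have nc: "L2norm ?I n <= c" using I(2) by (simp add: abs_le_square_iff[symmetric])
  have "(L2norm ?I (%r. 1))^2 = T"
    unfolding L2norm_sq_integral using T by (subst lebesgue_integral_eq_integral) (auto intro!: continuous_imp_integrable_real continuous_intros)
  then have T1: "L2norm ?I (%r. 1) = sqrt T" by (metis L2norm_nonneg real_sqrt_unique)
  have "integral {0..T} n = ip ?I n (%r. 1)" using lebesgue_integral_eq_integral[OF i] by (simp add: ip_def)
  also have "... <= L2norm ?I n * L2norm ?I (%r. 1)" using abs_le_D1[OF ip_Cauchy_Schwarz[OF nL 1]] .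
  also have "... <= c * sqrt T" unfolding T1 using nc T by (intro mult_right_mono) auto
  finally show "integral {0..T} n <= sqrt T * c" by (simp add: mult.commute)
qed

lemma sum_integral_grid:
  assumes n: "integrable (lebesgue_on {0..T}) (n :: real => real)" and k: "0 < k" "real N * k <= T"
  shows "(\<Sum>j<N. integral {real j * k..real (Suc j) * k} n) = integral {0..real N * k} n"
  using k(2)
proof (induction N)
  case (Suc N)
  have "real N * k <= real (Suc N) * k" using k(1) by (intro mult_right_mono) auto
  then have "integral {0..real N * k} n + integral {real N * k..real (Suc N) * k} n = integral {0..real (Suc N) * k} n"
    using k(1) Suc.prems by (intro Henstock_Kurzweil_Integration.integral_combine integrable_subinterval(2)[OF n]) auto
  then show ?case using Suc \<open>real N * k <= real (Suc N) * k\<close> by simp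
qed simp

text \<open>The window around a grid point consists of two grid cells, and each cell belongs to at
  most two windows.\<close>

lemma sum_integral_patches:
  assumes n: "integrable (lebesgue_on {0..T}) n" "\<And>r. (0::real) <= n r" and k: "0 < k" "real N * k <= T"
  shows "(\<Sum>j=1..<N. integral {real j * k - k..real j * k + k} n) <= 2 * integral {0..T} n"
    "(\<Sum>j=1..<N. integral {real j * k..real (Suc j) * k} n) <= integral {0..T} n"
proof -
  let ?J = "%j. integral {real j * k..real (Suc j) * k} n"
  have nn: "0 <= ?J j" if "j < N" for j
  proof -
    have "real (Suc j) * k <= real N * k" using k(1) that by (intro mult_right_mono) auto
    then have "real (Suc j) * k <= T" using k(2) by (rule order_trans)
    then show ?thesis using n(2) k(1) by (intro integral_nonneg integrable_subinterval(2)[OF n(1)]) auto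
  qed
  have tot: "(\<Sum>j<N. ?J j) <= integral {0..T} n"
    unfolding sum_integral_grid[OF n(1) k] using k n(2) by (intro integral_subset_le integrable_subinterval(2)[OF n(1)]) auto
  show 2: "(\<Sum>j=1..<N. ?J j) <= integral {0..T} n"
    by (rule order_trans[OF sum_mono2 tot]) (use nn in auto)
  have 1: "(\<Sum>j=1..<N. ?J (j - 1)) <= integral {0..T} n"
  proof -
    have "(\<Sum>j=1..<N. ?J (j - 1)) = (\<Sum>j<N - 1. ?J j)"
      by (rule sum.reindex_bij_witness[of _ Suc "%j. j - 1"]) auto
    also have "... <= (\<Sum>j<N. ?J j)" by (rule sum_mono2) (use nn in auto)
    finally show ?thesis using tot by linarith
  qed
  have "integral {real j * k - k..real j * k + k} n = ?J (j - 1) + ?J j" if j: "j : {1..<N}" for j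
  proof -
    have "real j * k + k <= real N * k" using j k(1) mult_right_mono[of "real (Suc j)" "real N" k] by (simp add: algebra_simps)
    moreover have "0 <= real j * k - k" using j k(1) mult_right_mono[of 1 "real j" k] by simp
    ultimately have "integral {real j * k - k..real j * k} n + integral {real j * k..real j * k + k} n = integral {real j * k - k..real j * k + k} n"
      using k by (intro Henstock_Kurzweil_Integration.integral_combine integrable_subinterval(2)[OF n(1)]) auto
    then show ?thesis using j by (simp add: algebra_simps of_nat_diff)
  qed
  then show "(\<Sum>j=1..<N. integral {real j * k - k..real j * k + k} n) <= 2 * integral {0..T} n"
    using 1 2 by (simp add: sum.distrib)
qed

context finite_domain
begin

lemma strongly_measurable_ip:
  assumes s: "strongly_measurable (L2d Om) (L2normd Om) T psi" and v: "v : L2d Om"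
  shows "(%r. ipd Om (psi r) v) : borel_measurable (lebesgue_on {0..T})"
proof -
  let ?I = "lebesgue_on {0..T}"
  obtain s where sf: "\<And>n. simple_function ?I (s n)" "\<And>n. s n ` {0..T} \<subseteq> L2d Om"
    and lim: "AE t in ?I. (%n. L2normd Om (psi t - s n t)) \<longlonglongrightarrow> 0"
    using s unfolding strongly_measurable_def by blast
  have [measurable]: "(%r. ipd Om (s n r) v) : borel_measurable ?I" for n
    by (intro borel_measurable_simple_function simple_function_compose1[OF sf(1), of "%w. ipd Om w v"])
  have "AE t in ?I. psi t : L2d Om" using s by (simp add: strongly_measurable_def)
  then have ae: "AE t in ?I. lim (%n. ipd Om (s n t) v) = ipd Om (psi t) v"
    using lim AE_space
  proof eventually_elim
    case (elim t)
    have "(%n. ipd Om (s n t) v) \<longlonglongrightarrow> ipd Om (psi t) v"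
    proof (rule ip_tendsto)
      show "s n t : L2d Om" for n using sf(2)[of n] elim(3) by auto
      show "(%n. L2normd Om (%x. s n t x - psi t x)) \<longlonglongrightarrow> 0"
        using elim(2) by (simp add: L2norm_diff_commute[of _ "psi t"] fun_diff_def)
    qed (use elim v in auto)
    then show ?case by (rule limI)
  qed
  show ?thesis
  proof (rule borel_measurable_lebesgue_on_AE[OF _ _ ae])
    show "(%t. lim (%n. ipd Om (s n t) v)) : borel_measurable ?I" by measurable
  qed simp
qed

lemma time_deriv_antideriv:
  assumes d: "has_time_deriv Om T phi psi" and v: "v : L2d Om" and T: "0 < T"
  shows "antideriv T (%t. ipd Om (phi t) v) (%r. ipd Om (psi r) v)"
    "AE r in lebesgue_on {0..T}. \<bar>ipd Om (psi r) v\<bar> <= L2normd Om (psi r) * L2normd Om v"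
    "integrable (lebesgue_on {0..T}) (%r. L2normd Om (psi r))"
proof -
  let ?z = "%r. ipd Om (psi r) v"
  have sm: "strongly_measurable (L2d Om) (L2normd Om) T psi" and pL: "\<And>t. t : {0..T} ==> phi t : L2d Om"
    and D: "\<And>t. t : {0..T} ==> ipd Om (phi t - phi 0) v = (LINT r|lebesgue_on {0..t}. ?z r)"
    using d v by (auto simp: has_time_deriv_def)
  show ni: "integrable (lebesgue_on {0..T}) (%r. L2normd Om (psi r))" using d by (auto simp: has_time_deriv_def)
  have "AE t in lebesgue_on {0..T}. psi t : L2d Om" using sm by (simp add: strongly_measurable_def)
  then show ae: "AE r in lebesgue_on {0..T}. \<bar>?z r\<bar> <= L2normd Om (psi r) * L2normd Om v"
    by (rule eventually_mono) (rule ip_Cauchy_Schwarz[OF _ v])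
  have zi: "integrable (lebesgue_on {0..T}) ?z"
  proof (rule Bochner_Integration.integrable_bound)
    show "integrable (lebesgue_on {0..T}) (%r. L2normd Om (psi r) * L2normd Om v)" using ni by simp
    show "AE r in lebesgue_on {0..T}. norm (?z r) <= norm (L2normd Om (psi r) * L2normd Om v)"
      using ae by (simp add: abs_mult)
  qed (rule strongly_measurable_ip[OF sm v])
  have 0: "ipd Om (phi t) v - ipd Om (phi 0) v = integral {0..t} ?z" if t: "0 <= t" "t <= T" for t
  proof -
    have "ipd Om (phi t - phi 0) v = integral {0..t} ?z"
      using D[of t] t integrable_subinterval(1)[OF zi order_refl t(2)] by (simp add: lebesgue_integral_eq_integral)
    then show ?thesis using ip_diff_left[OF pL[of t] pL[of 0] v] t T by (simp add: fun_diff_def)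
  qed
  show "antideriv T (%t. ipd Om (phi t) v) ?z"
    unfolding antideriv_def
  proof (intro conjI zi allI impI)
    fix s t assume st: "0 <= s \<and> s <= t \<and> t <= T"
    then have "integral {0..s} ?z + integral {s..t} ?z = integral {0..t} ?z"
      by (intro Henstock_Kurzweil_Integration.integral_combine integrable_subinterval(2)[OF zi]) auto
    then show "ipd Om (phi t) v - ipd Om (phi s) v = integral {s..t} ?z"
      using 0[of s] 0[of t] st by simp
  qed
qed

end

subsection \<open>Regularity of the solution in terms of the Bochner norms\<close>

lemma Linf_norm_AE:
  assumes "Linf_norm X N T psi <= ennreal B" "0 <= B"
  shows "AE t in lebesgue_on {0..T}. psi t : X \<and> N (psi t) <= B"
proof -
  have s: "strongly_measurable X N T psi" and e: "esssup (lebesgue_on {0..T}) (%t. ennreal (N (psi t))) <= ennreal B"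
    using assms(1) by (auto simp: Linf_norm_def top_unique split: if_splits)
  have "AE t in lebesgue_on {0..T}. psi t : X" using s by (simp add: strongly_measurable_def)
  moreover have "AE t in lebesgue_on {0..T}. ennreal (N (psi t)) <= esssup (lebesgue_on {0..T}) (%t. ennreal (N (psi t)))"
    by (rule esssup_AE)
  ultimately show ?thesis
  proof eventually_elim
    case (elim t)
    then have "ennreal (N (psi t)) <= ennreal B" using e by (meson order_trans)
    then show ?case using elim(1) assms(2) by simp
  qed
qed

lemma L2t_norm_le:
  assumes "L2t_norm X N T psi <= ennreal c" "0 <= c"
  shows "AE t in lebesgue_on {0..T}. psi t : X" "(\<integral>\<^sup>+t. ennreal ((N (psi t))^2) \<partial>lebesgue_on {0..T}) <= ennreal (c^2)"
proof -
  define I where "I = (\<integral>\<^sup>+t. ennreal ((N (psi t))^2) \<partial>lebesgue_on {0..T})"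
  have s: "strongly_measurable X N T psi" "I < top" "ennreal (sqrt (enn2real I)) <= ennreal c"
    using assms(1) by (auto simp: L2t_norm_def I_def[symmetric] Let_def top_unique split: if_splits)
  then show "AE t in lebesgue_on {0..T}. psi t : X" by (simp add: strongly_measurable_def)
  have "sqrt (enn2real I) <= c" using s(3) assms(2) by simp
  then have "enn2real I <= c^2" by (rule sqrt_le_D)
  then have "ennreal (enn2real I) <= ennreal (c^2)" by (rule ennreal_leI)
  then show "(\<integral>\<^sup>+t. ennreal ((N (psi t))^2) \<partial>lebesgue_on {0..T}) <= ennreal (c^2)"
    using s(2) by (simp add: I_def[symmetric])
qed

text \<open>X does not depend on the representative, so a bound valid for every representative
  passes to the infimum; the slack e stands in for a minimiser.\<close>

lemma norm_dt_bound:
  assumes "\<And>psi B. (has_time_deriv Om T ^^ j) phi psi ==> nrm psi <= ennreal B ==> 0 <= B ==> X <= c * B"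
    and "norm_dt Om T nrm j phi = ennreal l" "0 <= l" "0 <= c"
  shows "X <= c * l"
proof (rule field_le_epsilon)
  fix e :: real assume e: "0 < e"
  define d where "d = e / (c + 1)"
  have d: "0 < d" "c * d <= e" using e assms(4) by (auto simp: d_def field_simps)
  have "norm_dt Om T nrm j phi < ennreal (l + d)" using assms(2,3) d by (simp add: ennreal_less_iff)
  then obtain psi where "(has_time_deriv Om T ^^ j) phi psi" "nrm psi < ennreal (l + d)"
    unfolding norm_dt_def INF_less_iff by blast
  then have "X <= c * (l + d)" using assms(1)[of psi "l + d"] assms(3) d by simp
  then show "X <= c * l + e" using d by (simp add: algebra_simps)
qed

lemma deriv_within_unique:
  assumes "(y has_real_derivative a) (at t within {0..T})" "(y has_real_derivative b) (at t within {0..T})" "t : {0..T}" "0 < T"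
  shows "a = b"
proof (rule vector_derivative_unique_within)
  show "at t within {0..T} ~= bot" using assms(3,4) islimpt_Icc[of 0 T t] by (simp add: trivial_limit_within)
qed (use assms in \<open>auto simp: has_real_derivative_iff_has_vector_derivative\<close>)

lemma antideriv_cong:
  assumes "antideriv T y z" "\<And>t. t : {0..T} ==> y t = y' t" "\<And>t. t : {0..T} ==> z t = z' t"
  shows "antideriv T y' z'"
proof -
  have "integrable (lebesgue_on {0..T}) z' \<longleftrightarrow> integrable (lebesgue_on {0..T}) z"
    by (rule Bochner_Integration.integrable_cong) (simp_all add: assms(3))
  moreover have "integral {s..t} z' = integral {s..t} z" if "0 <= s" "t <= T" for s t
    by (rule Henstock_Kurzweil_Integration.integral_cong) (use that assms(3) in auto)
  ultimately show ?thesis using assms(1) unfolding antideriv_def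
    by (metis assms(2) atLeastAtMost_iff order_trans)
qed

text \<open>Counts the closed windows of radius k around grid points that contain a given
  time.\<close>

lemma card_near: "finite {n::nat. \<bar>real n - x\<bar> <= 1}" "card {n::nat. \<bar>real n - x\<bar> <= 1} <= 3"
proof -
  define y z where "y = x - 1" and "z = x + 1"
  have s: "int ` {n::nat. \<bar>real n - x\<bar> <= 1} \<subseteq> {\<lceil>y\<rceil>..\<lfloor>z\<rfloor>}"
    by (auto simp: le_floor_iff ceiling_le_iff y_def[symmetric] z_def[symmetric]) (simp_all add: y_def z_def)
  have i: "inj_on int {n::nat. \<bar>real n - x\<bar> <= 1}" by (simp add: inj_on_def)
  show "finite {n::nat. \<bar>real n - x\<bar> <= 1}" by (rule inj_on_finite[OF i s]) simp
  have "card {n::nat. \<bar>real n - x\<bar> <= 1} <= card {\<lceil>y\<rceil>..\<lfloor>z\<rfloor>}" by (rule card_inj_on_le[OF i s]) simp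
  also have "... <= 3" using floor_le_ceiling[of x] by (simp add: y_def z_def nat_le_iff)
  finally show "card {n::nat. \<bar>real n - x\<bar> <= 1} <= 3" .
qed

text \<open>\<open>ut\<close> and \<open>utt\<close> have values at every time, fixed by classical
  derivatives of inner products. The representatives in the Bochner norms are compared with them
  only through such products.\<close>

locale wave = finite_domain +
  fixes T :: real and u ut utt :: "real => sfun"
  assumes T: "0 < T"
    and u_H20: "\<And>t. t : {0..T} ==> u t : H20 Om"
    and ut_L2: "\<And>t. t : {0..T} ==> ut t : L2d Om" and utt_L2: "\<And>t. t : {0..T} ==> utt t : L2d Om"
    and u_deriv: "\<And>t v. t : {0..T} ==> v : L2d Om ==> ((%s. ipd Om (u s) v) has_real_derivative ipd Om (ut t) v) (at t within {0..T})"
    and ut_deriv: "\<And>t v. t : {0..T} ==> v : L2d Om ==> ((%s. ipd Om (ut s) v) has_real_derivative ipd Om (utt t) v) (at t within {0..T})"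
begin

lemma u_L2: "t : {0..T} ==> u t : L2d Om" by (intro H20_L2 u_H20)

text \<open>A weak derivative that has one itself is weakly continuous, hence the classical
  derivative at every time.\<close>

lemma chain2:
  assumes "has_time_deriv Om T u psi1" "has_time_deriv Om T psi1 psi2" "v : L2d Om" "t : {0..T}"
  shows "ipd Om (psi1 t) v = ipd Om (ut t) v"
  by (rule deriv_within_unique[OF antideriv_derivative[OF time_deriv_antideriv(1)[OF assms(1,3) T]
        antideriv_continuous[OF time_deriv_antideriv(1)[OF assms(2,3) T]] assms(4)] u_deriv[OF assms(4,3)] assms(4) T])

lemma antideriv_ut:
  assumes "has_time_deriv Om T u psi1" "has_time_deriv Om T psi1 psi2" "v : L2d Om"
  shows "antideriv T (%t. ipd Om (u t) v) (%t. ipd Om (ut t) v)" "antideriv T (%t. ipd Om (ut t) v) (%t. ipd Om (psi2 t) v)"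
proof -
  have e: "t : {0..T} ==> ipd Om (psi1 t) v = ipd Om (ut t) v" for t by (rule chain2[OF assms])
  show "antideriv T (%t. ipd Om (u t) v) (%t. ipd Om (ut t) v)"
    by (rule antideriv_cong[OF time_deriv_antideriv(1)[OF assms(1,3) T]]) (auto intro: e)
  show "antideriv T (%t. ipd Om (ut t) v) (%t. ipd Om (psi2 t) v)"
    by (rule antideriv_cong[OF time_deriv_antideriv(1)[OF assms(2,3) T]]) (auto intro: e)
qed

lemma chain3:
  assumes c: "has_time_deriv Om T u psi1" "has_time_deriv Om T psi1 psi2" "has_time_deriv Om T psi2 psi3" and v: "v : L2d Om"
  shows "antideriv T (%t. ipd Om (ut t) v) (%t. ipd Om (utt t) v)" "antideriv T (%t. ipd Om (utt t) v) (%t. ipd Om (psi3 t) v)"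
proof -
  have e: "ipd Om (psi2 t) v = ipd Om (utt t) v" if t: "t : {0..T}" for t
    by (rule deriv_within_unique[OF antideriv_derivative[OF antideriv_ut(2)[OF c(1,2) v]
          antideriv_continuous[OF time_deriv_antideriv(1)[OF c(3) v T]] t] ut_deriv[OF t v] t T])
  show "antideriv T (%t. ipd Om (ut t) v) (%t. ipd Om (utt t) v)"
    by (rule antideriv_cong[OF antideriv_ut(2)[OF c(1,2) v]]) (auto intro: e)
  show "antideriv T (%t. ipd Om (utt t) v) (%t. ipd Om (psi3 t) v)"
    by (rule antideriv_cong[OF time_deriv_antideriv(1)[OF c(3) v T]]) (auto intro: e)
qed

text \<open>The bound for \<open>psi2\<close> holds almost everywhere and its inner products need
  not be continuous, so the bound is carried to \<open>utt\<close> through difference quotients of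
  \<open>ut\<close>.\<close>

lemma bound_utt:
  assumes c: "has_time_deriv Om T u psi1" "has_time_deriv Om T psi1 psi2"
    and B: "AE t in lebesgue_on {0..T}. L2normd Om (psi2 t) <= B" "0 <= B" and t: "t : {0..T}"
  shows "L2normd Om (utt t) <= B"
proof (rule L2norm_le_dual[OF utt_L2[OF t] _ B(2)])
  fix v assume v: "v : L2d Om"
  let ?y = "%s. ipd Om (ut s) v" and ?B = "B * L2normd Om v"
  have ae: "AE r in lebesgue_on {0..T}. \<bar>ipd Om (psi2 r) v\<bar> <= ?B"
    using B(1) time_deriv_antideriv(2)[OF c(2) v T]
    by eventually_elim (meson L2norm_nonneg mult_right_mono order_trans)
  have "\<bar>(?y s - ?y t) / (s - t)\<bar> <= ?B" if s: "s : {0..T}" "s ~= t" for s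
  proof -
    have "\<bar>?y s - ?y t\<bar> <= ?B * \<bar>s - t\<bar>"
    proof (cases "s <= t")
      case True
      then show ?thesis using antideriv_bound_const[OF antideriv_ut(2)[OF c v] ae, of s t] s t by (simp add: abs_minus_commute)
    next
      case False
      then show ?thesis using antideriv_bound_const[OF antideriv_ut(2)[OF c v] ae, of t s] s t by simp
    qed
    then show ?thesis using s(2) by (simp add: pos_divide_le_eq)
  qed
  then have 1: "\<forall>\<^sub>F s in at t within {0..T}. norm ((?y s - ?y t) / (s - t)) <= ?B"
    by (auto simp: eventually_at_filter)
  have 2: "((%s. (?y s - ?y t) / (s - t)) \<longlongrightarrow> ipd Om (utt t) v) (at t within {0..T})"
    using ut_deriv[OF t v] by (simp add: has_field_derivative_iff)
  have "at t within {0..T} ~= bot" using t T islimpt_Icc[of 0 T t] by (simp add: trivial_limit_within)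
  from Lim_norm_ubound[OF this 2 1] show "\<bar>ipd Om (utt t) v\<bar> <= ?B" by simp
qed

lemma bound_Linf:
  assumes c: "has_time_deriv Om T phi psi" and B: "AE t in lebesgue_on {0..T}. phi t : L2d Om \<and> L2normd Om (phi t) <= B" "0 <= B" and t: "t : {0..T}"
  shows "L2normd Om (phi t) <= B"
proof (rule L2norm_le_dual[OF _ _ B(2)])
  show "phi t : L2d Om" using c t by (simp add: has_time_deriv_def)
  fix v assume v: "v : L2d Om"
  have "AE r in lebesgue_on {0..T}. \<bar>ipd Om (phi r) v\<bar> <= B * L2normd Om v"
    using B(1) by eventually_elim (meson L2norm_nonneg mult_right_mono order_trans ip_Cauchy_Schwarz v)
  then show "\<bar>ipd Om (phi t) v\<bar> <= B * L2normd Om v"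
    by (rule continuous_AE_bound[OF antideriv_continuous[OF time_deriv_antideriv(1)[OF c v T]] _ t T])
qed

text \<open>The norm need not be continuous in time, but each functional from
  \<open>Hs_norm_dual\<close> is; a bound almost everywhere thereby holds at each t where u lies in
  the space.\<close>

lemma bound_Hs:
  assumes c: "has_time_deriv Om T u psi" and H: "AE t in lebesgue_on {0..T}. u t : Hs s Om \<and> Hs_norm s Om (u t) <= B"
    and s: "0 <= s" and t: "t : {0..T}" "u t : Hs s Om"
  shows "Hs_norm s Om (u t) <= B"
proof (rule field_le_epsilon)
  fix e :: real assume "0 < e"
  obtain v where v: "v : L2d Om" "\<And>z. z : Hs s Om ==> \<bar>ipd Om z v\<bar> <= Hs_norm s Om z" "Hs_norm s Om (u t) <= ipd Om (u t) v + e"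
    using Hs_norm_dual[OF s t(2) \<open>0 < e\<close>] by metis
  have "AE r in lebesgue_on {0..T}. \<bar>ipd Om (u r) v\<bar> <= B"
    using H by eventually_elim (use v(2) in \<open>force intro: order_trans\<close>)
  then have "\<bar>ipd Om (u t) v\<bar> <= B"
    by (rule continuous_AE_bound[OF antideriv_continuous[OF time_deriv_antideriv(1)[OF c v(1) T]] _ t(1) T])
  then show "Hs_norm s Om (u t) <= B + e" using v(3) by linarith
qed

text \<open>A difference quotient is a mean of the time derivative. Tested with a dual functional
  this mean is at most B, and such functionals recover the norm.\<close>

lemma bound_dq_Hs:
  assumes c: "has_time_deriv Om T u psi" and H: "AE t in lebesgue_on {0..T}. psi t : Hs s Om \<and> Hs_norm s Om (psi t) <= B"
    and s: "0 <= s" and k: "0 < k" "0 <= a" "a + k <= T" and w: "w : Hs s Om" "w = (%x. (u (a + k) x - u a x) / k)"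
  shows "Hs_norm s Om w <= B"
proof (rule field_le_epsilon)
  fix e :: real assume "0 < e"
  obtain v where v: "v : L2d Om" "\<And>z. z : Hs s Om ==> \<bar>ipd Om z v\<bar> <= Hs_norm s Om z" "Hs_norm s Om w <= ipd Om w v + e"
    using Hs_norm_dual[OF s w(1) \<open>0 < e\<close>] by metis
  have "AE r in lebesgue_on {0..T}. \<bar>ipd Om (psi r) v\<bar> <= B"
    using H by eventually_elim (use v(2) in \<open>force intro: order_trans\<close>)
  then have "\<bar>ipd Om (u (a + k)) v - ipd Om (u a) v\<bar> <= B * (a + k - a)"
    by (rule antideriv_bound_const[OF time_deriv_antideriv(1)[OF c v(1) T]]) (use k in auto)
  moreover have "ipd Om w v = (ipd Om (u (a + k)) v - ipd Om (u a) v) / k"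
    using k unfolding w(2) ip_divide_left by (simp add: ip_diff_left u_L2 v)
  ultimately have "ipd Om w v <= B" using k(1) by (simp add: pos_divide_le_eq)
  then show "Hs_norm s Om w <= B + e" using v(3) by linarith
qed

lemma bound_initial:
  assumes c: "has_time_deriv Om T u psi1" "has_time_deriv Om T psi1 psi2" "has_time_deriv Om T psi2 psi3"
    and B: "AE t in lebesgue_on {0..T}. L2normd Om (psi3 t) <= B" "0 <= B" and k: "0 < k" "k <= T" and v: "v : L2d Om"
  shows "\<bar>(ipd Om (u k) v - ipd Om (u 0) v) / k - ipd Om (ut 0) v - k / 4 * (ipd Om (utt 0) v + ipd Om (utt k) v)\<bar>
    <= 2 * B * k^2 * L2normd Om v"
proof -
  have ae: "AE r in lebesgue_on {0..T}. \<bar>ipd Om (psi3 r) v\<bar> <= B * L2normd Om v"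
    using B(1) time_deriv_antideriv(2)[OF c(3) v T]
    by eventually_elim (meson L2norm_nonneg mult_right_mono order_trans)
  have "0 <= B * L2normd Om v" using B(2) by simp
  from initial_taylor[OF antideriv_ut(1)[OF c(1,2) v] chain3[OF c v] ae this k]
  show ?thesis by (simp add: mult_ac)
qed

lemma grid_interval:
  assumes "1 <= n" "n < N" "0 < k" "real N * k = T"
  shows "0 <= real n * k - k" "real n * k + k <= T" "real n * k : {0..T}" "real (n - 1) * k = real n * k - k" "real (n + 1) * k = real n * k + k"
proof -
  show 1: "0 <= real n * k - k" using assms mult_right_mono[of 1 "real n" k] by simp
  show 2: "real n * k + k <= T" using assms mult_right_mono[of "real (Suc n)" "real N" k] by (simp add: algebra_simps)
  show "real n * k : {0..T}" using 1 2 assms(3) by auto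
  show "real (n - 1) * k = real n * k - k" "real (n + 1) * k = real n * k + k" using assms(1) by (simp_all add: algebra_simps of_nat_diff)
qed

lemma ip_dbar2:
  assumes "1 <= n" "n < N" "0 < k" "real N * k = T" and v: "v : L2d Om"
  shows "ipd Om (dbar2 k (at_grid k u) n) v =
    (ipd Om (u (real n * k + k)) v - 2 * ipd Om (u (real n * k)) v + ipd Om (u (real n * k - k)) v) / k^2"
    and "dbar2 k (at_grid k u) n : L2d Om"
proof -
  note g = grid_interval[OF assms(1-4)]
  have L: "u (real n * k + k) : L2d Om" "u (real n * k) : L2d Om" "u (real n * k - k) : L2d Om"
    using g(1-3) assms(3) by (auto intro!: u_L2)
  have e: "dbar2 k (at_grid k u) n = (%x. (1 * (1 * u (real n * k + k) x + (-2) * u (real n * k) x) + 1 * u (real n * k - k) x) / k^2)"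
    unfolding dbar2_def at_grid_def g(4,5) by simp
  show "dbar2 k (at_grid k u) n : L2d Om" unfolding e by (intro L2_divide L2_lin L)
  show "ipd Om (dbar2 k (at_grid k u) n) v =
    (ipd Om (u (real n * k + k)) v - 2 * ipd Om (u (real n * k)) v + ipd Om (u (real n * k - k)) v) / k^2"
    unfolding e ip_divide_left ip_lin_left[OF L2_lin[OF L(1,2)] L(3) v] ip_lin_left[OF L(1,2) v] by simp
qed

lemma bound_dbar2_utt:
  assumes c: "has_time_deriv Om T u psi1" "has_time_deriv Om T psi1 psi2" "has_time_deriv Om T psi2 psi3" "has_time_deriv Om T psi3 psi4"
    and n: "1 <= n" "n < N" "0 < k" "real N * k = T"
  shows "L2normd Om (%x. dbar2 k (at_grid k u) n x - utt (real n * k) x)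
    <= 2 * k * integral {real n * k - k..real n * k + k} (%r. L2normd Om (psi4 r))"
proof (rule L2norm_le_dual)
  note g = grid_interval[OF n]
  note ni = time_deriv_antideriv(3)[OF c(4) const_L2[of 0] T]
  have L: "dbar2 k (at_grid k u) n : L2d Om" by (rule ip_dbar2(2)[OF n const_L2[of 0]])
  show "(%x. dbar2 k (at_grid k u) n x - utt (real n * k) x) : L2d Om" by (intro L2_diff L utt_L2 g)
  show "0 <= 2 * k * integral {real n * k - k..real n * k + k} (%r. L2normd Om (psi4 r))"
    using n(3) g by (intro mult_nonneg_nonneg integral_nonneg integrable_subinterval(2)[OF ni]) auto
  fix v assume v: "v : L2d Om"
  have nv: "integrable (lebesgue_on {0..T}) (%r. L2normd Om (psi4 r) * L2normd Om v)" using ni by simp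
  let ?y = "%t. ipd Om (u t) v" and ?a = "real n * k"
  define I where "I = integral {?a - k..?a + k} (%r. L2normd Om (psi4 r)) * L2normd Om v"
  have "\<bar>?y (?a + k) - 2 * ?y ?a + ?y (?a - k) - k^2 * ipd Om (utt ?a) v\<bar> <= 2 * k^3 * I"
    unfolding I_def
    using second_difference_taylor[OF antideriv_ut(1)[OF c(1,2) v] chain3[OF c(1-3) v] time_deriv_antideriv(1)[OF c(4) v T] nv
       time_deriv_antideriv(2)[OF c(4) v T] _ g(1,2) n(3)] by simp
  then have "\<bar>(?y (?a + k) - 2 * ?y ?a + ?y (?a - k) - k^2 * ipd Om (utt ?a) v) / k^2\<bar> <= 2 * k * I"
    using n(3) by (simp add: abs_divide pos_divide_le_eq power2_eq_square power3_eq_cube mult_ac)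
  moreover have "ipd Om (%x. dbar2 k (at_grid k u) n x - utt ?a x) v = (?y (?a + k) - 2 * ?y ?a + ?y (?a - k) - k^2 * ipd Om (utt ?a) v) / k^2"
    using n(3) by (simp add: ip_diff_left[OF L utt_L2[OF g(3)] v] ip_dbar2(1)[OF n v] diff_divide_distrib)
  ultimately show "\<bar>ipd Om (%x. dbar2 k (at_grid k u) n x - utt ?a x) v\<bar>
      <= 2 * k * integral {?a - k..?a + k} (%r. L2normd Om (psi4 r)) * L2normd Om v"
    by (simp add: I_def mult.assoc)
qed

text \<open>
  Measurability in time of the norm of \<open>H\<^sup>s\<close> is not needed: the norms of the finitely many
  second differences are replaced by functionals on \<open>L\<^sup>2\<close> that are dominated by the norm.
\<close>

lemma bound_dbar2_Hs:
  assumes c: "has_time_deriv Om T u psi1" "has_time_deriv Om T psi1 psi2"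
    and H: "AE t in lebesgue_on {0..T}. psi2 t : Hs s Om" "(\<integral>\<^sup>+t. ennreal ((Hs_norm s Om (psi2 t))^2) \<partial>lebesgue_on {0..T}) <= ennreal (C^2)" "0 <= C"
    and s: "0 <= s" and k: "0 < k" "real N * k = T"
    and w: "\<And>n. 1 <= n ==> n < N ==> dbar2 k (at_grid k u) n : Hs s Om"
  shows "(\<Sum>n=1..<N. k * Hs_norm s Om (dbar2 k (at_grid k u) n)) <= 6 * sqrt T * C"
proof (rule field_le_epsilon)
  fix e :: real assume e: "0 < e"
  \<comment> \<open>The defect d of the dual functionals is weighted by k and summed over N - 1
    steps, at most T d = e.\<close>
  define d where "d = e / T"
  have d: "0 < d" "T * d = e" using e T by (simp_all add: d_def)
  let ?w = "dbar2 k (at_grid k u)" and ?I = "lebesgue_on {0..T}"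
  have "\<forall>n\<in>{1..<N}. \<exists>v. v : L2d Om \<and> (\<forall>z\<in>Hs s Om. \<bar>ipd Om z v\<bar> <= Hs_norm s Om z) \<and> Hs_norm s Om (?w n) <= ipd Om (?w n) v + d"
  proof
    fix n assume "n : {1..<N}"
    then have "?w n : Hs s Om" by (intro w) auto
    then show "\<exists>v. v : L2d Om \<and> (\<forall>z\<in>Hs s Om. \<bar>ipd Om z v\<bar> <= Hs_norm s Om z) \<and> Hs_norm s Om (?w n) <= ipd Om (?w n) v + d"
      using Hs_norm_dual[OF s _ d(1)] by metis
  qed
  then obtain v where v: "\<And>n. n : {1..<N} ==> v n : L2d Om" "\<And>n z. n : {1..<N} ==> z : Hs s Om ==> \<bar>ipd Om z (v n)\<bar> <= Hs_norm s Om z"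
    "\<And>n. n : {1..<N} ==> Hs_norm s Om (?w n) <= ipd Om (?w n) (v n) + d"
    by metis
  define J where "J n = {real n * k - k..real n * k + k}" for n
  define y where "y n r = \<bar>ipd Om (psi2 r) (v n)\<bar>" for n r
  \<comment> \<open>Only windows containing r contribute, at most three of them: a measurable
    function below three times the norm of \<open>psi2 r\<close>.\<close>
  define F where "F r = (\<Sum>n=1..<N. if r : J n then y n r else 0)" for r
  have yi: "integrable ?I (y n)" if "n : {1..<N}" for n
    using antideriv_ut(2)[OF c v(1)[OF that]] unfolding y_def[abs_def] by (simp add: antideriv_def)
  have JT: "J n \<subseteq> {0..T}" if "n : {1..<N}" for n
    using grid_interval(1,2)[of n N k] that k by (auto simp: J_def)
  have step: "k * Hs_norm s Om (?w n) <= 2 * integral (J n) (y n) + k * d" if n: "n : {1..<N}" for n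
  proof -
    have n': "1 <= n" "n < N" using n by auto
    note g = grid_interval[OF n' k]
    have "\<bar>k^2 * ipd Om (?w n) (v n)\<bar> <= 2 * k * integral (J n) (y n)"
      unfolding J_def ip_dbar2(1)[OF n' k v(1)[OF n]]
      using second_difference_bound[OF antideriv_ut[OF c v(1)[OF n]] yi[OF n] _ _ g(1,2) k(1)] k(1) by (simp add: y_def)
    then have "k * (k * ipd Om (?w n) (v n)) <= k * (2 * integral (J n) (y n))" by (simp add: power2_eq_square mult_ac)
    then have "k * ipd Om (?w n) (v n) <= 2 * integral (J n) (y n)" using k(1) by simp
    moreover have "k * Hs_norm s Om (?w n) <= k * (ipd Om (?w n) (v n) + d)" using v(3)[OF n] k(1) by simp
    ultimately show ?thesis by (simp add: algebra_simps)
  qed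
  have Fm: "F : borel_measurable ?I"
    unfolding F_def[abs_def]
  proof (rule borel_measurable_sum)
    fix n assume n: "n : {1..<N}"
    have "(%r. indicator (J n) r * y n r) : borel_measurable ?I"
      using yi[OF n] by (intro borel_measurable_times borel_measurable_indicator') (auto simp: J_def sets_restrict_space_iff)
    moreover have "(%r. indicator (J n) r * y n r) = (%r. if r : J n then y n r else 0)" by auto
    ultimately show "(%r. if r : J n then y n r else 0) : borel_measurable ?I" by simp
  qed
  have F0: "0 <= F r" for r unfolding F_def by (intro sum_nonneg) (auto simp: y_def)
  have FH: "F r <= 3 * Hs_norm s Om (psi2 r)" if r: "psi2 r : Hs s Om" for r
  proof -
    define S where "S = {n : {1..<N}. r : J n}"
    have N0: "0 <= Hs_norm s Om (psi2 r)"
      unfolding Hs_norm_def Let_def by (auto intro!: add_nonneg_nonneg sum_nonneg mult_nonneg_nonneg simp: frac_lt_1 less_imp_le)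
    have "F r = (\<Sum>n\<in>S. y n r)" unfolding F_def S_def by (subst sum.inter_filter) auto
    also have "... <= (\<Sum>n\<in>S. Hs_norm s Om (psi2 r))" by (rule sum_mono) (auto simp: S_def y_def intro: v(2) r)
    also have "... = real (card S) * Hs_norm s Om (psi2 r)" by simp
    also have "... <= 3 * Hs_norm s Om (psi2 r)"
    proof (rule mult_right_mono[OF _ N0])
      have "S \<subseteq> {n. \<bar>real n - r / k\<bar> <= 1}" using k(1) by (auto simp: S_def J_def abs_le_iff field_simps)
      then have "card S <= 3" using card_mono[OF card_near(1)] card_near(2) by (meson order_trans)
      then show "real (card S) <= 3" by simp
    qed
    finally show ?thesis .
  qed
  have IF: "(\<integral>\<^sup>+r. ennreal ((F r / 3)^2) \<partial>?I) <= ennreal (C^2)"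
  proof (rule order_trans[OF nn_integral_mono_AE H(2)])
    show "AE r in ?I. ennreal ((F r / 3)^2) <= ennreal ((Hs_norm s Om (psi2 r))^2)"
      using H(1)
    proof eventually_elim
      case (elim r)
      then show ?case using FH[OF elim] F0[of r] by (intro ennreal_leI power_mono) auto
    qed
  qed
  have "integral {0..T} (%r. F r / 3) <= sqrt T * C"
    by (rule integral_le_L2t_norm(2)[OF _ _ T IF H(3)]) (use Fm F0 in auto)
  then have FI: "integral {0..T} F <= 3 * (sqrt T * C)" by simp
  have yJ: "(%r. if r : J n then y n r else 0) integrable_on {0..T}" if n: "n : {1..<N}" for n
  proof -
    have "y n integrable_on J n" unfolding J_def using grid_interval(1,2)[of n N k] n k by (intro integrable_subinterval(2)[OF yi[OF n]]) auto
    then show ?thesis using JT[OF n] by (simp add: integrable_restrict_Int Int_absorb2)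
  qed
  have "integral {0..T} F = (\<Sum>n=1..<N. integral {0..T} (%r. if r : J n then y n r else 0))"
    unfolding F_def[abs_def] by (rule Henstock_Kurzweil_Integration.integral_sum) (use yJ in auto)
  also have "... = (\<Sum>n=1..<N. integral (J n) (y n))"
    using JT by (intro sum.cong refl) (simp add: integral_restrict_Int Int_absorb2)
  finally have "(\<Sum>n=1..<N. integral (J n) (y n)) = integral {0..T} F" ..
  moreover have "(\<Sum>n=1..<N. k * Hs_norm s Om (?w n)) <= (\<Sum>n=1..<N. 2 * integral (J n) (y n) + k * d)" by (rule sum_mono) (rule step)
  moreover have "(\<Sum>n=1..<N. 2 * integral (J n) (y n) + k * d) = 2 * (\<Sum>n=1..<N. integral (J n) (y n)) + real (N - 1) * (k * d)"
    by (simp add: sum.distrib sum_distrib_left)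
  moreover have "real (N - 1) * (k * d) <= real N * (k * d)" using k(1) d(1) by (intro mult_right_mono) auto
  moreover have "real N * (k * d) = e" using k(2) d(2) by (simp add: mult.assoc[symmetric])
  \<comment> \<open>The factor 6 is 2 from the second difference times 3 from the overlap of the
    windows.\<close>
  ultimately show "(\<Sum>n=1..<N. k * Hs_norm s Om (?w n)) <= 6 * sqrt T * C + e"
    using FI by (simp only: algebra_simps)
qed

end

subsection \<open>The error of the fully discrete scheme\<close>

context mesh_domain
begin

lemma Hs_pw_lin: "v : Hs_pw 2 \<T> ==> w : Hs_pw 2 \<T> ==> (%x. c * v x + d * w x) : Hs_pw 2 \<T>"
  unfolding Hs_pw_def using Hs_lin[OF open_interior, of v 2 _ w c d] by auto

lemma mesh_norm_lin_le:
  assumes "v : Hs_pw 2 \<T>" "w : Hs_pw 2 \<T>"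
  shows "mesh_norm \<T> (%x. c * v x + d * w x) <= 2 * (\<bar>c\<bar> * mesh_norm \<T> v + \<bar>d\<bar> * mesh_norm \<T> w)"
proof (rule power2_le_imp_le)
  let ?a = "\<bar>c\<bar> * mesh_norm \<T> v" and ?b = "\<bar>d\<bar> * mesh_norm \<T> w"
  have nn: "0 <= ?a" "0 <= ?b" by (simp_all add: mesh_norm_nonneg)
  have "(mesh_norm \<T> (%x. c * v x + d * w x))^2 <= 2 * ?a^2 + 2 * ?b^2"
    using mesh_norm_lin_sq[OF mesh assms, of c d] by (simp add: power_mult_distrib)
  also have "... <= (2 * (?a + ?b))^2"
  proof -
    have "0 <= ?a * ?b" "0 <= ?a^2" "0 <= ?b^2" using nn by auto
    then show ?thesis by (simp only: power_mult_distrib power2_sum) simp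
  qed
  finally show "(mesh_norm \<T> (%x. c * v x + d * w x))^2 <= (2 * (?a + ?b))^2" .
  show "0 <= 2 * (?a + ?b)" using nn by simp
qed

end

text \<open>Here h is not the mesh size but the factor in the energy error of the Ritz projection.
  The instance takes h, c1, c2 to be C2 h^gamma, 2 C1 h^2 and C2 h^(2 gamma).\<close>

locale discretisation = mesh_domain +
  fixes V :: "sfun set" and ah :: "sfun => sfun => real" and Q R :: "sfun => sfun" and al k h c1 c2 gam :: real
  assumes V_pw: "V \<subseteq> Hs_pw 2 \<T>"
    and V_lin: "v : V ==> w : V ==> (%x. c * v x + d * w x) : V"
    and ah_sym: "v : V ==> w : V ==> ah v w = ah w v"
    and ah_lin: "v : V ==> v' : V ==> w : V ==> ah (%x. c * v x + d * v' x) w = c * ah v w + d * ah v' w"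
    and coercive: "v : V ==> al * (mesh_norm \<T> v)^2 <= ah v v"
    and cfl: "v : V ==> k^2 * ah v v <= (L2normd Om v)^2"
    and pos: "al > 0" "k > 0" "c1 > 0" "c2 > 0" "h > 0"
    and Q_H20: "v : V ==> Q v : H20 Om"
    and Q_err: "v : V ==> L2normd Om (%x. v x - Q v x) <= c1 * mesh_norm \<T> v"
    and R_V: "w : H20 Om ==> R w : V" and R_eq: "w : H20 Om ==> v : V ==> ah (R w) v = aform Om w (Q v)"
    and R_err: "w : H20 Om ==> w : Hs (2 + gam) Om ==> L2normd Om (%x. w x - R w x) <= c2 * Hs_norm (2 + gam) Om w"
      "w : H20 Om ==> w : Hs (2 + gam) Om ==> mesh_norm \<T> (%x. w x - R w x) <= h * Hs_norm (2 + gam) Om w"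
begin

lemma V_L2: "v : V ==> v : L2d Om"
  using V_pw Hs_pw_L2 by blast

sublocale energy: discrete_energy M V ah "mesh_norm \<T>" al k
  by unfold_locales (auto intro: V_L2 V_lin ah_sym ah_lin coercive cfl pos mesh_norm_nonneg)

lemma null: assumes v: "v : V" and z: "mesh_norm \<T> v = 0" shows "L2normd Om v = 0"
proof (rule mesh_null_imp_null[OF _ Q_H20[OF v] _ z])
  show "v : Hs_pw 2 \<T>" using v V_pw by blast
  show "L2normd Om (%x. v x - Q v x) = 0" using Q_err[OF v] z L2norm_nonneg[of M "%x. v x - Q v x"] by simp
qed

text \<open>r only satisfies the equation of the projection of z. Then r - R z has zero energy,
  hence zero mesh-dependent norm, hence is a null vector of L2. Applied to difference quotients,
  this replaces literal linearity of R.\<close>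

lemma ritz_error:
  assumes z: "z : H20 Om" "z : Hs (2 + gam) Om" and r: "r : V" "\<And>v. v : V ==> ah r v = aform Om z (Q v)"
  shows "L2normd Om (%x. r x - z x) <= c2 * Hs_norm (2 + gam) Om z"
proof -
  let ?d = "%x. 1 * r x + (-1) * R z x"
  have d: "?d : V" by (intro V_lin r R_V z)
  have "ah ?d ?d = 0" unfolding ah_lin[OF r(1) R_V[OF z(1)] d] r(2)[OF d] R_eq[OF z(1) d] by simp
  then have "al * (mesh_norm \<T> ?d)^2 <= 0" using coercive[OF d] by simp
  then have "mesh_norm \<T> ?d = 0" using pos(1) by (simp add: mult_le_0_iff)
  then have 0: "L2normd Om ?d = 0" by (rule null[OF d])
  have L: "?d : L2d Om" "z : L2d Om" "R z : L2d Om" by (intro V_L2 d R_V z H20_L2)+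
  have "(%x. r x - z x) = (%x. ?d x - (z x - R z x))" by auto
  then have "L2normd Om (%x. r x - z x) <= L2normd Om ?d + L2normd Om (%x. z x - R z x)"
    using L2norm_triangle_diff[OF L(1) L2_diff[OF L(2,3)]] by simp
  then show ?thesis using 0 R_err(1)[OF z] by linarith
qed

text \<open>The sequences w, g, z, F stand for u, f - u_tt, u_tt and f at the grid points, so that
  no function of time occurs. Here the projection error is added to the energy estimate for
  \<theta>.\<close>

lemma error_bound:
  fixes w g z F U :: "nat => sfun" and v0 :: sfun
  assumes N: "N \<ge> 1" and w: "\<And>n. n <= N ==> w n : H20 Om" "\<And>n. n <= N ==> w n : Hs (2 + gam) Om"
    and dw: "\<And>n. n < N ==> dbar k w n : Hs (2 + gam) Om" "\<And>n. 1 <= n ==> n < N ==> dbar2 k w n : Hs (2 + gam) Om"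
    and g: "\<And>n. n <= N ==> g n : L2d Om" "\<And>n v. n <= N ==> v : H20 Om ==> aform Om (w n) v = ipd Om (g n) v"
    and z: "\<And>n. n <= N ==> z n : L2d Om" and v0: "v0 : L2d Om"
    and F: "\<And>n. n <= N ==> F n : L2d Om" "\<And>n v. n <= N ==> v : L2d Om ==> ipd Om (F n) v = ipd Om (g n) v + ipd Om (z n) v"
    and U: "\<And>n. n <= N ==> U n : V" "U 0 = R (w 0)"
    and init: "\<And>v. v : V ==> 2 / k * ipd Om (dbar k U 0) v + ah (half U 0) v = ipd Om (%x. half F 0 x + 2 / k * v0 x) v"
    and step: "\<And>n v. 1 <= n ==> n < N ==> v : V ==> ipd Om (dbar2 k U n) v + ah (U n) v = ipd Om (F n) v"
    and G: "\<And>n. n <= N ==> L2normd Om (g n) <= G"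
    and W: "\<And>n. n <= N ==> Hs_norm (2 + gam) Om (w n) <= W" "\<And>n. n < N ==> Hs_norm (2 + gam) Om (dbar k w n) <= W'"
    and sg: "\<And>v. v : L2d Om ==> \<bar>ipd Om (dbar k w 0) v - ipd Om v0 v - k / 4 * (ipd Om (z 0) v + ipd Om (z 1) v)\<bar> <= \<sigma> * L2normd Om v"
    and nn: "0 <= G" "0 <= W" "0 <= W'" "0 <= \<sigma>" and m: "m < N"
  shows "L2normd Om (dbar k w m - dbar k U m) + mesh_norm \<T> (half w m - half U m)
    <= c2 * W' + 4 * h * W + 4 / min (3/4) al * (c2 * W' + \<sigma> + 5 * (c1 * G)
       + 2 * k * (\<Sum>n=1..<N. c2 * Hs_norm (2 + gam) Om (dbar2 k w n) + L2normd Om (%x. dbar2 k w n x - z n x))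
       + 2 * (\<Sum>n=1..<N. c1 * L2normd Om (%x. g (Suc n) x - g n x)))"
proof -
  define r where "r n = R (w n)" for n
  define \<theta> where "\<theta> n = (%x. 1 * r n x + (-1) * U n x)" for n
  have rV: "r n : V" if "n <= N" for n unfolding r_def by (intro R_V w that)
  have req: "ah (r n) v = ipd Om (g n) (Q v)" if "n <= N" "v : V" for n v
    unfolding r_def using R_eq[OF w(1)[OF that(1)] that(2)] g(2)[OF that(1) Q_H20[OF that(2)]] by simp
  have rL: "r n : L2d Om" and UL: "U n : L2d Om" and wL: "w n : L2d Om" if "n <= N" for n
    using that by (auto intro: V_L2 rV U H20_L2 w)
  have w2: "w n : Hs 2 Om" if "n <= N" for n by (intro H20_Hs w that)
  have \<theta>V: "\<theta> n : V" if "n <= N" for n unfolding \<theta>_def by (intro V_lin rV U that)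
  have dbar_eq: "dbar k X n = (%x. 1 / k * X (Suc n) x + (- 1 / k) * X n x)" for X :: "nat => sfun" and n
    by (auto simp: dbar_def diff_divide_distrib)
  have half_eq: "half X n = (%x. 1 / 2 * X (Suc n) x + 1 / 2 * X n x)" for X :: "nat => sfun" and n
    by (auto simp: half_def add_divide_distrib)
  have dbar2_eq: "dbar2 k X n = (%x. 1 * (1 / k^2 * X (Suc n) x + (- 2 / k^2) * X n x) + 1 / k^2 * X (n - 1) x)" for X :: "nat => sfun" and n
    by (auto simp: dbar2_def diff_divide_distrib add_divide_distrib)
  define e where "e n v = ah (r n) v - ipd Om (g n) v" for n v
  have e_eq: "e n v = - ipd Om (g n) (%x. v x - Q v x)" if "n <= N" "v : V" for n v
    unfolding e_def req[OF that] by (simp add: ip_diff_right g that V_L2 H20_L2 Q_H20)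
  have QL: "(%x. v x - Q v x) : L2d Om" if "v : V" for v by (intro L2_diff V_L2 H20_L2 Q_H20 that)
  have e_lin: "e n (%x. c * v x + d * v' x) = c * e n v + d * e n v'" if n: "n <= N" and v: "v : V" "v' : V" for n v v' c d
    unfolding e_def energy.a_lin_right[OF v rV[OF n]] ip_lin_right[OF V_L2[OF v(1)] V_L2[OF v(2)] g(1)[OF n]] by (simp add: algebra_simps)
  have e_bd: "\<bar>e n v\<bar> <= c1 * G * mesh_norm \<T> v" if n: "n <= N" and v: "v : V" for n v
  proof -
    have "\<bar>e n v\<bar> <= L2normd Om (g n) * L2normd Om (%x. v x - Q v x)"
      unfolding e_eq[OF that] abs_minus_cancel by (rule ip_Cauchy_Schwarz[OF g(1)[OF n] QL[OF v]])
    also have "... <= G * (c1 * mesh_norm \<T> v)" by (intro mult_mono G n Q_err v nn L2norm_nonneg)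
    finally show ?thesis by (simp add: mult_ac)
  qed
  have e_diff: "\<bar>e (Suc n) v - e n v\<bar> <= c1 * L2normd Om (%x. g (Suc n) x - g n x) * mesh_norm \<T> v" if n: "n < N" and v: "v : V" for n v
  proof -
    have gL: "g (Suc n) : L2d Om" "g n : L2d Om" using n by (auto intro: g)
    have "\<bar>e (Suc n) v - e n v\<bar> = \<bar>ipd Om (%x. g (Suc n) x - g n x) (%x. v x - Q v x)\<bar>"
      using n by (simp add: e_eq v ip_diff_left[OF gL QL[OF v]])
    also have "... <= L2normd Om (%x. g (Suc n) x - g n x) * L2normd Om (%x. v x - Q v x)"
      by (rule ip_Cauchy_Schwarz[OF L2_diff[OF gL] QL[OF v]])
    also have "... <= L2normd Om (%x. g (Suc n) x - g n x) * (c1 * mesh_norm \<T> v)" by (intro mult_left_mono Q_err v L2norm_nonneg)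
    finally show ?thesis by (simp add: mult_ac)
  qed
  have dr: "L2normd Om (%x. dbar k r n x - dbar k w n x) <= c2 * W'" if n: "n < N" for n
  proof -
    have n': "Suc n <= N" "n <= N" using n by auto
    have "L2normd Om (%x. dbar k r n x - dbar k w n x) <= c2 * Hs_norm (2 + gam) Om (dbar k w n)"
    proof (rule ritz_error)
      show "dbar k w n : H20 Om" "dbar k r n : V" unfolding dbar_eq by (intro H20_lin V_lin w rV n')+
      show "ah (dbar k r n) v = aform Om (dbar k w n) (Q v)" if v: "v : V" for v
        unfolding dbar_eq ah_lin[OF rV[OF n'(1)] rV[OF n'(2)] v] aform_lin_left[OF w2[OF n'(1)] w2[OF n'(2)] H20_Hs[OF Q_H20[OF v]]]
        by (simp add: r_def R_eq w n' v)
    qed (rule dw(1)[OF n])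
    also have "... <= c2 * W'" using W(2)[OF n] pos(4) by simp
    finally show ?thesis .
  qed
  have d2r: "L2normd Om (%x. dbar2 k r n x - dbar2 k w n x) <= c2 * Hs_norm (2 + gam) Om (dbar2 k w n)" if n: "1 <= n" "n < N" for n
  proof (rule ritz_error)
    have n': "Suc n <= N" "n <= N" "n - 1 <= N" using n by auto
    show "dbar2 k w n : H20 Om" "dbar2 k r n : V" unfolding dbar2_eq by (intro H20_lin V_lin w rV n')+
    show "ah (dbar2 k r n) v = aform Om (dbar2 k w n) (Q v)" if v: "v : V" for v
      unfolding dbar2_eq ah_lin[OF V_lin[OF rV[OF n'(1)] rV[OF n'(2)]] rV[OF n'(3)] v] ah_lin[OF rV[OF n'(1)] rV[OF n'(2)] v]
        aform_lin_left[OF Hs2_lin[OF w2[OF n'(1)] w2[OF n'(2)]] w2[OF n'(3)] H20_Hs[OF Q_H20[OF v]]]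
        aform_lin_left[OF w2[OF n'(1)] w2[OF n'(2)] H20_Hs[OF Q_H20[OF v]]]
      unfolding r_def R_eq[OF w(1)[OF n'(1)] v] R_eq[OF w(1)[OF n'(2)] v] R_eq[OF w(1)[OF n'(3)] v] ..
  qed (rule dw(2)[OF n])
  define rr where "rr n v = ipd Om (dbar2 k r n) v - ipd Om (z n) v" for n v
  \<comment> \<open>The modulus makes \<rho> nonnegative for every n, as the energy estimate
    demands; on the range of summation it is removed again through \<open>d2r\<close>.\<close>
  define \<rho> where "\<rho> n = \<bar>c2 * Hs_norm (2 + gam) Om (dbar2 k w n)\<bar> + L2normd Om (%x. dbar2 k w n x - z n x)" for n
  have L3: "dbar2 k X n : L2d Om" if "1 <= n" "n < N" "\<And>n. n <= N ==> X n : L2d Om" for X n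
    unfolding dbar2_eq using that by (intro L2_lin that(3)) auto
  have L1: "dbar k X n : L2d Om" if "n < N" "\<And>n. n <= N ==> X n : L2d Om" for X n
    unfolding dbar_eq using that by (intro L2_lin that(2)) auto
  have r_bd: "\<bar>rr n v\<bar> <= \<rho> n * L2normd Om v" if n: "1 <= n" "n < N" and v: "v : V" for n v
  proof -
    have L: "dbar2 k r n : L2d Om" "dbar2 k w n : L2d Om" "z n : L2d Om" "v : L2d Om" using n by (auto intro!: L3 rL wL z V_L2[OF v])
    have "rr n v = ipd Om (%x. (dbar2 k r n x - dbar2 k w n x) + (dbar2 k w n x - z n x)) v"
      unfolding rr_def by (subst ip_diff_left[symmetric]) (simp_all add: L)
    also have "\<bar>...\<bar> <= L2normd Om (%x. (dbar2 k r n x - dbar2 k w n x) + (dbar2 k w n x - z n x)) * L2normd Om v"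
      by (intro ip_Cauchy_Schwarz L2_add L2_diff L)
    also have "... <= \<rho> n * L2normd Om v"
    proof (rule mult_right_mono)
      show "L2normd Om (%x. (dbar2 k r n x - dbar2 k w n x) + (dbar2 k w n x - z n x)) <= \<rho> n"
        using L2norm_triangle[OF L2_diff[OF L(1,2)] L2_diff[OF L(2,3)]] d2r[OF n] unfolding \<rho>_def by linarith
    qed simp
    finally show ?thesis .
  qed
  have d2\<theta>: "dbar2 k \<theta> n = (%x. 1 * dbar2 k r n x + (-1) * dbar2 k U n x)" "dbar k \<theta> n = (%x. 1 * dbar k r n x + (-1) * dbar k U n x)"
    "half \<theta> n = (%x. 1 * half r n x + (-1) * half U n x)" for n
    by (auto simp: dbar2_def dbar_def half_def \<theta>_def diff_divide_distrib add_divide_distrib)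
  have step': "ipd Om (dbar2 k \<theta> n) v + ah (\<theta> n) v = rr n v + e n v" if n: "1 <= n" "n < N" and v: "v : V" for n v
  proof -
    have n': "n <= N" using n by simp
    have L: "dbar2 k r n : L2d Om" "dbar2 k U n : L2d Om" using n by (auto intro!: L3 rL UL)
    show ?thesis
      unfolding d2\<theta> ip_lin_left[OF L V_L2[OF v]] \<theta>_def ah_lin[OF rV[OF n'] U(1)[OF n'] v] rr_def e_def
      using step[OF n v] F(2)[OF n' V_L2[OF v]] by simp
  qed
  \<comment> \<open>Consistency error of the starting step; k/4 is k/2 times the weight 1/2 of the
    average of \<open>z 0\<close> and \<open>z 1\<close>.\<close>
  define s where "s v = ipd Om (dbar k r 0) v - ipd Om v0 v - k / 4 * (ipd Om (z 0) v + ipd Om (z 1) v)" for v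
  have N0: "0 < N" "0 <= N" "1 <= N" "Suc 0 <= N" using N by auto
  have s_bd: "\<bar>s v\<bar> <= (c2 * W' + \<sigma>) * L2normd Om v" if v: "v : V" for v
  proof -
    have L: "dbar k r 0 : L2d Om" "dbar k w 0 : L2d Om" "v : L2d Om" using N0 by (auto intro!: L1 rL wL V_L2[OF v])
    have "\<bar>ipd Om (dbar k r 0) v - ipd Om (dbar k w 0) v\<bar> <= L2normd Om (%x. dbar k r 0 x - dbar k w 0 x) * L2normd Om v"
      using ip_Cauchy_Schwarz[OF L2_diff[OF L(1,2)] L(3)] by (simp add: ip_diff_left[OF L])
    also have "... <= c2 * W' * L2normd Om v" by (intro mult_right_mono dr N0) simp
    finally show ?thesis using sg[OF L(3)] unfolding s_def by (simp add: distrib_right abs_le_iff)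
  qed
  have init': "2 / k * ipd Om (dbar k \<theta> 0) v + ah (half \<theta> 0) v = 2 / k * s v + (e 0 v + e 1 v) / 2" if v: "v : V" for v
  proof -
    have L: "dbar k r 0 : L2d Om" "dbar k U 0 : L2d Om" "v : L2d Om" using N0 by (auto intro!: L1 rL UL V_L2[OF v])
    have hV: "half r 0 : V" "half U 0 : V" unfolding half_eq by (intro V_lin rV U N0)+
    have FL: "half F 0 : L2d Om" unfolding half_eq by (intro L2_lin F N0)
    have rhs: "ipd Om (%x. half F 0 x + 2 / k * v0 x) v = (ipd Om (F 1) v + ipd Om (F 0) v) / 2 + 2 / k * ipd Om v0 v"
    proof -
      have "ipd Om (%x. half F 0 x + 2 / k * v0 x) v = ipd Om (half F 0) v + 2 / k * ipd Om v0 v"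
        using ip_lin_left[OF FL v0 L(3), of 1 "2 / k"] by simp
      moreover have "ipd Om (half F 0) v = (ipd Om (F 1) v + ipd Om (F 0) v) / 2"
        unfolding half_eq ip_lin_left[OF F(1)[OF N0(4)] F(1)[OF N0(2)] L(3)] by simp
      ultimately show ?thesis by simp
    qed
    have ar: "ah (half r 0) v = (ah (r 1) v + ah (r 0) v) / 2"
      unfolding half_eq ah_lin[OF rV[OF N0(4)] rV[OF N0(2)] v] by simp
    have "2 / k * ipd Om (dbar k \<theta> 0) v + ah (half \<theta> 0) v
      = 2 / k * ipd Om (dbar k r 0) v + ah (half r 0) v - (2 / k * ipd Om (dbar k U 0) v + ah (half U 0) v)"
      unfolding d2\<theta> ip_lin_left[OF L] ah_lin[OF hV v] by (simp add: algebra_simps)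
    also have "... = 2 / k * s v + (e 0 v + e 1 v) / 2"
      unfolding init[OF v] rhs ar s_def e_def F(2)[OF N0(2) L(3)] F(2)[OF N0(3) L(3)] using pos(2) by (simp add: field_simps)
    finally show ?thesis .
  qed
  have \<theta>0: "\<theta> 0 = (%x. 0)" by (auto simp: \<theta>_def r_def U(2))
  have en: "L2normd Om (dbar k \<theta> m) + mesh_norm \<T> (half \<theta> m)
    <= 2 / min (3/4) al * (c2 * W' + \<sigma> + 5 * (c1 * G) + 2 * k * (\<Sum>n=1..<N. \<rho> n) + 2 * (\<Sum>n=1..<N. c1 * L2normd Om (%x. g (Suc n) x - g n x)))"
    by (rule energy.energy_estimate[OF \<theta>V \<theta>0 N e_lin e_bd e_diff step' r_bd init' s_bd _ _ _ _ m])
      (use nn pos in \<open>auto simp: \<rho>_def intro!: add_nonneg_nonneg\<close>)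
  have "c2 * Hs_norm (2 + gam) Om (dbar2 k w n) \<ge> 0" if "1 <= n" "n < N" for n
    using order_trans[OF L2norm_nonneg d2r[OF that]] .
  then have \<rho>: "(\<Sum>n=1..<N. \<rho> n) = (\<Sum>n=1..<N. c2 * Hs_norm (2 + gam) Om (dbar2 k w n) + L2normd Om (%x. dbar2 k w n x - z n x))"
    unfolding \<rho>_def by (intro sum.cong refl) auto
  have m': "m <= N" "Suc m <= N" using m by auto
  have "L2normd Om (dbar k w m - dbar k U m) <= c2 * W' + L2normd Om (dbar k \<theta> m)"
  proof -
    have L: "dbar k r m : L2d Om" "dbar k w m : L2d Om" "dbar k \<theta> m : L2d Om" using m by (auto intro!: L1 rL wL V_L2[OF \<theta>V])
    have "dbar k w m - dbar k U m = (%x. dbar k \<theta> m x - (dbar k r m x - dbar k w m x))"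
      unfolding d2\<theta> by auto
    then show ?thesis using L2norm_triangle_diff[OF L(3) L2_diff[OF L(1,2)]] dr[OF m] by simp
  qed
  \<comment> \<open>Each use of \<open>mesh_norm_lin_le\<close> costs a factor 2: once for the
    average of the projection errors, once for adding \<theta>.\<close>
  moreover have "mesh_norm \<T> (half w m - half U m) <= 4 * h * W + 2 * mesh_norm \<T> (half \<theta> m)"
  proof -
    define p where "p n = (%x. w n x - r n x)" for n
    have pw: "p n : Hs_pw 2 \<T>" if "n <= N" for n
      unfolding p_def using Hs_pw_lin[OF H2_pw[OF w2[OF that]] subsetD[OF V_pw rV[OF that]], of 1 "-1"] by simp
    have hV: "half \<theta> m : Hs_pw 2 \<T>" unfolding half_eq by (intro subsetD[OF V_pw] V_lin \<theta>V m')
    have pb: "mesh_norm \<T> (p n) <= h * W" if "n <= N" for n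
      unfolding p_def r_def using R_err(2)[OF w(1)[OF that] w(2)[OF that]] W(1)[OF that] pos(5) by (smt (verit) mult_left_mono)
    have "mesh_norm \<T> (%x. 1 / 2 * p (Suc m) x + 1 / 2 * p m x) <= 2 * (\<bar>1 / 2\<bar> * mesh_norm \<T> (p (Suc m)) + \<bar>1 / 2\<bar> * mesh_norm \<T> (p m))"
      by (intro mesh_norm_lin_le pw m')
    also have "... <= 2 * (h * W)" using pb[OF m'(1)] pb[OF m'(2)] by simp
    finally have 1: "mesh_norm \<T> (%x. 1 / 2 * p (Suc m) x + 1 / 2 * p m x) <= 2 * (h * W)" .
    have "half w m - half U m = (%x. 1 * (1 / 2 * p (Suc m) x + 1 / 2 * p m x) + 1 * half \<theta> m x)"
      unfolding d2\<theta> by (auto simp: half_def p_def field_simps)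
    then have "mesh_norm \<T> (half w m - half U m) <= 2 * (\<bar>1\<bar> * mesh_norm \<T> (%x. 1 / 2 * p (Suc m) x + 1 / 2 * p m x) + \<bar>1\<bar> * mesh_norm \<T> (half \<theta> m))"
      by (simp only:) (intro mesh_norm_lin_le Hs_pw_lin pw m' hV)
    then show ?thesis using 1 by simp
  qed
  moreover have "p + q <= A + B + 4 / \<mu> * X" if "p <= A + a" "q <= B + 2 * b" "a + b <= 2 / \<mu> * X" "0 <= a" for p q A B a b \<mu> X :: real
  proof -
    have "4 / \<mu> * X = 2 * (2 / \<mu> * X)" by simp
    then show ?thesis using that by linarith
  qed
  ultimately show ?thesis using en[unfolded \<rho>] L2norm_nonneg[of M "dbar k \<theta> m"] by blast
qed

end

lemma relpowp_unfold:
  "(P ^^ 1) a b \<longleftrightarrow> P a b" "(P ^^ 2) a b \<longleftrightarrow> (\<exists>x. P a x \<and> P x b)" "(P ^^ 3) a b \<longleftrightarrow> (\<exists>x y. P a x \<and> P x y \<and> P y b)"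
  "(P ^^ 4) a b \<longleftrightarrow> (\<exists>x y z. P a x \<and> P x y \<and> P y z \<and> P z b)"
  by (auto simp: numeral_eq_Suc relcompp_apply)

lemma (in finite_domain) increment_bound:
  assumes L: "phi t : L2d Om" "phi s : L2d Om" and n: "integrable (lebesgue_on {0..T}) (%r. L2normd Om (psi r))"
    and a: "\<And>v. v : L2d Om ==> antideriv T (%t. ipd Om (phi t) v) (%r. ipd Om (psi r) v)"
      "\<And>v. v : L2d Om ==> AE r in lebesgue_on {0..T}. \<bar>ipd Om (psi r) v\<bar> <= L2normd Om (psi r) * L2normd Om v"
    and st: "0 <= s" "s <= t" "t <= T"
  shows "L2normd Om (%x. phi t x - phi s x) <= integral {s..t} (%r. L2normd Om (psi r))"
proof (rule L2norm_le_dual)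
  show "(%x. phi t x - phi s x) : L2d Om" by (rule L2_diff[OF L])
  show "0 <= integral {s..t} (%r. L2normd Om (psi r))"
    using st by (intro integral_nonneg integrable_subinterval(2)[OF n]) auto
  fix v assume v: "v : L2d Om"
  have nv: "integrable (lebesgue_on {0..T}) (%r. L2normd Om (psi r) * L2normd Om v)" using n by simp
  have "\<bar>ipd Om (phi t) v - ipd Om (phi s) v\<bar> <= integral {s..t} (%r. L2normd Om (psi r) * L2normd Om v)"
    by (rule antideriv_bound[OF a(1)[OF v] nv a(2)[OF v] st])
  then show "\<bar>ipd Om (%x. phi t x - phi s x) v\<bar> <= integral {s..t} (%r. L2normd Om (psi r)) * L2normd Om v"
    by (simp add: ip_diff_left[OF L v])
qed

locale wave_scheme = wave Om T u ut utt + discretisation Om \<T> V ah Q R al k h c1 c2 gam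
  for Om T u ut utt \<T> V ah Q R al k h c1 c2 gam +
  fixes N :: nat and f ft :: "real => sfun" and u0 v0 :: sfun and U :: "nat => sfun"
  assumes N: "N \<ge> 1" and Nk: "real N * k = T" and gam: "0 <= gam"
    and f: "has_time_deriv Om T f ft"
    and weak: "\<And>v t. v : H20 Om ==> t : {0..T} ==> aform Om (u t) v = ipd Om (f t) v - ipd Om (utt t) v"
    and u0: "AE x in lebesgue_on Om. u 0 x = u0 x" "u0 : L2d Om" and v0: "AE x in lebesgue_on Om. ut 0 x = v0 x" "v0 : L2d Om"
    and ell: "\<And>w g. w : H20 Om ==> g : L2d Om ==> (\<And>v. v : H20 Om ==> aform Om w v = ipd Om g v) ==> w : Hs (2 + gam) Om"
    and scheme: "explicit_scheme Om V ah R k N f u0 v0 U"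
begin

lemma f_L2: "t : {0..T} ==> f t : L2d Om" using f by (simp add: has_time_deriv_def)

text \<open>Each norm enters through \<open>norm_dt_bound\<close> with a representative of its own;
  the pointwise objects \<open>utt\<close> and the grid values of u are common to all of
  them.\<close>

lemma estimate:
  assumes l: "norm_dt Om T (Linf_norm (L2d Om) (L2normd Om) T) 0 f = ennreal l1"
      "norm_dt Om T (L2t_norm (L2d Om) (L2normd Om) T) 1 f = ennreal l2"
      "norm_dt Om T (Linf_norm (Hs (2 + gam) Om) (Hs_norm (2 + gam) Om) T) 0 u = ennreal l3"
      "norm_dt Om T (Linf_norm (Hs (2 + gam) Om) (Hs_norm (2 + gam) Om) T) 1 u = ennreal l4"
      "norm_dt Om T (Linf_norm (L2d Om) (L2normd Om) T) 2 u = ennreal l5"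
      "norm_dt Om T (L2t_norm (Hs (2 + gam) Om) (Hs_norm (2 + gam) Om) T) 2 u = ennreal l6"
      "norm_dt Om T (L2t_norm (L2d Om) (L2normd Om) T) 3 u = ennreal l7"
      "norm_dt Om T (Linf_norm (L2d Om) (L2normd Om) T) 3 u = ennreal m1"
      "norm_dt Om T (L2t_norm (L2d Om) (L2normd Om) T) 4 u = ennreal m2"
    and nn: "0 <= l1" "0 <= l2" "0 <= l3" "0 <= l4" "0 <= l5" "0 <= l6" "0 <= l7" "0 <= m1" "0 <= m2"
    and ex: "has_time_deriv Om T u psi1"
    and m: "m : {1..N - 1}"
  shows "L2normd Om (dbar k (at_grid k u) m - dbar k U m) + mesh_norm \<T> (half (at_grid k u) m - half U m)
    <= c2 * l4 + 4 * h * l3 + 4 / min (3/4) al * (c2 * l4 + 2 * k^2 * m1 + 5 * (c1 * (l1 + l5))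
       + 2 * (c2 * (6 * sqrt T * l6) + 4 * k^2 * sqrt T * m2) + 2 * (c1 * (sqrt T * (l2 + l7))))"
proof -
  let ?s = "2 + gam"
  have s0: "0 <= ?s" using gam by simp
  have mN: "m < N" "1 <= m" using m by auto
  define g where "g t = (%x. f t x - utt t x)" for t
  define G where "G = at_grid k g"
  define X where "X = at_grid k u"
  define Z where "Z = at_grid k utt"
  define F where "F = at_grid k f"
  \<comment> \<open>The scheme starts from the projection of u0, and R might tell apart functions
    that agree almost everywhere; hence w takes the value u0 itself at n = 0.\<close>
  define w where "w n = (if n = 0 then u0 else X n)" for n
  have tn: "real n * k : {0..T}" if "n <= N" for n
  proof -
    have "real n * k <= real N * k" using that pos(2) by (intro mult_right_mono) auto
    then show ?thesis using Nk pos(2) by simp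
  qed
  have XH: "X n : H20 Om" and GL: "G n : L2d Om" and ZL: "Z n : L2d Om" and FL: "F n : L2d Om" if "n <= N" for n
    unfolding X_def G_def Z_def F_def at_grid_def g_def using tn[OF that] by (auto intro!: u_H20 L2_diff f_L2 utt_L2)
  have XL: "n <= N ==> X n : L2d Om" and X2: "n <= N ==> X n : Hs 2 Om" for n by (intro H20_L2 H20_Hs XH; assumption)+
  have FG: "ipd Om (F n) v = ipd Om (G n) v + ipd Om (Z n) v" if "n <= N" "v : L2d Om" for n v
    unfolding G_def F_def Z_def at_grid_def g_def
    using ip_diff_left[OF f_L2[OF tn[OF that(1)]] utt_L2[OF tn[OF that(1)]] that(2)] by simp
  have aX: "aform Om (X n) v = ipd Om (G n) v" if "n <= N" "v : H20 Om" for n v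
    using FG[OF that(1) H20_L2[OF that(2)]] weak[OF that(2) tn[OF that(1)]] by (simp add: X_def F_def Z_def at_grid_def)
  \<comment> \<open>The equation holds at each time with right-hand side in L2, so elliptic
    regularity gives membership at every grid point, not just for almost every time. By linearity
    the same holds for the difference quotients.\<close>
  have XHs: "X n : Hs ?s Om" if "n <= N" for n by (rule ell[OF XH[OF that] GL[OF that] aX[OF that]])
  have dX: "dbar k Y n = (%x. 1 / k * Y (Suc n) x + (- 1 / k) * Y n x)" for Y :: "nat => sfun" and n
    by (auto simp: dbar_def diff_divide_distrib)
  have d2X: "dbar2 k Y n = (%x. 1 * (1 / k^2 * Y (Suc n) x + (- 2 / k^2) * Y n x) + 1 / k^2 * Y (n - 1) x)" for Y :: "nat => sfun" and n
    by (auto simp: dbar2_def diff_divide_distrib add_divide_distrib)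
  have dXHs: "dbar k X n : Hs ?s Om" if "n < N" for n
  proof (rule ell)
    have n: "Suc n <= N" "n <= N" using that by auto
    show "dbar k X n : H20 Om" "dbar k G n : L2d Om" unfolding dX by (intro H20_lin L2_lin XH GL n)+
    show "aform Om (dbar k X n) v = ipd Om (dbar k G n) v" if v: "v : H20 Om" for v
      unfolding dX aform_lin_left[OF X2[OF n(1)] X2[OF n(2)] H20_Hs[OF v]] ip_lin_left[OF GL[OF n(1)] GL[OF n(2)] H20_L2[OF v]]
        aX[OF n(1) v] aX[OF n(2) v] ..
  qed
  have d2XHs: "dbar2 k X n : Hs ?s Om" if "1 <= n" "n < N" for n
  proof (rule ell)
    have n: "Suc n <= N" "n <= N" "n - 1 <= N" using that by auto
    show "dbar2 k X n : H20 Om" "dbar2 k G n : L2d Om" unfolding d2X by (intro H20_lin L2_lin XH GL n)+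
    show "aform Om (dbar2 k X n) v = ipd Om (dbar2 k G n) v" if v: "v : H20 Om" for v
      unfolding d2X aform_lin_left[OF Hs2_lin[OF X2[OF n(1)] X2[OF n(2)]] X2[OF n(3)] H20_Hs[OF v]] aform_lin_left[OF X2[OF n(1)] X2[OF n(2)] H20_Hs[OF v]]
        ip_lin_left[OF L2_lin[OF GL[OF n(1)] GL[OF n(2)]] GL[OF n(3)] H20_L2[OF v]] ip_lin_left[OF GL[OF n(1)] GL[OF n(2)] H20_L2[OF v]]
        aX[OF n(1) v] aX[OF n(2) v] aX[OF n(3) v] ..
  qed
  have wX: "AE x in M. X n x = w n x" for n using u0(1) by (simp add: w_def X_def at_grid_def)
  have wL: "w n : L2d Om" if "n <= N" for n using u0(2) XL[OF that] by (simp add: w_def)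
  note wc = Hs_AE_cong[OF wX XL wL]
  have dw: "dbar k w n : Hs ?s Om" "Hs_norm ?s Om (dbar k w n) = Hs_norm ?s Om (dbar k X n)" if "n < N" for n
  proof -
    have n: "Suc n <= N" "n <= N" using that by auto
    have "AE x in M. dbar k X n x = dbar k w n x" using wX[of n] wX[of "Suc n"] unfolding dX by eventually_elim simp
    moreover have "dbar k X n : L2d Om" "dbar k w n : L2d Om" unfolding dX by (intro L2_lin XL wL n)+
    ultimately show "dbar k w n : Hs ?s Om" "Hs_norm ?s Om (dbar k w n) = Hs_norm ?s Om (dbar k X n)"
      using Hs_AE_cong(1,2)[of "dbar k X n" "dbar k w n"] dXHs[OF that] by metis+
  qed
  have d2w: "dbar2 k w n : Hs ?s Om" "Hs_norm ?s Om (dbar2 k w n) = Hs_norm ?s Om (dbar2 k X n)"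
      "L2normd Om (%x. dbar2 k w n x - Z n x) = L2normd Om (%x. dbar2 k X n x - Z n x)" if that: "1 <= n" "n < N" for n
  proof -
    have n: "Suc n <= N" "n <= N" "n - 1 <= N" using that by auto
    have ae: "AE x in M. dbar2 k X n x = dbar2 k w n x" using wX[of n] wX[of "Suc n"] wX[of "n - 1"] unfolding d2X by eventually_elim simp
    have L: "dbar2 k X n : L2d Om" "dbar2 k w n : L2d Om" unfolding d2X by (intro L2_lin XL wL n)+
    show "dbar2 k w n : Hs ?s Om" "Hs_norm ?s Om (dbar2 k w n) = Hs_norm ?s Om (dbar2 k X n)"
      using Hs_AE_cong(1,2)[OF ae L] d2XHs[OF that] by metis+
    show "L2normd Om (%x. dbar2 k w n x - Z n x) = L2normd Om (%x. dbar2 k X n x - Z n x)"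
      using ae by (intro L2norm_AE_cong L2_measurable[OF L2_diff] L ZL n) (auto elim: eventually_mono)
  qed
  have b1: "L2normd Om (f t) <= l1" if t: "t : {0..T}" for t
  proof -
    have "L2normd Om (f t) <= 1 * l1"
    proof (rule norm_dt_bound[OF _ l(1) nn(1)])
      fix psi B assume c: "(has_time_deriv Om T ^^ 0) f psi" and B: "Linf_norm (L2d Om) (L2normd Om) T psi <= ennreal B" "0 <= B"
      then have "psi = f" by simp
      then show "L2normd Om (f t) <= 1 * B" using bound_Linf[OF f Linf_norm_AE B(2) t] B by simp
    qed simp
    then show ?thesis by simp
  qed
  have b5: "L2normd Om (utt t) <= l5" if t: "t : {0..T}" for t
  proof -
    have "L2normd Om (utt t) <= 1 * l5"
    proof (rule norm_dt_bound[OF _ l(5) nn(5)])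
      fix psi B assume c: "(has_time_deriv Om T ^^ 2) u psi" and B: "Linf_norm (L2d Om) (L2normd Om) T psi <= ennreal B" "0 <= B"
      from c obtain \<xi> where c: "has_time_deriv Om T u \<xi>" "has_time_deriv Om T \<xi> psi" unfolding relpowp_unfold by blast
      have "AE t in lebesgue_on {0..T}. L2normd Om (psi t) <= B" using Linf_norm_AE[OF B] by (rule eventually_mono) simp
      then show "L2normd Om (utt t) <= 1 * B" using bound_utt[OF c _ B(2) t] by simp
    qed simp
    then show ?thesis by simp
  qed
  have bG: "L2normd Om (G n) <= l1 + l5" if "n <= N" for n
    using L2norm_triangle_diff[OF f_L2[OF tn[OF that]] utt_L2[OF tn[OF that]]] b1[OF tn[OF that]] b5[OF tn[OF that]]
    by (simp add: G_def at_grid_def g_def)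
  have bW: "Hs_norm ?s Om (w n) <= l3" if n: "n <= N" for n
  proof -
    have "Hs_norm ?s Om (u (real n * k)) <= 1 * l3"
    proof (rule norm_dt_bound[OF _ l(3) nn(3)])
      fix psi B assume c: "(has_time_deriv Om T ^^ 0) u psi" and B: "Linf_norm (Hs ?s Om) (Hs_norm ?s Om) T psi <= ennreal B" "0 <= B"
      have "psi = u" using c by simp
      note B = B[unfolded this]
      \<comment> \<open>For j = 0 the only representative is u itself; \<open>ex\<close> supplies
        its continuity in time after testing.\<close>
      show "Hs_norm ?s Om (u (real n * k)) <= 1 * B"
        using bound_Hs[OF ex Linf_norm_AE[OF B] s0 tn[OF n]] XHs[OF n] by (simp add: X_def at_grid_def)
    qed simp
    then show ?thesis using wc(2)[OF n n, of ?s] by (simp add: X_def at_grid_def)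
  qed
  have bW': "Hs_norm ?s Om (dbar k w n) <= l4" if n: "n < N" for n
  proof -
    have e: "real n * k + k = real (Suc n) * k" by (simp add: algebra_simps)
    have "Hs_norm ?s Om (dbar k X n) <= 1 * l4"
    proof (rule norm_dt_bound[OF _ l(4) nn(4)])
      fix psi B assume c: "(has_time_deriv Om T ^^ 1) u psi" and B: "Linf_norm (Hs ?s Om) (Hs_norm ?s Om) T psi <= ennreal B" "0 <= B"
      have "Hs_norm ?s Om (dbar k X n) <= B"
      proof (rule bound_dq_Hs[OF _ Linf_norm_AE[OF B] s0 pos(2) _ _ dXHs[OF n], where a = "real n * k"])
        show "has_time_deriv Om T u psi" using c unfolding relpowp_unfold .
        show "0 <= real n * k" "real n * k + k <= T" using tn[of n] tn[of "Suc n"] n unfolding e by auto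
        show "dbar k X n = (%x. (u (real n * k + k) x - u (real n * k) x) / k)"
          unfolding e by (simp add: dbar_def X_def at_grid_def)
      qed
      then show "Hs_norm ?s Om (dbar k X n) <= 1 * B" by simp
    qed simp
    then show ?thesis using dw(2)[OF n] by simp
  qed
  have sg: "\<bar>ipd Om (dbar k w 0) v - ipd Om v0 v - k / 4 * (ipd Om (Z 0) v + ipd Om (Z 1) v)\<bar> <= 2 * k^2 * m1 * L2normd Om v"
    if v: "v : L2d Om" for v
  proof -
    have k: "k <= T" using tn[of 1] N by simp
    have 0: "0 : {0..T}" "k : {0..T}" using T k pos(2) by auto
    have "ipd Om (dbar k w 0) v = (ipd Om (w 1) v - ipd Om (w 0) v) / k"
      unfolding dX by (subst ip_lin_left) (use N v in \<open>auto intro: wL simp: diff_divide_distrib\<close>)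
    also have "ipd Om (w 0) v = ipd Om (u 0) v"
    proof (rule ip_AE_cong)
      show "AE x in M. w 0 x = u 0 x" using u0(1) by (auto simp: w_def elim: eventually_mono)
    qed (use L2_measurable[OF u0(2)] L2_measurable[OF u_L2[OF 0(1)]] L2_measurable[OF v] in \<open>simp_all add: w_def\<close>)
    also have "w 1 = u k" by (simp add: w_def X_def at_grid_def)
    finally have 1: "ipd Om (dbar k w 0) v = (ipd Om (u k) v - ipd Om (u 0) v) / k" .
    have 2: "ipd Om v0 v = ipd Om (ut 0) v"
    proof (rule ip_AE_cong)
      show "AE x in M. v0 x = ut 0 x" using v0(1) by (auto elim: eventually_mono)
    qed (use L2_measurable[OF v0(2)] L2_measurable[OF ut_L2[OF 0(1)]] L2_measurable[OF v] in simp_all)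
    let ?X = "\<bar>(ipd Om (u k) v - ipd Om (u 0) v) / k - ipd Om (ut 0) v - k / 4 * (ipd Om (utt 0) v + ipd Om (utt k) v)\<bar>"
    have "?X <= (2 * k^2 * L2normd Om v) * m1"
    proof (rule norm_dt_bound[OF _ l(8) nn(8)])
      fix psi B assume c: "(has_time_deriv Om T ^^ 3) u psi" and B: "Linf_norm (L2d Om) (L2normd Om) T psi <= ennreal B" "0 <= B"
      from c obtain \<xi> \<xi>' where c: "has_time_deriv Om T u \<xi>" "has_time_deriv Om T \<xi> \<xi>'" "has_time_deriv Om T \<xi>' psi" unfolding relpowp_unfold by blast
      have "AE t in lebesgue_on {0..T}. L2normd Om (psi t) <= B" using Linf_norm_AE[OF B] by (rule eventually_mono) simp
      from bound_initial[OF c this B(2) pos(2) k v] show "?X <= 2 * k^2 * L2normd Om v * B" by (simp only: mult_ac)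
    qed simp
    then show ?thesis unfolding 1 2 by (simp add: Z_def at_grid_def mult_ac)
  qed
  have patch: "integrable (lebesgue_on {0..T}) n ==> (\<And>r. 0 <= n r) ==> (\<Sum>j=1..<N. integral {real j * k..real (Suc j) * k} n) <= integral {0..T} n"
     "integrable (lebesgue_on {0..T}) n ==> (\<And>r. 0 <= n r) ==> (\<Sum>j=1..<N. integral {real j * k - k..real j * k + k} n) <= 2 * integral {0..T} n" for n :: "real => real"
    using sum_integral_patches[of T n k N] pos(2) Nk by auto
  have L2t: "integral {0..T} (%r. L2normd Om (psi r)) <= sqrt T * B"
    if "has_time_deriv Om T phi psi" "L2t_norm (L2d Om) (L2normd Om) T psi <= ennreal B" "0 <= B" for phi psi B
    using integral_le_L2t_norm(2)[OF _ _ T L2t_norm_le(2)[OF that(2,3)] that(3)] that(1) by (auto simp: has_time_deriv_def)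
  have seg: "0 <= real n * k" "real n * k <= real (Suc n) * k" "real (Suc n) * k <= T" if "n < N" for n
    using tn[of n] tn[of "Suc n"] that pos(2) by (auto intro: mult_right_mono)
  have b2: "(\<Sum>n=1..<N. L2normd Om (%x. F (Suc n) x - F n x)) <= sqrt T * l2"
  proof (rule norm_dt_bound[OF _ l(2) nn(2)])
    fix psi B assume c: "(has_time_deriv Om T ^^ 1) f psi" and B: "L2t_norm (L2d Om) (L2normd Om) T psi <= ennreal B" "0 <= B"
    from c have c: "has_time_deriv Om T f psi" unfolding relpowp_unfold .
    note ni = time_deriv_antideriv(3)[OF c const_L2[of 0] T]
    have "(\<Sum>n=1..<N. L2normd Om (%x. F (Suc n) x - F n x)) <= (\<Sum>n=1..<N. integral {real n * k..real (Suc n) * k} (%r. L2normd Om (psi r)))"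
      unfolding F_def at_grid_def
      by (intro sum_mono increment_bound[OF f_L2 f_L2 ni time_deriv_antideriv(1)[OF c _ T] time_deriv_antideriv(2)[OF c _ T]] seg tn) auto
    also have "... <= integral {0..T} (%r. L2normd Om (psi r))" by (rule patch(1)[OF ni]) simp
    also have "... <= sqrt T * B" by (rule L2t[OF c B])
    finally show "(\<Sum>n=1..<N. L2normd Om (%x. F (Suc n) x - F n x)) <= sqrt T * B" .
  qed (use T in simp)
  have b7: "(\<Sum>n=1..<N. L2normd Om (%x. Z (Suc n) x - Z n x)) <= sqrt T * l7"
  proof (rule norm_dt_bound[OF _ l(7) nn(7)])
    fix psi B assume c: "(has_time_deriv Om T ^^ 3) u psi" and B: "L2t_norm (L2d Om) (L2normd Om) T psi <= ennreal B" "0 <= B"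
    from c obtain \<xi> \<xi>' where c: "has_time_deriv Om T u \<xi>" "has_time_deriv Om T \<xi> \<xi>'" "has_time_deriv Om T \<xi>' psi" unfolding relpowp_unfold by blast
    note ni = time_deriv_antideriv(3)[OF c(3) const_L2[of 0] T]
    have "(\<Sum>n=1..<N. L2normd Om (%x. Z (Suc n) x - Z n x)) <= (\<Sum>n=1..<N. integral {real n * k..real (Suc n) * k} (%r. L2normd Om (psi r)))"
      unfolding Z_def at_grid_def
      by (intro sum_mono increment_bound[OF utt_L2 utt_L2 ni chain3(2)[OF c] time_deriv_antideriv(2)[OF c(3) _ T]] seg tn) auto
    also have "... <= integral {0..T} (%r. L2normd Om (psi r))" by (rule patch(1)[OF ni]) simp
    also have "... <= sqrt T * B" by (rule L2t[OF c(3) B])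
    finally show "(\<Sum>n=1..<N. L2normd Om (%x. Z (Suc n) x - Z n x)) <= sqrt T * B" .
  qed (use T in simp)
  have b\<tau>: "(\<Sum>n=1..<N. L2normd Om (%x. dbar2 k X n x - Z n x)) <= 4 * k * sqrt T * m2"
  proof (rule norm_dt_bound[OF _ l(9) nn(9)])
    fix psi B assume c: "(has_time_deriv Om T ^^ 4) u psi" and B: "L2t_norm (L2d Om) (L2normd Om) T psi <= ennreal B" "0 <= B"
    from c obtain \<xi> \<xi>' \<xi>'' where c: "has_time_deriv Om T u \<xi>" "has_time_deriv Om T \<xi> \<xi>'" "has_time_deriv Om T \<xi>' \<xi>''" "has_time_deriv Om T \<xi>'' psi"
      unfolding relpowp_unfold by blast
    note ni = time_deriv_antideriv(3)[OF c(4) const_L2[of 0] T]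
    let ?I = "%n. integral {real n * k - k..real n * k + k} (%r. L2normd Om (psi r))"
    have "(\<Sum>n=1..<N. L2normd Om (%x. dbar2 k X n x - Z n x)) <= (\<Sum>n=1..<N. 2 * k * ?I n)"
      unfolding X_def Z_def at_grid_def[of k utt]
      by (intro sum_mono bound_dbar2_utt[OF c _ _ pos(2) Nk]) auto
    also have "... = 2 * k * (\<Sum>n=1..<N. ?I n)" by (simp add: sum_distrib_left)
    also have "... <= 2 * k * (2 * integral {0..T} (%r. L2normd Om (psi r)))" using pos(2) by (intro mult_left_mono patch(2) ni) auto
    also have "... <= 2 * k * (2 * (sqrt T * B))" using pos(2) by (intro mult_left_mono L2t[OF c(4) B]) auto
    finally show "(\<Sum>n=1..<N. L2normd Om (%x. dbar2 k X n x - Z n x)) <= 4 * k * sqrt T * B" by simp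
  qed (use T pos(2) in simp)
  have b6: "(\<Sum>n=1..<N. k * Hs_norm ?s Om (dbar2 k X n)) <= 6 * sqrt T * l6"
  proof (rule norm_dt_bound[OF _ l(6) nn(6)])
    fix psi B assume c: "(has_time_deriv Om T ^^ 2) u psi" and B: "L2t_norm (Hs ?s Om) (Hs_norm ?s Om) T psi <= ennreal B" "0 <= B"
    from c obtain \<xi> where c: "has_time_deriv Om T u \<xi>" "has_time_deriv Om T \<xi> psi" unfolding relpowp_unfold by blast
    show "(\<Sum>n=1..<N. k * Hs_norm ?s Om (dbar2 k X n)) <= 6 * sqrt T * B"
      unfolding X_def by (rule bound_dbar2_Hs[OF c L2t_norm_le[OF B] B(2) s0 pos(2) Nk d2XHs[unfolded X_def]])
  qed (use T in simp)
  have bG': "(\<Sum>n=1..<N. c1 * L2normd Om (%x. G (Suc n) x - G n x)) <= c1 * (sqrt T * (l2 + l7))"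
  proof -
    have "L2normd Om (%x. G (Suc n) x - G n x) <= L2normd Om (%x. F (Suc n) x - F n x) + L2normd Om (%x. Z (Suc n) x - Z n x)" if "n : {1..<N}" for n
    proof -
      have n: "Suc n <= N" "n <= N" using that by auto
      have "(%x. G (Suc n) x - G n x) = (%x. (F (Suc n) x - F n x) - (Z (Suc n) x - Z n x))"
        by (auto simp: G_def F_def Z_def at_grid_def g_def)
      then show ?thesis using L2norm_triangle_diff[OF L2_diff[OF FL[OF n(1)] FL[OF n(2)]] L2_diff[OF ZL[OF n(1)] ZL[OF n(2)]]] by simp
    qed
    then have "(\<Sum>n=1..<N. L2normd Om (%x. G (Suc n) x - G n x)) <= (\<Sum>n=1..<N. L2normd Om (%x. F (Suc n) x - F n x) + L2normd Om (%x. Z (Suc n) x - Z n x))"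
      by (rule sum_mono)
    also have "... <= sqrt T * (l2 + l7)" using b2 b7 by (simp add: sum.distrib algebra_simps)
    finally show ?thesis unfolding sum_distrib_left[symmetric] using pos(3) by (intro mult_left_mono) auto
  qed
  have b\<rho>: "k * (\<Sum>n=1..<N. c2 * Hs_norm ?s Om (dbar2 k w n) + L2normd Om (%x. dbar2 k w n x - Z n x))
      <= c2 * (6 * sqrt T * l6) + 4 * k^2 * sqrt T * m2"
  proof -
    have "k * (\<Sum>n=1..<N. c2 * Hs_norm ?s Om (dbar2 k w n) + L2normd Om (%x. dbar2 k w n x - Z n x))
      = c2 * (\<Sum>n=1..<N. k * Hs_norm ?s Om (dbar2 k X n)) + k * (\<Sum>n=1..<N. L2normd Om (%x. dbar2 k X n x - Z n x))"
    proof -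
      have "(\<Sum>n=1..<N. c2 * Hs_norm ?s Om (dbar2 k w n) + L2normd Om (%x. dbar2 k w n x - Z n x))
        = (\<Sum>n=1..<N. c2 * Hs_norm ?s Om (dbar2 k X n) + L2normd Om (%x. dbar2 k X n x - Z n x))"
        by (rule sum.cong[OF refl]) (use d2w(2,3) in auto)
      then show ?thesis by (simp add: sum.distrib sum_distrib_left algebra_simps)
    qed
    also have "... <= c2 * (6 * sqrt T * l6) + k * (4 * k * sqrt T * m2)"
      using pos b6 b\<tau> by (intro add_mono mult_left_mono) auto
    finally show ?thesis by (simp add: power2_eq_square mult_ac)
  qed
  have eb: "L2normd Om (dbar k w m - dbar k U m) + mesh_norm \<T> (half w m - half U m)
    <= c2 * l4 + 4 * h * l3 + 4 / min (3/4) al * (c2 * l4 + 2 * k^2 * m1 + 5 * (c1 * (l1 + l5))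
       + 2 * k * (\<Sum>n=1..<N. c2 * Hs_norm (2 + gam) Om (dbar2 k w n) + L2normd Om (%x. dbar2 k w n x - Z n x))
       + 2 * (\<Sum>n=1..<N. c1 * L2normd Om (%x. G (Suc n) x - G n x)))"
  proof (rule error_bound[OF N])
    show "w n : H20 Om" "w n : Hs (2 + gam) Om" if "n <= N" for n
      using wc(1,3)[OF that that] XH[OF that] XHs[OF that] by auto
    show "aform Om (w n) v = ipd Om (G n) v" if "n <= N" "v : H20 Om" for n v
      using wc(4)[OF that(1) that(1), of v] aX[OF that] by simp
    show "U n : V" if "n <= N" for n using scheme that by (simp add: explicit_scheme_def)
    show "U 0 = R (w 0)" using scheme by (simp add: explicit_scheme_def w_def)
    show "2 / k * ipd Om (dbar k U 0) v + ah (half U 0) v = ipd Om (%x. half F 0 x + 2 / k * v0 x) v" if "v : V" for v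
      using scheme that by (simp add: explicit_scheme_def F_def)
    show "ipd Om (dbar2 k U n) v + ah (U n) v = ipd Om (F n) v" if "1 <= n" "n < N" "v : V" for n v
      using scheme that by (simp add: explicit_scheme_def F_def)
    show "\<bar>ipd Om (dbar k w 0) v - ipd Om v0 v - k / 4 * (ipd Om (Z 0) v + ipd Om (Z 1) v)\<bar> <= 2 * k^2 * m1 * L2normd Om v"
      if "v : L2d Om" for v by (rule sg[OF that])
  qed (use nn pos in \<open>auto intro: dw d2w GL ZL FL v0(2) FG bG bW bW' mN\<close>)
  have e: "half w m = half X m" "dbar k w m = dbar k X m" using mN by (simp_all add: half_def dbar_def w_def)
  have "4 / min (3/4) al * (c2 * l4 + 2 * k^2 * m1 + 5 * (c1 * (l1 + l5))
       + 2 * k * (\<Sum>n=1..<N. c2 * Hs_norm (2 + gam) Om (dbar2 k w n) + L2normd Om (%x. dbar2 k w n x - Z n x))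
       + 2 * (\<Sum>n=1..<N. c1 * L2normd Om (%x. G (Suc n) x - G n x)))
    <= 4 / min (3/4) al * (c2 * l4 + 2 * k^2 * m1 + 5 * (c1 * (l1 + l5))
       + 2 * (c2 * (6 * sqrt T * l6) + 4 * k^2 * sqrt T * m2) + 2 * (c1 * (sqrt T * (l2 + l7))))"
    using pos(1) b\<rho> bG' by (intro mult_left_mono add_mono order_refl) (simp_all add: mult.assoc)
  then show ?thesis using eb unfolding e X_def by linarith
qed

end

section \<open>Instantiation from the hypotheses and choice of the constant\<close>

text \<open>Writes an element v of V as v + 0 in the sum with the Morley space, on which the form is
  symmetric and bilinear.\<close>

lemma zero_morley:
  assumes "mesh_of Om \<T>" shows "(%x. 0) : morley Om \<T>"
proof -
  have K: "convex K" "compact K" "interior K ~= {}" if "K : \<T>" for K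
    using that assms simplex_body[of K] by (auto simp: mesh_of_def)
  have pv: "point_value K g z = 0" if "K : \<T>" "z : K" "AE x in lebesgue_on K. 0 = g x" for K z g
    by (rule point_value_eq[OF K[OF that(1)] _ that(3,2)]) simp
  have w: "AE x in lebesgue_on K. 0 = weak_pd (interior K) [i] (%x. 0) x" if "K : \<T>" for K i
  proof -
    have "is_weak_pd (interior K) [i] (%x. 0) (%x. 0)" by (simp add: is_weak_pd_def)
    from weak_pd_eq[OF open_interior this] show ?thesis
      unfolding AE_convex_body[OF K(1,2)[OF that]] by (auto elim: eventually_mono)
  qed
  have gv: "gradient_value K (%x. 0) z = 0" if "K : \<T>" "z : K" for K z
    unfolding gradient_value_def using pv[OF that w[OF that(1)]] by (simp add: vec_eq_iff)
  have mid: "midpoint a b : K" if "closed_segment a b edge_of K" for a b and K :: "(real^2) set"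
  proof -
    have "closed_segment a b \<subseteq> K" using that face_of_imp_subset by (auto simp: edge_of_def)
    then show ?thesis using midpoint_in_closed_segment by blast
  qed
  have "(%x::real^2. 0) : poly2 2" unfolding poly2_def by (auto intro!: exI[of _ "%i j. 0"])
  then have "(%x. 0) : poly_pw 2 \<T>" unfolding poly_pw_def by (auto intro!: bexI[of _ "%x. 0"])
  then show ?thesis
    unfolding morley_def using pv gv mid by (auto simp: vertex_patch_def edge_patch_def)
qed

lemma fin_dim_subspace_lin:
  assumes "fin_dim_subspace V" "v : V" "w : V" shows "(%x. c * v x + d * w x) : V"
proof -
  obtain B where V: "V = {%x. \<Sum>b\<in>B. c b * b x | c. True}" using assms(1) by (auto simp: fin_dim_subspace_def)
  obtain p q where "v = (%x. \<Sum>b\<in>B. p b * b x)" "w = (%x. \<Sum>b\<in>B. q b * b x)" using assms(2,3) unfolding V by blast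
  then have "(%x. c * v x + d * w x) = (%x. \<Sum>b\<in>B. (c * p b + d * q b) * b x)"
    by (auto simp: sum_distrib_left sum.distrib algebra_simps)
  then show ?thesis unfolding V by (intro CollectI exI[of _ "%b. c * p b + d * q b"] conjI TrueI)
qed

text \<open>The weak solution gives the derivative of (u_t, v) only for v in H20. As
  \<open>psi2\<close> has a weak derivative, it is defined and weakly continuous at every time, and
  so serves as u_tt for all v in L2; on H20 the two derivatives coincide.\<close>

lemma (in finite_domain) wave_exists:
  assumes T: "0 < T" and s: "weak_solution Om T f u0 v0 u"
    and c: "has_time_deriv Om T u psi1" "has_time_deriv Om T psi1 psi2" "has_time_deriv Om T psi2 psi3"
  obtains ut where "wave Om T u ut psi2" "AE x in M. u 0 x = u0 x" "AE x in M. ut 0 x = v0 x"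
    "\<And>v t. v : H20 Om ==> t : {0..T} ==> aform Om (u t) v = ipd Om (f t) v - ipd Om (psi2 t) v"
proof -
  obtain ut where u: "C0_in (H20 Om) (Hs_norm 2 Om) T u" and ut: "C0_in (L2d Om) (L2normd Om) T ut"
    and dq: "\<And>t. t : {0..T} ==> ((%s. L2normd Om (%x. (u s x - u t x) / (s - t) - ut t x)) \<longlongrightarrow> 0) (at t within {0..T})"
    and ini: "AE x in M. u 0 x = u0 x" "AE x in M. ut 0 x = v0 x"
    and eq: "\<And>v t. v : H20 Om ==> t : {0..T} ==>
           ((%s. ipd Om (ut s) v) has_real_derivative (ipd Om (f t) v - aform Om (u t) v)) (at t within {0..T})"
    using s unfolding weak_solution_def by auto
  have uL: "u t : L2d Om" "ut t : L2d Om" if "t : {0..T}" for t using u ut that H20_L2 by (auto simp: C0_in_def)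
  have ud: "((%s. ipd Om (u s) v) has_real_derivative ipd Om (ut t) v) (at t within {0..T})" if t: "t : {0..T}" and v: "v : L2d Om" for t v
    unfolding has_field_derivative_iff
  proof (rule LIM_zero_cancel, rule Lim_null_comparison)
    let ?q = "%s x. (u s x - u t x) / (s - t) - ut t x"
    show "((%s. L2normd Om (?q s) * L2normd Om v) \<longlongrightarrow> 0) (at t within {0..T})" by (rule tendsto_mult_left_zero[OF dq[OF t]])
    have "norm ((ipd Om (u s) v - ipd Om (u t) v) / (s - t) - ipd Om (ut t) v) <= L2normd Om (?q s) * L2normd Om v" if s: "s : {0..T}" for s
    proof -
      have L: "(%x. (u s x - u t x) / (s - t)) : L2d Om" by (intro L2_divide L2_diff uL s t)
      have "(ipd Om (u s) v - ipd Om (u t) v) / (s - t) - ipd Om (ut t) v = ipd Om (?q s) v"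
        by (simp only: ip_diff_left[OF L uL(2)[OF t] v] ip_divide_left ip_diff_left[OF uL(1)[OF s] uL(1)[OF t] v])
      then show ?thesis using ip_Cauchy_Schwarz[OF L2_diff[OF L uL(2)[OF t]] v] by simp
    qed
    then show "\<forall>\<^sub>F s in at t within {0..T}. norm ((ipd Om (u s) v - ipd Om (u t) v) / (s - t) - ipd Om (ut t) v) <= L2normd Om (?q s) * L2normd Om v"
      by (auto simp: eventually_at_filter)
  qed
  have e: "ipd Om (psi1 t) v = ipd Om (ut t) v" if t: "t : {0..T}" and v: "v : L2d Om" for t v
    by (rule deriv_within_unique[OF antideriv_derivative[OF time_deriv_antideriv(1)[OF c(1) v T]
        antideriv_continuous[OF time_deriv_antideriv(1)[OF c(2) v T]] t] ud[OF t v] t T])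
  have utd: "((%s. ipd Om (ut s) v) has_real_derivative ipd Om (psi2 t) v) (at t within {0..T})" if t: "t : {0..T}" and v: "v : L2d Om" for t v
    by (rule has_field_derivative_transform_within[OF antideriv_derivative[OF time_deriv_antideriv(1)[OF c(2) v T]
        antideriv_continuous[OF time_deriv_antideriv(1)[OF c(3) v T]] t] zero_less_one t e[OF _ v]])
  show ?thesis
  proof (rule that[of ut])
    show "AE x in M. u 0 x = u0 x" "AE x in M. ut 0 x = v0 x" by (rule ini)+
    show "wave Om T u ut psi2"
      by unfold_locales (use T u ut ud utd c(3) in \<open>auto simp: C0_in_def has_time_deriv_def\<close>)
    show "aform Om (u t) v = ipd Om (f t) v - ipd Om (psi2 t) v" if "v : H20 Om" "t : {0..T}" for v t
      using deriv_within_unique[OF eq[OF that] utd[OF that(2) H20_L2[OF that(1)]] that(2) T] by simp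
  qed
qed

text \<open>H exceeds every mesh size, so \<open>D1\<close> and \<open>D2\<close> absorb the surplus
  factors in C1 h^2 and C2 h^(2 gamma) over h^gamma; K is the constant of the energy estimate,
  doubled by the seminorm inequality.\<close>

definition error_const :: "(real^2) set => real => real => real => real => real => real" where
  "error_const Om T gam al C1 C2 =
    (let H = diameter (closure Om) + 1; D1 = 2 * C1 * H powr (2 - gam); D2 = C2 * H powr gam; S = sqrt T; K = 4 / min (3/4) al
     in D2 + 4 * C2 + K * (D2 + 5 * D1 + 12 * D2 * S + 2 * D1 * S + 2 + 8 * S))"

lemma combine_constants:
  fixes l1 :: real
  assumes c: "c1 <= D1 * \<eta>" "c2 <= D2 * \<eta>" and nn: "0 <= D1" "0 <= D2" "0 <= C2" "0 <= \<eta>" "0 <= q" "0 <= K" "0 <= S"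
    and l: "0 <= l1" "0 <= l2" "0 <= l3" "0 <= l4" "0 <= l5" "0 <= l6" "0 <= l7" "0 <= m1" "0 <= m2"
    and A: "A = \<eta> * (l1 + l2 + l3 + l4 + l5 + l6 + l7) + q * (m1 + m2)"
  shows "c2 * l4 + 4 * (C2 * \<eta>) * l3 + K * (c2 * l4 + 2 * q * m1 + 5 * (c1 * (l1 + l5))
       + 2 * (c2 * (6 * S * l6) + 4 * q * S * m2) + 2 * (c1 * (S * (l2 + l7))))
    <= (D2 + 4 * C2 + K * (D2 + 5 * D1 + 12 * D2 * S + 2 * D1 * S + 2 + 8 * S)) * A"
proof -
  have n: "0 <= \<eta> * l1" "0 <= \<eta> * l2" "0 <= \<eta> * l3" "0 <= \<eta> * l4" "0 <= \<eta> * l5" "0 <= \<eta> * l6" "0 <= \<eta> * l7" "0 <= q * m1" "0 <= q * m2"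
    using nn l by auto
  have A': "A = \<eta> * l1 + \<eta> * l2 + \<eta> * l3 + \<eta> * l4 + \<eta> * l5 + \<eta> * l6 + \<eta> * l7 + q * m1 + q * m2"
    by (simp add: A algebra_simps)
  have h: "c * x <= D * A" if "c <= D * \<eta>" "0 <= D" "0 <= x" "\<eta> * x <= A" for c x D
  proof -
    have "c * x <= D * \<eta> * x" using that by (intro mult_right_mono) auto
    also have "... = D * (\<eta> * x)" by simp
    also have "... <= D * A" using that by (intro mult_left_mono) auto
    finally show ?thesis .
  qed
  have 1: "c2 * l4 <= D2 * A" by (rule h[OF c(2) nn(2) l(4)]) (use n A' in linarith)
  have 2: "C2 * \<eta> * l3 <= C2 * A" by (rule h[OF order_refl nn(3) l(3)]) (use n A' in linarith)
  have 3: "q * m1 <= A" using n A' by linarith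
  have 4: "c1 * (l1 + l5) <= D1 * A" by (rule h[OF c(1) nn(1)]) (use n A' l in \<open>auto simp: distrib_left\<close>)
  have 5: "S * (c2 * l6) <= S * (D2 * A)" by (rule mult_left_mono[OF h[OF c(2) nn(2) l(6)] nn(7)]) (use n A' in linarith)
  have 6: "S * (q * m2) <= S * A" by (rule mult_left_mono[OF _ nn(7)]) (use n A' in linarith)
  have 7: "S * (c1 * (l2 + l7)) <= S * (D1 * A)" by (rule mult_left_mono[OF h[OF c(1) nn(1)] nn(7)]) (use n A' l in \<open>auto simp: distrib_left\<close>)
  have "c2 * l4 + 2 * (q * m1) + 5 * (c1 * (l1 + l5)) + 2 * (6 * (S * (c2 * l6)) + 4 * (S * (q * m2))) + 2 * (S * (c1 * (l2 + l7)))
    <= D2 * A + 2 * A + 5 * (D1 * A) + 2 * (6 * (S * (D2 * A)) + 4 * (S * A)) + 2 * (S * (D1 * A))"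
    by (intro 1 3 4 5 6 7 add_mono mult_left_mono zero_le_numeral)
  from mult_left_mono[OF this nn(6)] 1 2 show ?thesis by (simp add: algebra_simps)
qed

lemma error_estimate:
  fixes Om :: "(real^2) set"
  assumes dom: "polygonal_lipschitz_domain Om" and T: "T > 0" and gam: "1/2 < gam" "gam <= 1" and ell: "elliptic_regularity Om gam"
    and pos: "al > 0" "\<beta> > 0" "C1 > 0" "C2 > 0"
    and mesh: "mesh_of Om \<T>" and h: "h = mesh_size \<T>"
    and V: "fin_dim_subspace V" "V \<subseteq> Hs_pw 2 \<T>" and bil: "symmetric_bilinear_on (sum_space V (morley Om \<T>)) ah"
    and coer: "\<forall>w\<in>V. al * (mesh_norm \<T> w)^2 <= ah w w"
    and bdd: "\<forall>w\<in>V. \<forall>v\<in>V. ah w v <= \<beta> * mesh_norm \<T> w * mesh_norm \<T> v"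
    and inv: "Cinv > 0" "\<forall>v\<in>V. mesh_norm \<T> v <= Cinv * h powr (- 2) * L2normd Om v"
    and IM: "morley_interpolation Om \<T> IM" "companion Om \<T> J" "Q = J \<circ> IM"
    and Qe: "\<forall>v\<in>V. \<forall>s\<in>{0..2}. v - Q v : Hs_pw s \<T> \<and>
         Hs_norm_pw s \<T> (v - Q v) <= C1 * h powr (2 - s) * (INF w\<in>H20 Om. mesh_norm \<T> (w - v))"
    and ritz: "ritz_projection Om V ah Q R"
    and Re: "\<forall>v\<in>H20 Om \<inter> Hs (2 + gam) Om. L2normd Om (v - R v) + h powr gam * mesh_norm \<T> (v - R v)
           <= C2 * h powr (2 * gam) * Hs_norm (2 + gam) Om v"
    and N: "N \<ge> 1" "k = T / real N" and f: "has_time_deriv Om T f ft"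
    and u0: "u0 : dom_A_pow Om \<mu> psi 2" and v0: "v0 : dom_A_pow Om \<mu> psi (3/2)"
    and sol: "weak_solution Om T f u0 v0 u" and scheme: "explicit_scheme Om V ah R k N f u0 v0 U"
    and cfl: "k <= \<beta> powr (- 1/2) * Cinv powr (- 1) * h^2" and m: "m : {1..N - 1}"
  shows "ennreal (L2normd Om (dbar k (at_grid k u) m - dbar k U m) + mesh_norm \<T> (half (at_grid k u) m - half U m))
     <= ennreal (error_const Om T gam al C1 C2) * (ennreal (h powr gam) * L_fu Om T gam f u + ennreal (k^2) * M_u Om T u)"
proof -
  have op: "open Om" "bounded Om" "Om ~= {}" using dom by (auto simp: polygonal_lipschitz_domain_def)
  interpret D: mesh_domain Om \<T>
    by unfold_locales (use op mesh lipschitz_domain_interior_closure[OF dom] in auto)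
  have hp: "0 < h" "h <= diameter (closure Om)" using D.mesh_size by (simp_all add: h)
  have kp: "0 < k" "real N * k = T" using N T by auto
  define H where "H = diameter (closure Om) + 1"
  have H: "h <= H" "0 < H" using hp by (auto simp: H_def)
  define C where "C = error_const Om T gam al C1 C2"
  define S where "S = sqrt T"
  define K where "K = 4 / min (3/4) al"
  define D1 where "D1 = 2 * C1 * H powr (2 - gam)"
  define D2 where "D2 = C2 * H powr gam"
  have C: "C = D2 + 4 * C2 + K * (D2 + 5 * D1 + 12 * D2 * S + 2 * D1 * S + 2 + 8 * S)"
    by (simp add: C_def error_const_def Let_def D1_def D2_def K_def S_def H_def)
  have nn: "0 <= D1" "0 <= D2" "0 <= C2" "0 <= K" "0 <= S" using pos T by (simp_all add: D1_def D2_def K_def S_def)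
  have C0: "0 < C" unfolding C using nn pos(4) by (intro add_pos_nonneg add_nonneg_pos mult_nonneg_nonneg add_nonneg_nonneg) auto
  show ?thesis
  \<comment> \<open>If a norm on the right is infinite then so is the right-hand side, because C, h
    and k are positive.\<close>
  proof (cases "L_fu Om T gam f u = \<infinity> \<or> M_u Om T u = \<infinity>")
    case True
    then have top: "ennreal (h powr gam) * L_fu Om T gam f u + ennreal (k^2) * M_u Om T u = top"
      using hp kp by (auto simp: ennreal_mult_top)
    show ?thesis unfolding top C_def[symmetric] using C0 by (simp add: ennreal_mult_top)
  next
    case False
    let ?LL = "Linf_norm (L2d Om) (L2normd Om) T" and ?TL = "L2t_norm (L2d Om) (L2normd Om) T"
      and ?LH = "Linf_norm (Hs (2 + gam) Om) (Hs_norm (2 + gam) Om) T" and ?TH = "L2t_norm (Hs (2 + gam) Om) (Hs_norm (2 + gam) Om) T"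
    let ?n = "%nrm j phi. enn2real (norm_dt Om T nrm j phi)"
    have fin: "norm_dt Om T ?LL 0 f = ennreal (?n ?LL 0 f)" "norm_dt Om T ?TL 1 f = ennreal (?n ?TL 1 f)"
      "norm_dt Om T ?LH 0 u = ennreal (?n ?LH 0 u)" "norm_dt Om T ?LH 1 u = ennreal (?n ?LH 1 u)"
      "norm_dt Om T ?LL 2 u = ennreal (?n ?LL 2 u)" "norm_dt Om T ?TH 2 u = ennreal (?n ?TH 2 u)"
      "norm_dt Om T ?TL 3 u = ennreal (?n ?TL 3 u)" "norm_dt Om T ?LL 3 u = ennreal (?n ?LL 3 u)" "norm_dt Om T ?TL 4 u = ennreal (?n ?TL 4 u)"
      using False by (simp_all add: L_fu_def M_u_def Let_def less_top[symmetric])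
    \<comment> \<open>The infimum over an empty set is infinite, so finiteness of this norm provides
      the whole chain of time derivatives of u.\<close>
    have "norm_dt Om T ?TL 4 u ~= top" using fin(9) by (metis ennreal_neq_top)
    then obtain psi4 where "(has_time_deriv Om T ^^ 4) u psi4" unfolding norm_dt_def by fastforce
    then obtain psi1 psi2 psi3 where ch: "has_time_deriv Om T u psi1" "has_time_deriv Om T psi1 psi2" "has_time_deriv Om T psi2 psi3"
      unfolding relpowp_unfold by blast
    obtain ut where W: "wave Om T u ut psi2" "AE x in lebesgue_on Om. u 0 x = u0 x" "AE x in lebesgue_on Om. ut 0 x = v0 x"
      "\<And>v t. v : H20 Om ==> t : {0..T} ==> aform Om (u t) v = ipd Om (f t) v - ipd Om (psi2 t) v"
      using D.wave_exists[OF T sol ch] by blast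
    interpret W: wave Om T u ut psi2 by (rule W(1))
    have Vs: "v : sum_space V (morley Om \<T>)" if "v : V" for v
      unfolding sum_space_def using that zero_morley[OF mesh]
      by (intro CollectI exI[of _ v] exI[of _ "%x. 0"]) simp
    have Vpw: "v : Hs_pw 2 \<T>" if "v : V" for v using V(2) that by blast
    interpret B: discretisation Om \<T> V ah Q R al k "C2 * h powr gam" "2 * C1 * h^2" "C2 * h powr (2 * gam)" gam
    proof unfold_locales
      show "V \<subseteq> Hs_pw 2 \<T>" by (rule V(2))
      show "(%x. c * v x + d * w x) : V" if "v : V" "w : V" for v w c d by (rule fin_dim_subspace_lin[OF V(1) that])
      show "ah v w = ah w v" if "v : V" "w : V" for v w
        using bil Vs[OF that(1)] Vs[OF that(2)] unfolding symmetric_bilinear_on_def by blast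
      show "ah (%x. c * v x + d * v' x) w = c * ah v w + d * ah v' w" if "v : V" "v' : V" "w : V" for v v' w c d
        using bil Vs[OF that(1)] Vs[OF that(2)] Vs[OF that(3)] unfolding symmetric_bilinear_on_def by blast
      show "al * (mesh_norm \<T> v)^2 <= ah v v" if "v : V" for v using coer that by blast
      show "k^2 * ah v v <= (L2normd Om v)^2" if v: "v : V" for v
      proof -
        \<comment> \<open>With the factor sqrt \<beta> the CFL bound and the inverse inequality
          cancel exactly to 1; squaring gives the form that enters the energy.\<close>
        have "k * (sqrt \<beta> * mesh_norm \<T> v) <= (\<beta> powr (- 1/2) * Cinv powr (- 1) * h^2) * (sqrt \<beta> * (Cinv * h powr (- 2) * L2normd Om v))"
          using cfl inv v kp pos by (intro mult_mono mult_nonneg_nonneg) (auto simp: mesh_norm_nonneg)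
        also have "... = L2normd Om v"
        proof -
          have "\<beta> powr (- 1/2) * sqrt \<beta> = 1" using pos(2) by (simp add: powr_half_sqrt[symmetric] powr_add[symmetric])
          moreover have "Cinv powr (- 1) * Cinv = 1" using inv(1) by (simp add: powr_minus)
          moreover have "h^2 * h powr (- 2) = 1" using hp(1) by (simp add: powr_minus powr_numeral)
          ultimately show ?thesis by (simp add: mult_ac) (metis (no_types, lifting) mult.commute mult.left_commute mult_1)
        qed
        finally have "(k * (sqrt \<beta> * mesh_norm \<T> v))^2 <= (L2normd Om v)^2"
          using kp pos by (intro power_mono mult_nonneg_nonneg) (auto simp: mesh_norm_nonneg)
        moreover have "(k * (sqrt \<beta> * mesh_norm \<T> v))^2 = k^2 * (\<beta> * mesh_norm \<T> v * mesh_norm \<T> v)"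
          using pos(2) by (simp add: power_mult_distrib power2_eq_square)
        moreover have "k^2 * ah v v <= k^2 * (\<beta> * mesh_norm \<T> v * mesh_norm \<T> v)" using bdd v by (intro mult_left_mono) auto
        ultimately show ?thesis by linarith
      qed
      show "Q v : H20 Om" if "v : V" for v
      proof -
        have "IM v : morley Om \<T>" using IM(1) Vpw[OF that] by (simp add: morley_interpolation_def)
        then show ?thesis using IM(2) by (simp add: companion_def IM(3))
      qed
      show "L2normd Om (%x. v x - Q v x) <= 2 * C1 * h^2 * mesh_norm \<T> v" if v: "v : V" for v
      proof -
        have q: "v - Q v : Hs_pw 0 \<T>" "Hs_norm_pw 0 \<T> (v - Q v) <= C1 * h powr 2 * (INF w\<in>H20 Om. mesh_norm \<T> (w - v))"
          using bspec[OF bspec[OF Qe v], of 0] by auto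
        \<comment> \<open>The infimum is taken at w = 0; the sign change under the mesh-dependent
          norm costs the factor 2 in 2 C1 h^2.\<close>
        have "(INF w\<in>H20 Om. mesh_norm \<T> (w - v)) <= mesh_norm \<T> ((%x. 0) - v)"
          by (rule cINF_lower) (auto intro!: bdd_belowI[of _ 0] D.H20_test simp: mesh_norm_nonneg)
        also have "(%x. 0) - v = (%x. (-1) * v x + 0 * v x)" by auto
        also have "mesh_norm \<T> (%x. (-1) * v x + 0 * v x) <= 2 * mesh_norm \<T> v"
          using D.mesh_norm_lin_le[OF Vpw[OF v] Vpw[OF v], of "-1" 0] by simp
        finally have "C1 * h powr 2 * (INF w\<in>H20 Om. mesh_norm \<T> (w - v)) <= C1 * h powr 2 * (2 * mesh_norm \<T> v)"
          by (rule mult_left_mono) (use pos in simp)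
        moreover have "L2normd Om (v - Q v) <= Hs_norm_pw 0 \<T> (v - Q v)" by (rule D.L2norm_le_Hs_norm_pw[OF q(1)])
        ultimately show ?thesis using q(2) hp(1) by (simp add: fun_diff_def powr_numeral)
      qed
      show "R w : V" if "w : H20 Om" for w using ritz that by (simp add: ritz_projection_def)
      show "ah (R w) v = aform Om w (Q v)" if "w : H20 Om" "v : V" for w v using ritz that by (simp add: ritz_projection_def)
      show "L2normd Om (%x. w x - R w x) <= C2 * h powr (2 * gam) * Hs_norm (2 + gam) Om w"
        "mesh_norm \<T> (%x. w x - R w x) <= C2 * h powr gam * Hs_norm (2 + gam) Om w" if "w : H20 Om" "w : Hs (2 + gam) Om" for w
      proof -
        have r: "L2normd Om (w - R w) + h powr gam * mesh_norm \<T> (w - R w) <= C2 * h powr (2 * gam) * Hs_norm (2 + gam) Om w"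
          using Re that by blast
        have e: "w - R w = (%x. w x - R w x)" by auto
        have "0 <= h powr gam * mesh_norm \<T> (w - R w)" by (simp add: mesh_norm_nonneg)
        then show "L2normd Om (%x. w x - R w x) <= C2 * h powr (2 * gam) * Hs_norm (2 + gam) Om w"
          using r unfolding e by linarith
        have "h powr (2 * gam) = h powr gam * h powr gam" by (simp flip: powr_add)
        then have "C2 * h powr (2 * gam) * Hs_norm (2 + gam) Om w = h powr gam * (C2 * h powr gam * Hs_norm (2 + gam) Om w)"
          by (simp only: mult_ac)
        then have "h powr gam * mesh_norm \<T> (w - R w) <= h powr gam * (C2 * h powr gam * Hs_norm (2 + gam) Om w)"
          using r L2norm_nonneg[of "lebesgue_on Om" "w - R w"] by linarith
        then show "mesh_norm \<T> (%x. w x - R w x) <= C2 * h powr gam * Hs_norm (2 + gam) Om w"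
          using hp(1) unfolding e by simp
      qed
    qed (use pos kp hp in auto)
    interpret WS: wave_scheme Om T u ut psi2 \<T> V ah Q R al k "C2 * h powr gam" "2 * C1 * h^2" "C2 * h powr (2 * gam)" gam N f ft u0 v0 U
    proof unfold_locales
      show "w : Hs (2 + gam) Om" if "w : H20 Om" "g : L2d Om" "\<And>v. v : H20 Om ==> aform Om w v = ipd Om g v" for w g
      proof -
        have b: "is_bilaplacian Om w g" by (rule D.is_bilaplacianI[OF D.H20_Hs[OF that(1)] that(2,3)])
        then have "w : dom_A Om" using that(1) by (auto simp: dom_A_def)
        then show ?thesis using ell b unfolding elliptic_regularity_def by blast
      qed
      show "aform Om (u t) v = ipd Om (f t) v - ipd Om (psi2 t) v" if "v : H20 Om" "t : {0..T}" for v t by (rule W(4)[OF that])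
      show "explicit_scheme Om V ah R k N f u0 v0 U" by (rule scheme)
    qed (use N kp gam f W(2,3) u0 v0 in \<open>auto simp: dom_A_pow_def\<close>)
    define l1 l2 l3 l4 l5 l6 l7 m1 m2 where l: "l1 = ?n ?LL 0 f" "l2 = ?n ?TL 1 f" "l3 = ?n ?LH 0 u" "l4 = ?n ?LH 1 u"
      "l5 = ?n ?LL 2 u" "l6 = ?n ?TH 2 u" "l7 = ?n ?TL 3 u" "m1 = ?n ?LL 3 u" "m2 = ?n ?TL 4 u"
    have l0: "0 <= l1" "0 <= l2" "0 <= l3" "0 <= l4" "0 <= l5" "0 <= l6" "0 <= l7" "0 <= m1" "0 <= m2" by (simp_all add: l)
    note fin = fin[folded l]
    define \<eta> where "\<eta> = h powr gam"
    have e1: "2 * C1 * h^2 <= D1 * \<eta>"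
    proof -
      have "h^2 = h powr (2 - gam) * \<eta>" using hp(1) by (simp add: \<eta>_def powr_add[symmetric] powr_numeral)
      also have "... <= H powr (2 - gam) * \<eta>" using H hp gam by (intro mult_right_mono powr_mono2) (auto simp: \<eta>_def)
      finally have "2 * C1 * h^2 <= 2 * C1 * (H powr (2 - gam) * \<eta>)" using pos by (intro mult_left_mono) auto
      then show ?thesis by (simp add: D1_def mult_ac)
    qed
    have e2: "C2 * h powr (2 * gam) <= D2 * \<eta>"
    proof -
      have "h powr (2 * gam) = h powr gam * \<eta>" by (simp add: \<eta>_def flip: powr_add)
      also have "... <= H powr gam * \<eta>" using H hp gam by (intro mult_right_mono powr_mono2) (auto simp: \<eta>_def)
      finally have "C2 * h powr (2 * gam) <= C2 * (H powr gam * \<eta>)" using pos by (intro mult_left_mono) auto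
      then show ?thesis by (simp add: D2_def mult_ac)
    qed
    have \<eta>0: "0 <= \<eta>" by (simp add: \<eta>_def)
    define A where "A = \<eta> * (l1 + l2 + l3 + l4 + l5 + l6 + l7) + k^2 * (m1 + m2)"
    have "L2normd Om (dbar k (at_grid k u) m - dbar k U m) + mesh_norm \<T> (half (at_grid k u) m - half U m) <= C * A"
      using order_trans[OF WS.estimate[OF fin l0 ch(1) m, folded \<eta>_def S_def K_def]
        combine_constants[OF e1 e2 nn(1-3) \<eta>0 zero_le_power2 nn(4,5) l0 A_def]] unfolding C .
    then have "ennreal (L2normd Om (dbar k (at_grid k u) m - dbar k U m) + mesh_norm \<T> (half (at_grid k u) m - half U m)) <= ennreal (C * A)"
      by (rule ennreal_leI)
    also have "ennreal (C * A) = ennreal C * (ennreal \<eta> * ennreal (l1 + l2 + l3 + l4 + l5 + l6 + l7) + ennreal (k^2) * ennreal (m1 + m2))"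
      using C0 \<eta>0 l0 by (simp add: A_def ennreal_mult add_nonneg_nonneg)
    also have "ennreal (l1 + l2 + l3 + l4 + l5 + l6 + l7) = L_fu Om T gam f u"
      unfolding L_fu_def Let_def fin using l0 by (simp add: add_nonneg_nonneg)
    also have "ennreal (m1 + m2) = M_u Om T u" unfolding M_u_def fin using l0 by simp
    finally show ?thesis unfolding C_def \<eta>_def .
  qed
qed

lemma error_const_pos: "0 < error_const Om T gam al C1 C2" if "0 < T" "0 < al" "0 < C1" "0 < C2"
  unfolding error_const_def Let_def using that by (intro add_pos_nonneg add_nonneg_pos mult_nonneg_nonneg add_nonneg_nonneg) auto

theorem theorem3p8:
  fixes \<Omega> :: "(real^2) set" and T \<gamma>\<^sub>0 \<alpha> \<beta> C\<^sub>1 C\<^sub>2 :: real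
  assumes "polygonal_lipschitz_domain \<Omega>" and "T > 0"
    and "1/2 < \<gamma>\<^sub>0" and "\<gamma>\<^sub>0 \<le> 1" and "elliptic_regularity \<Omega> \<gamma>\<^sub>0"
    and "\<alpha> > 0" and "\<beta> > 0" and "C\<^sub>1 > 0" and "C\<^sub>2 > 0"
  shows "\<exists>C>0. \<forall>(\<T> :: (real^2) set set) \<rho> \<kappa> h (V\<^sub>h :: sfun set) a\<^sub>h C\<^sub>i\<^sub>n\<^sub>v J I\<^sub>M Q R\<^sub>h (N::nat) k
           (\<mu> :: nat \<Rightarrow> real) \<psi> f f\<^sub>t f\<^sub>t\<^sub>t f\<^sub>t\<^sub>t\<^sub>t u\<^sub>0 v\<^sub>0 u U.
      mesh_of \<Omega> \<T> \<and> \<rho> > 0 \<and> shape_regular \<rho> \<T> \<and> \<kappa> > 0 \<and> quasi_uniform \<kappa> \<T> \<and> h = mesh_size \<T> \<and>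
      fin_dim_subspace V\<^sub>h \<and> V\<^sub>h \<subseteq> Hs_pw 2 \<T> \<and>
      symmetric_bilinear_on (sum_space V\<^sub>h (morley \<Omega> \<T>)) a\<^sub>h \<and>
      (\<forall>w\<in>V\<^sub>h. \<alpha> * (mesh_norm \<T> w)^2 \<le> a\<^sub>h w w) \<and>
      (\<forall>w\<in>V\<^sub>h. \<forall>v\<in>V\<^sub>h. a\<^sub>h w v \<le> \<beta> * mesh_norm \<T> w * mesh_norm \<T> v) \<and>
      C\<^sub>i\<^sub>n\<^sub>v > 0 \<and> (\<forall>v\<in>V\<^sub>h. mesh_norm \<T> v \<le> C\<^sub>i\<^sub>n\<^sub>v * h powr (- 2) * L2normd \<Omega> v) \<and>
      morley_interpolation \<Omega> \<T> I\<^sub>M \<and> companion \<Omega> \<T> J \<and> Q = J \<circ> I\<^sub>M \<and>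
      (\<forall>v\<in>V\<^sub>h. \<forall>s\<in>{0..2}. v - Q v \<in> Hs_pw s \<T> \<and>
         Hs_norm_pw s \<T> (v - Q v) \<le> C\<^sub>1 * h powr (2 - s) * (INF w\<in>H20 \<Omega>. mesh_norm \<T> (w - v))) \<and>
      ritz_projection \<Omega> V\<^sub>h a\<^sub>h Q R\<^sub>h \<and>
      (\<forall>v \<in> H20 \<Omega> \<inter> Hs (2 + \<gamma>\<^sub>0) \<Omega>.
         L2normd \<Omega> (v - R\<^sub>h v) + h powr \<gamma>\<^sub>0 * mesh_norm \<T> (v - R\<^sub>h v)
           \<le> C\<^sub>2 * h powr (2 * \<gamma>\<^sub>0) * Hs_norm (2 + \<gamma>\<^sub>0) \<Omega> v) \<and>
      N \<ge> 1 \<and> k = T / real N \<and>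
      eigenbasis_A \<Omega> \<mu> \<psi> \<and>
      has_time_deriv \<Omega> T f f\<^sub>t \<and> has_time_deriv \<Omega> T f\<^sub>t f\<^sub>t\<^sub>t \<and> has_time_deriv \<Omega> T f\<^sub>t\<^sub>t f\<^sub>t\<^sub>t\<^sub>t \<and>
      (\<forall>g\<in>{f, f\<^sub>t, f\<^sub>t\<^sub>t, f\<^sub>t\<^sub>t\<^sub>t}. L2t_norm (L2d \<Omega>) (L2normd \<Omega>) T g < \<infinity>) \<and>
      u\<^sub>0 \<in> dom_A_pow \<Omega> \<mu> \<psi> 2 \<and> v\<^sub>0 \<in> dom_A_pow \<Omega> \<mu> \<psi> (3/2) \<and>
      f 0 \<in> dom_A \<Omega> \<and> f\<^sub>t 0 \<in> dom_A_pow \<Omega> \<mu> \<psi> (1/2) \<and> f\<^sub>t\<^sub>t 0 \<in> L2d \<Omega> \<and>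
      weak_solution \<Omega> T f u\<^sub>0 v\<^sub>0 u \<and>
      explicit_scheme \<Omega> V\<^sub>h a\<^sub>h R\<^sub>h k N f u\<^sub>0 v\<^sub>0 U \<and>
      k \<le> \<beta> powr (- 1/2) * C\<^sub>i\<^sub>n\<^sub>v powr (- 1) * h^2
      \<longrightarrow>
      (\<forall>m\<in>{1..N - 1}.
         ennreal (L2normd \<Omega> (dbar k (at_grid k u) m - dbar k U m)
                  + mesh_norm \<T> (half (at_grid k u) m - half U m))
         \<le> ennreal C * (ennreal (h powr \<gamma>\<^sub>0) * L_fu \<Omega> T \<gamma>\<^sub>0 f u + ennreal (k^2) * M_u \<Omega> T u))"
\<comment> \<open>The witness is formed from the domain, T, gamma, alpha, C1 and C2 before mesh,
  time step and data are chosen; \<beta> acts through the CFL condition.\<close>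
proof (intro exI[of _ "error_const \<Omega> T \<gamma>\<^sub>0 \<alpha> C\<^sub>1 C\<^sub>2"] conjI allI impI ballI, goal_cases)
  case 1
  then show ?case using assms by (intro error_const_pos) auto
next
  case (2 \<T> \<rho> \<kappa> h V\<^sub>h a\<^sub>h C\<^sub>i\<^sub>n\<^sub>v J I\<^sub>M Q R\<^sub>h N k \<mu> \<psi> f f\<^sub>t f\<^sub>t\<^sub>t f\<^sub>t\<^sub>t\<^sub>t u\<^sub>0 v\<^sub>0 u U m)
  then show ?case
    by (elim conjE) (rule error_estimate[OF assms, of \<T> h V\<^sub>h a\<^sub>h C\<^sub>i\<^sub>n\<^sub>v I\<^sub>M J Q R\<^sub>h N k f f\<^sub>t u\<^sub>0 \<mu> \<psi> v\<^sub>0 u U m]; assumption)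
qed

end
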